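(* Let $(R,\mathfrak m)$ be a $1$-dimensional Cohen-Macaulay local ring admitting a canonical module $\omega=\omega_R$ such that the associated graded module $\operatorname{gr}_{\mathfrak m}(\omega^* )$ has positive depth. If $R$ is not Gorenstein and $\mathfrak m^2$ is Ulrich, then $\mathfrak m\omega^*$ is Ulrich.
   Context: Rings are commutative and noetherian. $\omega^*=\operatorname{Hom}_R(\omega,R)$. For a finitely generated $R$-module $M$, $\operatorname{gr}_{\mathfrak m}(M)=\bigoplus_{i\ge0}\mathfrak m^iM/\mathfrak m^{i+1}M$, a graded module over $\operatorname{gr}_{\mathfrak m}(R)$; its depth is taken with respect to the homogeneous maximal ideal $\bigoplus_{i\ge1}\mathfrak m^i/\mathfrak m^{i+1}$ of $\operatorname{gr}_{\mathfrak m}(R)$. A maximal Cohen-Macaulay $R$-module $M$ is Ulrich if its minimal number of generators equals its multiplicity $e(\mathfrak m,M)$ with respect to $\mathfrak m$. *)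

theory Defs
  imports
    "HOL-Algebra.Ring_Divisibility"
    "HOL-Algebra.QuotRing"
    "HOL-Algebra.Ideal_Product"
    "HOL-Algebra.Module"
    "HOL-Library.Extended_Nat"
    Complex_Main
begin

section \<open>Submodules, quotients, homomorphisms, free modules\<close>

text \<open>
  Module records inherit the fields \<open>mult\<close> and \<open>one\<close> from rings. The locale
  \<^locale>\<open>module\<close> does not constrain them, so they are filled with \<^const>\<open>undefined\<close> or
  with whatever is at hand.
\<close>

definition ring_module :: "('r, 'x) ring_scheme \<Rightarrow> ('r, 'r) module" where
  "ring_module R = \<lparr>carrier = carrier R, mult = mult R, one = one R,
                    zero = zero R, add = add R, smult = mult R\<rparr>"

definition gen_submodule ::
    "('r, 'x) ring_scheme \<Rightarrow> ('r, 'm) module \<Rightarrow> 'm set \<Rightarrow> 'm set" where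
  "gen_submodule R M S = \<Inter> {N. submodule N R M \<and> S \<subseteq> N}"

text \<open>
  \<open>ideal_mod R M I\<close> is \<open>IM\<close>. For an arbitrary subset \<open>I\<close> of \<open>R\<close> it is \<open>(I)M\<close>, with \<open>(I)\<close> the
  ideal generated by \<open>I\<close>.
\<close>

definition ideal_mod ::
    "('r, 'x) ring_scheme \<Rightarrow> ('r, 'm) module \<Rightarrow> 'r set \<Rightarrow> 'm set" where
  "ideal_mod R M I = gen_submodule R M {a \<odot>\<^bsub>M\<^esub> x | a x. a \<in> I \<and> x \<in> carrier M}"

definition ideal_pow :: "('r, 'x) ring_scheme \<Rightarrow> 'r set \<Rightarrow> nat \<Rightarrow> 'r set" where
  "ideal_pow R I n = I [^]\<^bsub>ideals_set R\<^esub> n"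

definition quot_module ::
    "('r, 'x) ring_scheme \<Rightarrow> ('r, 'm) module \<Rightarrow> 'm set \<Rightarrow> ('r, 'm set) module" where
  "quot_module R M N =
     \<lparr>carrier = a_rcosets\<^bsub>M\<^esub> N, mult = undefined, one = undefined,
      zero = N, add = set_add M,
      smult = (\<lambda>r X. \<Union>x\<in>X. N +>\<^bsub>M\<^esub> (r \<odot>\<^bsub>M\<^esub> x))\<rparr>"

definition lin_maps ::
    "('r, 'x) ring_scheme \<Rightarrow> ('r, 'm) module \<Rightarrow> ('r, 'n) module \<Rightarrow> ('m \<Rightarrow> 'n) set" where
  "lin_maps R M N =
     {f. f \<in> carrier M \<rightarrow> carrier N \<and>
         (\<forall>x\<in>carrier M. \<forall>y\<in>carrier M. f (x \<oplus>\<^bsub>M\<^esub> y) = f x \<oplus>\<^bsub>N\<^esub> f y) \<and>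
         (\<forall>a\<in>carrier R. \<forall>x\<in>carrier M. f (a \<odot>\<^bsub>M\<^esub> x) = a \<odot>\<^bsub>N\<^esub> f x)}"

text \<open>
  Elements of \<open>Hom\<^sub>R(M, N)\<close> are extensional, so that equality of functions is equality
  on the carrier of \<open>M\<close>.
\<close>

definition hom_module ::
    "('r, 'x) ring_scheme \<Rightarrow> ('r, 'm) module \<Rightarrow> ('r, 'n) module \<Rightarrow> ('r, 'm \<Rightarrow> 'n) module" where
  "hom_module R M N =
     \<lparr>carrier = lin_maps R M N \<inter> extensional (carrier M),
      mult = undefined, one = undefined,
      zero = (\<lambda>x\<in>carrier M. \<zero>\<^bsub>N\<^esub>),
      add = (\<lambda>f g. \<lambda>x\<in>carrier M. f x \<oplus>\<^bsub>N\<^esub> g x),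
      smult = (\<lambda>a f. \<lambda>x\<in>carrier M. a \<odot>\<^bsub>N\<^esub> f x)\<rparr>"

definition dual_module ::
    "('r, 'x) ring_scheme \<Rightarrow> ('r, 'm) module \<Rightarrow> ('r, 'm \<Rightarrow> 'r) module" where
  "dual_module R M = hom_module R M (ring_module R)"

definition free_module :: "('r, 'x) ring_scheme \<Rightarrow> nat \<Rightarrow> ('r, nat \<Rightarrow> 'r) module" where
  "free_module R n =
     \<lparr>carrier = {..<n} \<rightarrow>\<^sub>E carrier R, mult = undefined, one = undefined,
      zero = (\<lambda>i\<in>{..<n}. \<zero>\<^bsub>R\<^esub>),
      add = (\<lambda>u v. \<lambda>i\<in>{..<n}. u i \<oplus>\<^bsub>R\<^esub> v i),
      smult = (\<lambda>a u. \<lambda>i\<in>{..<n}. a \<otimes>\<^bsub>R\<^esub> u i)\<rparr>"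

definition generates :: "('r, 'x) ring_scheme \<Rightarrow> ('r, 'm) module \<Rightarrow> 'm set \<Rightarrow> bool" where
  "generates R M S \<longleftrightarrow> S \<subseteq> carrier M \<and> gen_submodule R M S = carrier M"

definition fin_gen :: "('r, 'x) ring_scheme \<Rightarrow> ('r, 'm) module \<Rightarrow> bool" where
  "fin_gen R M \<longleftrightarrow> (\<exists>S. finite S \<and> generates R M S)"

definition min_gens :: "('r, 'x) ring_scheme \<Rightarrow> ('r, 'm) module \<Rightarrow> nat" where
  "min_gens R M = (LEAST n. \<exists>S. finite S \<and> card S = n \<and> generates R M S)"

definition module_length :: "('r, 'x) ring_scheme \<Rightarrow> ('r, 'm) module \<Rightarrow> enat" where
  "module_length R M =
     Sup {enat n | n. \<exists>N :: nat \<Rightarrow> 'm set.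
            (\<forall>i\<le>n. submodule (N i) R M) \<and> (\<forall>i<n. N i \<subset> N (Suc i))}"


section \<open>Local rings, dimension, depth\<close>

definition noetherian_local :: "('r, 'x) ring_scheme \<Rightarrow> 'r set \<Rightarrow> bool" where
  "noetherian_local R \<mm> \<longleftrightarrow>
     cring R \<and> noetherian_ring R \<and> maximalideal \<mm> R \<and> (\<forall>J. maximalideal J R \<longrightarrow> J = \<mm>)"

definition krull_dim :: "('r, 'x) ring_scheme \<Rightarrow> enat" where
  "krull_dim R =
     Sup {enat n | n. \<exists>P :: nat \<Rightarrow> 'r set.
            (\<forall>i\<le>n. primeideal (P i) R) \<and> (\<forall>i<n. P i \<subset> P (Suc i))}"

text \<open>
  The first conjunct says that \<open>x\<^sub>i\<close> is a nonzerodivisor on \<open>M / (x\<^sub>1, \<dots>, x\<^sub>i\<^sub>-\<^sub>1)M\<close>.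
\<close>

definition regular_seq ::
    "('r, 'x) ring_scheme \<Rightarrow> ('r, 'm) module \<Rightarrow> 'r list \<Rightarrow> bool" where
  "regular_seq R M xs \<longleftrightarrow>
     (\<forall>i<length xs. \<forall>y\<in>carrier M.
        xs ! i \<odot>\<^bsub>M\<^esub> y \<in> ideal_mod R M (set (take i xs)) \<longrightarrow>
        y \<in> ideal_mod R M (set (take i xs))) \<and>
     ideal_mod R M (set xs) \<noteq> carrier M"

text \<open>
  Depth (grade) of \<open>M\<close> with respect to an ideal \<open>I\<close>, with the usual convention that it is
  infinite if \<open>IM = M\<close>; in particular the zero module has infinite depth.
\<close>

definition depth :: "('r, 'x) ring_scheme \<Rightarrow> 'r set \<Rightarrow> ('r, 'm) module \<Rightarrow> enat" where
  "depth R I M =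
     (if ideal_mod R M I = carrier M then \<infinity>
      else Sup {enat (length xs) | xs. set xs \<subseteq> I \<and> regular_seq R M xs})"

definition cohen_macaulay_local :: "('r, 'x) ring_scheme \<Rightarrow> 'r set \<Rightarrow> bool" where
  "cohen_macaulay_local R \<mm> \<longleftrightarrow>
     noetherian_local R \<mm> \<and> depth R \<mm> (ring_module R) = krull_dim R"

text \<open>The zero module is not maximal Cohen--Macaulay, its depth being infinite.\<close>

definition maximal_cohen_macaulay ::
    "('r, 'x) ring_scheme \<Rightarrow> 'r set \<Rightarrow> ('r, 'm) module \<Rightarrow> bool" where
  "maximal_cohen_macaulay R \<mm> M \<longleftrightarrow>
     module R M \<and> fin_gen R M \<and> depth R \<mm> M = krull_dim R"


section \<open>Multiplicity and Ulrich modules\<close>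

text \<open>
  \<open>e(\<mm>, M) = lim d! \<ell>(M/\<mm>\<^sup>nM) / n\<^sup>d\<close> with \<open>d = dim R\<close>. For maximal Cohen--Macaulay \<open>M\<close>, the
  only case used, \<open>dim M = dim R\<close>.
\<close>

definition multiplicity :: "('r, 'x) ring_scheme \<Rightarrow> 'r set \<Rightarrow> ('r, 'm) module \<Rightarrow> real" where
  "multiplicity R \<mm> M =
     (let d = the_enat (krull_dim R) in
      lim (\<lambda>n. fact d *
        real (the_enat (module_length R (quot_module R M (ideal_mod R M (ideal_pow R \<mm> n)))))
        / real n ^ d))"

definition ulrich :: "('r, 'x) ring_scheme \<Rightarrow> 'r set \<Rightarrow> ('r, 'm) module \<Rightarrow> bool" where
  "ulrich R \<mm> M \<longleftrightarrow>
     maximal_cohen_macaulay R \<mm> M \<and> real (min_gens R M) = multiplicity R \<mm> M"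


section \<open>Associated graded ring and modules\<close>

text \<open>
  The element \<open>\<Sum>\<^sub>i f\<^sub>i\<close> of \<open>\<Oplus>\<^sub>i \<mm>\<^sup>iM/\<mm>\<^sup>i\<^sup>+\<^sup>1M\<close> is represented by the function \<open>i \<mapsto> f\<^sub>i\<close>, each
  \<open>f\<^sub>i\<close> being a coset of \<open>\<mm>\<^sup>i\<^sup>+\<^sup>1M\<close>.
\<close>

definition gr_comp ::
    "('r, 'x) ring_scheme \<Rightarrow> 'r set \<Rightarrow> ('r, 'm) module \<Rightarrow> nat \<Rightarrow> ('r, 'm set) module" where
  "gr_comp R \<mm> M i =
     quot_module R (M\<lparr>carrier := ideal_mod R M (ideal_pow R \<mm> i)\<rparr>)
       (ideal_mod R M (ideal_pow R \<mm> (Suc i)))"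

definition gr_carrier ::
    "('r, 'x) ring_scheme \<Rightarrow> 'r set \<Rightarrow> ('r, 'm) module \<Rightarrow> (nat \<Rightarrow> 'm set) set" where
  "gr_carrier R \<mm> M =
     {f. (\<forall>i. f i \<in> carrier (gr_comp R \<mm> M i)) \<and> finite {i. f i \<noteq> \<zero>\<^bsub>gr_comp R \<mm> M i\<^esub>}}"

text \<open>
  The action is the Cauchy product of the pairings
  \<open>\<mm>\<^sup>i/\<mm>\<^sup>i\<^sup>+\<^sup>1 \<times> \<mm>\<^sup>jM/\<mm>\<^sup>j\<^sup>+\<^sup>1M \<rightarrow> \<mm>\<^sup>i\<^sup>+\<^sup>jM/\<mm>\<^sup>i\<^sup>+\<^sup>j\<^sup>+\<^sup>1M\<close> induced by scalar multiplication; the union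
  over all representatives is a single coset, as in \<^const>\<open>rcoset_mult\<close>.
\<close>

definition gr_pairing ::
    "('r, 'x) ring_scheme \<Rightarrow> 'r set \<Rightarrow> ('r, 'm) module \<Rightarrow> nat \<Rightarrow> 'r set \<Rightarrow> 'm set \<Rightarrow> 'm set" where
  "gr_pairing R \<mm> M n A X =
     (\<Union>a\<in>A. \<Union>x\<in>X. ideal_mod R M (ideal_pow R \<mm> (Suc n)) +>\<^bsub>M\<^esub> (a \<odot>\<^bsub>M\<^esub> x))"

definition gr_act ::
    "('r, 'x) ring_scheme \<Rightarrow> 'r set \<Rightarrow> ('r, 'm) module \<Rightarrow>
     (nat \<Rightarrow> 'r set) \<Rightarrow> (nat \<Rightarrow> 'm set) \<Rightarrow> nat \<Rightarrow> 'm set" where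
  "gr_act R \<mm> M a f =
     (\<lambda>n. \<Oplus>\<^bsub>gr_comp R \<mm> M n\<^esub> i\<in>{..n}. gr_pairing R \<mm> M n (a i) (f (n - i)))"

definition gr_ring :: "('r, 'x) ring_scheme \<Rightarrow> 'r set \<Rightarrow> (nat \<Rightarrow> 'r set) ring" where
  "gr_ring R \<mm> =
     \<lparr>carrier = gr_carrier R \<mm> (ring_module R),
      mult = gr_act R \<mm> (ring_module R),
      one = (\<lambda>n. if n = 0 then ideal_mod R (ring_module R) (ideal_pow R \<mm> 1) +>\<^bsub>R\<^esub> \<one>\<^bsub>R\<^esub>
                 else \<zero>\<^bsub>gr_comp R \<mm> (ring_module R) n\<^esub>),
      zero = (\<lambda>n. \<zero>\<^bsub>gr_comp R \<mm> (ring_module R) n\<^esub>),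
      add = (\<lambda>f g n. f n \<oplus>\<^bsub>gr_comp R \<mm> (ring_module R) n\<^esub> g n)\<rparr>"

definition gr_module ::
    "('r, 'x) ring_scheme \<Rightarrow> 'r set \<Rightarrow> ('r, 'm) module \<Rightarrow>
     (nat \<Rightarrow> 'r set, nat \<Rightarrow> 'm set) module" where
  "gr_module R \<mm> M =
     \<lparr>carrier = gr_carrier R \<mm> M, mult = undefined, one = undefined,
      zero = (\<lambda>n. \<zero>\<^bsub>gr_comp R \<mm> M n\<^esub>),
      add = (\<lambda>f g n. f n \<oplus>\<^bsub>gr_comp R \<mm> M n\<^esub> g n),
      smult = gr_act R \<mm> M\<rparr>"

definition gr_plus :: "('r, 'x) ring_scheme \<Rightarrow> 'r set \<Rightarrow> (nat \<Rightarrow> 'r set) set" where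
  "gr_plus R \<mm> = {f \<in> carrier (gr_ring R \<mm>). f 0 = \<zero>\<^bsub>gr_ring R \<mm>\<^esub> 0}"


section \<open>Ext and the type of a module\<close>

definition free_resolution ::
    "('r, 'x) ring_scheme \<Rightarrow> ('r, 'n) module \<Rightarrow> (nat \<Rightarrow> nat) \<Rightarrow>
     (nat \<Rightarrow> (nat \<Rightarrow> 'r) \<Rightarrow> (nat \<Rightarrow> 'r)) \<Rightarrow> ((nat \<Rightarrow> 'r) \<Rightarrow> 'n) \<Rightarrow> bool" where
  "free_resolution R N b d \<epsilon> \<longleftrightarrow>
     \<epsilon> \<in> lin_maps R (free_module R (b 0)) N \<and>
     \<epsilon> ` carrier (free_module R (b 0)) = carrier N \<and>
     (\<forall>i. d i \<in> lin_maps R (free_module R (b (Suc i))) (free_module R (b i))) \<and>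
     d 0 ` carrier (free_module R (b 1)) = {x \<in> carrier (free_module R (b 0)). \<epsilon> x = \<zero>\<^bsub>N\<^esub>} \<and>
     (\<forall>i. d (Suc i) ` carrier (free_module R (b (Suc (Suc i)))) =
          {x \<in> carrier (free_module R (b (Suc i))). d i x = \<zero>\<^bsub>free_module R (b i)\<^esub>})"

definition ext_cocycles ::
    "('r, 'x) ring_scheme \<Rightarrow> (nat \<Rightarrow> nat) \<Rightarrow> (nat \<Rightarrow> (nat \<Rightarrow> 'r) \<Rightarrow> (nat \<Rightarrow> 'r)) \<Rightarrow>
     ('r, 'm) module \<Rightarrow> nat \<Rightarrow> ((nat \<Rightarrow> 'r) \<Rightarrow> 'm) set" where
  "ext_cocycles R b d M i =
     {\<phi> \<in> carrier (hom_module R (free_module R (b i)) M).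
        \<forall>x\<in>carrier (free_module R (b (Suc i))). \<phi> (d i x) = \<zero>\<^bsub>M\<^esub>}"

definition ext_coboundaries ::
    "('r, 'x) ring_scheme \<Rightarrow> (nat \<Rightarrow> nat) \<Rightarrow> (nat \<Rightarrow> (nat \<Rightarrow> 'r) \<Rightarrow> (nat \<Rightarrow> 'r)) \<Rightarrow>
     ('r, 'm) module \<Rightarrow> nat \<Rightarrow> ((nat \<Rightarrow> 'r) \<Rightarrow> 'm) set" where
  "ext_coboundaries R b d M i =
     (case i of
        0 \<Rightarrow> {\<zero>\<^bsub>hom_module R (free_module R (b 0)) M\<^esub>}
      | Suc j \<Rightarrow> (\<lambda>\<psi>. \<lambda>x\<in>carrier (free_module R (b i)). \<psi> (d j x)) `
                   carrier (hom_module R (free_module R (b j)) M))"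

text \<open>
  \<open>Ext\<^sup>i\<^sub>R(N, M)\<close> for a finitely generated \<open>N\<close> over a Noetherian ring: such an \<open>N\<close> has a
  resolution by finitely generated free modules, and \<open>Ext\<close> does not depend, up to
  isomorphism, on the one that is chosen.
\<close>

definition ext_module ::
    "('r, 'x) ring_scheme \<Rightarrow> nat \<Rightarrow> ('r, 'n) module \<Rightarrow> ('r, 'm) module \<Rightarrow>
     ('r, ((nat \<Rightarrow> 'r) \<Rightarrow> 'm) set) module" where
  "ext_module R i N M =
     (let (b, d, \<epsilon>) = (SOME (b, d, \<epsilon>). free_resolution R N b d \<epsilon>) in
      quot_module R
        ((hom_module R (free_module R (b i)) M)\<lparr>carrier := ext_cocycles R b d M i\<rparr>)
        (ext_coboundaries R b d M i))"

text \<open>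
  A module annihilated by \<open>\<mm>\<close>, regarded as a vector space over \<open>R/\<mm>\<close>: a scalar acts through
  any of its representatives.
\<close>

definition residue_space ::
    "('r, 'x) ring_scheme \<Rightarrow> ('r, 'v) module \<Rightarrow> ('r set, 'v) module" where
  "residue_space R V =
     \<lparr>carrier = carrier V, mult = undefined, one = undefined,
      zero = zero V, add = add V, smult = (\<lambda>c v. (SOME r. r \<in> c) \<odot>\<^bsub>V\<^esub> v)\<rparr>"

definition finite_basis :: "('k, 'x) ring_scheme \<Rightarrow> ('k, 'v) module \<Rightarrow> 'v set \<Rightarrow> bool" where
  "finite_basis K V B \<longleftrightarrow>
     finite B \<and> generates K V B \<and>
     (\<forall>c \<in> B \<rightarrow> carrier K. (\<Oplus>\<^bsub>V\<^esub> v\<in>B. c v \<odot>\<^bsub>V\<^esub> v) = \<zero>\<^bsub>V\<^esub> \<longrightarrow> (\<forall>v\<in>B. c v = \<zero>\<^bsub>K\<^esub>))"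

definition vdim :: "('k, 'x) ring_scheme \<Rightarrow> ('k, 'v) module \<Rightarrow> enat" where
  "vdim K V = Inf {enat (card B) | B. finite_basis K V B}"

text \<open>\<open>r(M) = dim\<^sub>k Ext\<^sup>t\<^sub>R(k, M)\<close> with \<open>k = R/\<mm>\<close> and \<open>t = depth M\<close>.\<close>

definition cm_type :: "('r, 'x) ring_scheme \<Rightarrow> 'r set \<Rightarrow> ('r, 'm) module \<Rightarrow> enat" where
  "cm_type R \<mm> M =
     vdim (R Quot \<mm>)
       (residue_space R
          (ext_module R (the_enat (depth R \<mm> M)) (quot_module R (ring_module R) \<mm>) M))"


section \<open>Injective dimension, Gorenstein rings, canonical modules\<close>

text \<open>
  The extension property is required for modules \<open>B\<close> whose elements have the type of the
  elements of \<open>R\<close>, since a definition cannot quantify over types. These include \<open>R\<close> itself,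
  so by Baer's criterion the property for arbitrary \<open>B\<close> follows.
\<close>

definition injective_module :: "('r, 'x) ring_scheme \<Rightarrow> ('r, 'e) module \<Rightarrow> bool" where
  "injective_module R E \<longleftrightarrow>
     module R E \<and>
     (\<forall>(B :: ('r, 'r) module) A f.
        module R B \<and> submodule A R B \<and> f \<in> lin_maps R (B\<lparr>carrier := A\<rparr>) E \<longrightarrow>
        (\<exists>g\<in>lin_maps R B E. \<forall>x\<in>A. g x = f x))"

definition injective_resolution ::
    "('r, 'x) ring_scheme \<Rightarrow> ('r, 'm) module \<Rightarrow> (nat \<Rightarrow> ('r, 'e) module) \<Rightarrow>
     (nat \<Rightarrow> 'e \<Rightarrow> 'e) \<Rightarrow> ('m \<Rightarrow> 'e) \<Rightarrow> bool" where
  "injective_resolution R M E d \<eta> \<longleftrightarrow>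
     (\<forall>i. injective_module R (E i)) \<and>
     \<eta> \<in> lin_maps R M (E 0) \<and> inj_on \<eta> (carrier M) \<and>
     (\<forall>i. d i \<in> lin_maps R (E i) (E (Suc i))) \<and>
     \<eta> ` carrier M = {x \<in> carrier (E 0). d 0 x = \<zero>\<^bsub>E 1\<^esub>} \<and>
     (\<forall>i. d i ` carrier (E i) = {x \<in> carrier (E (Suc i)). d (Suc i) x = \<zero>\<^bsub>E (Suc (Suc i))\<^esub>})"

text \<open>
  Finite injective dimension of a finitely generated module over a nonzero Noetherian ring
  \<open>R\<close>. The modules of the resolution have elements in \<open>nat \<Rightarrow> 'r\<close>, which loses no
  generality: every term of the minimal injective resolution is a direct sum of modules
  \<open>E(R/p)\<close>, \<open>p\<close> prime, each occurring finitely often. There are at most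
  \<open>max(|R|, \<aleph>\<^sub>0)\<close> primes and each \<open>E(R/p)\<close>, being a countable union of \<open>R\<^sub>p\<close>-modules of finite
  length, has at most \<open>max(|R|, \<aleph>\<^sub>0)\<close> elements.
\<close>

definition finite_inj_dim :: "('r, 'x) ring_scheme \<Rightarrow> ('r, 'm) module \<Rightarrow> bool" where
  "finite_inj_dim R M \<longleftrightarrow>
     (\<exists>(E :: nat \<Rightarrow> ('r, nat \<Rightarrow> 'r) module) d \<eta> n.
        injective_resolution R M E d \<eta> \<and> (\<forall>i>n. carrier (E i) = {\<zero>\<^bsub>E i\<^esub>}))"

definition gorenstein_local :: "('r, 'x) ring_scheme \<Rightarrow> 'r set \<Rightarrow> bool" where
  "gorenstein_local R \<mm> \<longleftrightarrow> noetherian_local R \<mm> \<and> finite_inj_dim R (ring_module R)"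

text \<open>
  The definition of Bruns and Herzog: a canonical module is a maximal Cohen--Macaulay module
  of type 1 and of finite injective dimension.
\<close>

definition canonical_module ::
    "('r, 'x) ring_scheme \<Rightarrow> 'r set \<Rightarrow> ('r, 'w) module \<Rightarrow> bool" where
  "canonical_module R \<mm> \<omega> \<longleftrightarrow>
     maximal_cohen_macaulay R \<mm> \<omega> \<and> cm_type R \<mm> \<omega> = 1 \<and> finite_inj_dim R \<omega>"

end

theory Submission imports Defs begin

text \<open>
  Choose \<open>z \<in> \<mm>\<^sup>s\<close>, \<open>s > 0\<close>, with \<open>z\<mm>\<^sup>n = \<mm>\<^sup>n\<^sup>+\<^sup>s\<close> for all large \<open>n\<close>; for a finite residue field, \<open>s = 1\<close>
  may be impossible. On a finitely generated module \<open>M\<close> on which \<open>z\<close> is regular, the length of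
  \<open>M/zM\<close> is \<open>s\<close> times the multiplicity, and a Pluennecke inequality for lengths shows that the
  number of generators equals the multiplicity if and only if \<open>\<mm>\<^sup>sM = zM\<close>.

  If \<open>R\<close> is not Gorenstein, no functional on \<open>\<omega>\<close> takes a unit value, since \<open>\<omega>\<close> has type one and
  would be isomorphic to \<open>R\<close>. Hence every \<open>f \<in> \<mm>\<omega>\<^sup>*\<close> has values in \<open>\<mm>\<^sup>2\<close>. Since \<open>\<mm>\<^sup>s\<mm>\<^sup>2 = z\<mm>\<^sup>2\<close>, each
  \<open>cf\<close> with \<open>c \<in> \<mm>\<^sup>s\<close> is \<open>z\<close> times another functional, so \<open>\<mm>\<^sup>s(\<mm>\<omega>\<^sup>*) \<subseteq> z\<omega>\<^sup>*\<close>. If \<open>zu \<in> \<mm>\<^sup>s\<^sup>+\<^sup>1\<omega>\<^sup>*\<close>, then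
  \<open>\<mm>\<^sup>n\<^sup>+\<^sup>su = \<mm>\<^sup>nzu \<subseteq> \<mm>\<^sup>n\<^sup>+\<^sup>s\<^sup>+\<^sup>1\<omega>\<^sup>*\<close> for large \<open>n\<close>, and \<open>u \<in> \<mm>\<omega>\<^sup>*\<close> because the associated graded module
  has positive depth. So \<open>\<mm>\<^sup>s(\<mm>\<omega>\<^sup>*) = z\<mm>\<omega>\<^sup>*\<close>.
\<close>

subsection \<open>Submodules\<close>

text \<open>With an infinite residue field one could take \<open>s = 1\<close>, and the criterion
  would be immediate: \<open>zM \<subseteq> \<mm>M\<close>, and the two colengths are the
  multiplicity and the number of generators. A finite residue field is usually removed by enlarging
  the ring, but then the canonical module, its type and the associated graded module have to be
  carried along. Keeping the ring forces \<open>s > 1\<close>, and one multiplication by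
  \<open>\<mm>\<close> has to be compared with \<open>s\<close> of them. With
  \<open>L = \<mm>^n M\<close> for a large \<open>n\<close>, the number of generators equals the
  multiplicity exactly when \<open>\<ell>(\<mm>M/\<mm>L) = \<ell>(M/L)\<close>. The inequality
  extends this to \<open>\<ell>(\<mm>^s M/\<mm>^s L) \<le> \<ell>(M/L) = \<ell>(zM/zL)\<close>.
  Since \<open>\<mm>^s L = zL\<close> and \<open>zM \<subseteq> \<mm>^s M\<close>, it follows that
  \<open>zM = \<mm>^s M\<close>. The existence of \<open>z\<close> rests on the boundedness of the
  Hilbert function of the ring: the monomials in two forms of equal degree become dependent, so a
  single form can replace both up to nilpotents.\<close>

locale plain_module = module R M
  for R :: "('r, 'x) ring_scheme" (structure) and M :: "('r, 'm) module" (structure)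

lemma (in plain_module) gen_submodule_least:
  "submodule N R M \<Longrightarrow> S \<subseteq> N \<Longrightarrow> gen_submodule R M S \<subseteq> N"
  by (auto simp: gen_submodule_def)

lemma (in plain_module) submodule_gen:
  assumes "S \<subseteq> carrier M" shows "submodule (gen_submodule R M S) R M"
proof (rule submoduleI)
  note E = submoduleE
  show "gen_submodule R M S \<subseteq> carrier M"
    using assms carrier_is_submodule by (rule_tac gen_submodule_least)
  show "\<zero>\<^bsub>M\<^esub> \<in> gen_submodule R M S"
    unfolding gen_submodule_def
    by (clarsimp) (metis E(2) E(1) E(4) R.zero_closed smult_l_null subsetD ex_in_conv)
qed (auto simp: gen_submodule_def dest: submoduleE)

lemma (in plain_module) gen_submodule_superset: "S \<subseteq> gen_submodule R M S"
  by (auto simp: gen_submodule_def)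

lemma (in plain_module) gen_submodule_mono:
  "S \<subseteq> T \<Longrightarrow> gen_submodule R M S \<subseteq> gen_submodule R M T"
  by (auto simp: gen_submodule_def)

lemma (in plain_module) gen_submodule_eq: "submodule N R M \<Longrightarrow> gen_submodule R M N = N"
  by (auto simp: gen_submodule_def)

lemma (in plain_module) submodule_zero: "submodule N R M \<Longrightarrow> \<zero>\<^bsub>M\<^esub> \<in> N"
  using submoduleE[of N] by (metis R.zero_closed equals0I smult_l_null subsetD)

lemma (in plain_module) submodule_diff:
  "submodule N R M \<Longrightarrow> x \<in> N \<Longrightarrow> y \<in> N \<Longrightarrow> x \<ominus>\<^bsub>M\<^esub> y \<in> N"
  using submoduleE[of N] by (simp add: a_minus_def)

lemma (in plain_module) submodule_null: "submodule {\<zero>\<^bsub>M\<^esub>} R M"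
  by (rule submoduleI) auto

lemma (in plain_module) submodule_Int:
  "submodule A R M \<Longrightarrow> submodule B R M \<Longrightarrow> submodule (A \<inter> B) R M"
  by (rule submoduleI) (auto dest: submoduleE submodule_zero)

lemma (in plain_module) submodule_set_add:
  assumes A: "submodule A R M" and B: "submodule B R M"
  shows "submodule (A <+>\<^bsub>M\<^esub> B) R M"
proof (rule submoduleI)
  note cA = submoduleE(1)[OF A, THEN subsetD] and cB = submoduleE(1)[OF B, THEN subsetD]
  show "A <+>\<^bsub>M\<^esub> B \<subseteq> carrier M" using cA cB by (auto simp: set_add_def')
  show "\<zero>\<^bsub>M\<^esub> \<in> A <+>\<^bsub>M\<^esub> B"
    using submodule_zero[OF A] submodule_zero[OF B] by (force simp: set_add_def')
  fix x assume "x \<in> A <+>\<^bsub>M\<^esub> B"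
  then obtain a b where x: "a \<in> A" "b \<in> B" "x = a \<oplus>\<^bsub>M\<^esub> b" by (auto simp: set_add_def')
  have "\<ominus>\<^bsub>M\<^esub> x = \<ominus>\<^bsub>M\<^esub> a \<oplus>\<^bsub>M\<^esub> \<ominus>\<^bsub>M\<^esub> b" using x cA cB by (simp add: M.minus_add)
  then show "\<ominus>\<^bsub>M\<^esub> x \<in> A <+>\<^bsub>M\<^esub> B"
    using x submoduleE(3)[OF A] submoduleE(3)[OF B] by (auto simp: set_add_def')
  { fix y assume "y \<in> A <+>\<^bsub>M\<^esub> B"
    then obtain a' b' where y: "a' \<in> A" "b' \<in> B" "y = a' \<oplus>\<^bsub>M\<^esub> b'" by (auto simp: set_add_def')
    have "x \<oplus>\<^bsub>M\<^esub> y = (a \<oplus>\<^bsub>M\<^esub> a') \<oplus>\<^bsub>M\<^esub> (b \<oplus>\<^bsub>M\<^esub> b')"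
      using x y cA cB by (simp add: M.a_ac)
    then show "x \<oplus>\<^bsub>M\<^esub> y \<in> A <+>\<^bsub>M\<^esub> B"
      using submoduleE(5)[OF A x(1) y(1)] submoduleE(5)[OF B x(2) y(2)] unfolding set_add_def' by blast }
  fix r assume r: "r \<in> carrier R"
  have "r \<odot>\<^bsub>M\<^esub> x = r \<odot>\<^bsub>M\<^esub> a \<oplus>\<^bsub>M\<^esub> r \<odot>\<^bsub>M\<^esub> b"
    using x r cA cB by (simp add: smult_r_distr)
  then show "r \<odot>\<^bsub>M\<^esub> x \<in> A <+>\<^bsub>M\<^esub> B"
    using submoduleE(4)[OF A r x(1)] submoduleE(4)[OF B r x(2)] unfolding set_add_def' by blast
qed

lemma (in plain_module) set_add_upper1:
  "submodule A R M \<Longrightarrow> submodule B R M \<Longrightarrow> A \<subseteq> A <+>\<^bsub>M\<^esub> B"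
  using submodule_zero[of B] submoduleE(1)[of A] by (force simp: set_add_def')

lemma (in plain_module) set_add_upper2:
  "submodule A R M \<Longrightarrow> submodule B R M \<Longrightarrow> B \<subseteq> A <+>\<^bsub>M\<^esub> B"
  using submodule_zero[of A] submoduleE(1)[of B] by (force simp: set_add_def')

lemma (in plain_module) set_add_least:
  "submodule C R M \<Longrightarrow> A \<subseteq> C \<Longrightarrow> B \<subseteq> C \<Longrightarrow> A <+>\<^bsub>M\<^esub> B \<subseteq> C"
  using submoduleE(5)[of C] by (auto simp: set_add_def')

lemma (in plain_module) set_add_absorb:
  "submodule A R M \<Longrightarrow> submodule B R M \<Longrightarrow> B \<subseteq> A \<Longrightarrow> A <+>\<^bsub>M\<^esub> B = A"
  using set_add_upper1 set_add_least by blast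

section \<open>Multiples of submodules by elements and by ideals\<close>

definition scaled :: "('r, 'm) module \<Rightarrow> 'r \<Rightarrow> 'm set \<Rightarrow> 'm set" where
  "scaled M a A = (\<lambda>x. a \<odot>\<^bsub>M\<^esub> x) ` A"

lemma (in plain_module) submodule_scaled:
  assumes A: "submodule A R M" and a: "a \<in> carrier R"
  shows "submodule (scaled M a A) R M"
proof (rule submoduleI)
  note cA = submoduleE(1)[OF A, THEN subsetD]
  show "scaled M a A \<subseteq> carrier M" using a cA by (auto simp: scaled_def)
  show "\<zero>\<^bsub>M\<^esub> \<in> scaled M a A"
    unfolding scaled_def using submodule_zero[OF A] a by (force intro!: image_eqI)
  fix x assume "x \<in> scaled M a A"
  then obtain u where x: "u \<in> A" "x = a \<odot>\<^bsub>M\<^esub> u" by (auto simp: scaled_def)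
  show "\<ominus>\<^bsub>M\<^esub> x \<in> scaled M a A"
    unfolding scaled_def using x a cA submoduleE(3)[OF A x(1)]
    by (intro image_eqI[of _ _ "\<ominus>\<^bsub>M\<^esub> u"]) (auto simp: smult_r_minus)
  { fix y assume "y \<in> scaled M a A"
    then obtain v where y: "v \<in> A" "y = a \<odot>\<^bsub>M\<^esub> v" by (auto simp: scaled_def)
    show "x \<oplus>\<^bsub>M\<^esub> y \<in> scaled M a A"
      unfolding scaled_def using x y a cA submoduleE(5)[OF A x(1) y(1)]
      by (intro image_eqI[of _ _ "u \<oplus>\<^bsub>M\<^esub> v"]) (auto simp: smult_r_distr) }
  fix r assume r: "r \<in> carrier R"
  show "r \<odot>\<^bsub>M\<^esub> x \<in> scaled M a A"
    unfolding scaled_def using x r a cA submoduleE(4)[OF A r x(1)]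
    by (intro image_eqI[of _ _ "r \<odot>\<^bsub>M\<^esub> u"]) (auto simp: smult_assoc1[symmetric] R.m_comm)
qed

lemma scaled_mono: "A \<subseteq> B \<Longrightarrow> scaled M a A \<subseteq> scaled M a B"
  by (auto simp: scaled_def)

text \<open>Unlike \<open>ideal_mod\<close>, this takes an arbitrary second factor, in particular a
  submodule, so that products can be iterated. The first factor may be a mere generating set of the
  ideal.\<close>

definition ideal_smul ::
    "('r, 'x) ring_scheme \<Rightarrow> ('r, 'm) module \<Rightarrow> 'r set \<Rightarrow> 'm set \<Rightarrow> 'm set" where
  "ideal_smul R M I A = gen_submodule R M {a \<odot>\<^bsub>M\<^esub> x | a x. a \<in> I \<and> x \<in> A}"

lemma ideal_mod_smul: "ideal_mod R M I = ideal_smul R M I (carrier M)"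
  by (simp add: ideal_mod_def ideal_smul_def)

lemma (in plain_module) submodule_ideal_smul:
  "I \<subseteq> carrier R \<Longrightarrow> A \<subseteq> carrier M \<Longrightarrow> submodule (ideal_smul R M I A) R M"
  unfolding ideal_smul_def by (rule submodule_gen) auto

lemma (in plain_module) ideal_smulI:
  "a \<in> I \<Longrightarrow> x \<in> A \<Longrightarrow> a \<odot>\<^bsub>M\<^esub> x \<in> ideal_smul R M I A"
  unfolding ideal_smul_def by (rule subsetD[OF gen_submodule_superset]) blast

lemma (in plain_module) ideal_smul_least:
  "submodule N R M \<Longrightarrow> (\<And>a x. a \<in> I \<Longrightarrow> x \<in> A \<Longrightarrow> a \<odot>\<^bsub>M\<^esub> x \<in> N) \<Longrightarrow> ideal_smul R M I A \<subseteq> N"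
  unfolding ideal_smul_def by (rule gen_submodule_least) auto

lemma (in plain_module) ideal_smul_mono:
  "I \<subseteq> J \<Longrightarrow> A \<subseteq> B \<Longrightarrow> ideal_smul R M I A \<subseteq> ideal_smul R M J B"
  unfolding ideal_smul_def by (rule gen_submodule_mono) auto

lemma (in plain_module) ideal_smul_subset:
  "I \<subseteq> carrier R \<Longrightarrow> submodule A R M \<Longrightarrow> ideal_smul R M I A \<subseteq> A"
  by (rule ideal_smul_least) (auto dest: submoduleE)

text \<open>The colon submodule \<open>(N :_M I)\<close>. To prove \<open>I A \<subseteq> N\<close>
  for a generated submodule \<open>A\<close>, it suffices to find the generators of \<open>A\<close>
  in it.\<close>

lemma (in plain_module) submodule_colon:
  assumes N: "submodule N R M" and I: "I \<subseteq> carrier R"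
  shows "submodule {x \<in> carrier M. \<forall>a\<in>I. a \<odot>\<^bsub>M\<^esub> x \<in> N} R M"
proof (rule submoduleI)
  have I': "a \<in> carrier R" if "a \<in> I" for a using I that by blast
  fix r x assume r: "r \<in> carrier R" and x: "x \<in> {x \<in> carrier M. \<forall>a\<in>I. a \<odot>\<^bsub>M\<^esub> x \<in> N}"
  have "a \<odot>\<^bsub>M\<^esub> (r \<odot>\<^bsub>M\<^esub> x) \<in> N" if a: "a \<in> I" for a
  proof -
    have "a \<odot>\<^bsub>M\<^esub> (r \<odot>\<^bsub>M\<^esub> x) = r \<odot>\<^bsub>M\<^esub> (a \<odot>\<^bsub>M\<^esub> x)"
      using I'[OF a] r x by (simp add: smult_assoc1[symmetric] R.m_comm)
    then show ?thesis using a x submoduleE(4)[OF N r] by simp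
  qed
  then show "r \<odot>\<^bsub>M\<^esub> x \<in> {x \<in> carrier M. \<forall>a\<in>I. a \<odot>\<^bsub>M\<^esub> x \<in> N}" using r x by simp
next
  fix x y assume x: "x \<in> {x \<in> carrier M. \<forall>a\<in>I. a \<odot>\<^bsub>M\<^esub> x \<in> N}"
  have I': "a \<in> carrier R" if "a \<in> I" for a using I that by blast
  show "\<ominus>\<^bsub>M\<^esub> x \<in> {x \<in> carrier M. \<forall>a\<in>I. a \<odot>\<^bsub>M\<^esub> x \<in> N}"
    using x submoduleE(3)[OF N] by (auto simp: smult_r_minus I')
  assume y: "y \<in> {x \<in> carrier M. \<forall>a\<in>I. a \<odot>\<^bsub>M\<^esub> x \<in> N}"
  show "x \<oplus>\<^bsub>M\<^esub> y \<in> {x \<in> carrier M. \<forall>a\<in>I. a \<odot>\<^bsub>M\<^esub> x \<in> N}"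
    using x y submoduleE(5)[OF N] by (auto simp: smult_r_distr I')
next
  have "a \<odot>\<^bsub>M\<^esub> \<zero>\<^bsub>M\<^esub> = \<zero>\<^bsub>M\<^esub>" if "a \<in> I" for a using I that by auto
  then show "\<zero>\<^bsub>M\<^esub> \<in> {x \<in> carrier M. \<forall>a\<in>I. a \<odot>\<^bsub>M\<^esub> x \<in> N}"
    using submodule_zero[OF N] by simp
qed auto

lemma (in plain_module) ideal_smul_gen:
  assumes I: "I \<subseteq> carrier R" and S: "S \<subseteq> carrier M"
  shows "ideal_smul R M I (gen_submodule R M S) = ideal_smul R M I S"
proof
  let ?N = "ideal_smul R M I S"
  have N: "submodule ?N R M" using I S by (rule submodule_ideal_smul)
  have "gen_submodule R M S \<subseteq> {x \<in> carrier M. \<forall>a\<in>I. a \<odot>\<^bsub>M\<^esub> x \<in> ?N}"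
    using S ideal_smulI[of _ I _ S] by (intro gen_submodule_least submodule_colon N I) blast
  then show "ideal_smul R M I (gen_submodule R M S) \<subseteq> ?N"
    by (intro ideal_smul_least N) blast
  show "?N \<subseteq> ideal_smul R M I (gen_submodule R M S)"
    by (rule ideal_smul_mono[OF order_refl gen_submodule_superset])
qed

text \<open>The colon ideal \<open>(N :_R A)\<close>. It plays the role of
  \<open>submodule_colon\<close> for the other factor: inclusions are checked on generators of the
  ideal.\<close>

lemma (in plain_module) ideal_annihilator_mod:
  assumes N: "submodule N R M" and A: "A \<subseteq> carrier M"
  shows "ideal {a \<in> carrier R. \<forall>x\<in>A. a \<odot>\<^bsub>M\<^esub> x \<in> N} R"
proof (rule idealI)
  let ?J = "{a \<in> carrier R. \<forall>x\<in>A. a \<odot>\<^bsub>M\<^esub> x \<in> N}"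
  show "ring R" by (rule R.ring_axioms)
  have A': "x \<in> carrier M" if "x \<in> A" for x using A that by blast
  show "subgroup ?J (add_monoid R)"
  proof (rule R.add.subgroupI)
    have "\<zero> \<in> ?J" using submodule_zero[OF N] by (simp add: A')
    then show "?J \<noteq> {}" by blast
    fix a b assume a: "a \<in> ?J"
    show "\<ominus> a \<in> ?J" using a submoduleE(3)[OF N] by (auto simp: smult_l_minus A')
    assume b: "b \<in> ?J"
    show "a \<oplus> b \<in> ?J" using a b submoduleE(5)[OF N] by (auto simp: smult_l_distr A')
  qed auto
  fix a x assume a: "a \<in> ?J" and x: "x \<in> carrier R"
  show "x \<otimes> a \<in> ?J" using a x submoduleE(4)[OF N x] by (auto simp: smult_assoc1 A')
  then show "a \<otimes> x \<in> ?J" using a x by (simp add: R.m_comm)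
qed

lemma (in plain_module) ideal_smul_genideal:
  assumes T: "T \<subseteq> carrier R" and A: "A \<subseteq> carrier M"
  shows "ideal_smul R M (Idl T) A = ideal_smul R M T A"
proof
  let ?N = "ideal_smul R M T A"
  have N: "submodule ?N R M" using T A by (rule submodule_ideal_smul)
  have "Idl T \<subseteq> {a \<in> carrier R. \<forall>x\<in>A. a \<odot>\<^bsub>M\<^esub> x \<in> ?N}"
    using T ideal_smulI[of _ T _ A] by (intro R.genideal_minimal ideal_annihilator_mod N A) blast
  then show "ideal_smul R M (Idl T) A \<subseteq> ?N"
    by (intro ideal_smul_least N) blast
  show "?N \<subseteq> ideal_smul R M (Idl T) A"
    using R.genideal_self[OF T] by (rule ideal_smul_mono) auto
qed

lemma ideal_subset: "ideal I R \<Longrightarrow> I \<subseteq> carrier R"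
  by (rule additive_subgroup.a_subset[OF ideal.axioms(1)])

lemma (in plain_module) ideal_smul_prod:
  assumes I: "ideal I R" and J: "ideal J R" and A: "submodule A R M"
  shows "ideal_smul R M (I \<cdot> J) A = ideal_smul R M I (ideal_smul R M J A)"
proof
  have cI: "I \<subseteq> carrier R" and cJ: "J \<subseteq> carrier R" and cA: "A \<subseteq> carrier M"
    by (rule ideal_subset[OF I] ideal_subset[OF J] submoduleE(1)[OF A])+
  let ?N = "ideal_smul R M I (ideal_smul R M J A)"
  have JA: "submodule (ideal_smul R M J A) R M" by (rule submodule_ideal_smul[OF cJ cA])
  have N: "submodule ?N R M" by (rule submodule_ideal_smul[OF cI submoduleE(1)[OF JA]])
  have "I \<cdot> J \<subseteq> {a \<in> carrier R. \<forall>x\<in>A. a \<odot>\<^bsub>M\<^esub> x \<in> ?N}" (is "_ \<subseteq> ?C")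
  proof
    have C: "ideal ?C R" by (rule ideal_annihilator_mod[OF N cA])
    fix c assume "c \<in> I \<cdot> J"
    then show "c \<in> ?C"
    proof (induct c rule: ideal_prod.induct)
      case (prod i j)
      have ij: "i \<in> carrier R" "j \<in> carrier R" using prod cI cJ by blast+
      have "(i \<otimes> j) \<odot>\<^bsub>M\<^esub> x \<in> ?N" if x: "x \<in> A" for x
        using ideal_smulI[OF prod(1) ideal_smulI[OF prod(2) x]] subsetD[OF cA x] ij
        by (simp add: smult_assoc1)
      then show ?case using ij by simp
    next
      case (sum a b) show ?case by (rule additive_subgroup.a_closed[OF ideal.axioms(1)[OF C] sum(2) sum(4)])
    qed
  qed
  then show "ideal_smul R M (I \<cdot> J) A \<subseteq> ?N"
    by (intro ideal_smul_least N) blast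
  let ?N' = "ideal_smul R M (I \<cdot> J) A"
  have N': "submodule ?N' R M"
    using R.ideal_prod_in_carrier[OF I J] cA by (rule submodule_ideal_smul)
  have "ideal_smul R M J A \<subseteq> {x \<in> carrier M. \<forall>a\<in>I. a \<odot>\<^bsub>M\<^esub> x \<in> ?N'}"
  proof (intro ideal_smul_least submodule_colon N' cI, intro CollectI conjI ballI)
    fix b x a assume *: "b \<in> J" "x \<in> A"
    then show "b \<odot>\<^bsub>M\<^esub> x \<in> carrier M" using cJ cA by auto
    assume a: "a \<in> I"
    have "a \<odot>\<^bsub>M\<^esub> (b \<odot>\<^bsub>M\<^esub> x) = (a \<otimes> b) \<odot>\<^bsub>M\<^esub> x"
      using subsetD[OF cI a] subsetD[OF cJ *(1)] subsetD[OF cA *(2)] by (simp add: smult_assoc1)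
    then show "a \<odot>\<^bsub>M\<^esub> (b \<odot>\<^bsub>M\<^esub> x) \<in> ?N'"
      using * a by (simp add: ideal_smulI ideal_prod.prod)
  qed
  then show "?N \<subseteq> ?N'" by (intro ideal_smul_least N') blast
qed

lemma (in plain_module) ideal_smul_one:
  assumes A: "submodule A R M"
  shows "ideal_smul R M (carrier R) A = A"
proof
  show "ideal_smul R M (carrier R) A \<subseteq> A" by (rule ideal_smul_subset[OF order_refl A])
  show "A \<subseteq> ideal_smul R M (carrier R) A"
  proof
    fix x assume x: "x \<in> A"
    show "x \<in> ideal_smul R M (carrier R) A"
      using ideal_smulI[OF R.one_closed x] subsetD[OF submoduleE(1)[OF A] x] by simp
  qed
qed

lemma (in plain_module) ideal_smul_set_add:
  assumes I: "I \<subseteq> carrier R" and A: "submodule A R M" and B: "submodule B R M"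
  shows "ideal_smul R M I (A <+>\<^bsub>M\<^esub> B) = ideal_smul R M I A <+>\<^bsub>M\<^esub> ideal_smul R M I B"
proof
  note cA = submoduleE(1)[OF A] and cB = submoduleE(1)[OF B]
  have sA: "submodule (ideal_smul R M I A) R M" and sB: "submodule (ideal_smul R M I B) R M"
    by (rule submodule_ideal_smul[OF I cA] submodule_ideal_smul[OF I cB])+
  show "ideal_smul R M I (A <+>\<^bsub>M\<^esub> B) \<subseteq> ideal_smul R M I A <+>\<^bsub>M\<^esub> ideal_smul R M I B"
  proof (rule ideal_smul_least[OF submodule_set_add[OF sA sB]])
    fix a x assume a: "a \<in> I" and "x \<in> A <+>\<^bsub>M\<^esub> B"
    then obtain u v where x: "u \<in> A" "v \<in> B" "x = u \<oplus>\<^bsub>M\<^esub> v" by (auto simp: set_add_def')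
    have "a \<odot>\<^bsub>M\<^esub> x = a \<odot>\<^bsub>M\<^esub> u \<oplus>\<^bsub>M\<^esub> a \<odot>\<^bsub>M\<^esub> v"
      unfolding x using subsetD[OF I a] subsetD[OF cA x(1)] subsetD[OF cB x(2)] by (simp add: smult_r_distr)
    then show "a \<odot>\<^bsub>M\<^esub> x \<in> ideal_smul R M I A <+>\<^bsub>M\<^esub> ideal_smul R M I B"
      using ideal_smulI[OF a x(1)] ideal_smulI[OF a x(2)] unfolding set_add_def' by blast
  qed
  show "ideal_smul R M I A <+>\<^bsub>M\<^esub> ideal_smul R M I B \<subseteq> ideal_smul R M I (A <+>\<^bsub>M\<^esub> B)"
  proof (rule set_add_least)
    show "submodule (ideal_smul R M I (A <+>\<^bsub>M\<^esub> B)) R M"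
      by (rule submodule_ideal_smul[OF I submoduleE(1)[OF submodule_set_add[OF A B]]])
    show "ideal_smul R M I A \<subseteq> ideal_smul R M I (A <+>\<^bsub>M\<^esub> B)"
      by (rule ideal_smul_mono[OF subset_refl set_add_upper1[OF A B]])
    show "ideal_smul R M I B \<subseteq> ideal_smul R M I (A <+>\<^bsub>M\<^esub> B)"
      by (rule ideal_smul_mono[OF subset_refl set_add_upper2[OF A B]])
  qed
qed

lemma (in plain_module) ideal_smul_scaled:
  assumes I: "I \<subseteq> carrier R" and A: "submodule A R M" and a: "a \<in> carrier R"
  shows "ideal_smul R M I (scaled M a A) = scaled M a (ideal_smul R M I A)"
proof
  note cA = submoduleE(1)[OF A]
  have sA: "submodule (ideal_smul R M I A) R M" by (rule submodule_ideal_smul[OF I cA])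
  have comm: "b \<odot>\<^bsub>M\<^esub> (a \<odot>\<^bsub>M\<^esub> u) = a \<odot>\<^bsub>M\<^esub> (b \<odot>\<^bsub>M\<^esub> u)" if "b \<in> I" "u \<in> A" for b u
    using subsetD[OF I that(1)] subsetD[OF cA that(2)] a by (simp add: smult_assoc1[symmetric] R.m_comm)
  show "ideal_smul R M I (scaled M a A) \<subseteq> scaled M a (ideal_smul R M I A)"
    by (rule ideal_smul_least[OF submodule_scaled[OF sA a]])
      (use comm ideal_smulI in \<open>fastforce simp: scaled_def\<close>)
  have aA: "submodule (scaled M a A) R M" by (rule submodule_scaled[OF A a])
  let ?N = "ideal_smul R M I (scaled M a A)"
  have N: "submodule ?N R M" by (rule submodule_ideal_smul[OF I submoduleE(1)[OF aA]])
  have "ideal_smul R M I A \<subseteq> {x \<in> carrier M. \<forall>b\<in>{a}. b \<odot>\<^bsub>M\<^esub> x \<in> ?N}"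
  proof (intro ideal_smul_least submodule_colon N)
    show "{a} \<subseteq> carrier R" using a by simp
    fix b x assume bx: "b \<in> I" "x \<in> A"
    have "b \<odot>\<^bsub>M\<^esub> (a \<odot>\<^bsub>M\<^esub> x) \<in> ?N" using bx by (intro ideal_smulI) (auto simp: scaled_def)
    then show "b \<odot>\<^bsub>M\<^esub> x \<in> {x \<in> carrier M. \<forall>b\<in>{a}. b \<odot>\<^bsub>M\<^esub> x \<in> ?N}"
      using subsetD[OF I bx(1)] subsetD[OF cA bx(2)] comm[OF bx] by simp
  qed
  then show "scaled M a (ideal_smul R M I A) \<subseteq> ?N" by (auto simp: scaled_def)
qed

section \<open>Powers of an ideal\<close>

lemma (in cring) ideal_pow_0: "ideal_pow R I 0 = carrier R"
  by (simp add: ideal_pow_def nat_pow_def ideals_set_def)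

lemma (in cring) ideal_pow_Suc_right: "ideal_pow R I (Suc n) = ideal_pow R I n \<cdot> I"
  by (simp add: ideal_pow_def nat_pow_def ideals_set_def)

lemma (in cring) ideal_ideal_pow: "ideal I R \<Longrightarrow> ideal (ideal_pow R I n) R"
  by (induct n) (simp_all add: ideal_pow_0 ideal_pow_Suc_right oneideal ideal_prod_is_ideal)

lemma (in cring) ideal_pow_1: "ideal I R \<Longrightarrow> ideal_pow R I (Suc 0) = I"
  by (simp add: ideal_pow_0 ideal_pow_Suc_right ideal_prod_commute oneideal ideal_prod_one)

lemma (in cring) ideal_pow_add:
  assumes I: "ideal I R" shows "ideal_pow R I (i + j) = ideal_pow R I i \<cdot> ideal_pow R I j"
proof (induct j)
  case 0 then show ?case using ideal_prod_one[OF ideal_ideal_pow[OF I]] by (simp add: ideal_pow_0)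
next
  case (Suc j) then show ?case
    using ideal_prod_assoc[OF ideal_ideal_pow[OF I] ideal_ideal_pow[OF I] I]
    by (simp add: ideal_pow_Suc_right)
qed

lemma (in cring) ideal_pow_Suc:
  "ideal I R \<Longrightarrow> ideal_pow R I (Suc n) = I \<cdot> ideal_pow R I n"
  using ideal_pow_add[of I 1 n] ideal_pow_1[of I] by simp

lemma (in cring) ideal_pow_anti:
  assumes I: "ideal I R" and ij: "i \<le> j"
  shows "ideal_pow R I j \<subseteq> ideal_pow R I i"
proof -
  have "ideal_pow R I j = ideal_pow R I (j - i) \<cdot> ideal_pow R I i"
    using ideal_pow_add[OF I, of "j - i" i] ij by simp
  then show ?thesis
    using ideal_prod_inter[OF ideal_ideal_pow[OF I, of "j - i"] ideal_ideal_pow[OF I, of i]] by simp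
qed

lemma (in cring) ideal_pow_mult:
  "ideal I R \<Longrightarrow> a \<in> ideal_pow R I i \<Longrightarrow> b \<in> ideal_pow R I j \<Longrightarrow> a \<otimes> b \<in> ideal_pow R I (i + j)"
  by (simp add: ideal_pow_add ideal_prod.prod)

lemma (in cring) ideal_pow_carrier: "ideal I R \<Longrightarrow> ideal_pow R I i \<subseteq> carrier R"
  by (rule ideal_subset[OF ideal_ideal_pow])

lemma (in cring) ideal_pow_pow:
  assumes I: "ideal I R" and a: "a \<in> ideal_pow R I i"
  shows "a [^] (n::nat) \<in> ideal_pow R I (n * i)"
proof (induct n)
  case 0 then show ?case by (simp add: ideal_pow_0)
next
  case (Suc n)
  then show ?case using ideal_pow_mult[OF I Suc a] by (simp add: add.commute)
qed

lemma (in plain_module) ideal_smul_pow_add: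
  assumes I: "ideal I R" and A: "submodule A R M"
  shows "ideal_smul R M (ideal_pow R I i) (ideal_smul R M (ideal_pow R I j) A)
       = ideal_smul R M (ideal_pow R I (i + j)) A"
  by (simp add: ideal_pow_add[OF I] ideal_smul_prod R.ideal_ideal_pow I A)

lemma (in plain_module) ideal_smul_pow_0:
  "submodule A R M \<Longrightarrow> ideal_smul R M (ideal_pow R I 0) A = A"
  by (simp add: R.ideal_pow_0 ideal_smul_one)

lemma (in plain_module) submodule_ideal_smul_pow:
  "ideal I R \<Longrightarrow> submodule A R M \<Longrightarrow> submodule (ideal_smul R M (ideal_pow R I i) A) R M"
  by (rule submodule_ideal_smul[OF R.ideal_pow_carrier submoduleE(1)])

subsection \<open>Lengths\<close>

text \<open>The common form of \<open>module_length\<close> and of the length between two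
  submodules. Lengths are then compared by monotone maps between ordered sets, without quotient
  modules.\<close>

definition chain_length :: "'a::order set \<Rightarrow> enat" where
  "chain_length F = Sup {enat n | n. \<exists>N :: nat \<Rightarrow> 'a. (\<forall>i\<le>n. N i \<in> F) \<and> (\<forall>i<n. N i < N (Suc i))}"

text \<open>If \<open>P k\<close> fails, downward closure bounds all members by
  \<open>k - 1\<close>. The equivalence turns an inequality for a possibly infinite length into the
  existence of one chain.\<close>

lemma enat_le_Sup_iff:
  assumes "P 0" and down: "\<And>m n. P n \<Longrightarrow> m \<le> n \<Longrightarrow> P m"
  shows "enat k \<le> Sup {enat n | n. P n} \<longleftrightarrow> P k"
proof
  assume le: "enat k \<le> Sup {enat n | n. P n}"
  show "P k"
  proof (rule ccontr)
    assume nk: "\<not> P k"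
    then have k: "0 < k" using \<open>P 0\<close> by (cases k) auto
    have "Sup {enat n | n. P n} \<le> enat (k - 1)"
    proof (rule Sup_least)
      fix a assume "a \<in> {enat n | n. P n}"
      then obtain n where a: "a = enat n" "P n" by auto
      then have "n < k" using nk down[of n k] by (meson not_le)
      then show "a \<le> enat (k - 1)" using a by simp
    qed
    with le have "enat k \<le> enat (k - 1)" by (rule order_trans)
    with k show False by simp
  qed
next
  assume "P k"
  then show "enat k \<le> Sup {enat n | n. P n}" by (intro Sup_upper) auto
qed

lemma enat_le_chain_length_iff:
  assumes "F \<noteq> {}"
  shows "enat k \<le> chain_length F \<longleftrightarrow> (\<exists>N. (\<forall>i\<le>k. N i \<in> F) \<and> (\<forall>i<k. N i < N (Suc i)))"
  unfolding chain_length_def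
proof (rule enat_le_Sup_iff)
  obtain x where "x \<in> F" using assms by blast
  then show "\<exists>N::nat \<Rightarrow> _. (\<forall>i\<le>0. N i \<in> F) \<and> (\<forall>i<0. N i < N (Suc i))"
    by (intro exI[of _ "\<lambda>_. x"]) simp
  fix m n :: nat
  assume mn: "m \<le> n" and "\<exists>N. (\<forall>i\<le>n. N i \<in> F) \<and> (\<forall>i<n. N i < N (Suc i))"
  then obtain N where N: "\<forall>i\<le>n. N i \<in> F" "\<forall>i<n. N i < N (Suc i)" by auto
  have "(\<forall>i\<le>m. N i \<in> F) \<and> (\<forall>i<m. N i < N (Suc i))"
    using N le_trans[OF _ mn] less_le_trans[OF _ mn] by simp
  then show "\<exists>N. (\<forall>i\<le>m. N i \<in> F) \<and> (\<forall>i<m. N i < N (Suc i))" by (rule exI[of _ N])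
qed

lemma chain_length_mono_map:
  assumes "\<And>x. x \<in> F \<Longrightarrow> f x \<in> G"
    and "\<And>x y. x \<in> F \<Longrightarrow> y \<in> F \<Longrightarrow> x < y \<Longrightarrow> f x < f y"
  shows "chain_length F \<le> chain_length G"
  unfolding chain_length_def
proof (rule Sup_mono)
  fix a assume "a \<in> {enat n |n. \<exists>N. (\<forall>i\<le>n. N i \<in> F) \<and> (\<forall>i<n. N i < N (Suc i))}"
  then obtain n N where "a = enat n" and N: "\<forall>i\<le>n. N i \<in> F" "\<forall>i<n. N i < N (Suc i)" by blast
  moreover have "(\<forall>i\<le>n. (f \<circ> N) i \<in> G) \<and> (\<forall>i<n. (f \<circ> N) i < (f \<circ> N) (Suc i))"
    using N assms by simp
  ultimately show "\<exists>b\<in>{enat n |n. \<exists>N. (\<forall>i\<le>n. N i \<in> G) \<and> (\<forall>i<n. N i < N (Suc i))}. a \<le> b"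
    by blast
qed

text \<open>Repetitions are dropped and the strict steps remain. The induction also records that the
  new chain ends in \<open>N n\<close>, so that the next strict step can be appended.\<close>

lemma weak_chain:
  fixes N :: "nat \<Rightarrow> 'a::order"
  assumes "\<forall>i\<le>n. N i \<in> G" and "\<forall>i<n. N i \<le> N (Suc i)"
  shows "enat (card {i. i < n \<and> N i < N (Suc i)}) \<le> chain_length G"
proof -
  have "\<exists>K. (\<forall>i\<le>card {i. i < n \<and> N i < N (Suc i)}. K i \<in> G) \<and>
          (\<forall>i<card {i. i < n \<and> N i < N (Suc i)}. K i < K (Suc i)) \<and>
          K (card {i. i < n \<and> N i < N (Suc i)}) = N n"
    using assms
  proof (induct n)
    case 0 then show ?case by (intro exI[of _ N]) auto
  next
    case (Suc n)
    let ?c = "card {i. i < n \<and> N i < N (Suc i)}"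
    obtain K where K: "\<forall>i\<le>?c. K i \<in> G" "\<forall>i<?c. K i < K (Suc i)" "K ?c = N n"
      using Suc by auto
    show ?case
    proof (cases "N n < N (Suc n)")
      case True
      have "{i. i < Suc n \<and> N i < N (Suc i)} = insert n {i. i < n \<and> N i < N (Suc i)}"
        using True less_Suc_eq by auto
      then have c: "card {i. i < Suc n \<and> N i < N (Suc i)} = Suc ?c" by simp
      show ?thesis unfolding c
        using K True Suc.prems
        by (intro exI[of _ "\<lambda>i. if i \<le> ?c then K i else N (Suc n)"]) (auto simp: le_Suc_eq less_Suc_eq)
    next
      case False
      have "{i. i < Suc n \<and> N i < N (Suc i)} = {i. i < n \<and> N i < N (Suc i)}"
        using False less_Suc_eq by auto
      moreover have "N n = N (Suc n)" using False Suc.prems by (auto simp: order_le_less)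
      ultimately show ?thesis using K by auto
    qed
  qed
  then have "\<exists>K. (\<forall>i\<le>card {i. i < n \<and> N i < N (Suc i)}. K i \<in> G) \<and>
          (\<forall>i<card {i. i < n \<and> N i < N (Suc i)}. K i < K (Suc i))" by blast
  moreover have "G \<noteq> {}" using assms(1) by blast
  ultimately show ?thesis by (simp add: enat_le_chain_length_iff)
qed

text \<open>A strict step in \<open>F\<close> stays strict in \<open>G\<close> or in
  \<open>H\<close>. Hence the strict steps of the two image sequences together are at least as many
  as those of the chain.\<close>

lemma chain_length_subadditive:
  assumes "\<And>x. x \<in> F \<Longrightarrow> g x \<in> G" and "\<And>x. x \<in> F \<Longrightarrow> h x \<in> H"
    and "\<And>x y. x \<in> F \<Longrightarrow> y \<in> F \<Longrightarrow> x < y \<Longrightarrow> g x \<le> g y \<and> h x \<le> h y \<and> (g x < g y \<or> h x < h y)"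
  shows "chain_length F \<le> chain_length G + chain_length H"
  unfolding chain_length_def[of F]
proof (rule Sup_least)
  fix a assume "a \<in> {enat n |n. \<exists>N. (\<forall>i\<le>n. N i \<in> F) \<and> (\<forall>i<n. N i < N (Suc i))}"
  then obtain n N where a: "a = enat n" and N: "\<forall>i\<le>n. N i \<in> F" "\<forall>i<n. N i < N (Suc i)" by blast
  let ?g = "{i. i < n \<and> g (N i) < g (N (Suc i))}" and ?h = "{i. i < n \<and> h (N i) < h (N (Suc i))}"
  have "enat (card ?g) \<le> chain_length G"
    using weak_chain[of n "g \<circ> N" G] N assms by simp
  moreover have "enat (card ?h) \<le> chain_length H"
    using weak_chain[of n "h \<circ> N" H] N assms by simp
  moreover have "g (N i) < g (N (Suc i)) \<or> h (N i) < h (N (Suc i))" if "i < n" for i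
    using assms(3)[of "N i" "N (Suc i)"] N that by simp
  then have "{..<n} \<subseteq> ?g \<union> ?h" by auto
  then have "card {..<n} \<le> card (?g \<union> ?h)" by (intro card_mono) auto
  then have "n \<le> card ?g + card ?h" using card_Un_le[of ?g ?h] by simp
  then have "enat n \<le> enat (card ?g) + enat (card ?h)" by simp
  ultimately show "a \<le> chain_length G + chain_length H"
    unfolding a using add_mono order_trans by blast
qed

text \<open>Testing on finite lower bounds covers infinite summands too: if
  \<open>z = enat k\<close>, an infinite summand would have the lower bound
  \<open>Suc k\<close>.\<close>

lemma enat_add_leI:
  assumes "\<And>n m. enat n \<le> x \<Longrightarrow> enat m \<le> y \<Longrightarrow> enat (n + m) \<le> z"
  shows "x + y \<le> z"
proof (cases z)
  case (enat k)
  obtain n where x: "x = enat n"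
  proof (cases x)
    case infinity then show ?thesis using assms[of "Suc k" 0] enat by (simp add: zero_enat_def[symmetric])
  qed
  obtain m where "y = enat m"
  proof (cases y)
    case infinity then show ?thesis using assms[of 0 "Suc k"] enat by (simp add: zero_enat_def[symmetric])
  qed
  with x show ?thesis using assms[of n m] by simp
qed simp

lemma chain_length_superadditive:
  assumes "G \<noteq> {}" "H \<noteq> {}" "G \<subseteq> F" "H \<subseteq> F" and "\<And>x y. x \<in> G \<Longrightarrow> y \<in> H \<Longrightarrow> x \<le> y"
  shows "chain_length G + chain_length H \<le> chain_length F"
proof (rule enat_add_leI)
  fix n m assume "enat n \<le> chain_length G" "enat m \<le> chain_length H"
  then obtain A B where A: "\<forall>i\<le>n. A i \<in> G" "\<forall>i<n. A i < A (Suc i)"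
    and B: "\<forall>i\<le>m. B i \<in> H" "\<forall>i<m. B i < B (Suc i)"
    using assms enat_le_chain_length_iff by metis
  \<comment> \<open>At index \<open>n\<close> the top of the first chain gives way to the bottom of
    the second. The two may coincide, and \<open>A n \<le> B 0\<close> keeps the step from
    \<open>n - 1\<close> to \<open>n\<close> strict.\<close>
  let ?N = "\<lambda>i. if i < n then A i else B (i - n)"
  have "\<forall>i\<le>n + m. ?N i \<in> F" using A B assms(3,4) by auto
  moreover have "?N i < ?N (Suc i)" if "i < n + m" for i
  proof -
    consider "Suc i < n" | "Suc i = n" | "n \<le> i" by linarith
    then show ?thesis
    proof cases
      case 2
      then have "A i < A n" using A(2)[rule_format, of i] by simp
      also have "A n \<le> B 0" using A(1) B(1) by (intro assms(5)) simp_all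
      finally show ?thesis using 2 by simp
    next
      case 3 then show ?thesis using B(2)[rule_format, of "i - n"] that by (simp add: Suc_diff_le)
    next
      case 1 then show ?thesis using A(2) by simp
    qed
  qed
  ultimately have "\<exists>N. (\<forall>i\<le>n + m. N i \<in> F) \<and> (\<forall>i<n + m. N i < N (Suc i))"
    by (intro exI[of _ ?N]) simp
  moreover have "F \<noteq> {}" using assms by blast
  ultimately show "enat (n + m) \<le> chain_length F"
    by (simp add: enat_le_chain_length_iff)
qed

text \<open>The length of \<open>B/A\<close>, read off from the submodules between \<open>A\<close>
  and \<open>B\<close>.\<close>

definition sub_length ::
    "('r, 'x) ring_scheme \<Rightarrow> ('r, 'm) module \<Rightarrow> 'm set \<Rightarrow> 'm set \<Rightarrow> enat" where
  "sub_length R M A B = chain_length {N. submodule N R M \<and> A \<subseteq> N \<and> N \<subseteq> B}"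

lemma module_length_eq_chain_length: "module_length R M = chain_length {N. submodule N R M}"
  by (simp add: module_length_def chain_length_def)

lemma (in plain_module) set_add_mono:
  "A \<subseteq> A' \<Longrightarrow> B \<subseteq> B' \<Longrightarrow> A <+>\<^bsub>M\<^esub> B \<subseteq> A' <+>\<^bsub>M\<^esub> B'"
  unfolding set_add_def' by blast

text \<open>The inequality \<open>\<le>\<close> is the modular law: comparable submodules with the
  same intersection with \<open>B\<close> and the same sum with \<open>B\<close> are equal. The
  other inequality concatenates chains.\<close>

lemma (in plain_module) sub_length_add:
  assumes A: "submodule A R M" and B: "submodule B R M" and C: "submodule C R M"
    and AB: "A \<subseteq> B" and BC: "B \<subseteq> C"
  shows "sub_length R M A C = sub_length R M A B + sub_length R M B C"
proof (rule antisym)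
  show "sub_length R M A C \<le> sub_length R M A B + sub_length R M B C"
    unfolding sub_length_def
  proof (rule chain_length_subadditive[where g = "\<lambda>N. N \<inter> B" and h = "\<lambda>N. N <+>\<^bsub>M\<^esub> B"])
    fix N assume "N \<in> {N. submodule N R M \<and> A \<subseteq> N \<and> N \<subseteq> C}"
    then have N: "submodule N R M" "A \<subseteq> N" "N \<subseteq> C" by auto
    show "N \<inter> B \<in> {N. submodule N R M \<and> A \<subseteq> N \<and> N \<subseteq> B}"
      using N AB by (simp add: submodule_Int B)
    show "N <+>\<^bsub>M\<^esub> B \<in> {N. submodule N R M \<and> B \<subseteq> N \<and> N \<subseteq> C}"
      using submodule_set_add[OF N(1) B] set_add_upper2[OF N(1) B] set_add_least[OF C N(3) BC] by simp
    fix N' assume "N' \<in> {N. submodule N R M \<and> A \<subseteq> N \<and> N \<subseteq> C}" and lt: "N \<subset> N'"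
    then have N': "submodule N' R M" by auto
    have False if e1: "N \<inter> B = N' \<inter> B" and e2: "N <+>\<^bsub>M\<^esub> B = N' <+>\<^bsub>M\<^esub> B"
    proof -
      obtain x where x: "x \<in> N'" "x \<notin> N" using lt by blast
      have "x \<in> N <+>\<^bsub>M\<^esub> B" using set_add_upper1[OF N' B] x e2 by blast
      then obtain a b where ab: "a \<in> N" "b \<in> B" "x = a \<oplus>\<^bsub>M\<^esub> b" unfolding set_add_def' by blast
      have car: "a \<in> carrier M" "b \<in> carrier M"
        using ab submoduleE(1)[OF N(1)] submoduleE(1)[OF B] by blast+
      have "a \<in> N'" using lt ab by blast
      then have "x \<ominus>\<^bsub>M\<^esub> a \<in> N'" using submodule_diff[OF N'] x by blast
      moreover have "x \<ominus>\<^bsub>M\<^esub> a = b" using ab(3) car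
        by (simp add: a_minus_def M.a_assoc M.a_comm M.r_neg1 M.r_neg)
      ultimately have "b \<in> N" using e1 ab by blast
      then have "x \<in> N" using ab submoduleE(5)[OF N(1)] by blast
      with x show False by blast
    qed
    then show "N \<inter> B \<subseteq> N' \<inter> B \<and> N <+>\<^bsub>M\<^esub> B \<subseteq> N' <+>\<^bsub>M\<^esub> B \<and>
        (N \<inter> B \<subset> N' \<inter> B \<or> N <+>\<^bsub>M\<^esub> B \<subset> N' <+>\<^bsub>M\<^esub> B)"
      using lt set_add_mono[of N N' B B] by blast
  qed
  show "sub_length R M A B + sub_length R M B C \<le> sub_length R M A C"
    unfolding sub_length_def using assms by (intro chain_length_superadditive) blast+
qed

lemma (in plain_module) sub_length_eq_0:
  assumes A: "submodule A R M" and B: "submodule B R M"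
    and AB: "A \<subseteq> B" and "sub_length R M A B = 0"
  shows "A = B"
proof (rule ccontr)
  assume "A \<noteq> B"
  let ?F = "{N. submodule N R M \<and> A \<subseteq> N \<and> N \<subseteq> B}"
  have "\<exists>N. (\<forall>i\<le>1. N i \<in> ?F) \<and> (\<forall>i<1. N i < N (Suc i))"
    using A B AB \<open>A \<noteq> B\<close> by (intro exI[of _ "\<lambda>i::nat. if i = 0 then A else B"]) auto
  moreover have "?F \<noteq> {}" using A AB by blast
  ultimately have "enat 1 \<le> chain_length ?F" by (simp add: enat_le_chain_length_iff)
  with assms(4) show False by (simp add: sub_length_def zero_enat_def)
qed

lemma (in plain_module) sub_length_self: "submodule A R M \<Longrightarrow> sub_length R M A A = 0"
proof -
  assume A: "submodule A R M"
  have "{N. submodule N R M \<and> A \<subseteq> N \<and> N \<subseteq> A} = {A}" using A by auto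
  moreover have "chain_length {A} \<le> 0"
    unfolding chain_length_def by (rule Sup_least) (force simp: zero_enat_def)
  ultimately show ?thesis by (simp add: sub_length_def)
qed

lemma (in plain_module) sub_length_mono:
  assumes "A' \<subseteq> A" "B \<subseteq> B'"
  shows "sub_length R M A B \<le> sub_length R M A' B'"
  unfolding sub_length_def using assms by (intro chain_length_mono_map[where f = id]) auto

lemma (in plain_module) submodule_preimage:
  assumes A: "submodule A R M" and X: "submodule X R M" and c: "c \<in> carrier R"
  shows "submodule {a \<in> A. c \<odot>\<^bsub>M\<^esub> a \<in> X} R M"
proof -
  have "{a \<in> A. c \<odot>\<^bsub>M\<^esub> a \<in> X} = A \<inter> {x \<in> carrier M. \<forall>a\<in>{c}. a \<odot>\<^bsub>M\<^esub> x \<in> X}"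
    using submoduleE(1)[OF A] by auto
  then show ?thesis using submodule_Int[OF A submodule_colon[OF X, of "{c}"]] c by simp
qed

text \<open>Multiplication by \<open>c\<close> induces a surjection from \<open>A/B\<close> onto
  \<open>(K + cA)/K\<close>, because \<open>cB \<subseteq> K\<close>. Chains are pulled back along
  it.\<close>

lemma (in plain_module) sub_length_scaled_le:
  assumes K: "submodule K R M" and A: "submodule A R M" and c: "c \<in> carrier R"
    and B: "submodule B R M" and cB: "scaled M c B \<subseteq> K" and BA: "B \<subseteq> A"
  shows "sub_length R M K (K <+>\<^bsub>M\<^esub> scaled M c A) \<le> sub_length R M B A"
  unfolding sub_length_def
proof (rule chain_length_mono_map[where f = "\<lambda>X. {a \<in> A. c \<odot>\<^bsub>M\<^esub> a \<in> X}"])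
  fix X assume "X \<in> {N. submodule N R M \<and> K \<subseteq> N \<and> N \<subseteq> K <+>\<^bsub>M\<^esub> scaled M c A}"
  then have X: "submodule X R M" "K \<subseteq> X" "X \<subseteq> K <+>\<^bsub>M\<^esub> scaled M c A" by auto
  show "{a \<in> A. c \<odot>\<^bsub>M\<^esub> a \<in> X} \<in> {N. submodule N R M \<and> B \<subseteq> N \<and> N \<subseteq> A}"
    using submodule_preimage[OF A X(1) c] cB X(2) BA by (auto simp: scaled_def)
  fix Y assume "Y \<in> {N. submodule N R M \<and> K \<subseteq> N \<and> N \<subseteq> K <+>\<^bsub>M\<^esub> scaled M c A}" and XY: "X \<subset> Y"
  then have Y: "submodule Y R M" "K \<subseteq> Y" "Y \<subseteq> K <+>\<^bsub>M\<^esub> scaled M c A" by auto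
  obtain y where y: "y \<in> Y" "y \<notin> X" using XY by blast
  obtain k a where ka: "k \<in> K" "a \<in> A" "y = k \<oplus>\<^bsub>M\<^esub> c \<odot>\<^bsub>M\<^esub> a"
    using y Y unfolding set_add_def' scaled_def by blast
  have car: "k \<in> carrier M" "c \<odot>\<^bsub>M\<^esub> a \<in> carrier M"
    using ka c submoduleE(1)[OF K] submoduleE(1)[OF A] by blast+
  have "y \<ominus>\<^bsub>M\<^esub> k = c \<odot>\<^bsub>M\<^esub> a" using ka(3) car
    by (simp add: a_minus_def M.a_assoc M.a_comm M.r_neg1 M.r_neg)
  then have "c \<odot>\<^bsub>M\<^esub> a \<in> Y" using submodule_diff[OF Y(1) y(1), of k] ka(1) Y(2) by auto
  moreover have "c \<odot>\<^bsub>M\<^esub> a \<notin> X"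
    using submoduleE(5)[OF X(1), of k "c \<odot>\<^bsub>M\<^esub> a"] ka X(2) y by blast
  ultimately show "{a \<in> A. c \<odot>\<^bsub>M\<^esub> a \<in> X} \<subset> {a \<in> A. c \<odot>\<^bsub>M\<^esub> a \<in> Y}"
    using ka(2) XY by blast
qed

text \<open>If \<open>X\<close> is the preimage of \<open>K\<close> in \<open>A\<close> under
  \<open>c\<close>, then \<open>A/X\<close> is isomorphic to \<open>(K + cA)/K\<close>, and
  \<open>A/B\<close> is a quotient of \<open>A/X\<close>. Chains are pushed forward.\<close>

lemma (in plain_module) sub_length_scaled_ge:
  assumes K: "submodule K R M" and A: "submodule A R M" and c: "c \<in> carrier R"
    and B: "{a \<in> A. c \<odot>\<^bsub>M\<^esub> a \<in> K} \<subseteq> B"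
  shows "sub_length R M B A \<le> sub_length R M K (K <+>\<^bsub>M\<^esub> scaled M c A)"
  unfolding sub_length_def
proof (rule chain_length_mono_map[where f = "\<lambda>X. K <+>\<^bsub>M\<^esub> scaled M c X"])
  fix X assume "X \<in> {N. submodule N R M \<and> B \<subseteq> N \<and> N \<subseteq> A}"
  then have X: "submodule X R M" "B \<subseteq> X" "X \<subseteq> A" by auto
  note cX = submodule_scaled[OF X(1) c]
  show "K <+>\<^bsub>M\<^esub> scaled M c X \<in> {N. submodule N R M \<and> K \<subseteq> N \<and> N \<subseteq> K <+>\<^bsub>M\<^esub> scaled M c A}"
    using submodule_set_add[OF K cX] set_add_upper1[OF K cX]
      set_add_mono[OF subset_refl scaled_mono[OF X(3)]] by simp
  fix Y assume "Y \<in> {N. submodule N R M \<and> B \<subseteq> N \<and> N \<subseteq> A}" and XY: "X \<subset> Y"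
  then have Y: "submodule Y R M" "B \<subseteq> Y" "Y \<subseteq> A" by auto
  obtain y where y: "y \<in> Y" "y \<notin> X" using XY by blast
  have "c \<odot>\<^bsub>M\<^esub> y \<notin> K <+>\<^bsub>M\<^esub> scaled M c X"
  proof
    assume "c \<odot>\<^bsub>M\<^esub> y \<in> K <+>\<^bsub>M\<^esub> scaled M c X"
    then obtain k x where kx: "k \<in> K" "x \<in> X" "c \<odot>\<^bsub>M\<^esub> y = k \<oplus>\<^bsub>M\<^esub> c \<odot>\<^bsub>M\<^esub> x"
      unfolding set_add_def' scaled_def by blast
    have car: "k \<in> carrier M" "x \<in> carrier M" "y \<in> carrier M"
      using kx y submoduleE(1)[OF K] submoduleE(1)[OF X(1)] submoduleE(1)[OF Y(1)] by blast+
    have "c \<odot>\<^bsub>M\<^esub> (y \<ominus>\<^bsub>M\<^esub> x) = k \<oplus>\<^bsub>M\<^esub> c \<odot>\<^bsub>M\<^esub> x \<oplus>\<^bsub>M\<^esub> \<ominus>\<^bsub>M\<^esub> (c \<odot>\<^bsub>M\<^esub> x)"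
      using car c kx(3) by (simp add: a_minus_def smult_r_distr smult_r_minus)
    also have "\<dots> = k" using car c by (simp add: M.a_assoc M.r_neg)
    finally have "c \<odot>\<^bsub>M\<^esub> (y \<ominus>\<^bsub>M\<^esub> x) \<in> K" using kx by simp
    moreover have "y \<ominus>\<^bsub>M\<^esub> x \<in> A"
      using submodule_diff[OF A, of y x] y kx X Y by blast
    ultimately have "y \<ominus>\<^bsub>M\<^esub> x \<in> X" using B X by blast
    then have "(y \<ominus>\<^bsub>M\<^esub> x) \<oplus>\<^bsub>M\<^esub> x \<in> X" using submoduleE(5)[OF X(1)] kx by blast
    moreover have "(y \<ominus>\<^bsub>M\<^esub> x) \<oplus>\<^bsub>M\<^esub> x = y" using car by (simp add: a_minus_def M.a_assoc M.l_neg)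
    ultimately show False using y by simp
  qed
  moreover have "c \<odot>\<^bsub>M\<^esub> y \<in> K <+>\<^bsub>M\<^esub> scaled M c Y"
    using set_add_upper2[OF K submodule_scaled[OF Y(1) c]] y by (auto simp: scaled_def)
  moreover have "K <+>\<^bsub>M\<^esub> scaled M c X \<subseteq> K <+>\<^bsub>M\<^esub> scaled M c Y"
    using XY by (intro set_add_mono[OF subset_refl scaled_mono]) simp
  ultimately show "K <+>\<^bsub>M\<^esub> scaled M c X \<subset> K <+>\<^bsub>M\<^esub> scaled M c Y" by auto
qed

text \<open>The two preceding estimates with \<open>K = cB\<close>: by injectivity the preimage of
  \<open>cB\<close> in \<open>A\<close> is \<open>B\<close>.\<close>

lemma (in plain_module) sub_length_scaled_inj:
  assumes A: "submodule A R M" and B: "submodule B R M" and BA: "B \<subseteq> A" and c: "c \<in> carrier R"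
    and inj: "inj_on (\<lambda>x. c \<odot>\<^bsub>M\<^esub> x) (carrier M)"
  shows "sub_length R M (scaled M c B) (scaled M c A) = sub_length R M B A"
proof -
  have "{a \<in> A. c \<odot>\<^bsub>M\<^esub> a \<in> scaled M c B} \<subseteq> B"
  proof
    fix a assume "a \<in> {a \<in> A. c \<odot>\<^bsub>M\<^esub> a \<in> scaled M c B}"
    then obtain b where ab: "a \<in> A" "b \<in> B" "c \<odot>\<^bsub>M\<^esub> a = c \<odot>\<^bsub>M\<^esub> b" unfolding scaled_def by blast
    have "a = b"
      using ab(3) subsetD[OF submoduleE(1)[OF A] ab(1)] subsetD[OF submoduleE(1)[OF B] ab(2)]
      by (rule inj_onD[OF inj])
    with ab show "a \<in> B" by simp
  qed
  then have "sub_length R M B A \<le> sub_length R M (scaled M c B) (scaled M c B <+>\<^bsub>M\<^esub> scaled M c A)"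
    by (rule sub_length_scaled_ge[OF submodule_scaled[OF B c] A c])
  moreover have "sub_length R M (scaled M c B) (scaled M c B <+>\<^bsub>M\<^esub> scaled M c A) \<le> sub_length R M B A"
    by (rule sub_length_scaled_le[OF submodule_scaled[OF B c] A c B subset_refl BA])
  moreover have "scaled M c B <+>\<^bsub>M\<^esub> scaled M c A = scaled M c A"
    using set_add_least[OF submodule_scaled[OF A c] scaled_mono[OF BA] subset_refl]
      set_add_upper2[OF submodule_scaled[OF B c] submodule_scaled[OF A c]] by (rule subset_antisym)
  ultimately show ?thesis by simp
qed

subsection \<open>Quotients and local rings\<close>

lemma (in plain_module) abelian_subgroup_submodule:
  assumes "submodule A R M" shows "abelian_subgroup A M"
  by (rule abelian_subgroupI3[OF additive_subgroup.intro[OF submodule.axioms(1)[OF assms]] M.abelian_group_axioms])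

lemma (in plain_module) coset_eq_iff:
  assumes A: "submodule A R M" and x: "x \<in> carrier M" and y: "y \<in> carrier M"
  shows "A +>\<^bsub>M\<^esub> x = A +>\<^bsub>M\<^esub> y \<longleftrightarrow> x \<ominus>\<^bsub>M\<^esub> y \<in> A"
proof -
  note S = abelian_subgroup_submodule[OF A]
  have "x \<in> A +>\<^bsub>M\<^esub> y \<longleftrightarrow> x \<ominus>\<^bsub>M\<^esub> y \<in> A"
    using abelian_subgroup.a_rcos_module[OF S y x] by (simp add: a_minus_def)
  moreover have "x \<in> A +>\<^bsub>M\<^esub> y \<longleftrightarrow> A +>\<^bsub>M\<^esub> x = A +>\<^bsub>M\<^esub> y"
    using abelian_subgroup.a_repr_independence'[OF S _ y] abelian_subgroup.a_rcos_self[OF S x] by blast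
  ultimately show ?thesis by blast
qed

lemma (in plain_module) coset_self:
  "submodule A R M \<Longrightarrow> x \<in> carrier M \<Longrightarrow> x \<in> A +>\<^bsub>M\<^esub> x"
  by (rule abelian_subgroup.a_rcos_self[OF abelian_subgroup_submodule])

lemma (in plain_module) coset_memD:
  assumes A: "submodule A R M" and x: "x \<in> carrier M" and y: "y \<in> A +>\<^bsub>M\<^esub> x"
  shows "y \<in> carrier M" "A +>\<^bsub>M\<^esub> y = A +>\<^bsub>M\<^esub> x"
proof -
  obtain a where "a \<in> A" "y = a \<oplus>\<^bsub>M\<^esub> x" using y unfolding a_r_coset_def' by blast
  then show "y \<in> carrier M" using x submoduleE(1)[OF A] by blast
  show "A +>\<^bsub>M\<^esub> y = A +>\<^bsub>M\<^esub> x"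
    using abelian_subgroup.a_repr_independence'[OF abelian_subgroup_submodule[OF A] y x] by simp
qed

lemma (in plain_module) coset_eq_self_iff:
  assumes A: "submodule A R M" and x: "x \<in> carrier M"
  shows "A +>\<^bsub>M\<^esub> x = A \<longleftrightarrow> x \<in> A"
proof -
  have "\<ominus>\<^bsub>M\<^esub> \<zero>\<^bsub>M\<^esub> = \<zero>\<^bsub>M\<^esub>" using M.r_neg[OF M.zero_closed] by simp
  then have "x \<ominus>\<^bsub>M\<^esub> \<zero>\<^bsub>M\<^esub> = x" using x by (simp add: a_minus_def)
  moreover have "A +>\<^bsub>M\<^esub> \<zero>\<^bsub>M\<^esub> = A"
    by (rule abelian_subgroup.a_rcos_const[OF abelian_subgroup_submodule[OF A] submodule_zero[OF A]])
  ultimately show ?thesis using coset_eq_iff[OF A x M.zero_closed] by simp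
qed

lemma (in plain_module) coset_add:
  assumes A: "submodule A R M" and x: "x \<in> carrier M" and y: "y \<in> carrier M"
  shows "(A +>\<^bsub>M\<^esub> x) <+>\<^bsub>M\<^esub> (A +>\<^bsub>M\<^esub> y) = A +>\<^bsub>M\<^esub> (x \<oplus>\<^bsub>M\<^esub> y)"
  by (rule abelian_subgroup.a_rcos_sum[OF abelian_subgroup_submodule[OF A] x y])

lemma (in plain_module) quot_carrier:
  "carrier (quot_module R M A) = (\<lambda>x. A +>\<^bsub>M\<^esub> x) ` carrier M"
  by (auto simp: quot_module_def A_RCOSETS_def')

lemma (in plain_module) quot_add:
  assumes "submodule A R M" "x \<in> carrier M" "y \<in> carrier M"
  shows "(A +>\<^bsub>M\<^esub> x) \<oplus>\<^bsub>quot_module R M A\<^esub> (A +>\<^bsub>M\<^esub> y) = A +>\<^bsub>M\<^esub> (x \<oplus>\<^bsub>M\<^esub> y)"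
  using coset_add[OF assms] by (simp add: quot_module_def)

lemma (in plain_module) quot_smult:
  assumes A: "submodule A R M" and x: "x \<in> carrier M" and r: "r \<in> carrier R"
  shows "r \<odot>\<^bsub>quot_module R M A\<^esub> (A +>\<^bsub>M\<^esub> x) = A +>\<^bsub>M\<^esub> (r \<odot>\<^bsub>M\<^esub> x)"
proof -
  have "A +>\<^bsub>M\<^esub> (r \<odot>\<^bsub>M\<^esub> y) = A +>\<^bsub>M\<^esub> (r \<odot>\<^bsub>M\<^esub> x)" if "y \<in> A +>\<^bsub>M\<^esub> x" for y
  proof -
    have y: "y \<in> carrier M" "y \<ominus>\<^bsub>M\<^esub> x \<in> A"
      using coset_memD[OF A x that] coset_eq_iff[OF A _ x] by auto
    have "r \<odot>\<^bsub>M\<^esub> y \<ominus>\<^bsub>M\<^esub> r \<odot>\<^bsub>M\<^esub> x = r \<odot>\<^bsub>M\<^esub> (y \<ominus>\<^bsub>M\<^esub> x)"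
      using x y r by (simp add: a_minus_def smult_r_distr smult_r_minus)
    then show ?thesis
      using submoduleE(4)[OF A r y(2)] coset_eq_iff[OF A, of "r \<odot>\<^bsub>M\<^esub> y" "r \<odot>\<^bsub>M\<^esub> x"] x y r by simp
  qed
  then have "(\<Union>y\<in>A +>\<^bsub>M\<^esub> x. A +>\<^bsub>M\<^esub> (r \<odot>\<^bsub>M\<^esub> y)) = (\<Union>y\<in>A +>\<^bsub>M\<^esub> x. A +>\<^bsub>M\<^esub> (r \<odot>\<^bsub>M\<^esub> x))"
    by (intro SUP_cong) simp_all
  also have "\<dots> = A +>\<^bsub>M\<^esub> (r \<odot>\<^bsub>M\<^esub> x)" using coset_self[OF A x] by (simp only: UN_constant) auto
  finally show ?thesis by (simp add: quot_module_def)
qed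

lemma (in plain_module) quot_zero: "\<zero>\<^bsub>quot_module R M A\<^esub> = A"
  by (simp add: quot_module_def)

lemma (in plain_module) coset_zero: "submodule A R M \<Longrightarrow> A +>\<^bsub>M\<^esub> \<zero>\<^bsub>M\<^esub> = A"
  using coset_eq_self_iff submodule_zero by simp

lemma (in plain_module) module_quot:
  assumes A: "submodule A R M"
  shows "module R (quot_module R M A)"
proof (rule moduleI)
  let ?Q = "quot_module R M A"
  note simps = quot_carrier quot_add[OF A] quot_smult[OF A]
  show "cring R" by (rule R.is_cring)
  show "\<one> \<odot>\<^bsub>?Q\<^esub> x = x" if "x \<in> carrier ?Q" for x using that by (auto simp: simps)
  show "abelian_group ?Q"
  proof (rule abelian_groupI)
    show "\<zero>\<^bsub>?Q\<^esub> \<in> carrier ?Q"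
      unfolding quot_zero quot_carrier using coset_zero[OF A] by (metis M.zero_closed imageI)
    fix x assume "x \<in> carrier ?Q"
    then obtain u where u: "u \<in> carrier M" "x = A +>\<^bsub>M\<^esub> u" unfolding quot_carrier by blast
    show "\<zero>\<^bsub>?Q\<^esub> \<oplus>\<^bsub>?Q\<^esub> x = x"
      using quot_add[OF A M.zero_closed u(1)] u by (simp add: quot_zero coset_zero[OF A])
    have "(A +>\<^bsub>M\<^esub> (\<ominus>\<^bsub>M\<^esub> u)) \<oplus>\<^bsub>?Q\<^esub> x = \<zero>\<^bsub>?Q\<^esub>"
      using u by (simp add: quot_add[OF A] M.l_neg quot_zero coset_zero[OF A])
    moreover have "A +>\<^bsub>M\<^esub> (\<ominus>\<^bsub>M\<^esub> u) \<in> carrier ?Q" using u by (simp add: quot_carrier)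
    ultimately show "\<exists>y\<in>carrier ?Q. y \<oplus>\<^bsub>?Q\<^esub> x = \<zero>\<^bsub>?Q\<^esub>" by blast
    fix y assume "y \<in> carrier ?Q"
    then obtain v where v: "v \<in> carrier M" "y = A +>\<^bsub>M\<^esub> v" unfolding quot_carrier by blast
    show "x \<oplus>\<^bsub>?Q\<^esub> y \<in> carrier ?Q" using u v by (simp add: simps)
    show "x \<oplus>\<^bsub>?Q\<^esub> y = y \<oplus>\<^bsub>?Q\<^esub> x" using u v by (simp add: simps M.a_comm)
    fix z assume "z \<in> carrier ?Q"
    then obtain w where w: "w \<in> carrier M" "z = A +>\<^bsub>M\<^esub> w" unfolding quot_carrier by blast
    show "x \<oplus>\<^bsub>?Q\<^esub> y \<oplus>\<^bsub>?Q\<^esub> z = x \<oplus>\<^bsub>?Q\<^esub> (y \<oplus>\<^bsub>?Q\<^esub> z)" using u v w by (simp add: simps M.a_assoc)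
  qed
  fix a x assume a: "a \<in> carrier R" and "x \<in> carrier ?Q"
  then obtain u where u: "u \<in> carrier M" "x = A +>\<^bsub>M\<^esub> u" unfolding quot_carrier by blast
  show "a \<odot>\<^bsub>?Q\<^esub> x \<in> carrier ?Q" using a u by (simp add: simps)
  { fix y assume "y \<in> carrier ?Q"
    then obtain v where v: "v \<in> carrier M" "y = A +>\<^bsub>M\<^esub> v" unfolding quot_carrier by blast
    show "a \<odot>\<^bsub>?Q\<^esub> (x \<oplus>\<^bsub>?Q\<^esub> y) = a \<odot>\<^bsub>?Q\<^esub> x \<oplus>\<^bsub>?Q\<^esub> a \<odot>\<^bsub>?Q\<^esub> y"
      using a u v by (simp add: simps smult_r_distr) }
  fix b assume b: "b \<in> carrier R"
  show "(a \<oplus> b) \<odot>\<^bsub>?Q\<^esub> x = a \<odot>\<^bsub>?Q\<^esub> x \<oplus>\<^bsub>?Q\<^esub> b \<odot>\<^bsub>?Q\<^esub> x"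
    using a b u by (simp add: simps smult_l_distr)
  show "(a \<otimes> b) \<odot>\<^bsub>?Q\<^esub> x = a \<odot>\<^bsub>?Q\<^esub> (b \<odot>\<^bsub>?Q\<^esub> x)"
    using a b u by (simp add: simps smult_assoc1)
qed

text \<open>The correspondence theorem: preimages and images of chains remain strict. It turns the
  quotients in \<open>multiplicity\<close> into intervals of submodules.\<close>

lemma (in plain_module) module_length_quot:
  assumes A: "submodule A R M"
  shows "module_length R (quot_module R M A) = sub_length R M A (carrier M)"
  unfolding module_length_eq_chain_length sub_length_def
proof (rule antisym)
  let ?Q = "quot_module R M A"
  interpret Q: plain_module R ?Q by (intro plain_module.intro module_quot A)
  show "chain_length {N. submodule N R ?Q} \<le> chain_length {N. submodule N R M \<and> A \<subseteq> N \<and> N \<subseteq> carrier M}"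
  proof (rule chain_length_mono_map[where f = "\<lambda>H. {x \<in> carrier M. A +>\<^bsub>M\<^esub> x \<in> H}"])
    fix H assume "H \<in> {N. submodule N R ?Q}"
    then have H: "submodule H R ?Q" by simp
    have AH: "A \<in> H" using Q.submodule_zero[OF H] by (simp add: quot_zero)
    have "submodule {x \<in> carrier M. A +>\<^bsub>M\<^esub> x \<in> H} R M"
    proof (rule submoduleI)
      fix x assume x: "x \<in> {x \<in> carrier M. A +>\<^bsub>M\<^esub> x \<in> H}"
      show "r \<odot>\<^bsub>M\<^esub> x \<in> {x \<in> carrier M. A +>\<^bsub>M\<^esub> x \<in> H}" if r: "r \<in> carrier R" for r
        using x Q.submoduleE(4)[OF H r] quot_smult[OF A _ r] r by fastforce
      from this[of "\<ominus> \<one>"] show "\<ominus>\<^bsub>M\<^esub> x \<in> {x \<in> carrier M. A +>\<^bsub>M\<^esub> x \<in> H}"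
        using x by (simp add: smult_l_minus)
      fix y assume y: "y \<in> {x \<in> carrier M. A +>\<^bsub>M\<^esub> x \<in> H}"
      show "x \<oplus>\<^bsub>M\<^esub> y \<in> {x \<in> carrier M. A +>\<^bsub>M\<^esub> x \<in> H}"
        using x y Q.submoduleE(5)[OF H] quot_add[OF A] by fastforce
    qed (use AH coset_zero[OF A] in auto)
    moreover have "A \<subseteq> {x \<in> carrier M. A +>\<^bsub>M\<^esub> x \<in> H}"
    proof
      fix x assume x: "x \<in> A"
      have "x \<in> carrier M" by (rule subsetD[OF submoduleE(1)[OF A] x])
      with coset_eq_self_iff[OF A this] x AH show "x \<in> {x \<in> carrier M. A +>\<^bsub>M\<^esub> x \<in> H}" by simp
    qed
    ultimately show "{x \<in> carrier M. A +>\<^bsub>M\<^esub> x \<in> H} \<in> {N. submodule N R M \<and> A \<subseteq> N \<and> N \<subseteq> carrier M}"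
      by auto
    fix H' assume "H' \<in> {N. submodule N R ?Q}" and lt: "H \<subset> H'"
    then obtain X where X: "X \<in> H'" "X \<notin> H" "X \<in> carrier ?Q" using Q.submoduleE(1) by auto
    then obtain x where "x \<in> carrier M" "X = A +>\<^bsub>M\<^esub> x" unfolding quot_carrier by blast
    with X lt show "{x \<in> carrier M. A +>\<^bsub>M\<^esub> x \<in> H} \<subset> {x \<in> carrier M. A +>\<^bsub>M\<^esub> x \<in> H'}" by auto
  qed
  show "chain_length {N. submodule N R M \<and> A \<subseteq> N \<and> N \<subseteq> carrier M} \<le> chain_length {N. submodule N R ?Q}"
  proof (rule chain_length_mono_map[where f = "\<lambda>N. (\<lambda>x. A +>\<^bsub>M\<^esub> x) ` N"])
    fix N assume "N \<in> {N. submodule N R M \<and> A \<subseteq> N \<and> N \<subseteq> carrier M}"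
    then have N: "submodule N R M" "A \<subseteq> N" "N \<subseteq> carrier M" by auto
    note cN = subsetD[OF N(3)]
    have "submodule ((\<lambda>x. A +>\<^bsub>M\<^esub> x) ` N) R ?Q"
    proof (rule Q.submoduleI)
      show "(\<lambda>x. A +>\<^bsub>M\<^esub> x) ` N \<subseteq> carrier ?Q" using N by (auto simp: quot_carrier)
      show "\<zero>\<^bsub>?Q\<^esub> \<in> (\<lambda>x. A +>\<^bsub>M\<^esub> x) ` N"
        using submodule_zero[OF N(1)] coset_zero[OF A] by (metis imageI quot_zero)
      fix X assume "X \<in> (\<lambda>x. A +>\<^bsub>M\<^esub> x) ` N"
      then obtain x where x: "x \<in> N" "X = A +>\<^bsub>M\<^esub> x" by blast
      show sm: "r \<odot>\<^bsub>?Q\<^esub> X \<in> (\<lambda>x. A +>\<^bsub>M\<^esub> x) ` N" if r: "r \<in> carrier R" for r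
        using x quot_smult[OF A cN[OF x(1)] r] submoduleE(4)[OF N(1) r x(1)] by simp
      have "X \<in> carrier ?Q" using x cN by (auto simp: quot_carrier)
      then have "\<ominus>\<^bsub>?Q\<^esub> X = (\<ominus> \<one>) \<odot>\<^bsub>?Q\<^esub> X" by (simp add: Q.smult_l_minus)
      then show "\<ominus>\<^bsub>?Q\<^esub> X \<in> (\<lambda>x. A +>\<^bsub>M\<^esub> x) ` N" using sm[of "\<ominus> \<one>"] by simp
      fix Y assume "Y \<in> (\<lambda>x. A +>\<^bsub>M\<^esub> x) ` N"
      then obtain y where y: "y \<in> N" "Y = A +>\<^bsub>M\<^esub> y" by blast
      show "X \<oplus>\<^bsub>?Q\<^esub> Y \<in> (\<lambda>x. A +>\<^bsub>M\<^esub> x) ` N"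
        using x y quot_add[OF A cN[OF x(1)] cN[OF y(1)]] submoduleE(5)[OF N(1) x(1) y(1)] by simp
    qed
    then show "(\<lambda>x. A +>\<^bsub>M\<^esub> x) ` N \<in> {N. submodule N R ?Q}" by simp
    fix N' assume "N' \<in> {N. submodule N R M \<and> A \<subseteq> N \<and> N \<subseteq> carrier M}" and lt: "N \<subset> N'"
    then have N': "N' \<subseteq> carrier M" by auto
    obtain x where x: "x \<in> N'" "x \<notin> N" using lt by blast
    have "A +>\<^bsub>M\<^esub> x \<notin> (\<lambda>x. A +>\<^bsub>M\<^esub> x) ` N"
    proof
      assume "A +>\<^bsub>M\<^esub> x \<in> (\<lambda>x. A +>\<^bsub>M\<^esub> x) ` N"
      then obtain y where y: "y \<in> N" "A +>\<^bsub>M\<^esub> x = A +>\<^bsub>M\<^esub> y" by blast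
      have c: "x \<in> carrier M" "y \<in> carrier M" using x y N N' by auto
      have "x \<ominus>\<^bsub>M\<^esub> y \<in> N" using coset_eq_iff[OF A c] y(2) N(2) by blast
      then have "(x \<ominus>\<^bsub>M\<^esub> y) \<oplus>\<^bsub>M\<^esub> y \<in> N" using submoduleE(5)[OF N(1)] y by blast
      moreover have "(x \<ominus>\<^bsub>M\<^esub> y) \<oplus>\<^bsub>M\<^esub> y = x" using c by (simp add: a_minus_def M.a_assoc M.l_neg)
      ultimately show False using x by simp
    qed
    then show "(\<lambda>x. A +>\<^bsub>M\<^esub> x) ` N \<subset> (\<lambda>x. A +>\<^bsub>M\<^esub> x) ` N'" using lt x by blast
  qed
qed

section \<open>Prime ideals and the maximal ideal of a local ring\<close>

lemma (in cring) ideal_maximal_disjoint: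
  assumes I: "ideal I R" and "I \<inter> S = {}"
  obtains P where "ideal P R" "I \<subseteq> P" "P \<inter> S = {}"
    "\<And>J. ideal J R \<Longrightarrow> P \<subseteq> J \<Longrightarrow> J \<inter> S = {} \<Longrightarrow> J = P"
proof -
  let ?A = "{J. ideal J R \<and> I \<subseteq> J \<and> J \<inter> S = {}}"
  have "\<exists>P\<in>?A. \<forall>X\<in>?A. P \<subseteq> X \<longrightarrow> X = P"
  proof (rule subset_Zorn_nonempty)
    show "?A \<noteq> {}" using assms by blast
    fix C assume C: "C \<noteq> {}" "subset.chain ?A C"
    then have "subset.chain {I. ideal I R} C" unfolding pred_on.chain_def by blast
    from chain_Union_is_ideal[OF this] have "ideal (\<Union>C) R" using C(1) by simp
    then show "\<Union>C \<in> ?A" using C unfolding pred_on.chain_def by blast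
  qed
  then obtain P where "P \<in> ?A" "\<forall>X\<in>?A. P \<subseteq> X \<longrightarrow> X = P" by (rule bexE)
  then show ?thesis by (intro that[of P]) auto
qed

lemma (in cring) ideal_add_PIdl:
  assumes P: "ideal P R" and a: "a \<in> carrier R"
  shows "ideal (P <+>\<^bsub>R\<^esub> PIdl a) R" "P \<subseteq> P <+>\<^bsub>R\<^esub> PIdl a" "a \<in> P <+>\<^bsub>R\<^esub> PIdl a"
proof -
  note Q = cgenideal_ideal[OF a]
  show "ideal (P <+>\<^bsub>R\<^esub> PIdl a) R" by (rule add_ideals[OF P Q])
  have "p = p \<oplus> \<zero>" if "p \<in> P" for p using ideal.Icarr[OF P that] by simp
  moreover have "\<zero> \<in> PIdl a" by (rule additive_subgroup.zero_closed[OF ideal.axioms(1)[OF Q]])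
  ultimately show "P \<subseteq> P <+>\<^bsub>R\<^esub> PIdl a" unfolding set_add_def' by blast
  have "a = \<zero> \<oplus> a" using a by simp
  moreover have "\<zero> \<in> P" by (rule additive_subgroup.zero_closed[OF ideal.axioms(1)[OF P]])
  ultimately show "a \<in> P <+>\<^bsub>R\<^esub> PIdl a" unfolding set_add_def' using cgenideal_self[OF a] by blast
qed

text \<open>An ideal \<open>P\<close> maximal among those disjoint from \<open>S\<close> is prime:
  if \<open>a\<close> and \<open>b\<close> lie outside \<open>P\<close>, then \<open>P + (a)\<close>
  and \<open>P + (b)\<close> both meet \<open>S\<close>, and if \<open>ab \<in> P\<close>, the
  product of the two common elements lies in \<open>S\<close> and in \<open>P\<close>.\<close>

lemma (in cring) exists_prime_disjoint:
  assumes I: "ideal I R" and disj: "I \<inter> S = {}" and S: "S \<subseteq> carrier R" "S \<noteq> {}"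
    and mult: "\<And>s t. s \<in> S \<Longrightarrow> t \<in> S \<Longrightarrow> s \<otimes> t \<in> S"
  obtains P where "primeideal P R" "I \<subseteq> P" "P \<inter> S = {}"
proof -
  obtain P where P: "ideal P R" "I \<subseteq> P" "P \<inter> S = {}"
    and max: "\<And>J. ideal J R \<Longrightarrow> P \<subseteq> J \<Longrightarrow> J \<inter> S = {} \<Longrightarrow> J = P"
    using ideal_maximal_disjoint[OF I disj] by metis
  have "primeideal P R"
  proof (rule primeidealI[OF P(1) is_cring])
    show "carrier R \<noteq> P" using S P(3) by blast
    fix a b assume ab: "a \<in> carrier R" "b \<in> carrier R" "a \<otimes> b \<in> P"
    have meets: "\<exists>p r. p \<in> P \<and> r \<in> carrier R \<and> p \<oplus> r \<otimes> x \<in> S" if x: "x \<in> carrier R" "x \<notin> P" for x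
    proof -
      have "(P <+>\<^bsub>R\<^esub> PIdl x) \<inter> S \<noteq> {}"
        using max[OF ideal_add_PIdl(1,2)[OF P(1) x(1)]] ideal_add_PIdl(3)[OF P(1) x(1)] x(2) by auto
      then obtain s where s: "s \<in> S" "s \<in> P <+>\<^bsub>R\<^esub> PIdl x" by blast
      then obtain p q where "p \<in> P" "q \<in> PIdl x" "s = p \<oplus> q" unfolding set_add_def' by blast
      then show ?thesis using s unfolding cgenideal_def by blast
    qed
    show "a \<in> P \<or> b \<in> P"
    proof (rule ccontr)
      assume "\<not> (a \<in> P \<or> b \<in> P)"
      then obtain p r q t where *: "p \<in> P" "r \<in> carrier R" "p \<oplus> r \<otimes> a \<in> S"
          "q \<in> P" "t \<in> carrier R" "q \<oplus> t \<otimes> b \<in> S"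
        using meets[of a] meets[of b] ab by blast
      have c: "p \<in> carrier R" "q \<in> carrier R" using * ideal.Icarr[OF P(1)] by blast+
      have 1: "p \<otimes> (q \<oplus> t \<otimes> b) \<in> P" using ideal.I_r_closed[OF P(1) *(1)] c * ab by simp
      have 2: "q \<otimes> (r \<otimes> a) \<in> P" using ideal.I_r_closed[OF P(1) *(4)] c * ab by simp
      have 3: "(a \<otimes> b) \<otimes> (r \<otimes> t) \<in> P" using ideal.I_r_closed[OF P(1) ab(3)] * by simp
      have "(p \<oplus> r \<otimes> a) \<otimes> (q \<oplus> t \<otimes> b)
          = p \<otimes> (q \<oplus> t \<otimes> b) \<oplus> (q \<otimes> (r \<otimes> a) \<oplus> (a \<otimes> b) \<otimes> (r \<otimes> t))"
        using c * ab by (simp add: l_distr r_distr m_ac a_ac)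
      also have "\<dots> \<in> P"
        using 1 2 3 additive_subgroup.a_closed[OF ideal.axioms(1)[OF P(1)]] by simp
      finally show False using mult[OF *(3) *(6)] P(3) by blast
    qed
  qed
  with P that show ?thesis by blast
qed

locale local_ring = cring R for R :: "('r, 'x) ring_scheme" (structure) +
  fixes \<mm> :: "'r set"
  assumes local: "noetherian_local R \<mm>"
begin

lemma maximal_m: "maximalideal \<mm> R" and m_unique: "maximalideal J R \<Longrightarrow> J = \<mm>"
  using local by (auto simp: noetherian_local_def)

lemma ideal_m: "ideal \<mm> R" by (rule maximalideal.axioms(1)[OF maximal_m])

lemma m_carrier: "\<mm> \<subseteq> carrier R" by (rule ideal_subset[OF ideal_m])

lemma finitely_gen: "ideal I R \<Longrightarrow> \<exists>T\<subseteq>carrier R. finite T \<and> I = Idl T"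
  using local noetherian_ring.finetely_gen by (auto simp: noetherian_local_def)

lemma ideal_subset_m:
  assumes I: "ideal I R" and "I \<noteq> carrier R" shows "I \<subseteq> \<mm>"
proof -
  \<comment> \<open>Disjoint from \<open>{\<one>}\<close> means proper, so the maximal element found
    below is a maximal ideal.\<close>
  have "I \<inter> {\<one>} = {}" using assms ideal.one_imp_carrier by blast
  then obtain P where P: "ideal P R" "I \<subseteq> P" "P \<inter> {\<one>} = {}"
    and max: "\<And>J. ideal J R \<Longrightarrow> P \<subseteq> J \<Longrightarrow> J \<inter> {\<one>} = {} \<Longrightarrow> J = P"
    using ideal_maximal_disjoint[OF I] by metis
  have "maximalideal P R"
  proof (rule maximalidealI[OF P(1)])
    show "carrier R \<noteq> P" using P(3) one_closed by blast
    fix J assume J: "ideal J R" "P \<subseteq> J"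
    show "J = P \<or> J = carrier R"
      using max[OF J] ideal.one_imp_carrier[OF J(1)] by blast
  qed
  with P(2) m_unique show ?thesis by blast
qed

lemma one_notin_m: "\<one> \<notin> \<mm>"
  using ideal.one_imp_carrier[OF ideal_m] maximalideal.I_notcarr[OF maximal_m] by blast

lemma unit_notin_m:
  assumes a: "a \<in> carrier R" "a \<notin> \<mm>"
  obtains b where "b \<in> carrier R" "b \<otimes> a = \<one>"
proof -
  have "PIdl a = carrier R"
    using ideal_subset_m[OF cgenideal_ideal[OF a(1)]] cgenideal_self[OF a(1)] a(2) by blast
  then have "\<one> \<in> PIdl a" by simp
  then show ?thesis using that unfolding cgenideal_def by auto
qed

lemma one_minus_unit:
  assumes a: "a \<in> \<mm>"
  obtains b where "b \<in> carrier R" "b \<otimes> (\<one> \<ominus> a) = \<one>"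
proof (rule unit_notin_m)
  have c: "a \<in> carrier R" using a m_carrier by blast
  then show "\<one> \<ominus> a \<in> carrier R" by simp
  show "\<one> \<ominus> a \<notin> \<mm>"
  proof
    assume "\<one> \<ominus> a \<in> \<mm>"
    then have "(\<one> \<ominus> a) \<oplus> a \<in> \<mm>"
      using a additive_subgroup.a_closed[OF ideal.axioms(1)[OF ideal_m]] by blast
    moreover have "(\<one> \<ominus> a) \<oplus> a = \<one>" using c by (simp add: a_minus_def a_assoc l_neg)
    ultimately show False using one_notin_m by simp
  qed
qed (rule that)

end

section \<open>Cyclic submodules and Nakayama's lemma\<close>

definition cyclic :: "('r, 'x) ring_scheme \<Rightarrow> ('r, 'm) module \<Rightarrow> 'm \<Rightarrow> 'm set" where
  "cyclic R M u = (\<lambda>r. r \<odot>\<^bsub>M\<^esub> u) ` carrier R"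

context plain_module begin

lemma submodule_cyclic: "u \<in> carrier M \<Longrightarrow> submodule (cyclic R M u) R M"
proof (rule submoduleI)
  assume u: "u \<in> carrier M"
  show "cyclic R M u \<subseteq> carrier M" using u by (auto simp: cyclic_def)
  have "\<zero>\<^bsub>M\<^esub> = \<zero> \<odot>\<^bsub>M\<^esub> u" using u by simp
  then show "\<zero>\<^bsub>M\<^esub> \<in> cyclic R M u" unfolding cyclic_def by blast
  fix x assume "x \<in> cyclic R M u"
  then obtain r where r: "r \<in> carrier R" "x = r \<odot>\<^bsub>M\<^esub> u" unfolding cyclic_def by blast
  have "\<ominus>\<^bsub>M\<^esub> x = (\<ominus> r) \<odot>\<^bsub>M\<^esub> u" using r u by (simp add: smult_l_minus)
  then show "\<ominus>\<^bsub>M\<^esub> x \<in> cyclic R M u" using r unfolding cyclic_def by blast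
  { fix y assume "y \<in> cyclic R M u"
    then obtain s where s: "s \<in> carrier R" "y = s \<odot>\<^bsub>M\<^esub> u" unfolding cyclic_def by blast
    have "x \<oplus>\<^bsub>M\<^esub> y = (r \<oplus> s) \<odot>\<^bsub>M\<^esub> u" using r s u by (simp add: smult_l_distr)
    then show "x \<oplus>\<^bsub>M\<^esub> y \<in> cyclic R M u" using r s unfolding cyclic_def by blast }
  fix a assume a: "a \<in> carrier R"
  have "a \<odot>\<^bsub>M\<^esub> x = (a \<otimes> r) \<odot>\<^bsub>M\<^esub> u" using a r u by (simp add: smult_assoc1)
  then show "a \<odot>\<^bsub>M\<^esub> x \<in> cyclic R M u" using a r unfolding cyclic_def by blast
qed

lemma cyclic_self: "u \<in> carrier M \<Longrightarrow> u \<in> cyclic R M u"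
  unfolding cyclic_def using smult_one[of u] by (metis R.one_closed imageI)

lemma gen_insert:
  assumes B: "submodule B R M" and u: "u \<in> carrier M"
  shows "gen_submodule R M (insert u B) = B <+>\<^bsub>M\<^esub> cyclic R M u"
proof
  note C = submodule_cyclic[OF u]
  show "gen_submodule R M (insert u B) \<subseteq> B <+>\<^bsub>M\<^esub> cyclic R M u"
    using set_add_upper1[OF B C] set_add_upper2[OF B C] cyclic_self[OF u]
    by (intro gen_submodule_least submodule_set_add B C) blast
  have sub: "insert u B \<subseteq> carrier M" using u submoduleE(1)[OF B] by blast
  note G = submodule_gen[OF sub] and S = gen_submodule_superset[of "insert u B"]
  show "B <+>\<^bsub>M\<^esub> cyclic R M u \<subseteq> gen_submodule R M (insert u B)"
  proof (rule set_add_least[OF G])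
    show "B \<subseteq> gen_submodule R M (insert u B)" using S by blast
    show "cyclic R M u \<subseteq> gen_submodule R M (insert u B)"
      using submoduleE(4)[OF G] S unfolding cyclic_def by blast
  qed
qed

lemma gen_gen_Un:
  assumes "S \<subseteq> carrier M" "T \<subseteq> carrier M"
  shows "gen_submodule R M (gen_submodule R M S \<union> T) = gen_submodule R M (S \<union> T)"
proof
  have ST: "S \<union> T \<subseteq> carrier M" using assms by blast
  show "gen_submodule R M (gen_submodule R M S \<union> T) \<subseteq> gen_submodule R M (S \<union> T)"
    using gen_submodule_mono[of S "S \<union> T"] gen_submodule_superset[of "S \<union> T"]
    by (intro gen_submodule_least submodule_gen ST) blast
  show "gen_submodule R M (S \<union> T) \<subseteq> gen_submodule R M (gen_submodule R M S \<union> T)"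
    using gen_submodule_superset[of S] by (intro gen_submodule_mono) blast
qed

end

lemma chain_length_le_1:
  assumes "\<And>x y z. x \<in> F \<Longrightarrow> y \<in> F \<Longrightarrow> z \<in> F \<Longrightarrow> x < y \<Longrightarrow> \<not> y < z"
  shows "chain_length F \<le> 1"
  unfolding chain_length_def
proof (rule Sup_least)
  fix a assume "a \<in> {enat n |n. \<exists>N::nat \<Rightarrow> _. (\<forall>i\<le>n. N i \<in> F) \<and> (\<forall>i<n. N i < N (Suc i))}"
  then obtain n and N :: "nat \<Rightarrow> _" where a: "a = enat n" and N: "\<forall>i\<le>n. N i \<in> F" "\<forall>i<n. N i < N (Suc i)"
    by auto
  have "n \<le> 1"
  proof (rule ccontr)
    assume "\<not> n \<le> 1"
    then have n: "2 \<le> n" by simp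
    have "N 0 < N 1" "N 1 < N 2" using N(2) n by (auto simp: numeral_2_eq_2)
    moreover have "N 0 \<in> F" "N 1 \<in> F" "N 2 \<in> F" using N(1) n by auto
    ultimately show False using assms by blast
  qed
  then show "a \<le> 1" by (simp add: a one_enat_def)
qed

locale local_module = plain_module R M + local_ring R \<mm>
  for R :: "('r, 'x) ring_scheme" (structure) and M :: "('r, 'm) module" (structure) and \<mm>
begin

text \<open>Generators are discarded one at a time: modulo the others one has
  \<open>x = b + a x\<close> with \<open>a \<in> \<mm>\<close>, and \<open>1 - a\<close> is a unit.
  The inclusion hypothesis concerns only \<open>A\<close> and \<open>B\<close>, and \<open>A\<close>
  does not change when \<open>x\<close> is dropped, so the induction continues.\<close>

lemma nakayama_aux:
  assumes "finite S" "S \<subseteq> carrier M" and B: "submodule B R M"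
    and "A = gen_submodule R M (B \<union> S)" "A \<subseteq> B <+>\<^bsub>M\<^esub> ideal_smul R M \<mm> A"
  shows "A = B"
  using assms(1,2,4,5)
proof (induct S arbitrary: A)
  case empty then show ?case using gen_submodule_eq[OF B] by simp
next
  case (insert x S)
  have cB: "B \<subseteq> carrier M" by (rule submoduleE(1)[OF B])
  have x: "x \<in> carrier M" and S: "S \<subseteq> carrier M" using insert by auto
  have BS: "B \<union> S \<subseteq> carrier M" using cB S by blast
  define B' where "B' = gen_submodule R M (B \<union> S)"
  have B': "submodule B' R M" unfolding B'_def by (rule submodule_gen[OF BS])
  have BB': "B \<subseteq> B'" unfolding B'_def using gen_submodule_superset[of "B \<union> S"] by blast
  have C: "submodule (cyclic R M x) R M" by (rule submodule_cyclic[OF x])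
  have "A = gen_submodule R M (B' \<union> {x})"
    unfolding B'_def using gen_gen_Un[OF BS, of "{x}"] x insert(5) by simp
  then have A: "A = B' <+>\<^bsub>M\<^esub> cyclic R M x" using gen_insert[OF B' x] by simp
  have mA: "ideal_smul R M \<mm> A \<subseteq> B' <+>\<^bsub>M\<^esub> ideal_smul R M \<mm> (cyclic R M x)"
    unfolding A ideal_smul_set_add[OF m_carrier B' C]
    by (intro set_add_mono ideal_smul_subset m_carrier B' subset_refl)
  have mx: "ideal_smul R M \<mm> (cyclic R M x) \<subseteq> (\<lambda>a. a \<odot>\<^bsub>M\<^esub> x) ` \<mm>"
  proof (rule ideal_smul_least)
    show "submodule ((\<lambda>a. a \<odot>\<^bsub>M\<^esub> x) ` \<mm>) R M"
    proof (rule submoduleI)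
      note aS = ideal.axioms(1)[OF ideal_m]
      show "(\<lambda>a. a \<odot>\<^bsub>M\<^esub> x) ` \<mm> \<subseteq> carrier M" using x m_carrier by blast
      have "\<zero>\<^bsub>M\<^esub> = \<zero> \<odot>\<^bsub>M\<^esub> x" using x by simp
      then show "\<zero>\<^bsub>M\<^esub> \<in> (\<lambda>a. a \<odot>\<^bsub>M\<^esub> x) ` \<mm>"
        using additive_subgroup.zero_closed[OF aS] by blast
      fix u assume "u \<in> (\<lambda>a. a \<odot>\<^bsub>M\<^esub> x) ` \<mm>"
      then obtain a where a: "a \<in> \<mm>" "u = a \<odot>\<^bsub>M\<^esub> x" by blast
      have ca: "a \<in> carrier R" using a m_carrier by blast
      have "\<ominus>\<^bsub>M\<^esub> u = (\<ominus> a) \<odot>\<^bsub>M\<^esub> x" using a ca x by (simp add: smult_l_minus)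
      then show "\<ominus>\<^bsub>M\<^esub> u \<in> (\<lambda>a. a \<odot>\<^bsub>M\<^esub> x) ` \<mm>"
        using additive_subgroup.a_inv_closed[OF aS a(1)] by blast
      { fix v assume "v \<in> (\<lambda>a. a \<odot>\<^bsub>M\<^esub> x) ` \<mm>"
        then obtain b where b: "b \<in> \<mm>" "v = b \<odot>\<^bsub>M\<^esub> x" by blast
        have "u \<oplus>\<^bsub>M\<^esub> v = (a \<oplus> b) \<odot>\<^bsub>M\<^esub> x" using a b ca m_carrier x by (simp add: smult_l_distr subsetD)
        then show "u \<oplus>\<^bsub>M\<^esub> v \<in> (\<lambda>a. a \<odot>\<^bsub>M\<^esub> x) ` \<mm>"
          using additive_subgroup.a_closed[OF aS a(1) b(1)] by blast }
      fix r assume r: "r \<in> carrier R"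
      have "r \<odot>\<^bsub>M\<^esub> u = (r \<otimes> a) \<odot>\<^bsub>M\<^esub> x" using a ca r x by (simp add: smult_assoc1)
      then show "r \<odot>\<^bsub>M\<^esub> u \<in> (\<lambda>a. a \<odot>\<^bsub>M\<^esub> x) ` \<mm>" using ideal.I_l_closed[OF ideal_m a(1) r] by blast
    qed
    fix a u assume a: "a \<in> \<mm>" and "u \<in> cyclic R M x"
    then obtain r where r: "r \<in> carrier R" "u = r \<odot>\<^bsub>M\<^esub> x" unfolding cyclic_def by blast
    have "a \<odot>\<^bsub>M\<^esub> u = (a \<otimes> r) \<odot>\<^bsub>M\<^esub> x" using a r x m_carrier by (simp add: smult_assoc1 subsetD)
    then show "a \<odot>\<^bsub>M\<^esub> u \<in> (\<lambda>a. a \<odot>\<^bsub>M\<^esub> x) ` \<mm>" using ideal.I_r_closed[OF ideal_m a r(1)] by blast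
  qed
  have "B' <+>\<^bsub>M\<^esub> ideal_smul R M \<mm> (cyclic R M x) \<subseteq> B' <+>\<^bsub>M\<^esub> ((\<lambda>a. a \<odot>\<^bsub>M\<^esub> x) ` \<mm>)"
    by (rule set_add_mono[OF subset_refl mx])
  moreover have "x \<in> A" unfolding A using set_add_upper2[OF B' C] cyclic_self[OF x] by blast
  then have "x \<in> B <+>\<^bsub>M\<^esub> ideal_smul R M \<mm> A" using insert(6) by blast
  moreover have "B <+>\<^bsub>M\<^esub> ideal_smul R M \<mm> A \<subseteq> B' <+>\<^bsub>M\<^esub> ideal_smul R M \<mm> (cyclic R M x)"
    using BB' mA
    by (intro set_add_least submodule_set_add submodule_ideal_smul B' m_carrier submoduleE(1)[OF C])
      (use set_add_upper1[OF B' submodule_ideal_smul[OF m_carrier submoduleE(1)[OF C]]] in blast)+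
  ultimately have "x \<in> B' <+>\<^bsub>M\<^esub> ((\<lambda>a. a \<odot>\<^bsub>M\<^esub> x) ` \<mm>)" by blast
  then obtain b a where ba: "b \<in> B'" "a \<in> \<mm>" "x = b \<oplus>\<^bsub>M\<^esub> a \<odot>\<^bsub>M\<^esub> x" unfolding set_add_def' by blast
  have c: "b \<in> carrier M" "a \<in> carrier R" using ba submoduleE(1)[OF B'] m_carrier by blast+
  have "(\<one> \<ominus> a) \<odot>\<^bsub>M\<^esub> x = x \<oplus>\<^bsub>M\<^esub> \<ominus>\<^bsub>M\<^esub> (a \<odot>\<^bsub>M\<^esub> x)"
    using c x by (simp add: R.minus_eq smult_l_distr smult_l_minus)
  also have "\<dots> = (b \<oplus>\<^bsub>M\<^esub> a \<odot>\<^bsub>M\<^esub> x) \<oplus>\<^bsub>M\<^esub> \<ominus>\<^bsub>M\<^esub> (a \<odot>\<^bsub>M\<^esub> x)" using ba(3) by simp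
  also have "\<dots> = b" using c x by (simp add: M.a_assoc M.r_neg)
  finally have b: "(\<one> \<ominus> a) \<odot>\<^bsub>M\<^esub> x = b" .
  obtain e where e: "e \<in> carrier R" "e \<otimes> (\<one> \<ominus> a) = \<one>" using one_minus_unit[OF ba(2)] .
  have "x = e \<odot>\<^bsub>M\<^esub> b" unfolding b[symmetric] using e c x by (simp add: smult_assoc1[symmetric])
  then have "x \<in> B'" using submoduleE(4)[OF B' e(1) ba(1)] by simp
  then have "cyclic R M x \<subseteq> B'" using submoduleE(4)[OF B'] unfolding cyclic_def by blast
  then have AB': "A = B'" using set_add_absorb[OF B' C] A by simp
  show ?case using insert(3)[OF S AB'[unfolded B'_def] insert(6)] .
qed

text \<open>The quotient is an image of the residue field: an element outside \<open>B\<close> has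
  the form \<open>b + r u\<close> with \<open>r\<close> a unit, so every larger submodule contains
  \<open>u\<close>.\<close>

lemma sub_length_cyclic_le:
  assumes B: "submodule B R M" and u: "u \<in> carrier M" and mu: "\<And>a. a \<in> \<mm> \<Longrightarrow> a \<odot>\<^bsub>M\<^esub> u \<in> B"
  shows "sub_length R M B (B <+>\<^bsub>M\<^esub> cyclic R M u) \<le> 1"
  unfolding sub_length_def
proof (rule chain_length_le_1)
  fix X Y Z
  assume X: "X \<in> {N. submodule N R M \<and> B \<subseteq> N \<and> N \<subseteq> B <+>\<^bsub>M\<^esub> cyclic R M u}"
    and Y: "Y \<in> {N. submodule N R M \<and> B \<subseteq> N \<and> N \<subseteq> B <+>\<^bsub>M\<^esub> cyclic R M u}"
    and Z: "Z \<in> {N. submodule N R M \<and> B \<subseteq> N \<and> N \<subseteq> B <+>\<^bsub>M\<^esub> cyclic R M u}" and XY: "X < Y"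
  have sY: "submodule Y R M" and BY: "B \<subseteq> Y" using Y by auto
  obtain y where y: "y \<in> Y" "y \<notin> B" using X XY by blast
  then obtain b r where br: "b \<in> B" "r \<in> carrier R" "y = b \<oplus>\<^bsub>M\<^esub> r \<odot>\<^bsub>M\<^esub> u"
    using Y unfolding set_add_def' cyclic_def by blast
  have "r \<notin> \<mm>" using mu[of r] submoduleE(5)[OF B br(1), of "r \<odot>\<^bsub>M\<^esub> u"] br(3) y(2) by blast
  then obtain e where e: "e \<in> carrier R" "e \<otimes> r = \<one>" using unit_notin_m[OF br(2)] by blast
  have c: "b \<in> carrier M" using br submoduleE(1)[OF B] by blast
  have "y \<ominus>\<^bsub>M\<^esub> b = r \<odot>\<^bsub>M\<^esub> u" using br c u
    by (simp add: a_minus_def M.a_assoc M.a_comm M.r_neg1 M.r_neg)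
  then have "r \<odot>\<^bsub>M\<^esub> u \<in> Y" using submodule_diff[OF sY y(1), of b] br(1) BY by auto
  then have "e \<odot>\<^bsub>M\<^esub> (r \<odot>\<^bsub>M\<^esub> u) \<in> Y" using submoduleE(4)[OF sY e(1)] by blast
  then have "u \<in> Y" using e br(2) u by (simp add: smult_assoc1[symmetric])
  then have "cyclic R M u \<subseteq> Y" using submoduleE(4)[OF sY] unfolding cyclic_def by blast
  then have "B <+>\<^bsub>M\<^esub> cyclic R M u \<subseteq> Y" using set_add_least[OF sY BY] by blast
  then show "\<not> Y < Z" using Z by auto
qed

lemma sub_length_gen_le:
  assumes A: "submodule A R M" and "finite S" "S \<subseteq> carrier M"
    and "\<And>a s. a \<in> \<mm> \<Longrightarrow> s \<in> S \<Longrightarrow> a \<odot>\<^bsub>M\<^esub> s \<in> A"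
  shows "sub_length R M A (gen_submodule R M (A \<union> S)) \<le> enat (card S)"
  using assms(2-4)
proof (induct S)
  case empty then show ?case using gen_submodule_eq[OF A] sub_length_self[OF A] by simp
next
  case (insert u S)
  have u: "u \<in> carrier M" and S: "S \<subseteq> carrier M" and AS: "A \<union> S \<subseteq> carrier M"
    using insert submoduleE(1)[OF A] by auto
  let ?B = "gen_submodule R M (A \<union> S)"
  have B: "submodule ?B R M" by (rule submodule_gen[OF AS])
  have AB: "A \<subseteq> ?B" using gen_submodule_superset[of "A \<union> S"] by blast
  have e: "gen_submodule R M (A \<union> insert u S) = ?B <+>\<^bsub>M\<^esub> cyclic R M u"
    using gen_gen_Un[OF AS, of "{u}"] gen_insert[OF B u] u by simp
  note C = submodule_cyclic[OF u]
  have "sub_length R M A (?B <+>\<^bsub>M\<^esub> cyclic R M u)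
      = sub_length R M A ?B + sub_length R M ?B (?B <+>\<^bsub>M\<^esub> cyclic R M u)"
    by (rule sub_length_add[OF A B submodule_set_add[OF B C] AB set_add_upper1[OF B C]])
  also have "\<dots> \<le> enat (card S) + 1"
    using insert AB by (intro add_mono insert(3) sub_length_cyclic_le B u S) auto
  finally show ?case unfolding e using insert by (simp add: one_enat_def)
qed

end

subsection \<open>Minimal numbers of generators and multiplicities\<close>

text \<open>Generation is tested in the ambient module, which avoids a record with restricted
  carrier.\<close>

definition fg_sub :: "('r, 'x) ring_scheme \<Rightarrow> ('r, 'm) module \<Rightarrow> 'm set \<Rightarrow> bool" where
  "fg_sub R M A \<longleftrightarrow> (\<exists>S. finite S \<and> S \<subseteq> carrier M \<and> gen_submodule R M S = A)"

lemma fin_gen_iff_fg_sub: "fin_gen R M \<longleftrightarrow> fg_sub R M (carrier M)"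
  by (auto simp: fin_gen_def generates_def fg_sub_def)

lemma (in plain_module) fg_sub_submodule: "fg_sub R M A \<Longrightarrow> submodule A R M"
  using submodule_gen unfolding fg_sub_def by blast

lemma (in plain_module) fg_sub_ideal_smul:
  assumes T: "finite T" "T \<subseteq> carrier R" and A: "fg_sub R M A"
  shows "fg_sub R M (ideal_smul R M (Idl T) A)"
proof -
  obtain S where S: "finite S" "S \<subseteq> carrier M" "gen_submodule R M S = A"
    using A unfolding fg_sub_def by blast
  have cA: "A \<subseteq> carrier M" by (rule submoduleE(1)[OF fg_sub_submodule[OF A]])
  have "ideal_smul R M (Idl T) A = ideal_smul R M T A" by (rule ideal_smul_genideal[OF T(2) cA])
  also have "\<dots> = ideal_smul R M T S" using ideal_smul_gen[OF T(2) S(2)] S(3) by simp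
  also have "\<dots> = gen_submodule R M ((\<lambda>(a, x). a \<odot>\<^bsub>M\<^esub> x) ` (T \<times> S))"
    unfolding ideal_smul_def by (rule arg_cong[where f = "gen_submodule R M"]) auto
  finally show ?thesis
    unfolding fg_sub_def using S T by (intro exI[of _ "(\<lambda>(a, x). a \<odot>\<^bsub>M\<^esub> x) ` (T \<times> S)"]) auto
qed

context local_module begin

lemma fg_sub_smul:
  assumes "ideal I R" and A: "fg_sub R M A" shows "fg_sub R M (ideal_smul R M I A)"
  using finitely_gen[OF assms(1)] fg_sub_ideal_smul[OF _ _ A] by auto

lemma nakayama:
  assumes A: "fg_sub R M A" and B: "submodule B R M" and BA: "B \<subseteq> A"
    and le: "A \<subseteq> B <+>\<^bsub>M\<^esub> ideal_smul R M \<mm> A"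
  shows "A = B"
proof -
  obtain S where S: "finite S" "S \<subseteq> carrier M" "gen_submodule R M S = A"
    using A unfolding fg_sub_def by blast
  have "gen_submodule R M (B \<union> S) = A"
  proof
    show "gen_submodule R M (B \<union> S) \<subseteq> A"
      using gen_submodule_superset[of S] S(3) BA by (intro gen_submodule_least fg_sub_submodule[OF A]) blast
    show "A \<subseteq> gen_submodule R M (B \<union> S)" using gen_submodule_mono[of S "B \<union> S"] S(3) by blast
  qed
  from nakayama_aux[OF S(1,2) B this[symmetric] le] show ?thesis .
qed

lemma sub_length_fg_finite:
  assumes A: "fg_sub R M A" shows "sub_length R M (ideal_smul R M \<mm> A) A \<noteq> \<infinity>"
proof -
  obtain S where S: "finite S" "S \<subseteq> carrier M" "gen_submodule R M S = A"
    using A unfolding fg_sub_def by blast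
  have sA: "submodule A R M" by (rule fg_sub_submodule[OF A])
  let ?K = "ideal_smul R M \<mm> A"
  have K: "submodule ?K R M" by (rule submodule_ideal_smul[OF m_carrier submoduleE(1)[OF sA]])
  have SA: "S \<subseteq> A" using gen_submodule_superset[of S] S(3) by simp
  have KA: "?K \<subseteq> A" by (rule ideal_smul_subset[OF m_carrier sA])
  have "gen_submodule R M (?K \<union> S) = A"
  proof
    show "gen_submodule R M (?K \<union> S) \<subseteq> A" using SA KA by (intro gen_submodule_least sA) blast
    show "A \<subseteq> gen_submodule R M (?K \<union> S)" using gen_submodule_mono[of S "?K \<union> S"] S(3) by blast
  qed
  moreover have "sub_length R M ?K (gen_submodule R M (?K \<union> S)) \<le> enat (card S)"
    using SA by (intro sub_length_gen_le K S) (auto intro: ideal_smulI)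
  ultimately show ?thesis by (metis enat_ord_simps(5) infinity_ileE)
qed

theorem min_gens_eq_length:
  assumes fg: "fin_gen R M"
  shows "enat (min_gens R M) = sub_length R M (ideal_smul R M \<mm> (carrier M)) (carrier M)"
proof (rule antisym)
  let ?K = "ideal_smul R M \<mm> (carrier M)"
  note cM = carrier_is_submodule
  have A: "fg_sub R M (carrier M)" using fg by (simp add: fin_gen_iff_fg_sub)
  have K: "submodule ?K R M" by (rule submodule_ideal_smul[OF m_carrier subset_refl])
  have KM: "?K \<subseteq> carrier M" by (rule submoduleE(1)[OF K])
  obtain S where S: "finite S" "card S = min_gens R M" "generates R M S"
    using LeastI_ex[of "\<lambda>n. \<exists>S. finite S \<and> card S = n \<and> generates R M S"] fg
    unfolding min_gens_def fin_gen_def by auto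
  have cS: "S \<subseteq> carrier M" and gS: "gen_submodule R M S = carrier M" using S(3) by (auto simp: generates_def)
  have "gen_submodule R M (?K \<union> S) = carrier M"
  proof
    show "gen_submodule R M (?K \<union> S) \<subseteq> carrier M" using cS KM by (intro gen_submodule_least cM) blast
    show "carrier M \<subseteq> gen_submodule R M (?K \<union> S)" using gen_submodule_mono[of S "?K \<union> S"] gS by blast
  qed
  moreover have "sub_length R M ?K (gen_submodule R M (?K \<union> S)) \<le> enat (card S)"
    using cS by (intro sub_length_gen_le K S) (auto intro: ideal_smulI)
  ultimately show "sub_length R M ?K (carrier M) \<le> enat (min_gens R M)" using S(2) by simp
  then obtain n where n: "sub_length R M ?K (carrier M) = enat n" by (cases "sub_length R M ?K (carrier M)") auto
  \<comment> \<open>A greedy choice: until the set generates modulo \<open>\<mm>M\<close>, each new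
    element raises the length by at least one. At \<open>k = n\<close> the second alternative leaves
    no length for anything more, and Nakayama's lemma then removes \<open>\<mm>M\<close>.\<close>
  have "\<exists>S. finite S \<and> S \<subseteq> carrier M \<and> card S \<le> k \<and>
      (gen_submodule R M (?K \<union> S) = carrier M \<or> enat k \<le> sub_length R M ?K (gen_submodule R M (?K \<union> S)))" for k
  proof (induct k)
    case 0 show ?case by (intro exI[of _ "{}"]) (simp add: zero_enat_def[symmetric])
  next
    case (Suc k)
    then obtain S where S: "finite S" "S \<subseteq> carrier M" "card S \<le> k"
      and alt: "gen_submodule R M (?K \<union> S) = carrier M \<or> enat k \<le> sub_length R M ?K (gen_submodule R M (?K \<union> S))"
      by blast
    let ?B = "gen_submodule R M (?K \<union> S)"
    have KS: "?K \<union> S \<subseteq> carrier M" using KM S by blast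
    have B: "submodule ?B R M" by (rule submodule_gen[OF KS])
    show ?case
    proof (cases "?B = carrier M")
      case True then show ?thesis using S by (intro exI[of _ S]) simp
    next
      case False
      then have le: "enat k \<le> sub_length R M ?K ?B" using alt by blast
      obtain u where u: "u \<in> carrier M" "u \<notin> ?B" using False submoduleE(1)[OF B] by blast
      have e: "gen_submodule R M (?K \<union> insert u S) = gen_submodule R M (insert u ?B)"
        using gen_gen_Un[OF KS, of "{u}"] u by simp
      have uB: "insert u ?B \<subseteq> carrier M" using u submoduleE(1)[OF B] by blast
      let ?C = "gen_submodule R M (insert u ?B)"
      have C: "submodule ?C R M" by (rule submodule_gen[OF uB])
      have KB: "?K \<subseteq> ?B" using gen_submodule_superset[of "?K \<union> S"] by blast
      have BC: "insert u ?B \<subseteq> ?C" by (rule gen_submodule_superset)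
      have "sub_length R M ?B ?C \<noteq> 0" using sub_length_eq_0[OF B C] BC u(2) by blast
      then have "1 \<le> sub_length R M ?B ?C" by (simp add: ileI1 one_eSuc i0_less)
      then have "enat k + 1 \<le> sub_length R M ?K ?B + sub_length R M ?B ?C" using le by (rule add_mono[rotated])
      also have "\<dots> = sub_length R M ?K ?C" using BC by (intro sub_length_add[symmetric] K B C KB) blast
      finally have "enat (Suc k) \<le> sub_length R M ?K ?C" by (simp add: one_enat_def)
      moreover have "card (insert u S) \<le> Suc k" using S by (simp add: card_insert_if)
      ultimately show ?thesis using S u e by (intro exI[of _ "insert u S"]) simp
    qed
  qed
  then obtain S where S: "finite S" "S \<subseteq> carrier M" "card S \<le> n"
    and alt: "gen_submodule R M (?K \<union> S) = carrier M \<or> enat n \<le> sub_length R M ?K (gen_submodule R M (?K \<union> S))"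
    by blast
  let ?B = "gen_submodule R M (?K \<union> S)"
  have KS: "?K \<union> S \<subseteq> carrier M" using KM S by blast
  have B: "submodule ?B R M" by (rule submodule_gen[OF KS])
  have KB: "?K \<subseteq> ?B" using gen_submodule_superset[of "?K \<union> S"] by blast
  have BM: "?B = carrier M"
  proof (rule ccontr)
    assume "?B \<noteq> carrier M"
    then have "enat n \<le> sub_length R M ?K ?B" using alt by blast
    moreover have "enat n = sub_length R M ?K ?B + sub_length R M ?B (carrier M)"
      using sub_length_add[OF K B cM KB submoduleE(1)[OF B]] n by simp
    ultimately have "sub_length R M ?B (carrier M) = 0"
      by (cases "sub_length R M ?K ?B"; cases "sub_length R M ?B (carrier M)") (auto simp: zero_enat_def)
    with sub_length_eq_0[OF B cM submoduleE(1)[OF B]] \<open>?B \<noteq> carrier M\<close> show False by blast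
  qed
  have G: "submodule (gen_submodule R M S) R M" by (rule submodule_gen[OF S(2)])
  have "carrier M = gen_submodule R M S"
  proof (rule nakayama[OF A G submoduleE(1)[OF G]])
    have "?B \<subseteq> gen_submodule R M S <+>\<^bsub>M\<^esub> ?K"
      using set_add_upper1[OF G K] set_add_upper2[OF G K] gen_submodule_superset[of S]
      by (intro gen_submodule_least submodule_set_add G K) blast
    then show "carrier M \<subseteq> gen_submodule R M S <+>\<^bsub>M\<^esub> ?K" using BM by simp
  qed
  then have "generates R M S" using S by (simp add: generates_def)
  then have "min_gens R M \<le> card S" unfolding min_gens_def using S(1) by (intro Least_le) blast
  then show "enat (min_gens R M) \<le> sub_length R M ?K (carrier M)" using S n by simp
qed

end

section \<open>A Pluennecke inequality for lengths\<close>

text \<open>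
  The argument is Petridis' proof of Pluennecke's inequality: \<open>W\<close> minimizes
  \<open>\<ell>(IW/IL) - \<ell>(W/L)\<close> among the submodules between \<open>L\<close> and \<open>V\<close>, and \<open>I\<^sup>jW\<close> is built up from
  \<open>I\<^sup>jL\<close> by adding the submodules \<open>cW\<close> one generator \<open>c\<close> of \<open>I\<^sup>j\<close> at a time.
\<close>

lemma (in plain_module) length_smul_pow_step:
  assumes I: "ideal I R" and T: "finite T" "T \<subseteq> carrier R" "Idl T = ideal_pow R I j"
    and L: "submodule L R M" and W: "submodule W R M" and V: "submodule V R M"
    and LW: "L \<subseteq> W" and WV: "W \<subseteq> V"
    and fin: "sub_length R M (ideal_smul R M I L) (ideal_smul R M I W) \<noteq> \<infinity>"
      "sub_length R M L V \<noteq> \<infinity>"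
    and min: "\<And>X. submodule X R M \<Longrightarrow> L \<subseteq> X \<Longrightarrow> X \<subseteq> V \<Longrightarrow>
      sub_length R M (ideal_smul R M I L) (ideal_smul R M I W) + sub_length R M W V
      \<le> sub_length R M (ideal_smul R M I L) (ideal_smul R M I X) + sub_length R M X V"
  shows "sub_length R M (ideal_smul R M (ideal_pow R I (Suc j)) L) (ideal_smul R M (ideal_pow R I (Suc j)) W)
      \<le> sub_length R M (ideal_smul R M (ideal_pow R I j) L) (ideal_smul R M (ideal_pow R I j) W)"
proof -
  let ?s = "\<lambda>A. ideal_smul R M I A" and ?l = "sub_length R M"
  note cI = ideal_subset[OF I]
  have sI: "submodule (?s A) R M" if "submodule A R M" for A
    by (rule submodule_ideal_smul[OF cI submoduleE(1)[OF that]])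
  have sm: "?s A \<subseteq> ?s B" if "A \<subseteq> B" for A B by (rule ideal_smul_mono[OF subset_refl that])
  define D where "D = ideal_smul R M (ideal_pow R I j) L"
  define E where "E = ideal_smul R M (ideal_pow R I j) W"
  have D: "submodule D R M" and E: "submodule E R M"
    unfolding D_def E_def by (rule submodule_ideal_smul_pow[OF I L] submodule_ideal_smul_pow[OF I W])+
  have DE: "D \<subseteq> E" unfolding D_def E_def by (rule ideal_smul_mono[OF subset_refl LW])
  \<comment> \<open>Minimality of \<open>W\<close> compared with \<open>X\<close>, after cancelling
    the lengths common to both sides, all of which are finite.\<close>
  have incr: "?l (?s X) (?s W) \<le> ?l X W" if X: "submodule X R M" "L \<subseteq> X" "X \<subseteq> W" for X
  proof -
    have XV: "X \<subseteq> V" using X WV by blast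
    have 1: "?l (?s L) (?s W) = ?l (?s L) (?s X) + ?l (?s X) (?s W)"
      by (rule sub_length_add[OF sI[OF L] sI[OF X(1)] sI[OF W] sm[OF X(2)] sm[OF X(3)]])
    have 2: "?l X V = ?l X W + ?l W V" by (rule sub_length_add[OF X(1) W V X(3) WV])
    have "?l X V \<le> ?l L V" by (rule sub_length_mono[OF X(2) subset_refl])
    then have f: "?l X V \<noteq> \<infinity>" using fin(2) by (cases "?l X V") auto
    have "?l (?s L) (?s W) + ?l W V \<le> ?l (?s L) (?s X) + ?l X V" by (rule min[OF X(1,2) XV])
    then show ?thesis using 1 2 f fin(1)
      by (cases "?l (?s L) (?s X)"; cases "?l (?s X) (?s W)"; cases "?l X W"; cases "?l W V") auto
  qed
  have "\<exists>A. submodule A R M \<and> D \<subseteq> A \<and> A \<subseteq> E \<and> (\<forall>t\<in>T'. scaled M t W \<subseteq> A) \<and>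
      ?l (?s D) (?s A) \<le> ?l D A" if "T' \<subseteq> T" for T'
    using finite_subset[OF that T(1)] that
  proof (induct T')
    case empty
    show ?case by (intro exI[of _ D]) (simp add: D DE sub_length_self sI)
  next
    case (insert c T')
    then obtain A where A: "submodule A R M" "D \<subseteq> A" "A \<subseteq> E" "\<forall>t\<in>T'. scaled M t W \<subseteq> A"
      "?l (?s D) (?s A) \<le> ?l D A" by blast
    have c: "c \<in> carrier R" "c \<in> ideal_pow R I j"
      using insert T R.genideal_self[OF T(2)] by auto
    note cW = submodule_scaled[OF W c(1)]
    define A' where "A' = A <+>\<^bsub>M\<^esub> scaled M c W"
    \<comment> \<open>\<open>X\<close> is the preimage of \<open>A\<close> under \<open>c\<close>,
      so the length added below is \<open>\<ell>(W/X)\<close>. Since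
      \<open>c(IX) \<subseteq> IA\<close>, the length added after multiplication by \<open>I\<close>
      is at most \<open>\<ell>(IW/IX)\<close>, and \<open>incr\<close> compares the two.\<close>
    define X where "X = {w \<in> W. c \<odot>\<^bsub>M\<^esub> w \<in> A}"
    have X: "submodule X R M" unfolding X_def by (rule submodule_preimage[OF W A(1) c(1)])
    have XW: "X \<subseteq> W" unfolding X_def by blast
    have LX: "L \<subseteq> X" unfolding X_def using LW A(2) ideal_smulI[OF c(2), of _ L] unfolding D_def by blast
    have A': "submodule A' R M" and AA': "A \<subseteq> A'" and cA': "scaled M c W \<subseteq> A'"
      unfolding A'_def by (rule submodule_set_add[OF A(1) cW] set_add_upper1[OF A(1) cW] set_add_upper2[OF A(1) cW])+
    have cE: "scaled M c W \<subseteq> E" unfolding E_def scaled_def using ideal_smulI[OF c(2), of _ W] by blast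
    have A'E: "A' \<subseteq> E" unfolding A'_def by (rule set_add_least[OF E A(3) cE])
    have sA': "?s A' = ?s A <+>\<^bsub>M\<^esub> scaled M c (?s W)"
      unfolding A'_def ideal_smul_set_add[OF cI A(1) cW] ideal_smul_scaled[OF cI W c(1)] ..
    have "scaled M c (?s X) \<subseteq> ?s A"
      unfolding ideal_smul_scaled[OF cI X c(1), symmetric] by (rule sm) (auto simp: X_def scaled_def)
    then have "?l (?s A) (?s A') \<le> ?l (?s X) (?s W)"
      unfolding sA' by (intro sub_length_scaled_le sI A W X c sm XW)
    also have "\<dots> \<le> ?l X W" by (rule incr[OF X LX XW])
    also have "\<dots> \<le> ?l A A'" unfolding A'_def by (rule sub_length_scaled_ge[OF A(1) W c(1)]) (simp add: X_def)
    finally have "?l (?s D) (?s A) + ?l (?s A) (?s A') \<le> ?l D A + ?l A A'" by (rule add_mono[OF A(5)])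
    moreover have "?l (?s D) (?s A') = ?l (?s D) (?s A) + ?l (?s A) (?s A')"
      by (rule sub_length_add[OF sI[OF D] sI[OF A(1)] sI[OF A'] sm[OF A(2)] sm[OF AA']])
    moreover have "?l D A' = ?l D A + ?l A A'" by (rule sub_length_add[OF D A(1) A' A(2) AA'])
    ultimately have "?l (?s D) (?s A') \<le> ?l D A'" by simp
    moreover have "\<forall>t\<in>insert c T'. scaled M t W \<subseteq> A'" using A(4) AA' cA' by auto
    moreover have "D \<subseteq> A'" using A(2) AA' by blast
    ultimately show ?case using A' A'E by blast
  qed
  from this[OF subset_refl] obtain A where A: "submodule A R M" "A \<subseteq> E" "\<forall>t\<in>T. scaled M t W \<subseteq> A"
    "?l (?s D) (?s A) \<le> ?l D A" by blast
  have "E = ideal_smul R M T W"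
    unfolding E_def T(3)[symmetric] by (rule ideal_smul_genideal[OF T(2) submoduleE(1)[OF W]])
  also have "\<dots> \<subseteq> A" using A(3) unfolding scaled_def by (intro ideal_smul_least A(1)) blast
  finally have AE: "A = E" using A(2) by blast
  have "?s D = ideal_smul R M (ideal_pow R I (Suc j)) L" "?s E = ideal_smul R M (ideal_pow R I (Suc j)) W"
    unfolding D_def E_def using ideal_smul_pow_add[OF I L, of 1 j] ideal_smul_pow_add[OF I W, of 1 j]
    by (simp_all add: R.ideal_pow_1[OF I])
  then show ?thesis using A(4) unfolding AE D_def[symmetric] E_def[symmetric] by simp
qed

text \<open>Here \<open>z \<in> I\<^sup>s\<close> plays the role of the \<open>s\<close>-th power of a reduction of \<open>I\<close>.\<close>

locale reduction_pair = plain_module R M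
  for R :: "('r, 'x) ring_scheme" (structure) and M :: "('r, 'm) module" (structure) +
  fixes I :: "'r set" and s :: nat and z :: 'r
  assumes I: "ideal I R" and fg: "ideal J R \<Longrightarrow> \<exists>T\<subseteq>carrier R. finite T \<and> J = Idl T"
    and s: "0 < s" and z: "z \<in> ideal_pow R I s"
    and inj: "inj_on (\<lambda>x. z \<odot>\<^bsub>M\<^esub> x) (carrier M)"
begin

abbreviation "pw n A \<equiv> ideal_smul R M (ideal_pow R I n) A"

lemma z_carrier: "z \<in> carrier R"
  using z R.ideal_pow_carrier[OF I] by blast

lemma scaled_subset_pw: "scaled M z A \<subseteq> pw s A"
  unfolding scaled_def using ideal_smulI[OF z] by blast

text \<open>Multiplication by \<open>z\<close> embeds \<open>W/L\<close> into
  \<open>I^s W / I^s L\<close>, because \<open>I^s L = zL\<close>. Iterating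
  \<open>length_smul_pow_step\<close> brings the exponent \<open>s\<close> down to one.\<close>

lemma length_min:
  assumes L: "submodule L R M" and W: "submodule W R M" and V: "submodule V R M"
    and LW: "L \<subseteq> W" and WV: "W \<subseteq> V" and fin: "sub_length R M L V \<noteq> \<infinity>"
      "sub_length R M (pw 1 L) (pw 1 W) \<noteq> \<infinity>"
    and zL: "pw s L = scaled M z L"
    and min: "\<And>X. submodule X R M \<Longrightarrow> L \<subseteq> X \<Longrightarrow> X \<subseteq> V \<Longrightarrow>
      sub_length R M (pw 1 L) (pw 1 W) + sub_length R M W V
      \<le> sub_length R M (pw 1 L) (pw 1 X) + sub_length R M X V"
  shows "sub_length R M L W \<le> sub_length R M (pw 1 L) (pw 1 W)"
    and "sub_length R M (pw s L) (pw s W) \<le> sub_length R M (pw 1 L) (pw 1 W)"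
proof -
  let ?l = "sub_length R M"
  have step: "?l (pw (Suc j) L) (pw (Suc j) W) \<le> ?l (pw j L) (pw j W)" for j
  proof -
    obtain T where "T \<subseteq> carrier R" "finite T" "ideal_pow R I j = Idl T"
      using fg[OF R.ideal_ideal_pow[OF I]] by blast
    then show ?thesis
      using length_smul_pow_step[OF I _ _ _ L W V LW WV _ fin(1), of T j] fin(2) min
      by (simp add: R.ideal_pow_1[OF I])
  qed
  have "?l (pw (Suc j) L) (pw (Suc j) W) \<le> ?l (pw 1 L) (pw 1 W)" for j
  proof (induct j)
    case (Suc j) then show ?case using step[of "Suc j"] order_trans by blast
  qed simp
  from this[of "s - 1"] s show le: "?l (pw s L) (pw s W) \<le> ?l (pw 1 L) (pw 1 W)" by simp
  have "?l L W = ?l (scaled M z L) (scaled M z W)"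
    by (rule sub_length_scaled_inj[OF W L LW z_carrier inj, symmetric])
  also have "\<dots> \<le> ?l (pw s L) (pw s W)" unfolding zL by (rule sub_length_mono[OF subset_refl scaled_subset_pw])
  finally show "?l L W \<le> ?l (pw 1 L) (pw 1 W)" using le by (rule order_trans)
qed

text \<open>A minimizer \<open>W\<close> of \<open>?g\<close> gives \<open>\<ell>(V/L) = \<ell>(W/L)
  + \<ell>(V/W) \<le> ?g W \<le> ?g V\<close>, and \<open>?g V\<close> is the right-hand
  side.\<close>

lemma length_smul_ge:
  assumes L: "submodule L R M" and V: "submodule V R M"
    and LV: "L \<subseteq> V" and fin: "sub_length R M L V \<noteq> \<infinity>" and zL: "pw s L = scaled M z L"
  shows "sub_length R M L V \<le> sub_length R M (pw 1 L) (pw 1 V)"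
proof -
  let ?l = "sub_length R M" and ?F = "{X. submodule X R M \<and> L \<subseteq> X \<and> X \<subseteq> V}"
  \<comment> \<open>This is \<open>\<ell>(IX/IL) - \<ell>(X/L)\<close> shifted by the constant
    \<open>\<ell>(V/L)\<close>, which avoids subtraction in \<open>enat\<close>.\<close>
  let ?g = "\<lambda>X. ?l (pw 1 L) (pw 1 X) + ?l X V"
  have LF: "L \<in> ?F" using L LV by simp
  have "\<exists>e. e \<in> ?g ` ?F" using LF by blast
  then have "(LEAST e. e \<in> ?g ` ?F) \<in> ?g ` ?F" by (rule LeastI_ex)
  then obtain W where W: "W \<in> ?F" and e: "(LEAST e. e \<in> ?g ` ?F) = ?g W" by auto
  have min: "?g W \<le> ?g X" if "X \<in> ?F" for X
    unfolding e[symmetric] using that by (intro Least_le) blast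
  have W': "submodule W R M" "L \<subseteq> W" "W \<subseteq> V" using W by auto
  have "submodule (pw 1 L) R M" by (rule submodule_ideal_smul_pow[OF I L])
  then have "?g L = ?l L V" by (simp add: sub_length_self)
  then have "?g W \<le> ?l L V" using min[OF LF] by (rule order_trans[rotated, OF eq_refl])
  then have "?l (pw 1 L) (pw 1 W) \<noteq> \<infinity>" using fin by (cases "?l (pw 1 L) (pw 1 W)") (auto simp del: One_nat_def)
  then have "?l L W \<le> ?l (pw 1 L) (pw 1 W)"
    using min by (intro length_min(1)[OF L W'(1) V W'(2,3) fin _ zL]) auto
  then have "?l L W + ?l W V \<le> ?g W" by (rule add_right_mono)
  moreover have "?l L V = ?l L W + ?l W V" by (rule sub_length_add[OF L W'(1) V W'(2,3)])
  moreover have "?g W \<le> ?g V" by (rule min) (simp add: V LV)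
  ultimately have "?l L V \<le> ?g V" by (simp only: order_trans)
  then show ?thesis using sub_length_self[OF V] by (simp del: One_nat_def)
qed

text \<open>Equality makes \<open>V\<close> itself a minimizer, by \<open>length_smul_ge\<close> for
  the submodules in between. Then
  \<open>\<ell>(I^s V/I^s L) \<le> \<ell>(V/L) = \<ell>(zV/zL)\<close>, which leaves no room between
  \<open>zV\<close> and \<open>I^s V\<close>.\<close>

lemma pw_eq_scaled:
  assumes L: "submodule L R M" and V: "submodule V R M"
    and LV: "L \<subseteq> V" and fin: "sub_length R M L V \<noteq> \<infinity>" and zL: "pw s L = scaled M z L"
    and eq: "sub_length R M (pw 1 L) (pw 1 V) = sub_length R M L V"
  shows "pw s V = scaled M z V"
proof -
  let ?l = "sub_length R M"
  have "?l (pw 1 L) (pw 1 V) + ?l V V \<le> ?l (pw 1 L) (pw 1 X) + ?l X V"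
    if X: "submodule X R M" "L \<subseteq> X" "X \<subseteq> V" for X
  proof -
    have a: "?l L V = ?l L X + ?l X V" by (rule sub_length_add[OF L X(1) V X(2,3)])
    have "?l L X \<noteq> \<infinity>" using fin a by (cases "?l L X") auto
    then have "?l L X \<le> ?l (pw 1 L) (pw 1 X)" by (rule length_smul_ge[OF L X(1,2) _ zL])
    then show ?thesis unfolding eq a using sub_length_self[OF V] by (simp add: add_right_mono)
  qed
  then have le: "?l (pw s L) (pw s V) \<le> ?l (pw 1 L) (pw 1 V)"
    using fin eq by (intro length_min(2)[OF L V V LV subset_refl fin _ zL]) auto
  have zV: "submodule (scaled M z V) R M" and zL': "submodule (scaled M z L) R M"
    by (rule submodule_scaled[OF V z_carrier] submodule_scaled[OF L z_carrier])+
  have sV: "submodule (pw s V) R M" by (rule submodule_ideal_smul_pow[OF I V])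
  have "?l (scaled M z L) (pw s V) = ?l (scaled M z L) (scaled M z V) + ?l (scaled M z V) (pw s V)"
    by (rule sub_length_add[OF zL' zV sV scaled_mono[OF LV] scaled_subset_pw])
  moreover have "?l (scaled M z L) (scaled M z V) = ?l L V"
    by (rule sub_length_scaled_inj[OF V L LV z_carrier inj])
  ultimately have "?l L V + ?l (scaled M z V) (pw s V) \<le> ?l L V" using le eq zL by simp
  then have "?l (scaled M z V) (pw s V) = 0"
    using fin by (cases "?l L V"; cases "?l (scaled M z V) (pw s V)") (auto simp: zero_enat_def)
  then show ?thesis using sub_length_eq_0[OF zV sV scaled_subset_pw] by simp
qed

text \<open>A sandwich: the lengths of \<open>I^i V / I^i L\<close> increase weakly with
  \<open>i\<close>, and the value at \<open>i = s\<close> is that of \<open>zV/zL\<close>, hence the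
  value at \<open>i = 0\<close>.\<close>

lemma length_smul_eq:
  assumes L: "submodule L R M" and V: "submodule V R M"
    and LV: "L \<subseteq> V" and fin: "\<And>i. sub_length R M (pw i L) (pw i V) \<noteq> \<infinity>"
    and zL: "pw s L = scaled M z L" and zV: "pw s V = scaled M z V"
  shows "sub_length R M (pw 1 L) (pw 1 V) = sub_length R M L V"
proof -
  let ?l = "sub_length R M"
  have step: "?l (pw i L) (pw i V) \<le> ?l (pw (Suc i) L) (pw (Suc i) V)" for i
  proof -
    \<comment> \<open>The relation between \<open>I^s\<close> and \<open>z\<close> passes from
      \<open>L\<close> to \<open>I^i L\<close>, so \<open>length_smul_ge\<close> applies in every
      degree.\<close>
    have "pw s (pw i L) = scaled M z (pw i L)"
      using ideal_smul_pow_add[OF I L, of s i] ideal_smul_pow_add[OF I L, of i s] zL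
        ideal_smul_scaled[OF R.ideal_pow_carrier[OF I] L z_carrier] by (simp add: add.commute)
    then have "?l (pw i L) (pw i V) \<le> ?l (pw 1 (pw i L)) (pw 1 (pw i V))"
      by (intro length_smul_ge submodule_ideal_smul_pow I L V fin ideal_smul_mono[OF subset_refl LV])
    then show ?thesis using ideal_smul_pow_add[OF I L, of 1 i] ideal_smul_pow_add[OF I V, of 1 i] by simp
  qed
  have "?l (pw (Suc 0) L) (pw (Suc 0) V) \<le> ?l (pw (Suc j) L) (pw (Suc j) V)" for j
  proof (induct j)
    case (Suc j) then show ?case using step[of "Suc j"] order_trans by blast
  qed simp
  from this[of "s - 1"] s have "?l (pw 1 L) (pw 1 V) \<le> ?l (pw s L) (pw s V)" by simp
  also have "\<dots> = ?l L V" unfolding zL zV by (rule sub_length_scaled_inj[OF V L LV z_carrier inj])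
  finally have "?l (pw 1 L) (pw 1 V) \<le> ?l L V" .
  moreover have "?l L V \<le> ?l (pw 1 L) (pw 1 V)"
    using step[of 0] by (simp add: ideal_smul_pow_0 L V)
  ultimately show ?thesis by (rule antisym)
qed

end

theorem (in local_module) min_gens_eq_multiplicity_iff:
  assumes fin_gen: "fin_gen R M" and dim: "krull_dim R = 1"
    and s: "0 < s" and z: "z \<in> ideal_pow R \<mm> s"
    and inj: "inj_on (\<lambda>x. z \<odot>\<^bsub>M\<^esub> x) (carrier M)"
    and red: "\<And>n. n0 \<le> n \<Longrightarrow> scaled M z (ideal_smul R M (ideal_pow R \<mm> n) (carrier M))
      = ideal_smul R M (ideal_pow R \<mm> (n + s)) (carrier M)"
  shows "real (min_gens R M) = multiplicity R \<mm> M \<longleftrightarrow>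
    ideal_smul R M (ideal_pow R \<mm> s) (carrier M) = scaled M z (carrier M)"
proof -
  interpret reduction_pair R M \<mm> s z
    by (intro reduction_pair.intro reduction_pair_axioms.intro plain_module_axioms ideal_m s z inj finitely_gen)
  let ?l = "sub_length R M"
  define V where "V n = pw n (carrier M)" for n
  note cM = carrier_is_submodule
  have V: "submodule (V n) R M" for n unfolding V_def by (rule submodule_ideal_smul_pow[OF ideal_m cM])
  have V0: "V 0 = carrier M" unfolding V_def by (rule ideal_smul_pow_0[OF cM])
  have VV: "pw i (V n) = V (i + n)" for i n unfolding V_def by (rule ideal_smul_pow_add[OF ideal_m cM])
  have anti: "V (Suc n) \<subseteq> V n" for n
    unfolding V_def by (rule ideal_smul_mono[OF R.ideal_pow_anti[OF ideal_m] subset_refl]) simp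
  have anti': "V n \<subseteq> V m" if "m \<le> n" for m n
    unfolding V_def by (rule ideal_smul_mono[OF R.ideal_pow_anti[OF ideal_m that] subset_refl])
  have fgV: "fg_sub R M (V n)" for n
    unfolding V_def using fin_gen by (intro fg_sub_smul R.ideal_ideal_pow ideal_m) (simp add: fin_gen_iff_fg_sub)
  have smulV: "ideal_smul R M \<mm> (V n) = V (Suc n)" for n
    using VV[of 1 n] by (simp add: R.ideal_pow_1[OF ideal_m])
  have zV: "pw s (V n) = scaled M z (V n)" if "n0 \<le> n" for n
    using red[OF that] VV[of s n] by (simp add: V_def add.commute)
  have hfin: "?l (V (Suc n)) (V n) \<noteq> \<infinity>" for n
    using sub_length_fg_finite[OF fgV[of n]] smulV by simp
  \<comment> \<open>From \<open>n0\<close> on, consecutive \<open>V n\<close> both satisfy the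
    relation with \<open>z\<close>, so the Hilbert function is constant. Its value \<open>e\<close>
    is the multiplicity.\<close>
  have hstep: "?l (V (Suc (Suc n))) (V (Suc n)) = ?l (V (Suc n)) (V n)" if "n0 \<le> n" for n
  proof -
    have "?l (pw 1 (V (Suc n))) (pw 1 (V n)) = ?l (V (Suc n)) (V n)"
      using hfin that zV[of n] zV[of "Suc n"] by (intro length_smul_eq V anti) (simp_all add: VV)
    then show ?thesis by (simp add: VV)
  qed
  obtain e where e: "?l (V (Suc n0)) (V n0) = enat e" using hfin[of n0] by auto
  have h: "?l (V (Suc (n0 + k))) (V (n0 + k)) = enat e" for k
    by (induct k) (simp_all add: e hstep)
  have "\<exists>k. ?l (V n) (carrier M) = enat k" for n
  proof (induct n)
    case 0 then show ?case using sub_length_self[OF cM] by (auto simp: V0 zero_enat_def)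
  next
    case (Suc n)
    have "?l (V (Suc n)) (carrier M) = ?l (V (Suc n)) (V n) + ?l (V n) (carrier M)"
      by (rule sub_length_add[OF V V cM anti submoduleE(1)[OF V]])
    then show ?case using Suc hfin[of n] by auto
  qed
  then obtain l where l: "\<And>n. ?l (V n) (carrier M) = enat (l n)" by metis
  have lk: "l (n0 + k) = l n0 + k * e" for k
  proof (induct k)
    case (Suc k)
    have "?l (V (Suc (n0 + k))) (carrier M) = ?l (V (Suc (n0 + k))) (V (n0 + k)) + ?l (V (n0 + k)) (carrier M)"
      by (rule sub_length_add[OF V V cM anti submoduleE(1)[OF V]])
    then show ?case using Suc l h by simp
  qed simp
  have ml: "module_length R (quot_module R M (ideal_mod R M (ideal_pow R \<mm> n))) = enat (l n)" for n
    using module_length_quot[OF V[of n]] l[of n] by (simp add: ideal_mod_smul V_def)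
  \<comment> \<open>The length of \<open>M/\<mm>^n M\<close> is \<open>c + n e\<close> for
    \<open>n \<ge> n0\<close>; only the slope survives in the limit.\<close>
  define c where "c = real (l n0) - real n0 * real e"
  have "(\<lambda>n. c / real n + real e) \<longlonglongrightarrow> 0 + real e"
    by (intro tendsto_add lim_const_over_n tendsto_const)
  moreover have "\<forall>\<^sub>F n in sequentially. c / real n + real e = real (l n) / real n"
  proof (rule eventually_sequentiallyI[of "Suc n0"])
    fix n assume n: "Suc n0 \<le> n"
    then have "l n = l n0 + (n - n0) * e" using lk[of "n - n0"] by simp
    then have "real (l n) = real (l n0) + real (n - n0) * real e" by simp
    also have "real (n - n0) = real n - real n0" using n by (intro of_nat_diff) simp
    finally have "real (l n) = c + real n * real e" by (simp add: c_def algebra_simps)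
    then show "c / real n + real e = real (l n) / real n" using n by (simp add: field_simps)
  qed
  ultimately have "(\<lambda>n. real (l n) / real n) \<longlonglongrightarrow> real e"
    using Lim_transform_eventually by fastforce
  then have mult: "multiplicity R \<mm> M = real e"
    unfolding multiplicity_def dim by (simp add: Let_def ml one_enat_def limI)
  let ?L = "V n0"
  have VL: "?l (V (Suc n0)) (carrier M) = ?l (V (Suc n0)) (V (Suc 0)) + ?l (V (Suc 0)) (carrier M)"
    by (rule sub_length_add[OF V V cM anti' submoduleE(1)[OF V]]) simp
  have VL': "?l (V (Suc n0)) (carrier M) = enat e + ?l ?L (carrier M)"
    using sub_length_add[OF V V cM anti submoduleE(1)[OF V], of n0] e by simp
  have mg: "enat (min_gens R M) = ?l (V (Suc 0)) (carrier M)"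
    using min_gens_eq_length[OF fin_gen] smulV[of 0] V0 by simp
  have p1: "pw 1 ?L = V (Suc n0)" "pw 1 (carrier M) = V (Suc 0)"
    using VV[of 1 n0] by (simp_all add: V_def)
  have finL: "?l ?L (carrier M) \<noteq> \<infinity>" using l[of n0] by simp
  \<comment> \<open>The length of \<open>M/\<mm>^(n0+1) M\<close> is split once at
    \<open>\<mm>M\<close> and once at \<open>\<mm>^n0 M\<close>. The quotient at one end is
    \<open>M/\<mm>M\<close> in the first splitting and has length \<open>e\<close> in the
    second.\<close>
  have key: "min_gens R M = e \<longleftrightarrow> ?l (pw 1 ?L) (pw 1 (carrier M)) = ?l ?L (carrier M)"
  proof -
    obtain q where q: "?l (V (Suc n0)) (V (Suc 0)) = enat q"
      using VL l[of "Suc n0"] by (cases "?l (V (Suc n0)) (V (Suc 0))") auto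
    have "q + min_gens R M = e + l n0" using VL VL' l mg[symmetric] q by simp
    then show ?thesis unfolding p1 q l[of n0] by auto
  qed
  have "pw s (carrier M) = scaled M z (carrier M) \<longleftrightarrow> ?l (pw 1 ?L) (pw 1 (carrier M)) = ?l ?L (carrier M)"
  proof
    assume "?l (pw 1 ?L) (pw 1 (carrier M)) = ?l ?L (carrier M)"
    then show "pw s (carrier M) = scaled M z (carrier M)"
      by (rule pw_eq_scaled[OF V cM submoduleE(1)[OF V] finL zV[OF order_refl]])
  next
    assume a: "pw s (carrier M) = scaled M z (carrier M)"
    have "?l (pw i ?L) (pw i (carrier M)) \<noteq> \<infinity>" for i
    proof -
      have "?l (pw i ?L) (pw i (carrier M)) = ?l (V (i + n0)) (V i)" using VV[of i n0] by (simp add: V_def)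
      also have "\<dots> \<le> ?l (V (i + n0)) (carrier M)" by (rule sub_length_mono[OF subset_refl submoduleE(1)[OF V]])
      finally show ?thesis using l[of "i + n0"] by (cases "?l (pw i ?L) (pw i (carrier M))") auto
    qed
    then show "?l (pw 1 ?L) (pw 1 (carrier M)) = ?l ?L (carrier M)"
      using a by (intro length_smul_eq V cM submoduleE(1)[OF V] zV order_refl)
  qed
  then show ?thesis using key mult by simp
qed

subsection \<open>One-dimensional Cohen--Macaulay rings\<close>

lemma ring_module_simps [simp]:
  "carrier (ring_module R) = carrier R" "mult (ring_module R) = mult R" "one (ring_module R) = one R"
  "zero (ring_module R) = zero R" "add (ring_module R) = add R" "smult (ring_module R) = mult R"
  by (simp_all add: ring_module_def)

lemma (in cring) module_ring_module: "module R (ring_module R)"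
proof (rule moduleI)
  show "cring R" by (rule is_cring)
  show "abelian_group (ring_module R)"
  proof (rule abelian_groupI)
    fix x assume x: "x \<in> carrier (ring_module R)"
    then show "\<exists>y\<in>carrier (ring_module R). y \<oplus>\<^bsub>ring_module R\<^esub> x = \<zero>\<^bsub>ring_module R\<^esub>"
      by (intro bexI[of _ "\<ominus> x"]) (simp_all add: l_neg)
  qed (simp_all add: a_ac)
qed (simp_all add: l_distr r_distr m_assoc)

lemma (in cring) submodule_ring_module_iff: "submodule I R (ring_module R) \<longleftrightarrow> ideal I R"
proof
  interpret M: plain_module R "ring_module R" by (intro plain_module.intro module_ring_module)
  assume I: "submodule I R (ring_module R)"
  show "ideal I R"
  proof (rule idealI[OF ring_axioms])
    \<comment> \<open>The additive monoids of \<open>R\<close> and \<open>ring_module R\<close> are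
      different records with the same operations; unfolding the inverse makes the conditions
      coincide.\<close>
    show "subgroup I (add_monoid R)" using submodule.axioms(1)[OF I] by (simp add: subgroup_def m_inv_def)
    fix a x assume a: "a \<in> I" and x: "x \<in> carrier R"
    show xa: "x \<otimes> a \<in> I" using M.submoduleE(4)[OF I x a] by simp
    show "a \<otimes> x \<in> I" using xa x subsetD[OF M.submoduleE(1)[OF I] a] by (simp add: m_comm)
  qed
next
  interpret M: plain_module R "ring_module R" by (intro plain_module.intro module_ring_module)
  assume I: "ideal I R"
  note S = ideal.axioms(1)[OF I]
  show "submodule I R (ring_module R)"
  proof (rule M.submoduleI)
    fix a assume a: "a \<in> I"
    have "\<ominus>\<^bsub>ring_module R\<^esub> a = \<ominus> a" by (simp add: a_inv_def m_inv_def)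
    with additive_subgroup.a_inv_closed[OF S a] show "\<ominus>\<^bsub>ring_module R\<^esub> a \<in> I" by simp
    show "a \<oplus>\<^bsub>ring_module R\<^esub> b \<in> I" if b: "b \<in> I" for b
      using additive_subgroup.a_closed[OF S a b] by simp
    show "x \<odot>\<^bsub>ring_module R\<^esub> a \<in> I" if x: "x \<in> carrier R" for x
      using ideal.I_l_closed[OF I a x] by simp
  next
    show "I \<subseteq> carrier (ring_module R)" using ideal_subset[OF I] by simp
    show "\<zero>\<^bsub>ring_module R\<^esub> \<in> I" using additive_subgroup.zero_closed[OF S] by simp
  qed
qed

lemma (in cring) ideal_smul_ring_module:
  assumes I: "ideal I R" and J: "ideal J R"
  shows "ideal_smul R (ring_module R) I J = I \<cdot> J"
proof
  interpret M: plain_module R "ring_module R" by (intro plain_module.intro module_ring_module)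
  have IJ: "submodule (I \<cdot> J) R (ring_module R)"
    by (simp add: submodule_ring_module_iff ideal_prod_is_ideal I J)
  show "ideal_smul R (ring_module R) I J \<subseteq> I \<cdot> J"
    by (rule M.ideal_smul_least[OF IJ]) (simp add: ideal_prod.prod)
  have K: "submodule (ideal_smul R (ring_module R) I J) R (ring_module R)"
    by (rule M.submodule_ideal_smul) (simp_all add: ideal_subset I J)
  show "I \<cdot> J \<subseteq> ideal_smul R (ring_module R) I J"
  proof
    fix x assume "x \<in> I \<cdot> J"
    then show "x \<in> ideal_smul R (ring_module R) I J"
    proof (induct x rule: ideal_prod.induct)
      case (prod i j) then show ?case using M.ideal_smulI[of i I j J] by simp
    next
      case (sum a b) show ?case using M.submoduleE(5)[OF K sum(2) sum(4)] by simp
    qed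
  qed
qed

lemma (in local_ring) local_module_ring: "local_module R (ring_module R) \<mm>"
  by (intro local_module.intro plain_module.intro module_ring_module local_ring_axioms)

section \<open>Powers of a finitely generated ideal inside a graded family of ideals\<close>

fun monomials :: "('r, 'x) ring_scheme \<Rightarrow> 'r set \<Rightarrow> nat \<Rightarrow> 'r set" where
  "monomials R T 0 = {\<one>\<^bsub>R\<^esub>}"
| "monomials R T (Suc n) = {c \<otimes>\<^bsub>R\<^esub> x | c x. c \<in> T \<and> x \<in> monomials R T n}"

context cring begin

lemma monomials_carrier: "T \<subseteq> carrier R \<Longrightarrow> monomials R T n \<subseteq> carrier R"
  by (induct n) auto

lemma ideal_pow_eq_monomials:
  assumes T: "T \<subseteq> carrier R"
  shows "ideal_pow R (Idl T) n = Idl (monomials R T n)"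
proof (induct n)
  case 0 then show ?case by (simp add: ideal_pow_0 genideal_one)
next
  case (Suc n)
  interpret M: plain_module R "ring_module R" by (intro plain_module.intro module_ring_module)
  have I: "ideal (Idl T) R" by (rule genideal_ideal[OF T])
  note mc = monomials_carrier[OF T]
  have J: "ideal (Idl (monomials R T n)) R" by (rule genideal_ideal[OF mc])
  show ?case
  proof
    note K = genideal_ideal[OF mc, of "Suc n"]
    have K': "submodule (Idl (monomials R T (Suc n))) R (ring_module R)"
      using K by (simp add: submodule_ring_module_iff)
    have gen: "gen_submodule R (ring_module R) S = Idl S" if "S \<subseteq> carrier R" for S
      unfolding gen_submodule_def genideal_def submodule_ring_module_iff ..
    have "ideal_pow R (Idl T) (Suc n) = ideal_smul R (ring_module R) (Idl T) (Idl (monomials R T n))"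
      unfolding ideal_pow_Suc[OF I] Suc ideal_smul_ring_module[OF I J] ..
    also have "\<dots> = ideal_smul R (ring_module R) T (monomials R T n)"
      using M.ideal_smul_genideal[OF T, of "Idl (monomials R T n)"] M.ideal_smul_gen[OF T, of "monomials R T n"]
        ideal_subset[OF J] mc[of n] gen[OF mc[of n]] by simp
    also have "\<dots> \<subseteq> Idl (monomials R T (Suc n))"
      using genideal_self[OF mc[of "Suc n"]] by (intro M.ideal_smul_least K') auto
    finally show "ideal_pow R (Idl T) (Suc n) \<subseteq> Idl (monomials R T (Suc n))" .
    have "monomials R T (Suc n) \<subseteq> ideal_pow R (Idl T) (Suc n)"
    proof
      fix x assume "x \<in> monomials R T (Suc n)"
      then obtain c y where cy: "c \<in> T" "y \<in> monomials R T n" "x = c \<otimes> y" by auto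
      have "c \<in> Idl T" using genideal_self[OF T] cy by blast
      moreover have "y \<in> Idl (monomials R T n)" using genideal_self[OF mc[of n]] cy by blast
      ultimately show "x \<in> ideal_pow R (Idl T) (Suc n)"
        unfolding ideal_pow_Suc[OF I] Suc cy(3) by (rule ideal_prod.prod)
    qed
    then show "Idl (monomials R T (Suc n)) \<subseteq> ideal_pow R (Idl T) (Suc n)"
      by (rule genideal_minimal[OF ideal_ideal_pow[OF I]])
  qed
qed

lemma monomials_insert:
  assumes T: "insert c T \<subseteq> carrier R" and "x \<in> monomials R (insert c T) n"
  obtains i y where "i \<le> n" "y \<in> monomials R T (n - i)" "x = c [^] i \<otimes> y"
proof -
  have "\<exists>i\<le>n. \<exists>y\<in>monomials R T (n - i). x = c [^] i \<otimes> y"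
    using assms(2)
  proof (induct n arbitrary: x)
    case (Suc n)
    then obtain d u where du: "d \<in> insert c T" "u \<in> monomials R (insert c T) n" "x = d \<otimes> u" by auto
    then obtain i y where iy: "i \<le> n" "y \<in> monomials R T (n - i)" "u = c [^] i \<otimes> y" using Suc(1) by blast
    have car: "c \<in> carrier R" "d \<in> carrier R" "y \<in> carrier R"
      using T du iy monomials_carrier[of T "n - i"] by auto
    show ?case
    proof (cases "d = c")
      case True
      then have "x = c [^] Suc i \<otimes> y" using du iy car by (simp add: m_ac)
      then show ?thesis using iy by (intro exI[of _ "Suc i"]) auto
    next
      case False
      then have "d \<in> T" using du by simp
      then have "d \<otimes> y \<in> monomials R T (Suc n - i)" using iy by (auto simp: Suc_diff_le)
      moreover have "x = c [^] i \<otimes> (d \<otimes> y)" using du iy car by (simp add: m_ac)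
      ultimately show ?thesis using iy by (intro exI[of _ i]) auto
    qed
  qed auto
  then show ?thesis using that by blast
qed

text \<open>Pigeonhole: in a long monomial either the exponent of \<open>c\<close> reaches
  \<open>N\<close>, and \<open>c^N \<in> J N\<close> suffices, or the part in the other generators
  is long enough for the induction hypothesis. The remaining factors only raise the degree.\<close>

lemma monomials_in_graded:
  assumes "finite T" and T: "T \<subseteq> carrier R"
    and J: "\<And>d. J d \<subseteq> carrier R"
    and mult: "\<And>c d x. c \<in> T \<Longrightarrow> x \<in> J d \<Longrightarrow> c \<otimes> x \<in> J (Suc d)"
    and nil: "\<And>c. c \<in> T \<Longrightarrow> \<exists>N. c [^] (N::nat) \<in> J N"
    and T0: "T \<noteq> {}"
  shows "\<exists>M. \<forall>n\<ge>M. monomials R T n \<subseteq> J n"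
proof -
  have pow: "c [^] (i::nat) \<otimes> x \<in> J (i + d)" if "c \<in> T" "x \<in> J d" for c i x d
  proof (induct i)
    case 0 then show ?case using that(2) subsetD[OF J that(2)] by simp
  next
    case (Suc i)
    have car: "c \<in> carrier R" "x \<in> carrier R" using that T J by blast+
    have "c [^] Suc i \<otimes> x = c \<otimes> (c [^] i \<otimes> x)" using car by (simp add: m_ac)
    then show ?case using mult[OF that(1) Suc] by simp
  qed
  have mon: "y \<otimes> x \<in> J (k + d)" if "y \<in> monomials R T k" "x \<in> J d" for y k x d
    using that(1)
  proof (induct k arbitrary: y)
    case 0 then show ?case using that(2) subsetD[OF J that(2)] by simp
  next
    case (Suc k)
    then obtain c u where cu: "c \<in> T" "u \<in> monomials R T k" "y = c \<otimes> u" by auto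
    have "c \<in> carrier R" "u \<in> carrier R" "x \<in> carrier R"
      using cu T monomials_carrier[OF T, of k] that(2) J by blast+
    then have "y \<otimes> x = c \<otimes> (u \<otimes> x)" unfolding cu(3) by (simp add: m_assoc)
    then show ?case using mult[OF cu(1) Suc(1)[OF cu(2)]] by simp
  qed
  have "\<exists>M. \<forall>n\<ge>M. monomials R T' n \<subseteq> J n" if "T' \<subseteq> T" for T'
    using finite_subset[OF that assms(1)] that
  proof (induct T')
    case empty
    have "monomials R {} n = {}" if "n \<ge> 1" for n using that by (cases n) auto
    then show ?case by blast
  next
    case (insert c T')
    obtain M where M: "\<And>n. n \<ge> M \<Longrightarrow> monomials R T' n \<subseteq> J n" using insert by blast
    obtain N where N: "c [^] (N::nat) \<in> J N" using nil[of c] insert by blast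
    have cT: "insert c T' \<subseteq> carrier R" using insert T by blast
    have c: "c \<in> T" using insert by blast
    have "x \<in> J n" if n: "n \<ge> M + N" and x: "x \<in> monomials R (insert c T') n" for n x
    proof -
      obtain i y where iy: "i \<le> n" "y \<in> monomials R T' (n - i)" "x = c [^] i \<otimes> y"
        using monomials_insert[OF cT x] .
      have sub: "monomials R T' k \<subseteq> monomials R T k" for k
        using insert(4) by (induct k) auto
      have car: "c \<in> carrier R" "y \<in> carrier R"
        using cT iy monomials_carrier[of T' "n - i"] by auto
      show ?thesis
      proof (cases "N \<le> i")
        case True
        have e: "c [^] i = c [^] (i - N) \<otimes> c [^] N" using True car by (simp add: nat_pow_mult)
        have "c [^] i \<in> J i" using pow[OF c N, of "i - N"] True e by simp
        then have "y \<otimes> c [^] i \<in> J (n - i + i)" using iy(2) sub by (intro mon) blast+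
        then show ?thesis using iy car by (simp add: m_comm)
      next
        case False
        then have "M \<le> n - i" using n by simp
        then have "y \<in> J (n - i)" using M[of "n - i"] iy(2) by blast
        from pow[OF c this, of i] show ?thesis using iy by simp
      qed
    qed
    then show ?case by blast
  qed
  then show ?thesis by blast
qed

text \<open>For a constant \<open>J\<close> this says that an ideal with finitely many generators,
  nilpotent modulo \<open>J\<close>, is itself nilpotent modulo \<open>J\<close>. For
  \<open>lead_ideal\<close> it is the same statement in the associated graded ring.\<close>

lemma ideal_pow_in_graded:
  assumes "finite T" and T: "T \<subseteq> carrier R" and J: "\<And>d. ideal (J d) R"
    and mult: "\<And>c d x. c \<in> T \<Longrightarrow> x \<in> J d \<Longrightarrow> c \<otimes> x \<in> J (Suc d)"
    and nil: "\<And>c. c \<in> T \<Longrightarrow> \<exists>N. c [^] (N::nat) \<in> J N"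
  shows "\<exists>M. \<forall>n\<ge>M. ideal_pow R (Idl T) n \<subseteq> J n"
proof (cases "T = {}")
  case True
  have "monomials R {} n = {}" if "n \<ge> 1" for n using that by (cases n) auto
  then have "ideal_pow R (Idl T) n \<subseteq> J n" if "n \<ge> 1" for n
    using genideal_minimal[OF J, of "{}" n] \<open>\<And>n. n \<ge> 1 \<Longrightarrow> monomials R {} n = {}\<close>[OF that]
    unfolding True ideal_pow_eq_monomials[OF empty_subsetI] by simp
  then show ?thesis by blast
next
  case False
  obtain M where M: "\<forall>n\<ge>M. monomials R T n \<subseteq> J n"
    using monomials_in_graded[OF assms(1) T ideal_subset[OF J] mult nil False] by blast
  then have "ideal_pow R (Idl T) n \<subseteq> J n" if "n \<ge> M" for n
    unfolding ideal_pow_eq_monomials[OF T] using that by (intro genideal_minimal J) blast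
  then show ?thesis by blast
qed

end

text \<open>The first term of a regular sequence. The zero submodule is written as the one generated
  by the empty set, so that the lemma applies to \<open>gr_module\<close> over
  \<open>gr_ring\<close> directly from the definitions.\<close>

lemma depth_pos_regular:
  assumes "0 < depth R I M" and "ideal_mod R M I \<noteq> carrier M"
  shows "\<exists>y\<in>I. \<forall>x\<in>carrier M. y \<odot>\<^bsub>M\<^esub> x \<in> gen_submodule R M {} \<longrightarrow> x \<in> gen_submodule R M {}"
proof -
  have e: "ideal_mod R M {} = gen_submodule R M {}" by (simp add: ideal_mod_def)
  have "0 < Sup {enat (length xs) | xs. set xs \<subseteq> I \<and> regular_seq R M xs}"
    using assms by (simp add: depth_def)
  then obtain xs where xs: "set xs \<subseteq> I" "regular_seq R M xs" "0 < length xs"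
    unfolding less_Sup_iff by (auto simp: zero_enat_def)
  have "xs ! 0 \<in> I" using xs by (meson nth_mem subsetD)
  moreover have "\<forall>x\<in>carrier M. xs ! 0 \<odot>\<^bsub>M\<^esub> x \<in> gen_submodule R M {} \<longrightarrow> x \<in> gen_submodule R M {}"
    using xs(2,3) unfolding regular_seq_def e[symmetric] by (metis list.set(1) take0 take_0)
  ultimately show ?thesis by blast
qed

lemma (in plain_module) gen_empty: "gen_submodule R M {} = {\<zero>\<^bsub>M\<^esub>}"
  using gen_submodule_least[OF submodule_null, of "{}"] submodule_zero[OF submodule_gen[of "{}"]] by blast

lemma (in plain_module) depth_eq_1_regular:
  assumes "depth R I M = 1"
  shows "\<exists>y\<in>I. \<forall>x\<in>carrier M. y \<odot>\<^bsub>M\<^esub> x = \<zero>\<^bsub>M\<^esub> \<longrightarrow> x = \<zero>\<^bsub>M\<^esub>"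
    and "ideal_mod R M I \<noteq> carrier M"
proof -
  show "ideal_mod R M I \<noteq> carrier M" using assms by (auto simp: depth_def one_enat_def split: if_splits)
  then show "\<exists>y\<in>I. \<forall>x\<in>carrier M. y \<odot>\<^bsub>M\<^esub> x = \<zero>\<^bsub>M\<^esub> \<longrightarrow> x = \<zero>\<^bsub>M\<^esub>"
    using depth_pos_regular[of R I M] assms by (simp add: gen_empty)
qed

section \<open>Chains of primes in dimension one\<close>

lemma krull_dim_1_chain:
  assumes "krull_dim R = 1" "primeideal P0 R" "primeideal P1 R" "primeideal P2 R" "P0 \<subset> P1"
  shows "\<not> P1 \<subset> P2"
proof
  assume "P1 \<subset> P2"
  define P where "P i = (if i = 0 then P0 else if i = 1 then P1 else P2)" for i :: nat
  have "(\<forall>i\<le>2. primeideal (P i) R) \<and> (\<forall>i<2. P i \<subset> P (Suc i))"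
    using assms \<open>P1 \<subset> P2\<close> by (auto simp: P_def less_Suc_eq numeral_2_eq_2)
  then have "enat 2 \<in> {enat n | n. \<exists>P :: nat \<Rightarrow> _. (\<forall>i\<le>n. primeideal (P i) R) \<and> (\<forall>i<n. P i \<subset> P (Suc i))}"
    by blast
  then have "enat 2 \<le> krull_dim R" unfolding krull_dim_def by (rule Sup_upper)
  then show False using assms(1) by (simp add: one_enat_def)
qed

text \<open>\<open>?S\<close> is the multiplicative set generated by \<open>y\<close> and the
  complement of \<open>P\<close>. A prime disjoint from it is contained in \<open>P\<close> and
  misses \<open>y \<in> P\<close>. Read backwards, this says that a minimal prime becomes a nil
  ideal after localization.\<close>

lemma (in cring) prime_below:
  assumes P: "primeideal P R" and y: "y \<in> P"
    and nz: "\<And>s n. s \<in> carrier R \<Longrightarrow> s \<notin> P \<Longrightarrow> s \<otimes> y [^] (n::nat) \<noteq> \<zero>"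
  obtains P0 where "primeideal P0 R" "P0 \<subset> P"
proof -
  note iP = primeideal.axioms(1)[OF P]
  have cy: "y \<in> carrier R" by (rule ideal.Icarr[OF iP y])
  let ?S = "{s \<otimes> y [^] (n::nat) | s n. s \<in> carrier R \<and> s \<notin> P}"
  have oneP: "\<one> \<notin> P" using ideal.one_imp_carrier[OF iP] primeideal.I_notcarr[OF P] by blast
  have Z: "{\<zero>} \<inter> ?S = {}"
    using nz by fastforce
  have S1: "?S \<subseteq> carrier R" using cy by auto
  have S2: "?S \<noteq> {}" using oneP by blast
  have S3: "u \<otimes> v \<in> ?S" if uv: "u \<in> ?S" "v \<in> ?S" for u v
  proof -
    obtain s n t k where *: "s \<in> carrier R" "s \<notin> P" "u = s \<otimes> y [^] (n::nat)"
        "t \<in> carrier R" "t \<notin> P" "v = t \<otimes> y [^] (k::nat)" using uv by auto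
    have "u \<otimes> v = (s \<otimes> t) \<otimes> y [^] (n + k)" using * cy by (simp add: nat_pow_mult[symmetric] m_ac)
    moreover have "s \<otimes> t \<notin> P" using primeideal.I_prime[OF P *(1,4)] * by blast
    ultimately show ?thesis using *(1,4) by blast
  qed
  obtain P0 where P0: "primeideal P0 R" "{\<zero>} \<subseteq> P0" "P0 \<inter> ?S = {}"
    by (rule exists_prime_disjoint[OF zeroideal Z S1 S2 S3])
  have "P0 \<subseteq> P"
  proof
    fix x assume x: "x \<in> P0"
    have cx: "x \<in> carrier R" by (rule ideal.Icarr[OF primeideal.axioms(1)[OF P0(1)] x])
    show "x \<in> P"
    proof (rule ccontr)
      assume "x \<notin> P"
      then have "x \<otimes> y [^] (0::nat) \<in> ?S" using cx by blast
      then show False using x cx P0(3) by auto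
    qed
  qed
  moreover have "\<one> \<otimes> y [^] (1::nat) \<in> ?S" using oneP by blast
  then have "y \<notin> P0" using P0(3) cy by auto
  ultimately show ?thesis using that[OF P0(1)] y by blast
qed

lemma (in cring) prime_below_regular:
  assumes P: "primeideal P R" and y: "y \<in> P"
    and reg: "\<And>x. x \<in> carrier R \<Longrightarrow> y \<otimes> x = \<zero> \<Longrightarrow> x = \<zero>"
  obtains P0 where "primeideal P0 R" "P0 \<subset> P"
proof (rule prime_below[OF P y])
  note iP = primeideal.axioms(1)[OF P]
  have cy: "y \<in> carrier R" by (rule ideal.Icarr[OF iP y])
  have ypow: "x = \<zero>" if "x \<in> carrier R" "x \<otimes> y [^] (n::nat) = \<zero>" for x n
    using that
  proof (induct n)
    case (Suc n)
    have "y \<otimes> (x \<otimes> y [^] n) = \<zero>" using Suc(2,3) cy by (simp add: m_ac)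
    then have "x \<otimes> y [^] n = \<zero>" by (rule reg[rotated]) (use Suc(2) cy in simp)
    then show ?case using Suc by blast
  qed simp
  fix s and n :: nat assume s: "s \<in> carrier R" "s \<notin> P"
  show "s \<otimes> y [^] n \<noteq> \<zero>"
    using ypow[OF s(1), of n] s(2) additive_subgroup.zero_closed[OF ideal.axioms(1)[OF iP]] by blast
qed (rule that)

lemma (in cring) PIdl_eq_scaled: "PIdl y = scaled (ring_module R) y (carrier R)" if "y \<in> carrier R"
  using that by (auto simp: cgenideal_def scaled_def m_comm)

locale cm1_ring = local_ring +
  assumes cm: "cohen_macaulay_local R \<mm>" and dim: "krull_dim R = 1"
begin

text \<open>If no power of some \<open>a \<in> \<mm>\<close> lay in \<open>(y)\<close>, a prime over
  \<open>(y)\<close> without \<open>a\<close> would lie strictly below \<open>\<mm>\<close>. It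
  contains the regular element \<open>y\<close>, so a further prime lies strictly below it, contrary
  to dimension one.\<close>

lemma exists_parameter:
  obtains y k where "y \<in> \<mm>" "\<And>x. x \<in> carrier R \<Longrightarrow> y \<otimes> x = \<zero> \<Longrightarrow> x = \<zero>"
    "ideal_pow R \<mm> k \<subseteq> PIdl y"
proof -
  interpret M: local_module R "ring_module R" \<mm> by (rule local_module_ring)
  have "depth R \<mm> (ring_module R) = 1" using cm dim by (simp add: cohen_macaulay_local_def)
  from M.depth_eq_1_regular(1)[OF this] obtain y where y: "y \<in> \<mm>"
    and reg: "\<And>x. x \<in> carrier R \<Longrightarrow> y \<otimes> x = \<zero> \<Longrightarrow> x = \<zero>" by auto
  have cy: "y \<in> carrier R" using y m_carrier by blast
  note iy = cgenideal_ideal[OF cy]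
  have nil: "\<exists>N::nat. a [^] N \<in> PIdl y" if a: "a \<in> \<mm>" for a
  proof (rule ccontr)
    assume "\<not> (\<exists>N::nat. a [^] N \<in> PIdl y)"
    then have disj: "PIdl y \<inter> range (\<lambda>n::nat. a [^] n) = {}" by auto
    have ca: "a \<in> carrier R" using a m_carrier by blast
    have mult: "u \<otimes> v \<in> range (\<lambda>n::nat. a [^] n)"
      if "u \<in> range (\<lambda>n::nat. a [^] n)" "v \<in> range (\<lambda>n::nat. a [^] n)" for u v
      using that ca by (auto simp: nat_pow_mult)
    have "range (\<lambda>n::nat. a [^] n) \<subseteq> carrier R" using ca by auto
    then obtain P where P: "primeideal P R" "PIdl y \<subseteq> P" "P \<inter> range (\<lambda>n::nat. a [^] n) = {}"
      using exists_prime_disjoint[OF iy disj _ _ mult] by blast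
    have yP: "y \<in> P" using P(2) cgenideal_self[OF cy] by blast
    obtain P0 where P0: "primeideal P0 R" "P0 \<subset> P" using prime_below_regular[OF P(1) yP reg] .
    have "P \<subseteq> \<mm>"
      by (rule ideal_subset_m[OF primeideal.axioms(1)[OF P(1)]]) (use primeideal.I_notcarr[OF P(1)] in auto)
    moreover have "a [^] (1::nat) \<notin> P" using P(3) by blast
    then have "a \<notin> P" using ca by simp
    ultimately have "P \<subset> \<mm>" using a by blast
    then show False using krull_dim_1_chain[OF dim P0(1) P(1) maximalideal_prime[OF maximal_m] P0(2)] by blast
  qed
  obtain T where T: "T \<subseteq> carrier R" "finite T" "\<mm> = Idl T" using finitely_gen[OF ideal_m] by blast
  have "\<exists>M. \<forall>n\<ge>M. ideal_pow R (Idl T) n \<subseteq> PIdl y"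
    using nil genideal_self[OF T(1)] T(1,3) ideal.I_l_closed[OF iy]
    by (intro ideal_pow_in_graded T(1,2) iy) auto
  then show ?thesis using that[OF y reg] T(3) by blast
qed

end

subsection \<open>A substitute for minimal reductions over finite residue fields\<close>

text \<open>The submodules generated over \<open>K\<close> by the initial segments of
  \<open>x\<close> cannot increase strictly \<open>n + 1\<close> times.\<close>

lemma (in plain_module) length_dependent:
  assumes K: "submodule K R M" and A: "submodule A R M" and KA: "K \<subseteq> A"
    and x: "\<And>i. i \<le> n \<Longrightarrow> x i \<in> A" and le: "sub_length R M K A \<le> enat n"
  obtains j where "j \<le> n" "x j \<in> gen_submodule R M (K \<union> x ` {..<j})"
proof -
  define B where "B j = gen_submodule R M (K \<union> x ` {..<j})" for j :: nat
  have sub: "K \<union> x ` {..<j} \<subseteq> A" if "j \<le> Suc n" for j using KA x that by auto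
  have car: "K \<union> x ` {..<j} \<subseteq> carrier M" if "j \<le> Suc n" for j
    using sub[OF that] submoduleE(1)[OF A] by blast
  have B: "submodule (B j) R M" if "j \<le> Suc n" for j
    unfolding B_def by (rule submodule_gen[OF car[OF that]])
  have "\<exists>j\<le>n. x j \<in> B j"
  proof (rule ccontr)
    assume no: "\<not> (\<exists>j\<le>n. x j \<in> B j)"
    have "B j \<subset> B (Suc j)" if j: "j < Suc n" for j
    proof -
      have "B j \<subseteq> B (Suc j)" unfolding B_def by (rule gen_submodule_mono) auto
      moreover have "x j \<in> B (Suc j)"
        unfolding B_def by (rule subsetD[OF gen_submodule_superset]) simp
      moreover have "x j \<notin> B j" using no j by auto
      ultimately show ?thesis by blast
    qed
    moreover have "K \<subseteq> B j" for j
      unfolding B_def using gen_submodule_superset[of "K \<union> x ` {..<j}"] by blast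
    moreover have "B j \<subseteq> A" if "j \<le> Suc n" for j
      unfolding B_def by (rule gen_submodule_least[OF A sub[OF that]])
    ultimately have "(\<forall>i\<le>Suc n. B i \<in> {N. submodule N R M \<and> K \<subseteq> N \<and> N \<subseteq> A}) \<and> (\<forall>i<Suc n. B i < B (Suc i))"
      using B by simp
    then have "\<exists>N. (\<forall>i\<le>Suc n. N i \<in> {N. submodule N R M \<and> K \<subseteq> N \<and> N \<subseteq> A}) \<and> (\<forall>i<Suc n. N i < N (Suc i))"
      by (rule exI[of _ B])
    moreover have "{N. submodule N R M \<and> K \<subseteq> N \<and> N \<subseteq> A} \<noteq> {}" using K KA by blast
    ultimately have "enat (Suc n) \<le> sub_length R M K A"
      unfolding sub_length_def by (simp add: enat_le_chain_length_iff)
    then have "enat (Suc n) \<le> enat n" using le by (rule order_trans)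
    then show False by simp
  qed
  then show ?thesis using that unfolding B_def by blast
qed

context local_ring begin

abbreviation "P n \<equiv> ideal_pow R \<mm> n"

lemma ideal_P: "ideal (P n) R" by (rule ideal_ideal_pow[OF ideal_m])
lemma P_carrier: "x \<in> P n \<Longrightarrow> x \<in> carrier R" by (rule ideal.Icarr[OF ideal_P])
lemma P_anti: "x \<in> P n \<Longrightarrow> k \<le> n \<Longrightarrow> x \<in> P k" using ideal_pow_anti[OF ideal_m] by blast
lemma P_mult: "x \<in> P i \<Longrightarrow> y \<in> P j \<Longrightarrow> x \<otimes> y \<in> P (i + j)" by (rule ideal_pow_mult[OF ideal_m])
lemma P_pow: "x \<in> P i \<Longrightarrow> x [^] (n::nat) \<in> P (n * i)" by (rule ideal_pow_pow[OF ideal_m])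
lemma P_zero: "\<zero> \<in> P n" by (rule additive_subgroup.zero_closed[OF ideal.axioms(1)[OF ideal_P]])
lemma P_add: "x \<in> P n \<Longrightarrow> y \<in> P n \<Longrightarrow> x \<oplus> y \<in> P n"
  by (rule additive_subgroup.a_closed[OF ideal.axioms(1)[OF ideal_P]])
lemma P_minus: "x \<in> P n \<Longrightarrow> \<ominus> x \<in> P n"
  by (rule additive_subgroup.a_inv_closed[OF ideal.axioms(1)[OF ideal_P]])
lemma P_diff: "x \<in> P n \<Longrightarrow> y \<in> P n \<Longrightarrow> x \<ominus> y \<in> P n"
  by (simp add: a_minus_def P_add P_minus)

text \<open>
  \<open>lead_ideal w t\<close> is the preimage in degree \<open>d\<close> of the ideal of the associated graded ring
  generated by the initial form of degree \<open>t\<close> of \<open>w\<close>. For \<open>d < t\<close> the truncated subtraction does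
  no harm, since then \<open>w \<in> \<mm>\<^sup>d\<^sup>+\<^sup>1\<close>.
\<close>

definition lead_ideal :: "'r \<Rightarrow> nat \<Rightarrow> nat \<Rightarrow> 'r set" where
  "lead_ideal w t d = {w \<otimes> u \<oplus> v | u v. u \<in> P (d - t) \<and> v \<in> P (Suc d)}"

text \<open>For \<open>a \<in> P d\<close>: the initial form of \<open>a\<close> in degree
  \<open>d\<close> is nilpotent modulo that of \<open>w\<close> in degree \<open>t\<close>.\<close>

definition lead_nil :: "'r \<Rightarrow> nat \<Rightarrow> 'r \<Rightarrow> nat \<Rightarrow> bool" where
  "lead_nil w t a d \<longleftrightarrow> (\<exists>N::nat. a [^] N \<in> lead_ideal w t (N * d))"

context fixes w t assumes w: "w \<in> P t" begin

lemma ideal_lead_ideal: "ideal (lead_ideal w t d) R"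
proof -
  interpret M: local_module R "ring_module R" \<mm> by (rule local_module_ring)
  have "lead_ideal w t d = scaled (ring_module R) w (P (d - t)) <+>\<^bsub>ring_module R\<^esub> P (Suc d)"
    unfolding lead_ideal_def scaled_def set_add_def' by auto
  moreover have "submodule \<dots> R (ring_module R)"
    by (intro M.submodule_set_add M.submodule_scaled) (simp_all add: submodule_ring_module_iff ideal_P P_carrier[OF w])
  ultimately show ?thesis by (simp add: submodule_ring_module_iff)
qed

lemma lead_ideal_mult:
  assumes c: "c \<in> P e" and x: "x \<in> lead_ideal w t d"
  shows "c \<otimes> x \<in> lead_ideal w t (e + d)"
proof -
  obtain u v where uv: "u \<in> P (d - t)" "v \<in> P (Suc d)" "x = w \<otimes> u \<oplus> v" using x unfolding lead_ideal_def by blast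
  have "c \<otimes> x = w \<otimes> (c \<otimes> u) \<oplus> c \<otimes> v"
    unfolding uv(3) using P_carrier[OF w] P_carrier[OF c] P_carrier[OF uv(1)] P_carrier[OF uv(2)]
    by (simp add: r_distr m_ac)
  \<comment> \<open>Truncated subtraction is harmless here:
    \<open>e + d - t \<le> e + (d - t)\<close>.\<close>
  moreover have "c \<otimes> u \<in> P (e + d - t)" by (rule P_anti[OF P_mult[OF c uv(1)]]) simp
  moreover have "c \<otimes> v \<in> P (Suc (e + d))" using P_mult[OF c uv(2)] by simp
  ultimately show ?thesis unfolding lead_ideal_def by blast
qed

lemma lead_idealI1: "v \<in> P (Suc d) \<Longrightarrow> v \<in> lead_ideal w t d"
proof -
  assume v: "v \<in> P (Suc d)"
  have "v = w \<otimes> \<zero> \<oplus> v" using P_carrier[OF w] P_carrier[OF v] by simp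
  then show ?thesis unfolding lead_ideal_def using P_zero v by blast
qed

lemma lead_idealI2: "u \<in> P d \<Longrightarrow> w \<otimes> u \<in> lead_ideal w t (t + d)"
proof -
  assume u: "u \<in> P d"
  have "w \<otimes> u = w \<otimes> u \<oplus> \<zero>" using P_carrier[OF w] P_carrier[OF u] by simp
  moreover have "u \<in> P (t + d - t)" using u by simp
  ultimately show ?thesis unfolding lead_ideal_def using P_zero by blast
qed

text \<open>Sums of nilpotents are nilpotent: \<open>ideal_pow_in_graded\<close> for the two
  generators \<open>x, y\<close> of degree \<open>d\<close>, with the family
  \<open>lead_ideal w t (k * d)\<close> indexed by \<open>k\<close>.\<close>

lemma lead_nil_add:
  assumes x: "x \<in> P d" "lead_nil w t x d" and y: "y \<in> P d" "lead_nil w t y d"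
  shows "lead_nil w t (x \<oplus> y) d"
proof -
  have T: "{x, y} \<subseteq> carrier R" using P_carrier x y by blast
  have "\<exists>M. \<forall>n\<ge>M. ideal_pow R (Idl {x, y}) n \<subseteq> lead_ideal w t (n * d)"
  proof (rule ideal_pow_in_graded)
    fix c k u assume "c \<in> {x, y}" "u \<in> lead_ideal w t (k * d)"
    then show "c \<otimes> u \<in> lead_ideal w t (Suc k * d)" using lead_ideal_mult[of c d u "k * d"] x y by auto
  next
    fix c assume "c \<in> {x, y}"
    then show "\<exists>N::nat. c [^] N \<in> lead_ideal w t (N * d)" using x y unfolding lead_nil_def by auto
  qed (use T ideal_lead_ideal in simp_all)
  then obtain M where M: "ideal_pow R (Idl {x, y}) M \<subseteq> lead_ideal w t (M * d)" by blast
  have I: "ideal (Idl {x, y}) R" by (rule genideal_ideal[OF T])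
  have "x \<in> Idl {x, y}" "y \<in> Idl {x, y}" using genideal_self[OF T] by auto
  then have "x \<oplus> y \<in> ideal_pow R (Idl {x, y}) 1"
    using additive_subgroup.a_closed[OF ideal.axioms(1)[OF I]] by (simp add: ideal_pow_1[OF I])
  from ideal_pow_pow[OF I this, of M] show ?thesis using M unfolding lead_nil_def by auto
qed

lemma lead_nil_P: "v \<in> P (Suc d) \<Longrightarrow> lead_nil w t v d"
  unfolding lead_nil_def by (intro exI[of _ 1]) (simp add: lead_idealI1 P_carrier)

lemma lead_nil_mult:
  assumes x: "x \<in> P d" "lead_nil w t x d" and u: "u \<in> P e"
  shows "lead_nil w t (x \<otimes> u) (d + e)"
proof -
  obtain N :: nat where N: "x [^] N \<in> lead_ideal w t (N * d)" using x unfolding lead_nil_def by blast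
  have "(x \<otimes> u) [^] N = u [^] N \<otimes> x [^] N"
    using P_carrier[OF x(1)] P_carrier[OF u] by (simp add: nat_pow_distrib m_comm)
  also have "\<dots> \<in> lead_ideal w t (N * e + N * d)" by (rule lead_ideal_mult[OF P_pow[OF u] N])
  finally show ?thesis unfolding lead_nil_def by (intro exI[of _ N]) (simp add: algebra_simps)
qed

lemma lead_nil_of_pow:
  assumes "lead_nil w t (c [^] (N::nat)) (N * d)" and "c \<in> P d"
  shows "lead_nil w t c d"
proof -
  obtain L :: nat where "(c [^] N) [^] L \<in> lead_ideal w t (L * (N * d))" using assms unfolding lead_nil_def by blast
  then have "c [^] (N * L) \<in> lead_ideal w t (N * L * d)"
    using P_carrier[OF assms(2)] by (simp add: nat_pow_pow mult_ac)
  then show ?thesis unfolding lead_nil_def by blast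
qed

end

lemma lead_nil_trans:
  assumes w: "w \<in> P t" and w': "w' \<in> P t'" and c: "c \<in> P d" and d: "0 < d"
    and cw: "lead_nil w t c d" and ww': "lead_nil w' t' w t"
  shows "lead_nil w' t' c d"
proof -
  obtain N :: nat where N: "c [^] N \<in> lead_ideal w t (N * d)" using cw unfolding lead_nil_def by blast
  \<comment> \<open>The extra factor \<open>c^t\<close> lifts the degree to at least
    \<open>t\<close>. There the subtraction in \<open>lead_ideal\<close> is exact, so
    \<open>w u\<close> lies in the same power of \<open>\<mm>\<close> as the left-hand side.\<close>
  have "c [^] t \<otimes> c [^] N \<in> lead_ideal w t (t * d + N * d)" by (rule lead_ideal_mult[OF w P_pow[OF c] N])
  then have "c [^] (t + N) \<in> lead_ideal w t ((t + N) * d)"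
    using P_carrier[OF c] by (simp add: nat_pow_mult algebra_simps)
  then obtain u v where uv: "u \<in> P ((t + N) * d - t)" "v \<in> P (Suc ((t + N) * d))" "c [^] (t + N) = w \<otimes> u \<oplus> v"
    unfolding lead_ideal_def by blast
  have td: "t \<le> (t + N) * d" using d by (simp add: trans_le_add1 add_mult_distrib)
  have "lead_nil w' t' (w \<otimes> u) ((t + N) * d)" using lead_nil_mult[OF w' w ww' uv(1)] td by simp
  moreover have "lead_nil w' t' v ((t + N) * d)" by (rule lead_nil_P[OF w' uv(2)])
  moreover have "w \<otimes> u \<in> P ((t + N) * d)" using P_mult[OF w uv(1)] td by simp
  moreover have "v \<in> P ((t + N) * d)" by (rule P_anti[OF uv(2)]) simp
  ultimately have "lead_nil w' t' (c [^] (t + N)) ((t + N) * d)"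
    unfolding uv(3) by (intro lead_nil_add[OF w'])
  then show ?thesis by (rule lead_nil_of_pow[OF w' _ c])
qed

text \<open>
  If the initial forms of \<open>z\<close> and \<open>b\<close> satisfy \<open>z\<^sup>n\<^sup>-\<^sup>jq = 0\<close> with \<open>q = b\<^sup>j - zg\<close>, then both are
  nilpotent modulo the initial form of \<open>z\<^sup>j\<^sup>n + q\<^sup>n\<close>.
\<close>

lemma exists_common_lead:
  assumes z: "z \<in> P t" and b: "b \<in> P t" and t: "0 < t"
    and bound: "\<And>d. sub_length R (ring_module R) (P (Suc d)) (P d) \<le> enat n"
  obtains w r where "0 < r" "w \<in> P r" "lead_nil w r z t" "lead_nil w r b t"
proof -
  interpret M: local_module R "ring_module R" \<mm> by (rule local_module_ring)
  have subm: "submodule (P d) R (ring_module R)" for d by (simp add: submodule_ring_module_iff ideal_P)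
  have cz: "z \<in> carrier R" and cb: "b \<in> carrier R" using z b P_carrier by blast+
  \<comment> \<open>The \<open>n + 1\<close> monomials of degree \<open>n\<close> in
    \<open>z\<close> and \<open>b\<close> lie in \<open>P (n * t)\<close>, whose quotient by the
    next power has length at most \<open>n\<close>. One of them depends on its predecessors.\<close>
  let ?x = "\<lambda>i. z [^] (n - i) \<otimes> b [^] i"
  have x: "?x i \<in> P (n * t)" if "i \<le> n" for i
  proof -
    have "?x i \<in> P ((n - i) * t + i * t)" by (rule P_mult[OF P_pow[OF z] P_pow[OF b]])
    moreover have "(n - i) * t + i * t = n * t" using that by (simp add: add_mult_distrib[symmetric])
    ultimately show ?thesis by simp
  qed
  obtain j where j: "j \<le> n" and dep: "?x j \<in> gen_submodule R (ring_module R) (P (Suc (n * t)) \<union> ?x ` {..<j})"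
    by (rule M.length_dependent[OF subm subm _ x bound]) (use P_anti in auto)
  show ?thesis
  proof (cases "j = 0")
    case True
    \<comment> \<open>The initial form of \<open>z\<close> is nilpotent, hence nilpotent modulo
      anything, and \<open>w = b\<close> serves.\<close>
    then have "z [^] n \<in> P (Suc (n * t))" using dep M.gen_submodule_eq[OF subm] cz by simp
    then have "lead_nil b t z t" unfolding lead_nil_def using lead_idealI1[OF b] by blast
    moreover have "b \<otimes> \<one> \<in> lead_ideal b t (t + 0)" by (rule lead_idealI2[OF b]) (simp add: ideal_pow_0)
    then have "lead_nil b t b t" unfolding lead_nil_def using cb by (intro exI[of _ 1]) simp
    ultimately show ?thesis using that[OF t b] by blast
  next
    case False
    then have j0: "0 < j" by simp
    then have n0: "0 < n" using j by simp
    \<comment> \<open>All monomials before the \<open>j\<close>-th are divisible by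
      \<open>z^(n-j+1)\<close>. The dependence therefore reads
      \<open>z^(n-j) b^j = z^(n-j+1) g\<close> modulo the next power, with \<open>g\<close> of
      degree \<open>(j-1)t\<close>.\<close>
    let ?N = "P (Suc (n * t)) <+>\<^bsub>ring_module R\<^esub> scaled (ring_module R) (z [^] (n - j) \<otimes> z) (P ((j - 1) * t))"
    have zz: "z [^] (n - j) \<otimes> z \<in> carrier R" using cz by simp
    note sc = M.submodule_scaled[OF subm zz]
    have N: "submodule ?N R (ring_module R)" by (rule M.submodule_set_add[OF subm sc])
    have xN: "?x i \<in> ?N" if i: "i < j" for i
    proof -
      have "z [^] (j - 1 - i) \<otimes> b [^] i \<in> P ((j - 1 - i) * t + i * t)" by (rule P_mult[OF P_pow[OF z] P_pow[OF b]])
      moreover have "(j - 1 - i) * t + i * t = (j - 1) * t" using i by (simp add: add_mult_distrib[symmetric])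
      ultimately have "z [^] (j - 1 - i) \<otimes> b [^] i \<in> P ((j - 1) * t)" by simp
      moreover have "?x i = (z [^] (n - j) \<otimes> z) \<otimes> (z [^] (j - 1 - i) \<otimes> b [^] i)"
      proof -
        have e: "n - i = Suc ((n - j) + (j - 1 - i))" using i j by simp
        show ?thesis unfolding e using cz cb by (simp add: nat_pow_mult[symmetric] m_ac)
      qed
      ultimately have "?x i \<in> scaled (ring_module R) (z [^] (n - j) \<otimes> z) (P ((j - 1) * t))"
        unfolding scaled_def by simp
      then show ?thesis using M.set_add_upper2[OF subm sc] by blast
    qed
    have "P (Suc (n * t)) \<union> ?x ` {..<j} \<subseteq> ?N" using M.set_add_upper1[OF subm sc] xN by blast
    then have "?x j \<in> ?N" using dep M.gen_submodule_least[OF N] by blast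
    then obtain k g where kg: "k \<in> P (Suc (n * t))" "g \<in> P ((j - 1) * t)"
        "?x j = k \<oplus> (z [^] (n - j) \<otimes> z) \<otimes> g"
      unfolding set_add_def' scaled_def by auto
    have ck: "k \<in> carrier R" "g \<in> carrier R" using kg P_carrier by blast+
    have jt: "t + (j - 1) * t = j * t" using j0 by (cases j) auto
    have zg: "z \<otimes> g \<in> P (j * t)" using P_mult[OF z kg(2)] jt by simp
    define q where "q = b [^] j \<ominus> z \<otimes> g"
    have q: "q \<in> P (j * t)" unfolding q_def by (rule P_diff[OF P_pow[OF b] zg])
    have cq: "q \<in> carrier R" by (rule P_carrier[OF q])
    have "z [^] (n - j) \<otimes> q = ?x j \<oplus> \<ominus> ((z [^] (n - j) \<otimes> z) \<otimes> g)"
      unfolding q_def using cz cb ck by (simp add: a_minus_def r_distr r_minus m_assoc)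
    also have "\<dots> = k" unfolding kg(3) using cz ck by (simp add: a_assoc r_neg)
    finally have zq: "z [^] (n - j) \<otimes> q \<in> P (Suc (n * t))" using kg(1) by simp
    \<comment> \<open>The exponents bring both summands to degree \<open>r\<close>, as
      \<open>z\<close> has degree \<open>t\<close> and \<open>q\<close> has degree
      \<open>j t\<close>. Since \<open>z^(jn) q\<close> vanishes in the graded ring,
      \<open>z^(2jn)\<close> and \<open>q^(n+1)\<close> are multiples of \<open>w\<close> there, and
      \<open>b^j = q + zg\<close> takes care of \<open>b\<close>.\<close>
    define w where "w = z [^] (j * n) \<oplus> q [^] n"
    define r where "r = j * n * t"
    have zr: "z [^] (j * n) \<in> P r" using P_pow[OF z] by (simp add: r_def)
    have qr: "q [^] n \<in> P r" using P_pow[OF q, of n] by (simp add: r_def mult_ac)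
    have w: "w \<in> P r" unfolding w_def by (rule P_add[OF zr qr])
    have r0: "0 < r" using j0 n0 t by (simp add: r_def)
    have nj: "n - j \<le> j * n" using j0 by (cases j) auto
    have zqn: "z [^] (j * n) \<otimes> q \<in> P (Suc (r + j * t))"
    proof -
      have "z [^] (j * n) \<otimes> q = z [^] (j * n - (n - j)) \<otimes> (z [^] (n - j) \<otimes> q)"
        using cz cq nj by (simp add: m_assoc[symmetric] nat_pow_mult)
      also have "\<dots> \<in> P ((j * n - (n - j)) * t + Suc (n * t))" by (rule P_mult[OF P_pow[OF z] zq])
      finally have "z [^] (j * n) \<otimes> q \<in> P ((j * n - (n - j)) * t + Suc (n * t))" .
      moreover have "(j * n - (n - j)) * t + n * t = r + j * t"
      proof -
        have "j * n - (n - j) + n = j * n + j" using nj j by simp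
        then show ?thesis unfolding r_def by (metis add_mult_distrib)
      qed
      ultimately show ?thesis by simp
    qed
    have zqq: "z [^] (j * n) \<otimes> q [^] n \<in> P (Suc (r + r))"
    proof -
      obtain n' where n': "n = Suc n'" using n0 by (cases n) auto
      have "z [^] (j * n) \<otimes> q [^] n = (z [^] (j * n) \<otimes> q) \<otimes> q [^] n'"
        using cz cq by (simp add: n' m_ac)
      also have "\<dots> \<in> P (Suc (r + j * t) + n' * (j * t))" by (rule P_mult[OF zqn P_pow[OF q]])
      finally show ?thesis by (simp add: r_def n' algebra_simps)
    qed
    have "lead_nil w r z t"
    proof -
      have "z [^] (j * n + j * n) = w \<otimes> z [^] (j * n) \<oplus> \<ominus> (z [^] (j * n) \<otimes> q [^] n)"
      proof -
        have "w \<otimes> z [^] (j * n) = z [^] (j * n + j * n) \<oplus> z [^] (j * n) \<otimes> q [^] n"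
          unfolding w_def using cz cq by (simp add: l_distr nat_pow_mult m_comm[of "q [^] n"])
        then show ?thesis using cz cq by (simp add: a_assoc r_neg)
      qed
      also have "\<dots> \<in> lead_ideal w r (r + r)"
        by (intro additive_subgroup.a_closed[OF ideal.axioms(1)[OF ideal_lead_ideal[OF w]]]
            lead_idealI2[OF w zr] lead_idealI1[OF w] P_minus zqq)
      finally show ?thesis unfolding lead_nil_def
        by (intro exI[of _ "j * n + j * n"]) (simp add: r_def algebra_simps)
    qed
    moreover have qnil: "lead_nil w r q (j * t)"
    proof -
      have "q [^] Suc n = w \<otimes> q \<oplus> \<ominus> (z [^] (j * n) \<otimes> q)"
      proof -
        have "w \<otimes> q = q [^] Suc n \<oplus> z [^] (j * n) \<otimes> q"
          unfolding w_def using cz cq by (simp add: l_distr a_comm)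
        then show ?thesis using cz cq by (simp add: a_assoc r_neg)
      qed
      also have "\<dots> \<in> lead_ideal w r (r + j * t)"
        by (intro additive_subgroup.a_closed[OF ideal.axioms(1)[OF ideal_lead_ideal[OF w]]]
            lead_idealI2[OF w q] lead_idealI1[OF w] P_minus zqn)
      finally show ?thesis unfolding lead_nil_def
        by (intro exI[of _ "Suc n"]) (simp add: r_def algebra_simps)
    qed
    moreover have "lead_nil w r b t"
    proof -
      have "lead_nil w r (z \<otimes> g) (j * t)" using lead_nil_mult[OF w z calculation(1) kg(2)] jt by simp
      then have "lead_nil w r (q \<oplus> z \<otimes> g) (j * t)" by (rule lead_nil_add[OF w q qnil zg])
      moreover have "q \<oplus> z \<otimes> g = b [^] j" unfolding q_def using cz cb ck by (simp add: a_minus_def a_assoc l_neg)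
      ultimately show ?thesis using lead_nil_of_pow[OF w _ b] by simp
    qed
    ultimately show ?thesis using that[OF r0 w] by blast
  qed
qed

end

section \<open>The bounded Hilbert function and the element \<open>z\<close>\<close>

context cm1_ring begin

text \<open>Computing the length of \<open>R/y\<mm>^d\<close> through \<open>\<mm>^d\<close> and
  through \<open>yR\<close> gives \<open>\<ell>(\<mm>^d/y\<mm>^d) = \<ell>(R/yR)\<close>, because
  \<open>R/\<mm>^d\<close> and \<open>yR/y\<mm>^d\<close> have equal finite length. Moreover
  \<open>y\<mm>^d \<subseteq> \<mm>^(d+1)\<close>. The bound is the length of
  \<open>R/\<mm>^k\<close>.\<close>

lemma gr_length_bounded: "\<exists>n. \<forall>d. sub_length R (ring_module R) (P (Suc d)) (P d) \<le> enat n"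
proof -
  interpret M: local_module R "ring_module R" \<mm> by (rule local_module_ring)
  let ?l = "sub_length R (ring_module R)"
  obtain y k where y: "y \<in> \<mm>" and reg: "\<And>x. x \<in> carrier R \<Longrightarrow> y \<otimes> x = \<zero> \<Longrightarrow> x = \<zero>"
    and k: "P k \<subseteq> PIdl y" using exists_parameter by blast
  have cy: "y \<in> carrier R" using y m_carrier by blast
  have subm: "submodule (P d) R (ring_module R)" for d by (simp add: submodule_ring_module_iff ideal_P)
  have cR: "submodule (carrier R) R (ring_module R)" using M.carrier_is_submodule by simp
  have fg: "fg_sub R (ring_module R) (carrier R)"
  proof -
    have "gen_submodule R (ring_module R) {\<one>} = carrier R"
    proof
      have G: "submodule (gen_submodule R (ring_module R) {\<one>}) R (ring_module R)" by (rule M.submodule_gen) simp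
      show "gen_submodule R (ring_module R) {\<one>} \<subseteq> carrier R" using M.submoduleE(1)[OF G] by simp
      have "\<one> \<in> gen_submodule R (ring_module R) {\<one>}" using M.gen_submodule_superset[of "{\<one>}"] by simp
      then show "carrier R \<subseteq> gen_submodule R (ring_module R) {\<one>}" using M.submoduleE(4)[OF G, of _ \<one>] by auto
    qed
    then show ?thesis unfolding fg_sub_def by (intro exI[of _ "{\<one>}"]) simp
  qed
  have smulP: "ideal_smul R (ring_module R) \<mm> (P d) = P (Suc d)" for d
    by (simp add: ideal_smul_ring_module ideal_m ideal_P ideal_pow_Suc)
  have fgP: "fg_sub R (ring_module R) (P d)" for d
    by (induct d) (simp_all add: ideal_pow_0 fg smulP[symmetric] M.fg_sub_smul ideal_m)
  have PS: "P (Suc d) \<subseteq> P d" for d by (rule ideal_pow_anti[OF ideal_m]) simp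
  have fin: "?l (P d) (carrier R) \<noteq> \<infinity>" for d
  proof (induct d)
    case 0 then show ?case using M.sub_length_self[OF cR] by (simp add: ideal_pow_0)
  next
    case (Suc d)
    have "?l (P (Suc d)) (carrier R) = ?l (P (Suc d)) (P d) + ?l (P d) (carrier R)"
      by (rule M.sub_length_add[OF subm subm cR PS ideal_subset[OF ideal_P]])
    then show ?case using M.sub_length_fg_finite[OF fgP[of d]] Suc smulP by auto
  qed
  let ?y = "scaled (ring_module R) y"
  have sy: "submodule (?y (P d)) R (ring_module R)" "submodule (?y (carrier R)) R (ring_module R)" for d
    by (rule M.submodule_scaled[OF subm cy] M.submodule_scaled[OF cR cy])+
  have inj: "inj_on (\<lambda>x. y \<odot>\<^bsub>ring_module R\<^esub> x) (carrier (ring_module R))"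
  proof (rule inj_onI)
    fix u v assume uv: "u \<in> carrier (ring_module R)" "v \<in> carrier (ring_module R)"
      "y \<odot>\<^bsub>ring_module R\<^esub> u = y \<odot>\<^bsub>ring_module R\<^esub> v"
    have "y \<otimes> (u \<ominus> v) = y \<otimes> u \<ominus> y \<otimes> v" using uv(1,2) cy by (simp add: a_minus_def r_distr r_minus)
    also have "\<dots> = \<zero>" using uv cy by (simp add: a_minus_def r_neg)
    finally have "u \<ominus> v = \<zero>" by (rule reg[rotated]) (use uv in simp)
    then show "u = v" using uv(1,2) by simp
  qed
  obtain n where n: "?l (P k) (carrier R) = enat n" using fin[of k] by auto
  have yR: "?y (carrier R) = PIdl y" using PIdl_eq_scaled[OF cy] by simp
  have "?l (P (Suc d)) (P d) \<le> enat n" for d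
  proof -
    have c: "?l (?y (P d)) (?y (carrier R)) = ?l (P d) (carrier R)"
      by (rule M.sub_length_scaled_inj[OF cR subm ideal_subset[OF ideal_P] cy inj])
    have yP: "?y (P d) \<subseteq> P (Suc d)" using y unfolding scaled_def ideal_pow_Suc[OF ideal_m] by (auto intro: ideal_prod.prod)
    have yP': "?y (P d) \<subseteq> P d" using yP PS by blast
    have "?l (?y (P d)) (carrier R) = ?l (?y (P d)) (P d) + ?l (P d) (carrier R)"
      by (rule M.sub_length_add[OF sy(1) subm cR yP' ideal_subset[OF ideal_P]])
    moreover have "?l (?y (P d)) (carrier R) = ?l (?y (P d)) (?y (carrier R)) + ?l (?y (carrier R)) (carrier R)"
      by (rule M.sub_length_add[OF sy cR scaled_mono[OF ideal_subset[OF ideal_P]]])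
        (use M.submoduleE(1)[OF sy(2)] in simp)
    ultimately have "?l (?y (P d)) (P d) = ?l (?y (carrier R)) (carrier R)"
      using c fin[of d]
      by (cases "?l (?y (P d)) (P d)"; cases "?l (P d) (carrier R)"; cases "?l (?y (carrier R)) (carrier R)") auto
    also have "\<dots> \<le> ?l (P k) (carrier R)" unfolding yR by (rule M.sub_length_mono[OF k subset_refl])
    finally have "?l (?y (P d)) (P d) \<le> enat n" by (simp add: n)
    moreover have "?l (P (Suc d)) (P d) \<le> ?l (?y (P d)) (P d)" by (rule M.sub_length_mono[OF yP subset_refl])
    ultimately show ?thesis by simp
  qed
  then show ?thesis by blast
qed

text \<open>Running through generators of \<open>\<mm>\<close>, \<open>exists_common_lead\<close>
  merges the element found so far with the next generator. In the end the ideal of positive degree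
  elements is nilpotent modulo the initial form of \<open>z\<close>.\<close>

lemma exists_reduction:
  obtains s z n0 where "0 < s" "z \<in> P s" "\<And>n. n0 \<le> n \<Longrightarrow> scaled (ring_module R) z (P n) = P (n + s)"
proof -
  interpret M: local_module R "ring_module R" \<mm> by (rule local_module_ring)
  obtain n where bound: "\<And>d. sub_length R (ring_module R) (P (Suc d)) (P d) \<le> enat n"
    using gr_length_bounded by blast
  obtain T where T: "T \<subseteq> carrier R" "finite T" "\<mm> = Idl T" using finitely_gen[OF ideal_m] by blast
  have P1: "P 1 = \<mm>" by (simp add: ideal_pow_1[OF ideal_m])
  have Tm: "c \<in> P 1" if "c \<in> T" for c using genideal_self[OF T(1)] T(3) that P1 by blast
  have "\<exists>t w. 0 < t \<and> w \<in> P t \<and> (\<forall>c\<in>T'. lead_nil w t c 1)" if "T' \<subseteq> T" for T'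
    using finite_subset[OF that T(2)] that
  proof (induct T')
    \<comment> \<open>The zero element has any prescribed degree; the degree is taken positive
      because the final \<open>s\<close> must be.\<close>
    case empty show ?case using P_zero[of 1] by (intro exI[of _ 1] exI[of _ \<zero>]) simp
  next
    case (insert b T')
    then obtain t w where w: "0 < t" "w \<in> P t" "\<forall>c\<in>T'. lead_nil w t c 1" by blast
    have b: "b \<in> P 1" using insert Tm by blast
    \<comment> \<open>The power \<open>t\<close> gives the new generator the degree of
      \<open>w\<close>, as \<open>exists_common_lead\<close> requires.\<close>
    have bt: "b [^] t \<in> P t" using P_pow[OF b, of t] by simp
    obtain w' r where w': "0 < r" "w' \<in> P r" "lead_nil w' r w t" "lead_nil w' r (b [^] t) t"
      using exists_common_lead[OF w(2) bt w(1) bound] .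
    have "lead_nil w' r b 1" using lead_nil_of_pow[OF w'(2), of b t 1] w'(4) b by simp
    moreover have "lead_nil w' r c 1" if "c \<in> T'" for c
    proof -
      have "c \<in> P 1" using that insert Tm by blast
      then show ?thesis using w(3) that by (intro lead_nil_trans[OF w(2) w'(2) _ _ _ w'(3)]) simp_all
    qed
    ultimately show ?case using w'(1,2) by blast
  qed
  from this[OF subset_refl] obtain s z where sz: "0 < s" "z \<in> P s" "\<forall>c\<in>T. lead_nil z s c 1" by blast
  have "\<exists>N. \<forall>n\<ge>N. ideal_pow R (Idl T) n \<subseteq> lead_ideal z s n"
  proof (rule ideal_pow_in_graded[OF T(2,1) ideal_lead_ideal[OF sz(2)]])
    fix c d x assume "c \<in> T" "x \<in> lead_ideal z s d"
    then show "c \<otimes> x \<in> lead_ideal z s (Suc d)" using lead_ideal_mult[OF sz(2) Tm] by fastforce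
  next
    fix c assume "c \<in> T" then show "\<exists>N::nat. c [^] N \<in> lead_ideal z s N" using sz(3) unfolding lead_nil_def by auto
  qed
  then obtain N where N: "\<And>n. n \<ge> N \<Longrightarrow> P n \<subseteq> lead_ideal z s n" using T(3) by auto
  have subm: "submodule (P d) R (ring_module R)" for d by (simp add: submodule_ring_module_iff ideal_P)
  have cz: "z \<in> carrier R" by (rule P_carrier[OF sz(2)])
  have smulP: "ideal_smul R (ring_module R) \<mm> (P d) = P (Suc d)" for d
    by (simp add: ideal_smul_ring_module ideal_m ideal_P ideal_pow_Suc)
  have fgP: "fg_sub R (ring_module R) (P d)" for d
  proof -
    obtain S where S: "S \<subseteq> carrier R" "finite S" "P d = Idl S" using finitely_gen[OF ideal_P] by blast
    moreover have "gen_submodule R (ring_module R) S = Idl S"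
      unfolding gen_submodule_def genideal_def submodule_ring_module_iff ..
    ultimately show ?thesis unfolding fg_sub_def by auto
  qed
  have "scaled (ring_module R) z (P n) = P (n + s)" if n: "N \<le> n" for n
  proof -
    let ?B = "scaled (ring_module R) z (P n)"
    have B: "submodule ?B R (ring_module R)" by (rule M.submodule_scaled[OF subm cz])
    have BP: "?B \<subseteq> P (n + s)" using P_mult[OF _ sz(2)] cz P_carrier unfolding scaled_def by (auto simp: m_comm)
    \<comment> \<open>In degree \<open>n + s\<close> the lead ideal is
      \<open>z\<mm>^n + \<mm>^(n+s+1)\<close>. Nakayama's lemma removes the second term.\<close>
    have "P (n + s) \<subseteq> lead_ideal z s (n + s)" using N n by simp
    also have "\<dots> \<subseteq> ?B <+>\<^bsub>ring_module R\<^esub> P (Suc (n + s))"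
      unfolding lead_ideal_def scaled_def set_add_def' by auto
    finally have "P (n + s) \<subseteq> ?B <+>\<^bsub>ring_module R\<^esub> ideal_smul R (ring_module R) \<mm> (P (n + s))" by (simp add: smulP)
    then show ?thesis using M.nakayama[OF fgP B BP] by simp
  qed
  with sz(1,2) that show ?thesis by blast
qed

end

subsection \<open>Regular elements and depth\<close>

lemma lin_mapsD:
  assumes "f \<in> lin_maps R M N" "x \<in> carrier M"
  shows "f x \<in> carrier N"
    and "y \<in> carrier M \<Longrightarrow> f (x \<oplus>\<^bsub>M\<^esub> y) = f x \<oplus>\<^bsub>N\<^esub> f y"
    and "a \<in> carrier R \<Longrightarrow> f (a \<odot>\<^bsub>M\<^esub> x) = a \<odot>\<^bsub>N\<^esub> f x"
  using assms by (auto simp: lin_maps_def)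

lemma lin_mapsI:
  assumes "\<And>x. x \<in> carrier M \<Longrightarrow> f x \<in> carrier N"
    and "\<And>x y. x \<in> carrier M \<Longrightarrow> y \<in> carrier M \<Longrightarrow> f (x \<oplus>\<^bsub>M\<^esub> y) = f x \<oplus>\<^bsub>N\<^esub> f y"
    and "\<And>a x. a \<in> carrier R \<Longrightarrow> x \<in> carrier M \<Longrightarrow> f (a \<odot>\<^bsub>M\<^esub> x) = a \<odot>\<^bsub>N\<^esub> f x"
  shows "f \<in> lin_maps R M N"
  using assms by (auto simp: lin_maps_def)

lemma lin_maps_zero:
  assumes "module R M" "module R N" "f \<in> lin_maps R M N"
  shows "f \<zero>\<^bsub>M\<^esub> = \<zero>\<^bsub>N\<^esub>"
proof -
  interpret M: plain_module R M by (intro plain_module.intro assms)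
  interpret N: plain_module R N by (intro plain_module.intro assms)
  have "f (\<zero>\<^bsub>R\<^esub> \<odot>\<^bsub>M\<^esub> \<zero>\<^bsub>M\<^esub>) = \<zero>\<^bsub>R\<^esub> \<odot>\<^bsub>N\<^esub> f \<zero>\<^bsub>M\<^esub>" by (rule lin_mapsD(3)[OF assms(3)]) simp_all
  moreover have "f \<zero>\<^bsub>M\<^esub> \<in> carrier N" by (rule lin_mapsD(1)[OF assms(3)]) simp
  ultimately show ?thesis by simp
qed

lemma lin_maps_minus:
  assumes "module R M" "module R N" "f \<in> lin_maps R M N" "x \<in> carrier M"
  shows "f (\<ominus>\<^bsub>M\<^esub> x) = \<ominus>\<^bsub>N\<^esub> f x"
proof -
  interpret M: plain_module R M by (intro plain_module.intro assms)
  interpret N: plain_module R N by (intro plain_module.intro assms)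
  have e: "\<ominus>\<^bsub>M\<^esub> x = (\<ominus>\<^bsub>R\<^esub> \<one>\<^bsub>R\<^esub>) \<odot>\<^bsub>M\<^esub> x" using assms(4) by (simp add: M.smult_l_minus)
  have "f (\<ominus>\<^bsub>M\<^esub> x) = (\<ominus>\<^bsub>R\<^esub> \<one>\<^bsub>R\<^esub>) \<odot>\<^bsub>N\<^esub> f x" unfolding e by (rule lin_mapsD(3)[OF assms(3,4)]) simp
  then show ?thesis using lin_mapsD(1)[OF assms(3,4)] by (simp add: N.smult_l_minus)
qed

lemma hom_module_simps:
  "carrier (hom_module R M N) = lin_maps R M N \<inter> extensional (carrier M)"
  "\<zero>\<^bsub>hom_module R M N\<^esub> = (\<lambda>x\<in>carrier M. \<zero>\<^bsub>N\<^esub>)"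
  "f \<oplus>\<^bsub>hom_module R M N\<^esub> g = (\<lambda>x\<in>carrier M. f x \<oplus>\<^bsub>N\<^esub> g x)"
  "a \<odot>\<^bsub>hom_module R M N\<^esub> f = (\<lambda>x\<in>carrier M. a \<odot>\<^bsub>N\<^esub> f x)"
  by (simp_all add: hom_module_def)

lemma module_hom:
  fixes M :: "('r, 'm) module" and N :: "('r, 'n) module"
  assumes M: "module R M" and N: "module R N"
  shows "module R (hom_module R M N)"
proof -
  interpret M: plain_module R M by (intro plain_module.intro assms)
  interpret N: plain_module R N by (intro plain_module.intro assms)
  note S = hom_module_simps
  let ?H = "hom_module R M N"
  have ext: "f = g" if "f \<in> extensional (carrier M)" "g \<in> extensional (carrier M)"
    "\<And>x. x \<in> carrier M \<Longrightarrow> f x = g x" for f g :: "'m \<Rightarrow> 'n"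
    by (rule extensionalityI[OF that])
  have addc: "(\<lambda>x\<in>carrier M. f x \<oplus>\<^bsub>N\<^esub> g x) \<in> lin_maps R M N"
    if "f \<in> lin_maps R M N" "g \<in> lin_maps R M N" for f g
    by (rule lin_mapsI)
      (simp_all add: lin_mapsD[OF that(1)] lin_mapsD[OF that(2)] N.M.a_ac N.smult_r_distr)
  have smc: "(\<lambda>x\<in>carrier M. a \<odot>\<^bsub>N\<^esub> f x) \<in> lin_maps R M N"
    if "f \<in> lin_maps R M N" "a \<in> carrier R" for f a
    by (rule lin_mapsI)
      (simp_all add: lin_mapsD[OF that(1)] N.smult_r_distr that(2) N.smult_assoc1[symmetric] M.R.m_comm)
  have zc: "(\<lambda>x\<in>carrier M. \<zero>\<^bsub>N\<^esub>) \<in> lin_maps R M N" by (rule lin_mapsI) simp_all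
  show ?thesis
  proof (rule moduleI)
    show "cring R" by (rule M.R.is_cring)
    show "abelian_group ?H"
    proof (rule abelian_groupI)
      show "\<zero>\<^bsub>?H\<^esub> \<in> carrier ?H" using zc by (simp add: S)
      fix f assume f: "f \<in> carrier ?H"
      then have f': "f \<in> lin_maps R M N" "f \<in> extensional (carrier M)" by (auto simp: S)
      note fD = lin_mapsD[OF f'(1)]
      show "\<zero>\<^bsub>?H\<^esub> \<oplus>\<^bsub>?H\<^esub> f = f" by (rule ext) (simp_all add: S fD f'(2))
      show "\<exists>g\<in>carrier ?H. g \<oplus>\<^bsub>?H\<^esub> f = \<zero>\<^bsub>?H\<^esub>"
      proof (rule bexI)
        let ?g = "\<lambda>x\<in>carrier M. (\<ominus>\<^bsub>R\<^esub> \<one>\<^bsub>R\<^esub>) \<odot>\<^bsub>N\<^esub> f x"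
        show "?g \<in> carrier ?H" using smc[OF f'(1), of "\<ominus>\<^bsub>R\<^esub> \<one>\<^bsub>R\<^esub>"] by (simp add: S)
        show "?g \<oplus>\<^bsub>?H\<^esub> f = \<zero>\<^bsub>?H\<^esub>"
          by (rule ext) (simp_all add: S fD N.smult_l_minus N.M.l_neg)
      qed
      fix g assume g: "g \<in> carrier ?H"
      then have g': "g \<in> lin_maps R M N" "g \<in> extensional (carrier M)" by (auto simp: S)
      note gD = lin_mapsD[OF g'(1)]
      show "f \<oplus>\<^bsub>?H\<^esub> g \<in> carrier ?H" using addc[OF f'(1) g'(1)] by (simp add: S)
      show "f \<oplus>\<^bsub>?H\<^esub> g = g \<oplus>\<^bsub>?H\<^esub> f" by (rule ext) (simp_all add: S fD gD N.M.a_comm)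
      fix h assume h: "h \<in> carrier ?H"
      then have h': "h \<in> lin_maps R M N" "h \<in> extensional (carrier M)" by (auto simp: S)
      show "f \<oplus>\<^bsub>?H\<^esub> g \<oplus>\<^bsub>?H\<^esub> h = f \<oplus>\<^bsub>?H\<^esub> (g \<oplus>\<^bsub>?H\<^esub> h)"
        by (rule ext) (simp_all add: S fD gD lin_mapsD[OF h'(1)] N.M.a_assoc)
    qed
    fix f assume f: "f \<in> carrier ?H"
    then have f': "f \<in> lin_maps R M N" "f \<in> extensional (carrier M)" by (auto simp: S)
    note fD = lin_mapsD[OF f'(1)]
    show "\<one>\<^bsub>R\<^esub> \<odot>\<^bsub>?H\<^esub> f = f" by (rule ext) (simp_all add: S fD f'(2))
    fix a assume a: "a \<in> carrier R"
    show "a \<odot>\<^bsub>?H\<^esub> f \<in> carrier ?H" using smc[OF f'(1) a] by (simp add: S)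
    { fix g assume g: "g \<in> carrier ?H"
      then have g': "g \<in> lin_maps R M N" "g \<in> extensional (carrier M)" by (auto simp: S)
      show "a \<odot>\<^bsub>?H\<^esub> (f \<oplus>\<^bsub>?H\<^esub> g) = a \<odot>\<^bsub>?H\<^esub> f \<oplus>\<^bsub>?H\<^esub> a \<odot>\<^bsub>?H\<^esub> g"
        by (rule ext) (simp_all add: S fD lin_mapsD[OF g'(1)] a N.smult_r_distr) }
    fix b assume b: "b \<in> carrier R"
    show "(a \<oplus>\<^bsub>R\<^esub> b) \<odot>\<^bsub>?H\<^esub> f = a \<odot>\<^bsub>?H\<^esub> f \<oplus>\<^bsub>?H\<^esub> b \<odot>\<^bsub>?H\<^esub> f"
      by (rule ext) (simp_all add: S fD a b N.smult_l_distr)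
    show "(a \<otimes>\<^bsub>R\<^esub> b) \<odot>\<^bsub>?H\<^esub> f = a \<odot>\<^bsub>?H\<^esub> (b \<odot>\<^bsub>?H\<^esub> f)"
      by (rule ext) (simp_all add: S fD a b N.smult_assoc1)
  qed
qed

context local_module begin

text \<open>
  Submodules of a module with finitely many jointly injective functionals are finitely
  generated: peel off one functional at a time, its image being a finitely generated ideal.
\<close>

lemma fg_sub_of_functionals:
  assumes "finite F" and lin: "\<And>\<phi>. \<phi> \<in> F \<Longrightarrow> \<phi> \<in> lin_maps R M (ring_module R)"
    and A: "submodule A R M"
    and inj: "\<And>x. x \<in> A \<Longrightarrow> (\<And>\<phi>. \<phi> \<in> F \<Longrightarrow> \<phi> x = \<zero>) \<Longrightarrow> x = \<zero>\<^bsub>M\<^esub>"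
  shows "fg_sub R M A"
  using assms
proof (induct F arbitrary: A)
  case empty
  then have "x = \<zero>\<^bsub>M\<^esub>" if "x \<in> A" for x using that by blast
  then have "A = {\<zero>\<^bsub>M\<^esub>}" using submodule_zero[OF empty(2)] by blast
  then show ?case using gen_empty unfolding fg_sub_def by (intro exI[of _ "{}"]) auto
next
  case (insert \<phi> F)
  note A = insert(5) and cA = submoduleE(1)[OF insert(5), THEN subsetD]
  have \<phi>: "\<phi> \<in> lin_maps R M (ring_module R)" using insert by blast
  note \<phi>D = lin_mapsD[OF \<phi>, simplified]
  have \<phi>m: "\<phi> (\<ominus>\<^bsub>M\<^esub> x) = \<ominus> \<phi> x" if "x \<in> carrier M" for x
  proof -
    have "\<phi> (\<ominus>\<^bsub>M\<^esub> x) = \<phi> ((\<ominus> \<one>) \<odot>\<^bsub>M\<^esub> x)" using that by (simp add: smult_l_minus)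
    then show ?thesis using that \<phi>D by (simp add: R.l_minus)
  qed
  have \<phi>0: "\<phi> \<zero>\<^bsub>M\<^esub> = \<zero>" using \<phi>D(3)[of "\<zero>\<^bsub>M\<^esub>" \<zero>] \<phi>D(1)[of "\<zero>\<^bsub>M\<^esub>"] by simp
  have i\<phi>: "ideal (\<phi> ` A) R"
    unfolding submodule_ring_module_iff[symmetric]
  proof -
    interpret RM: plain_module R "ring_module R" by (intro plain_module.intro R.module_ring_module)
    show "submodule (\<phi> ` A) R (ring_module R)"
    proof (rule RM.submoduleI)
      show "\<phi> ` A \<subseteq> carrier (ring_module R)" using \<phi>D(1) cA by auto
      show "\<zero>\<^bsub>ring_module R\<^esub> \<in> \<phi> ` A" using \<phi>0 submodule_zero[OF A] by (metis imageI ring_module_simps(4))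
      fix a assume "a \<in> \<phi> ` A"
      then obtain x where x: "x \<in> A" "a = \<phi> x" by blast
      show sm: "r \<odot>\<^bsub>ring_module R\<^esub> a \<in> \<phi> ` A" if r: "r \<in> carrier R" for r
        using x \<phi>D(3)[OF cA[OF x(1)] r] submoduleE(4)[OF A r x(1)] by (metis imageI ring_module_simps(6))
      have ca: "a \<in> carrier (ring_module R)" using x \<phi>D(1) cA by simp
      have "\<ominus>\<^bsub>ring_module R\<^esub> a = (\<ominus> \<one>) \<odot>\<^bsub>ring_module R\<^esub> a"
        using RM.smult_l_minus[OF R.one_closed ca] RM.smult_one[OF ca] by simp
      then show "\<ominus>\<^bsub>ring_module R\<^esub> a \<in> \<phi> ` A" using sm[of "\<ominus> \<one>"] by simp
      fix b assume "b \<in> \<phi> ` A"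
      then obtain y where y: "y \<in> A" "b = \<phi> y" by blast
      show "a \<oplus>\<^bsub>ring_module R\<^esub> b \<in> \<phi> ` A"
        using x y \<phi>D(2)[OF cA[OF x(1)] cA[OF y(1)]] submoduleE(5)[OF A x(1) y(1)]
        by (metis imageI ring_module_simps(5))
    qed
  qed
  obtain T where T: "T \<subseteq> carrier R" "finite T" "\<phi> ` A = Idl T" using finitely_gen[OF i\<phi>] by blast
  have "T \<subseteq> \<phi> ` A" using R.genideal_self[OF T(1)] T(3) by simp
  then obtain S where S: "S \<subseteq> A" "finite S" "T = \<phi> ` S" using T(2) finite_subset_image by meson
  \<comment> \<open>On the kernel of \<open>\<phi>\<close> the remaining functionals are still
    jointly injective, so the induction hypothesis applies to it.\<close>
  define A' where "A' = {x \<in> A. \<phi> x = \<zero>}"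
  have A': "submodule A' R M"
    using submoduleE(3-5)[OF A] submodule_zero[OF A] cA
    by (intro submoduleI) (auto simp: A'_def \<phi>m \<phi>D \<phi>0)
  have "fg_sub R M A'"
  proof (rule insert(3)[OF _ A'])
    fix \<psi> assume "\<psi> \<in> F" then show "\<psi> \<in> lin_maps R M (ring_module R)" using insert by blast
  next
    fix x assume x: "x \<in> A'" "\<And>\<psi>. \<psi> \<in> F \<Longrightarrow> \<psi> x = \<zero>"
    have "\<psi> x = \<zero>" if "\<psi> \<in> insert \<phi> F" for \<psi> using that x unfolding A'_def by auto
    moreover have "x \<in> A" using x unfolding A'_def by blast
    ultimately show "x = \<zero>\<^bsub>M\<^esub>" using insert(6)[of x] by blast
  qed
  then obtain S' where S': "finite S'" "S' \<subseteq> carrier M" "gen_submodule R M S' = A'" unfolding fg_sub_def by blast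
  have S'A: "S' \<subseteq> A'" using gen_submodule_superset[of S'] S'(3) by simp
  have SS: "S \<union> S' \<subseteq> carrier M" using S S' cA by blast
  let ?G = "gen_submodule R M (S \<union> S')"
  have G: "submodule ?G R M" by (rule submodule_gen[OF SS])
  have A'G: "A' \<subseteq> ?G" using gen_submodule_mono[of S' "S \<union> S'"] S'(3) by auto
  have "Idl T \<subseteq> \<phi> ` (gen_submodule R M S)"
  proof -
    let ?H = "gen_submodule R M S"
    have cS: "S \<subseteq> carrier M" using SS by blast
    have H: "submodule ?H R M" by (rule submodule_gen[OF cS])
    note cH = submoduleE(1)[OF H, THEN subsetD]
    have "ideal (\<phi> ` ?H) R"
    proof (rule idealI[OF R.ring_axioms])
      show "subgroup (\<phi> ` ?H) (add_monoid R)"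
      proof (rule R.add.subgroupI)
        show "\<phi> ` ?H \<subseteq> carrier R" using \<phi>D(1) cH by auto
        show "\<phi> ` ?H \<noteq> {}" using submodule_zero[OF H] by blast
        fix a assume "a \<in> \<phi> ` ?H"
        then obtain x where x: "x \<in> ?H" "a = \<phi> x" by blast
        show "\<ominus> a \<in> \<phi> ` ?H" using \<phi>m[OF cH[OF x(1)]] submoduleE(3)[OF H x(1)] x(2) by (metis imageI)
        fix b assume "b \<in> \<phi> ` ?H"
        then obtain y where y: "y \<in> ?H" "b = \<phi> y" by blast
        show "a \<oplus> b \<in> \<phi> ` ?H"
          using \<phi>D(2)[OF cH[OF x(1)] cH[OF y(1)]] submoduleE(5)[OF H x(1) y(1)] x(2) y(2) by (metis imageI)
      qed
      fix a r assume "a \<in> \<phi> ` ?H" and r: "r \<in> carrier R"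
      then obtain x where x: "x \<in> ?H" "a = \<phi> x" by blast
      show *: "r \<otimes> a \<in> \<phi> ` ?H" using \<phi>D(3)[OF cH[OF x(1)] r] submoduleE(4)[OF H r x(1)] x(2) by (metis imageI)
      have "a \<in> carrier R" using x \<phi>D(1) cH by simp
      then show "a \<otimes> r \<in> \<phi> ` ?H" using * r by (simp add: R.m_comm)
    qed
    moreover have "T \<subseteq> \<phi> ` ?H" unfolding S(3) using gen_submodule_superset by blast
    ultimately show ?thesis by (rule R.genideal_minimal)
  qed
  then have img: "\<phi> ` A \<subseteq> \<phi> ` gen_submodule R M S" using T(3) by simp
  have "A \<subseteq> ?G"
  proof
    fix x assume x: "x \<in> A"
    then obtain g where g: "g \<in> gen_submodule R M S" "\<phi> x = \<phi> g" using img by blast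
    have gA: "g \<in> A" using g(1) gen_submodule_least[OF A S(1)] by blast
    have c: "x \<in> carrier M" "g \<in> carrier M" using x gA cA by blast+
    have "\<phi> (x \<ominus>\<^bsub>M\<^esub> g) = \<phi> x \<ominus> \<phi> g" using c \<phi>D \<phi>m by (simp add: a_minus_def)
    also have "\<dots> = \<zero>" using g(2) c \<phi>D(1) by (simp add: a_minus_def R.r_neg)
    finally have "x \<ominus>\<^bsub>M\<^esub> g \<in> A'" unfolding A'_def using submodule_diff[OF A x gA] by simp
    then have 1: "x \<ominus>\<^bsub>M\<^esub> g \<in> ?G" using A'G by blast
    have 2: "g \<in> ?G" using g(1) gen_submodule_mono[of S "S \<union> S'"] by blast
    have "(x \<ominus>\<^bsub>M\<^esub> g) \<oplus>\<^bsub>M\<^esub> g = x" using c by (simp add: a_minus_def M.a_assoc M.l_neg)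
    then show "x \<in> ?G" using submoduleE(5)[OF G 1 2] by simp
  qed
  moreover have "?G \<subseteq> A" using S(1) S'A unfolding A'_def by (intro gen_submodule_least A) blast
  ultimately have "?G = A" by blast
  then show ?case unfolding fg_sub_def using SS S S' by (intro exI[of _ "S \<union> S'"]) auto
qed

text \<open>Since \<open>\<mm>^k \<subseteq> (y)\<close>, there is a last power with
  \<open>\<mm>^j A\<close> not inside \<open>yM\<close>. An element of it outside \<open>yM\<close>
  is sent into \<open>yM\<close> by \<open>\<mm>\<close>.\<close>

lemma socle_element:
  assumes A: "submodule A R M" and y: "y \<in> carrier R" and k: "P k \<subseteq> PIdl y"
    and nA: "\<not> A \<subseteq> scaled M y (carrier M)"
  obtains u where "u \<in> A" "u \<notin> scaled M y (carrier M)"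
    "\<And>a. a \<in> \<mm> \<Longrightarrow> a \<odot>\<^bsub>M\<^esub> u \<in> scaled M y (carrier M)"
proof -
  let ?Y = "scaled M y (carrier M)"
  have Y: "submodule ?Y R M" by (rule submodule_scaled[OF carrier_is_submodule y])
  note cA = submoduleE(1)[OF A, THEN subsetD]
  let ?Q = "\<lambda>n. ideal_smul R M (P n) A \<subseteq> ?Y"
  have Qk: "?Q k"
  proof (rule ideal_smul_least[OF Y])
    fix a x assume ax: "a \<in> P k" "x \<in> A"
    then obtain r where r: "r \<in> carrier R" "a = r \<otimes> y" using k unfolding cgenideal_def by blast
    have "a \<odot>\<^bsub>M\<^esub> x = y \<odot>\<^bsub>M\<^esub> (r \<odot>\<^bsub>M\<^esub> x)"
      using r y cA[OF ax(2)] by (simp add: smult_assoc1[symmetric] R.m_comm)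
    then show "a \<odot>\<^bsub>M\<^esub> x \<in> ?Y" unfolding scaled_def using r cA[OF ax(2)] by simp
  qed
  have n0: "\<not> ?Q 0" using nA ideal_smul_pow_0[OF A] by simp
  have L: "?Q (LEAST n. ?Q n)" by (rule LeastI[of ?Q, OF Qk])
  obtain j where j: "(LEAST n. ?Q n) = Suc j" using L n0 by (cases "LEAST n. ?Q n") auto
  have "\<not> ?Q j" using not_less_Least[of j ?Q] j by simp
  then obtain u where u: "u \<in> ideal_smul R M (P j) A" "u \<notin> ?Y" by blast
  have sub: "ideal_smul R M (P j) A \<subseteq> A" by (rule ideal_smul_subset[OF R.ideal_pow_carrier[OF ideal_m] A])
  have "a \<odot>\<^bsub>M\<^esub> u \<in> ?Y" if "a \<in> \<mm>" for a
  proof -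
    have "a \<odot>\<^bsub>M\<^esub> u \<in> ideal_smul R M (P 1) (ideal_smul R M (P j) A)"
      using that u(1) by (intro ideal_smulI) (simp_all add: R.ideal_pow_1[OF ideal_m])
    then have "a \<odot>\<^bsub>M\<^esub> u \<in> ideal_smul R M (P (Suc j)) A" using ideal_smul_pow_add[OF ideal_m A, of 1 j] by simp
    then show ?thesis using L j by auto
  qed
  then show ?thesis using that[OF subsetD[OF sub u(1)] u(2)] by blast
qed

lemma smult_proper:
  assumes "fin_gen R M" and "carrier M \<noteq> {\<zero>\<^bsub>M\<^esub>}"
  shows "ideal_smul R M \<mm> (carrier M) \<noteq> carrier M"
proof
  assume e: "ideal_smul R M \<mm> (carrier M) = carrier M"
  have "carrier M \<subseteq> {\<zero>\<^bsub>M\<^esub>} <+>\<^bsub>M\<^esub> ideal_smul R M \<mm> (carrier M)"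
    unfolding e by (rule set_add_upper2[OF submodule_null carrier_is_submodule])
  then have "carrier M = {\<zero>\<^bsub>M\<^esub>}"
    using assms(1) by (intro nakayama submodule_null) (auto simp: fin_gen_iff_fg_sub)
  with assms(2) show False by simp
qed

lemma regular_inj:
  assumes "y \<in> carrier R" and reg: "\<And>x. x \<in> carrier M \<Longrightarrow> y \<odot>\<^bsub>M\<^esub> x = \<zero>\<^bsub>M\<^esub> \<Longrightarrow> x = \<zero>\<^bsub>M\<^esub>"
  shows "inj_on (\<lambda>x. y \<odot>\<^bsub>M\<^esub> x) (carrier M)"
proof (rule inj_onI)
  fix u v assume uv: "u \<in> carrier M" "v \<in> carrier M" "y \<odot>\<^bsub>M\<^esub> u = y \<odot>\<^bsub>M\<^esub> v"
  have "y \<odot>\<^bsub>M\<^esub> (u \<ominus>\<^bsub>M\<^esub> v) = \<zero>\<^bsub>M\<^esub>"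
    using uv assms(1) by (simp add: a_minus_def smult_r_distr smult_r_minus M.r_neg)
  then have "u \<ominus>\<^bsub>M\<^esub> v = \<zero>\<^bsub>M\<^esub>" by (rule reg[rotated]) (use uv in simp)
  moreover have "(u \<ominus>\<^bsub>M\<^esub> v) \<oplus>\<^bsub>M\<^esub> v = u" using uv(1,2) by (simp add: a_minus_def M.a_assoc M.l_neg)
  ultimately show "u = v" using uv(2) by simp
qed

lemma scaled_eq_ideal_mod:
  assumes y: "y \<in> carrier R"
  shows "ideal_mod R M {y} = scaled M y (carrier M)"
proof
  have Y: "submodule (scaled M y (carrier M)) R M" by (rule submodule_scaled[OF carrier_is_submodule y])
  show "ideal_mod R M {y} \<subseteq> scaled M y (carrier M)"
    unfolding ideal_mod_smul by (rule ideal_smul_least[OF Y]) (auto simp: scaled_def)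
  show "scaled M y (carrier M) \<subseteq> ideal_mod R M {y}"
    unfolding ideal_mod_smul scaled_def using ideal_smulI[of y "{y}"] by blast
qed

text \<open>A regular sequence cannot have two terms \<open>x, x'\<close>: a socle element
  \<open>u\<close> of \<open>M/yM\<close> is transported to \<open>M/xM\<close> by
  \<open>xu = yv\<close>. Then \<open>x'v \<in> xM\<close>, so \<open>v = xw\<close> for some
  \<open>w\<close>, and cancelling \<open>x\<close> gives \<open>u = yw\<close>, a
  contradiction.\<close>

lemma depth_eq_1:
  assumes fg: "fin_gen R M" and ne: "carrier M \<noteq> {\<zero>\<^bsub>M\<^esub>}" and y: "y \<in> \<mm>" and k: "P k \<subseteq> PIdl y"
    and reg: "\<And>x. x \<in> carrier M \<Longrightarrow> y \<odot>\<^bsub>M\<^esub> x = \<zero>\<^bsub>M\<^esub> \<Longrightarrow> x = \<zero>\<^bsub>M\<^esub>"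
  shows "depth R \<mm> M = 1"
proof -
  have cy: "y \<in> carrier R" using y m_carrier by blast
  have mM: "ideal_mod R M \<mm> \<noteq> carrier M" unfolding ideal_mod_smul by (rule smult_proper[OF fg ne])
  have proper: "ideal_mod R M X \<noteq> carrier M" if "X \<subseteq> \<mm>" for X
  proof
    assume "ideal_mod R M X = carrier M"
    moreover have "ideal_mod R M X \<subseteq> ideal_mod R M \<mm>"
      unfolding ideal_mod_smul by (rule ideal_smul_mono[OF that subset_refl])
    moreover have "ideal_mod R M \<mm> \<subseteq> carrier M"
      unfolding ideal_mod_smul by (rule ideal_smul_subset[OF m_carrier carrier_is_submodule])
    ultimately show False using mM by blast
  qed
  have mod0: "ideal_mod R M {} = {\<zero>\<^bsub>M\<^esub>}" by (simp add: ideal_mod_def gen_empty)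
  have yreg: "regular_seq R M [y]" unfolding regular_seq_def using proper[of "{y}"] y reg by (simp add: mod0)
  have "length xs \<le> 1" if xs: "set xs \<subseteq> \<mm>" "regular_seq R M xs" for xs
  proof (rule ccontr)
    assume "\<not> length xs \<le> 1"
    then obtain x x' zs where e: "xs = x # x' # zs" by (cases xs; cases "tl xs") auto
    have x: "x \<in> \<mm>" "x' \<in> \<mm>" using xs(1) e by auto
    have cx: "x \<in> carrier R" "x' \<in> carrier R" using x m_carrier by blast+
    have r1: "v = \<zero>\<^bsub>M\<^esub>" if "v \<in> carrier M" "x \<odot>\<^bsub>M\<^esub> v = \<zero>\<^bsub>M\<^esub>" for v
      using xs(2) that unfolding regular_seq_def e by (force simp: mod0)
    have r2: "v \<in> scaled M x (carrier M)" if "v \<in> carrier M" "x' \<odot>\<^bsub>M\<^esub> v \<in> scaled M x (carrier M)" for v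
    proof -
      have "\<forall>i<length xs. \<forall>w\<in>carrier M. xs ! i \<odot>\<^bsub>M\<^esub> w \<in> ideal_mod R M (set (take i xs)) \<longrightarrow>
        w \<in> ideal_mod R M (set (take i xs))" using xs(2) unfolding regular_seq_def by blast
      from this[rule_format, of 1 v] show ?thesis using that scaled_eq_ideal_mod[OF cx(1)] by (simp add: e)
    qed
    have "\<not> carrier M \<subseteq> scaled M y (carrier M)"
      using proper[of "{y}"] y scaled_eq_ideal_mod[OF cy] submoduleE(1)[OF submodule_scaled[OF carrier_is_submodule cy]]
      by auto
    then obtain u where u: "u \<in> carrier M" "u \<notin> scaled M y (carrier M)"
      "\<And>a. a \<in> \<mm> \<Longrightarrow> a \<odot>\<^bsub>M\<^esub> u \<in> scaled M y (carrier M)"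
      using socle_element[OF carrier_is_submodule cy k] by metis
    obtain v where v: "v \<in> carrier M" "x \<odot>\<^bsub>M\<^esub> u = y \<odot>\<^bsub>M\<^esub> v" using u(3)[OF x(1)] unfolding scaled_def by blast
    obtain v' where v': "v' \<in> carrier M" "x' \<odot>\<^bsub>M\<^esub> u = y \<odot>\<^bsub>M\<^esub> v'" using u(3)[OF x(2)] unfolding scaled_def by blast
    have comm: "a \<odot>\<^bsub>M\<^esub> (b \<odot>\<^bsub>M\<^esub> w) = b \<odot>\<^bsub>M\<^esub> (a \<odot>\<^bsub>M\<^esub> w)"
      if "a \<in> carrier R" "b \<in> carrier R" "w \<in> carrier M" for a b w
      using that by (simp add: smult_assoc1[symmetric] R.m_comm)
    have injy: "a = b" if "y \<odot>\<^bsub>M\<^esub> a = y \<odot>\<^bsub>M\<^esub> b" "a \<in> carrier M" "b \<in> carrier M" for a b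
      using inj_onD[OF regular_inj[OF cy reg]] that by simp
    have injx: "a = b" if "x \<odot>\<^bsub>M\<^esub> a = x \<odot>\<^bsub>M\<^esub> b" "a \<in> carrier M" "b \<in> carrier M" for a b
      using inj_onD[OF regular_inj[OF cx(1) r1]] that by simp
    have "y \<odot>\<^bsub>M\<^esub> (x' \<odot>\<^bsub>M\<^esub> v) = x' \<odot>\<^bsub>M\<^esub> (x \<odot>\<^bsub>M\<^esub> u)" using v cy cx by (simp add: comm)
    also have "\<dots> = x \<odot>\<^bsub>M\<^esub> (x' \<odot>\<^bsub>M\<^esub> u)" using u(1) cx by (simp add: comm)
    also have "\<dots> = y \<odot>\<^bsub>M\<^esub> (x \<odot>\<^bsub>M\<^esub> v')" using v' cy cx by (simp add: comm)
    finally have "x' \<odot>\<^bsub>M\<^esub> v = x \<odot>\<^bsub>M\<^esub> v'" by (rule injy) (use v v' cx in auto)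
    then have "x' \<odot>\<^bsub>M\<^esub> v \<in> scaled M x (carrier M)" using v' unfolding scaled_def by blast
    then obtain w where w: "w \<in> carrier M" "v = x \<odot>\<^bsub>M\<^esub> w" using r2[OF v(1)] unfolding scaled_def by blast
    have "x \<odot>\<^bsub>M\<^esub> u = x \<odot>\<^bsub>M\<^esub> (y \<odot>\<^bsub>M\<^esub> w)" using v(2) w cx cy by (simp add: comm)
    then have "u = y \<odot>\<^bsub>M\<^esub> w" by (rule injx) (use u w cy in auto)
    then show False using u(2) w unfolding scaled_def by blast
  qed
  then have "Sup {enat (length xs) |xs. set xs \<subseteq> \<mm> \<and> regular_seq R M xs} \<le> 1"
    by (intro Sup_least) (auto simp: one_enat_def)
  moreover have "enat (length [y]) \<le> Sup {enat (length xs) |xs. set xs \<subseteq> \<mm> \<and> regular_seq R M xs}"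
    by (rule Sup_upper, rule CollectI, rule exI[of _ "[y]"]) (use y yreg in simp)
  ultimately show ?thesis unfolding depth_def using mM by (simp add: one_enat_def)
qed

text \<open>Transfers regularity from the element provided by the depth to the parameter
  \<open>y\<close>, and from \<open>y\<close> to \<open>z\<close>: in each case the new element
  divides a power of the old one.\<close>

lemma regular_of_regular:
  assumes y': "y' \<in> \<mm>" "\<And>x. x \<in> carrier M \<Longrightarrow> y' \<odot>\<^bsub>M\<^esub> x = \<zero>\<^bsub>M\<^esub> \<Longrightarrow> x = \<zero>\<^bsub>M\<^esub>"
    and c: "y \<in> carrier R" "r \<in> carrier R" "y' [^] (n::nat) = r \<otimes> y"
    and x: "x \<in> carrier M" "y \<odot>\<^bsub>M\<^esub> x = \<zero>\<^bsub>M\<^esub>"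
  shows "x = \<zero>\<^bsub>M\<^esub>"
proof -
  have cy': "y' \<in> carrier R" using y' m_carrier by blast
  have "x = \<zero>\<^bsub>M\<^esub>" if "x \<in> carrier M" "y' [^] (n::nat) \<odot>\<^bsub>M\<^esub> x = \<zero>\<^bsub>M\<^esub>" for n x
    using that
  proof (induct n)
    case (Suc n)
    have "y' \<odot>\<^bsub>M\<^esub> (y' [^] n \<odot>\<^bsub>M\<^esub> x) = \<zero>\<^bsub>M\<^esub>" using Suc(2,3) cy' by (simp add: smult_assoc1[symmetric] R.m_comm)
    then have "y' [^] n \<odot>\<^bsub>M\<^esub> x = \<zero>\<^bsub>M\<^esub>" by (rule y'(2)[rotated]) (use Suc(2) cy' in simp)
    then show ?case using Suc by blast
  qed simp
  moreover have "y' [^] n \<odot>\<^bsub>M\<^esub> x = \<zero>\<^bsub>M\<^esub>" using x c by (simp add: smult_assoc1)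
  ultimately show ?thesis using x(1) by blast
qed

end

subsection \<open>Associated graded modules\<close>

lemma (in cring) ideal_mod_ring_module:
  assumes I: "ideal I R" shows "ideal_mod R (ring_module R) I = I"
  unfolding ideal_mod_smul ring_module_simps(1) ideal_smul_ring_module[OF I oneideal] by (rule ideal_prod_one[OF I])

lemma (in abelian_group) finsum_all_zero:
  assumes "\<And>i. i \<in> A \<Longrightarrow> f i = \<zero>" shows "(\<Oplus>i\<in>A. f i) = \<zero>"
proof -
  have "(\<Oplus>i\<in>A. f i) = (\<Oplus>i\<in>A. \<zero>)" by (rule finsum_cong') (use assms in auto)
  then show ?thesis by simp
qed

context local_module begin

abbreviation pm :: "nat \<Rightarrow> 'm set" where "pm n \<equiv> ideal_mod R M (P n)"

lemma submodule_pm: "submodule (pm n) R M"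
  unfolding ideal_mod_smul by (rule submodule_ideal_smul_pow[OF ideal_m carrier_is_submodule])

lemma pm_anti: "i \<le> j \<Longrightarrow> pm j \<subseteq> pm i"
  unfolding ideal_mod_smul by (rule ideal_smul_mono[OF R.ideal_pow_anti[OF ideal_m] subset_refl])

lemma pm_carrier: "x \<in> pm n \<Longrightarrow> x \<in> carrier M"
  using submoduleE(1)[OF submodule_pm] by blast

lemma pm_smult: "a \<in> P i \<Longrightarrow> x \<in> pm j \<Longrightarrow> a \<odot>\<^bsub>M\<^esub> x \<in> pm (i + j)"
  unfolding ideal_mod_smul using ideal_smul_pow_add[OF ideal_m carrier_is_submodule, of i j] ideal_smulI by blast

lemma pm_0: "pm 0 = carrier M"
  unfolding ideal_mod_smul by (rule ideal_smul_pow_0[OF carrier_is_submodule])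

lemma coset_restrict: "K +>\<^bsub>M\<lparr>carrier := X\<rparr>\<^esub> x = K +>\<^bsub>M\<^esub> x"
  by (simp add: a_r_coset_def')

lemma plain_module_pm: "plain_module R (M\<lparr>carrier := pm n\<rparr>)"
  by (intro plain_module.intro submodule.submodule_is_module[OF submodule_pm] module_axioms)

lemma submodule_pm_pm: "submodule (pm (Suc n)) R (M\<lparr>carrier := pm n\<rparr>)"
proof -
  interpret N: plain_module R "M\<lparr>carrier := pm n\<rparr>" by (rule plain_module_pm)
  show ?thesis
  proof (rule N.module_incl_imp_submodule)
    show "pm (Suc n) \<subseteq> carrier (M\<lparr>carrier := pm n\<rparr>)" using pm_anti[of n "Suc n"] by simp
    show "module R (M\<lparr>carrier := pm n\<rparr>\<lparr>carrier := pm (Suc n)\<rparr>)"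
      using plain_module.axioms[OF plain_module_pm[of "Suc n"]] by simp
  qed
qed

lemma module_gr_comp: "module R (gr_comp R \<mm> M n)"
  unfolding gr_comp_def by (rule plain_module.module_quot[OF plain_module_pm submodule_pm_pm])

lemma gr_comp_carrier: "carrier (gr_comp R \<mm> M n) = (\<lambda>x. pm (Suc n) +>\<^bsub>M\<^esub> x) ` pm n"
  unfolding gr_comp_def plain_module.quot_carrier[OF plain_module_pm] by (simp add: coset_restrict)

lemma gr_comp_zero: "\<zero>\<^bsub>gr_comp R \<mm> M n\<^esub> = pm (Suc n)"
  unfolding gr_comp_def by (simp add: quot_module_def)

lemma gr_comp_subset: "X \<in> carrier (gr_comp R \<mm> M n) \<Longrightarrow> X \<subseteq> pm n"
proof -
  assume "X \<in> carrier (gr_comp R \<mm> M n)"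
  then obtain x where x: "x \<in> pm n" "X = pm (Suc n) +>\<^bsub>M\<^esub> x" unfolding gr_comp_carrier by blast
  show "X \<subseteq> pm n"
    unfolding x(2) a_r_coset_def' using submoduleE(5)[OF submodule_pm[of n]] x(1) pm_anti[of n "Suc n"] by auto
qed

lemma gr_comp_nonempty: "X \<in> carrier (gr_comp R \<mm> M n) \<Longrightarrow> X \<noteq> {}"
  unfolding gr_comp_carrier using coset_self[OF submodule_pm] pm_carrier by blast

lemma gr_pairing_const:
  assumes "A \<noteq> {}" "X \<noteq> {}" and z: "z \<in> carrier M"
    and "\<And>a x. a \<in> A \<Longrightarrow> x \<in> X \<Longrightarrow> a \<odot>\<^bsub>M\<^esub> x \<in> carrier M \<and> a \<odot>\<^bsub>M\<^esub> x \<ominus>\<^bsub>M\<^esub> z \<in> pm (Suc n)"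
  shows "gr_pairing R \<mm> M n A X = pm (Suc n) +>\<^bsub>M\<^esub> z"
proof -
  have "pm (Suc n) +>\<^bsub>M\<^esub> (a \<odot>\<^bsub>M\<^esub> x) = pm (Suc n) +>\<^bsub>M\<^esub> z" if "a \<in> A" "x \<in> X" for a x
    using coset_eq_iff[OF submodule_pm _ z] assms(4)[OF that] by blast
  then have "gr_pairing R \<mm> M n A X = (\<Union>a\<in>A. \<Union>x\<in>X. pm (Suc n) +>\<^bsub>M\<^esub> z)"
    unfolding gr_pairing_def by (intro SUP_cong refl)
  then show ?thesis using assms(1,2) by auto
qed

lemma gr_pairing_zero:
  assumes "A \<noteq> {}" "X \<noteq> {}" and "\<And>a x. a \<in> A \<Longrightarrow> x \<in> X \<Longrightarrow> a \<odot>\<^bsub>M\<^esub> x \<in> pm (Suc n)"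
  shows "gr_pairing R \<mm> M n A X = pm (Suc n)"
proof -
  have m0: "\<ominus>\<^bsub>M\<^esub> \<zero>\<^bsub>M\<^esub> = \<zero>\<^bsub>M\<^esub>" using M.r_neg[OF M.zero_closed] by simp
  have "gr_pairing R \<mm> M n A X = pm (Suc n) +>\<^bsub>M\<^esub> \<zero>\<^bsub>M\<^esub>"
  proof (rule gr_pairing_const[OF assms(1,2) M.zero_closed])
    fix a x assume "a \<in> A" "x \<in> X"
    then have *: "a \<odot>\<^bsub>M\<^esub> x \<in> pm (Suc n)" by (rule assms(3))
    then show "a \<odot>\<^bsub>M\<^esub> x \<in> carrier M \<and> a \<odot>\<^bsub>M\<^esub> x \<ominus>\<^bsub>M\<^esub> \<zero>\<^bsub>M\<^esub> \<in> pm (Suc n)"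
      using pm_carrier[OF *] by (simp add: a_minus_def m0)
  qed
  then show ?thesis using coset_zero[OF submodule_pm] by simp
qed

end

context local_ring begin

lemma gr_ring_comp:
  assumes "A \<in> carrier (gr_comp R \<mm> (ring_module R) i)"
  shows "A \<noteq> {}" "A \<subseteq> P i"
proof -
  interpret RM: local_module R "ring_module R" \<mm> by (rule local_module_ring)
  show "A \<noteq> {}" by (rule RM.gr_comp_nonempty[OF assms])
  show "A \<subseteq> P i" using RM.gr_comp_subset[OF assms] by (simp add: ideal_mod_ring_module ideal_P)
qed

lemma gr_ring_comp_coset:
  assumes "A \<in> carrier (gr_comp R \<mm> (ring_module R) i)"
  obtains a where "a \<in> P i" "\<And>b. b \<in> A \<Longrightarrow> \<exists>p\<in>P (Suc i). b = p \<oplus> a"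
proof -
  interpret RM: local_module R "ring_module R" \<mm> by (rule local_module_ring)
  obtain a where a: "a \<in> P i" "A = P (Suc i) +>\<^bsub>ring_module R\<^esub> a"
    using assms unfolding RM.gr_comp_carrier by (auto simp: ideal_mod_ring_module ideal_P)
  then show ?thesis by (intro that[of a]) (auto simp: a_r_coset_def')
qed

lemma gr_ring_zero: "\<zero>\<^bsub>gr_comp R \<mm> (ring_module R) i\<^esub> = P (Suc i)"
proof -
  interpret RM: local_module R "ring_module R" \<mm> by (rule local_module_ring)
  show ?thesis by (simp add: RM.gr_comp_zero ideal_mod_ring_module ideal_P)
qed

end

context local_module begin

lemma gr_pairing_closed:
  assumes A: "A \<in> carrier (gr_comp R \<mm> (ring_module R) i)" and X: "X \<in> carrier (gr_comp R \<mm> M j)"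
  shows "gr_pairing R \<mm> M (i + j) A X \<in> carrier (gr_comp R \<mm> M (i + j))"
proof -
  obtain a where a: "a \<in> P i" "\<And>b. b \<in> A \<Longrightarrow> \<exists>p\<in>P (Suc i). b = p \<oplus> a" using gr_ring_comp_coset[OF A] by blast
  obtain x where x: "x \<in> pm j" "X = pm (Suc j) +>\<^bsub>M\<^esub> x" using X unfolding gr_comp_carrier by blast
  have ca: "a \<in> carrier R" and cx: "x \<in> carrier M" using a x P_carrier pm_carrier by blast+
  have "gr_pairing R \<mm> M (i + j) A X = pm (Suc (i + j)) +>\<^bsub>M\<^esub> (a \<odot>\<^bsub>M\<^esub> x)"
  proof (rule gr_pairing_const[OF gr_ring_comp(1)[OF A] gr_comp_nonempty[OF X]])
    show "a \<odot>\<^bsub>M\<^esub> x \<in> carrier M" using ca cx by simp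
    fix b v assume b: "b \<in> A" and "v \<in> X"
    then obtain w where w: "w \<in> pm (Suc j)" "v = w \<oplus>\<^bsub>M\<^esub> x" unfolding x(2) a_r_coset_def' by blast
    obtain p where p: "p \<in> P (Suc i)" "b = p \<oplus> a" using a(2)[OF b] by blast
    have c: "w \<in> carrier M" "p \<in> carrier R" using w p pm_carrier P_carrier by blast+
    have v: "v \<in> pm j" using w x(1) pm_anti[of j "Suc j"] submoduleE(5)[OF submodule_pm[of j]] by auto
    have cv: "v \<in> carrier M" by (rule pm_carrier[OF v])
    \<comment> \<open>With \<open>b = p + a\<close> and \<open>v = w + x\<close>, the two error
      terms \<open>p v\<close> and \<open>a w\<close> lie one power deeper. This is the independence
      of representatives.\<close>
    have "b \<odot>\<^bsub>M\<^esub> v = p \<odot>\<^bsub>M\<^esub> v \<oplus>\<^bsub>M\<^esub> (a \<odot>\<^bsub>M\<^esub> w \<oplus>\<^bsub>M\<^esub> a \<odot>\<^bsub>M\<^esub> x)"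
      unfolding p(2) using c ca cx cv by (simp add: smult_l_distr w(2) smult_r_distr M.a_ac)
    then have "b \<odot>\<^bsub>M\<^esub> v \<ominus>\<^bsub>M\<^esub> a \<odot>\<^bsub>M\<^esub> x = p \<odot>\<^bsub>M\<^esub> v \<oplus>\<^bsub>M\<^esub> a \<odot>\<^bsub>M\<^esub> w"
      using c ca cx cv by (simp add: a_minus_def M.a_assoc M.r_neg)
    moreover have "p \<odot>\<^bsub>M\<^esub> v \<in> pm (Suc (i + j))" using pm_smult[OF p(1) v] by simp
    moreover have "a \<odot>\<^bsub>M\<^esub> w \<in> pm (Suc (i + j))" using pm_smult[OF a(1) w(1)] by simp
    ultimately show "b \<odot>\<^bsub>M\<^esub> v \<in> carrier M \<and> b \<odot>\<^bsub>M\<^esub> v \<ominus>\<^bsub>M\<^esub> a \<odot>\<^bsub>M\<^esub> x \<in> pm (Suc (i + j))"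
      using submoduleE(5)[OF submodule_pm] p c ca cv by simp
  qed
  then show ?thesis unfolding gr_comp_carrier using pm_smult[OF a(1) x(1)] by simp
qed

abbreviation "Gr \<equiv> gr_module R \<mm> M"

lemma gr_comp_group: "abelian_group (gr_comp R \<mm> M n)"
  by (rule module.axioms(2)[OF module_gr_comp])

lemma gr_carrierI:
  assumes "\<And>n. f n \<in> carrier (gr_comp R \<mm> M n)" "\<And>n. b \<le> n \<Longrightarrow> f n = \<zero>\<^bsub>gr_comp R \<mm> M n\<^esub>"
  shows "f \<in> carrier Gr"
proof -
  have "{n. f n \<noteq> \<zero>\<^bsub>gr_comp R \<mm> M n\<^esub>} \<subseteq> {..<b}" using assms(2) by (auto simp: not_less[symmetric])
  then have "finite {n. f n \<noteq> \<zero>\<^bsub>gr_comp R \<mm> M n\<^esub>}" by (rule finite_subset) simp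
  then show ?thesis using assms(1) by (simp add: gr_module_def gr_carrier_def)
qed

lemma gr_carrier_bound:
  assumes "f \<in> gr_carrier R \<mm> N"
  obtains b where "\<And>n. b \<le> n \<Longrightarrow> f n = \<zero>\<^bsub>gr_comp R \<mm> N n\<^esub>"
proof -
  have "finite {n. f n \<noteq> \<zero>\<^bsub>gr_comp R \<mm> N n\<^esub>}" using assms by (simp add: gr_carrier_def)
  then obtain b where "\<And>n. n \<in> {n. f n \<noteq> \<zero>\<^bsub>gr_comp R \<mm> N n\<^esub>} \<Longrightarrow> n < b"
    using finite_nat_set_iff_bounded by metis
  then have "f n = \<zero>\<^bsub>gr_comp R \<mm> N n\<^esub>" if "b \<le> n" for n using that by (metis (mono_tags) mem_Collect_eq not_le)
  then show ?thesis using that by blast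
qed

lemma gr_comp_mem: "f \<in> carrier Gr \<Longrightarrow> f n \<in> carrier (gr_comp R \<mm> M n)"
  by (simp add: gr_module_def gr_carrier_def)

lemma gr_zero: "\<zero>\<^bsub>Gr\<^esub> = (\<lambda>n. \<zero>\<^bsub>gr_comp R \<mm> M n\<^esub>)"
  by (simp add: gr_module_def)

lemma gr_add: "f \<oplus>\<^bsub>Gr\<^esub> g = (\<lambda>n. f n \<oplus>\<^bsub>gr_comp R \<mm> M n\<^esub> g n)"
  by (simp add: gr_module_def)

lemma gr_zero_closed: "\<zero>\<^bsub>Gr\<^esub> \<in> carrier Gr"
  unfolding gr_zero by (rule gr_carrierI[of _ 0])
    (simp_all add: abelian_monoid.zero_closed[OF abelian_group.axioms(1)[OF gr_comp_group]])

lemma gr_group: "abelian_group Gr"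
proof (rule abelian_groupI)
  note mon = abelian_group.axioms(1)[OF gr_comp_group]
  show "\<zero>\<^bsub>Gr\<^esub> \<in> carrier Gr" by (rule gr_zero_closed)
  fix f assume f: "f \<in> carrier Gr"
  obtain b where b: "\<And>n. b \<le> n \<Longrightarrow> f n = \<zero>\<^bsub>gr_comp R \<mm> M n\<^esub>"
    using f gr_carrier_bound[of f M] by (auto simp: gr_module_def)
  show "\<zero>\<^bsub>Gr\<^esub> \<oplus>\<^bsub>Gr\<^esub> f = f"
    unfolding gr_zero gr_add using abelian_monoid.l_zero[OF mon gr_comp_mem[OF f]] by simp
  show "\<exists>g\<in>carrier Gr. g \<oplus>\<^bsub>Gr\<^esub> f = \<zero>\<^bsub>Gr\<^esub>"
  proof (rule bexI)
    let ?g = "\<lambda>n. \<ominus>\<^bsub>gr_comp R \<mm> M n\<^esub> f n"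
    have z: "\<ominus>\<^bsub>gr_comp R \<mm> M n\<^esub> \<zero>\<^bsub>gr_comp R \<mm> M n\<^esub> = \<zero>\<^bsub>gr_comp R \<mm> M n\<^esub>" for n
    proof -
      interpret C: abelian_group "gr_comp R \<mm> M n" by (rule gr_comp_group)
      show ?thesis using C.r_neg[OF C.zero_closed] by simp
    qed
    show "?g \<in> carrier Gr"
      by (rule gr_carrierI[of _ b]) (simp_all add: b z abelian_group.a_inv_closed[OF gr_comp_group gr_comp_mem[OF f]])
    show "?g \<oplus>\<^bsub>Gr\<^esub> f = \<zero>\<^bsub>Gr\<^esub>"
      unfolding gr_zero gr_add using abelian_group.l_neg[OF gr_comp_group gr_comp_mem[OF f]] by simp
  qed
  fix g assume g: "g \<in> carrier Gr"
  obtain b' where b': "\<And>n. b' \<le> n \<Longrightarrow> g n = \<zero>\<^bsub>gr_comp R \<mm> M n\<^esub>"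
    using g gr_carrier_bound[of g M] by (auto simp: gr_module_def)
  show "f \<oplus>\<^bsub>Gr\<^esub> g \<in> carrier Gr"
    unfolding gr_add
  proof (rule gr_carrierI[of _ "max b b'"])
    show "f n \<oplus>\<^bsub>gr_comp R \<mm> M n\<^esub> g n \<in> carrier (gr_comp R \<mm> M n)" for n
      by (rule abelian_monoid.a_closed[OF mon gr_comp_mem[OF f] gr_comp_mem[OF g]])
    show "f n \<oplus>\<^bsub>gr_comp R \<mm> M n\<^esub> g n = \<zero>\<^bsub>gr_comp R \<mm> M n\<^esub>" if "max b b' \<le> n" for n
      using that b[of n] b'[of n] abelian_monoid.l_zero[OF mon abelian_monoid.zero_closed[OF mon]] by simp
  qed
  show "f \<oplus>\<^bsub>Gr\<^esub> g = g \<oplus>\<^bsub>Gr\<^esub> f"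
    unfolding gr_add using abelian_monoid.a_comm[OF mon gr_comp_mem[OF f] gr_comp_mem[OF g]] by simp
  fix h assume h: "h \<in> carrier Gr"
  show "f \<oplus>\<^bsub>Gr\<^esub> g \<oplus>\<^bsub>Gr\<^esub> h = f \<oplus>\<^bsub>Gr\<^esub> (g \<oplus>\<^bsub>Gr\<^esub> h)"
    unfolding gr_add using abelian_monoid.a_assoc[OF mon gr_comp_mem[OF f] gr_comp_mem[OF g] gr_comp_mem[OF h]] by simp
qed

lemma gr_act_closed:
  assumes a: "a \<in> carrier (gr_ring R \<mm>)" and f: "f \<in> carrier Gr"
  shows "gr_act R \<mm> M a f \<in> carrier Gr"
proof -
  have a': "a \<in> gr_carrier R \<mm> (ring_module R)" using a by (simp add: gr_ring_def)
  have ac: "a n \<in> carrier (gr_comp R \<mm> (ring_module R) n)" for n using a' by (simp add: gr_carrier_def)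
  obtain b where b: "\<And>n. b \<le> n \<Longrightarrow> a n = P (Suc n)" using gr_carrier_bound[OF a'] gr_ring_zero by metis
  obtain b' where b': "\<And>n. b' \<le> n \<Longrightarrow> f n = \<zero>\<^bsub>gr_comp R \<mm> M n\<^esub>"
    using f gr_carrier_bound[of f M] by (auto simp: gr_module_def)
  have cl: "gr_pairing R \<mm> M n (a i) (f (n - i)) \<in> carrier (gr_comp R \<mm> M n)" if "i \<le> n" for i n
    using gr_pairing_closed[OF ac gr_comp_mem[OF f], of i "n - i"] that by simp
  show ?thesis
  proof (rule gr_carrierI[of _ "b + b'"])
    show "gr_act R \<mm> M a f n \<in> carrier (gr_comp R \<mm> M n)" for n
      unfolding gr_act_def
      by (rule abelian_monoid.finsum_closed[OF abelian_group.axioms(1)[OF gr_comp_group]]) (use cl in auto)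
    fix n assume n: "b + b' \<le> n"
    have "gr_pairing R \<mm> M n (a i) (f (n - i)) = \<zero>\<^bsub>gr_comp R \<mm> M n\<^esub>" if i: "i \<le> n" for i
      unfolding gr_comp_zero
    proof (rule gr_pairing_zero[OF gr_ring_comp(1)[OF ac] gr_comp_nonempty[OF gr_comp_mem[OF f]]])
      fix c x assume c: "c \<in> a i" and x: "x \<in> f (n - i)"
      have ci: "c \<in> P i" using c gr_ring_comp(2)[OF ac] by blast
      have xi: "x \<in> pm (n - i)" using x gr_comp_subset[OF gr_comp_mem[OF f]] by blast
      show "c \<odot>\<^bsub>M\<^esub> x \<in> pm (Suc n)"
      proof (cases "b \<le> i")
        case True
        then have "c \<in> P (Suc i)" using c b by blast
        then show ?thesis using pm_smult[OF _ xi, of c "Suc i"] i by simp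
      next
        case False
        then have "b' \<le> n - i" using n by simp
        then have "x \<in> pm (Suc (n - i))" using x b'[of "n - i"] by (simp add: gr_comp_zero)
        then show ?thesis using pm_smult[OF ci, of x "Suc (n - i)"] i by simp
      qed
    qed
    then show "gr_act R \<mm> M a f n = \<zero>\<^bsub>gr_comp R \<mm> M n\<^esub>"
      unfolding gr_act_def by (intro abelian_group.finsum_all_zero[OF gr_comp_group]) auto
  qed
qed

lemma gr_act_0:
  assumes "gr_pairing R \<mm> M 0 (a 0) (f 0) = \<zero>\<^bsub>gr_comp R \<mm> M 0\<^esub>"
  shows "gr_act R \<mm> M a f 0 = \<zero>\<^bsub>gr_comp R \<mm> M 0\<^esub>"
  unfolding gr_act_def by (rule abelian_group.finsum_all_zero[OF gr_comp_group]) (use assms in simp)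

lemma gr_pairing_right_zero:
  assumes A: "A \<in> carrier (gr_comp R \<mm> (ring_module R) i)" and "i \<le> n"
  shows "gr_pairing R \<mm> M n A \<zero>\<^bsub>gr_comp R \<mm> M (n - i)\<^esub> = \<zero>\<^bsub>gr_comp R \<mm> M n\<^esub>"
  unfolding gr_comp_zero
proof (rule gr_pairing_zero[OF gr_ring_comp(1)[OF A]])
  show "pm (Suc (n - i)) \<noteq> {}" by (rule submoduleE(2)[OF submodule_pm])
  fix c x assume "c \<in> A" "x \<in> pm (Suc (n - i))"
  then show "c \<odot>\<^bsub>M\<^esub> x \<in> pm (Suc n)"
    using pm_smult[of c i x "Suc (n - i)"] gr_ring_comp(2)[OF A] assms(2) by auto
qed

text \<open>The predicate \<open>submodule\<close> amounts to an additive subgroup stable under the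
  action, so the additive group structure of \<open>Gr\<close> is the basis of this criterion.
  Negatives are characterized by the sum being zero, which can be checked degree by degree.\<close>

lemma submodule_gr:
  assumes "H \<subseteq> carrier Gr" "\<zero>\<^bsub>Gr\<^esub> \<in> H" "\<And>f g. f \<in> H \<Longrightarrow> g \<in> H \<Longrightarrow> f \<oplus>\<^bsub>Gr\<^esub> g \<in> H"
    and "\<And>f g. f \<in> H \<Longrightarrow> g \<in> carrier Gr \<Longrightarrow> g \<oplus>\<^bsub>Gr\<^esub> f = \<zero>\<^bsub>Gr\<^esub> \<Longrightarrow> g \<in> H"
    and "\<And>a f. a \<in> carrier (gr_ring R \<mm>) \<Longrightarrow> f \<in> H \<Longrightarrow> gr_act R \<mm> M a f \<in> H"
  shows "submodule H (gr_ring R \<mm>) Gr"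
proof -
  interpret G: abelian_group Gr by (rule gr_group)
  have "subgroup H (add_monoid Gr)"
  proof (rule G.add.subgroupI)
    show "H \<noteq> {}" using assms(2) by blast
    fix f assume f: "f \<in> H"
    have cf: "f \<in> carrier Gr" using f assms(1) by blast
    show "\<ominus>\<^bsub>Gr\<^esub> f \<in> H" by (rule assms(4)[OF f G.a_inv_closed[OF cf] G.l_neg[OF cf]])
  qed (use assms in auto)
  moreover have "a \<odot>\<^bsub>Gr\<^esub> f = gr_act R \<mm> M a f" for a f by (simp add: gr_module_def)
  ultimately show ?thesis using assms(5) by (intro submodule.intro submodule_axioms.intro) simp_all
qed

lemma gr_gen_empty: "gen_submodule (gr_ring R \<mm>) Gr {} = {\<zero>\<^bsub>Gr\<^esub>}"
proof
  interpret G: abelian_group Gr by (rule gr_group)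
  have "submodule {\<zero>\<^bsub>Gr\<^esub>} (gr_ring R \<mm>) Gr"
  proof (rule submodule_gr)
    fix a f assume a: "a \<in> carrier (gr_ring R \<mm>)" and f: "f \<in> {\<zero>\<^bsub>Gr\<^esub>}"
    have ac: "a n \<in> carrier (gr_comp R \<mm> (ring_module R) n)" for n
      using a by (simp add: gr_ring_def gr_carrier_def)
    have "gr_act R \<mm> M a \<zero>\<^bsub>Gr\<^esub> n = \<zero>\<^bsub>Gr\<^esub> n" for n
      unfolding gr_act_def gr_zero
      by (rule abelian_group.finsum_all_zero[OF gr_comp_group]) (use gr_pairing_right_zero[OF ac] in simp)
    then show "gr_act R \<mm> M a f \<in> {\<zero>\<^bsub>Gr\<^esub>}" using f by auto
  qed (auto simp: gr_zero_closed)
  then show "gen_submodule (gr_ring R \<mm>) Gr {} \<subseteq> {\<zero>\<^bsub>Gr\<^esub>}" unfolding gen_submodule_def by blast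
  show "{\<zero>\<^bsub>Gr\<^esub>} \<subseteq> gen_submodule (gr_ring R \<mm>) Gr {}"
    unfolding gen_submodule_def using subgroup.one_closed[OF submodule.axioms(1)] by force
qed

lemma gr_homogeneous:
  assumes v: "v \<in> pm i"
  shows "(\<lambda>n. if n = i then pm (Suc i) +>\<^bsub>M\<^esub> v else \<zero>\<^bsub>gr_comp R \<mm> M n\<^esub>) \<in> carrier Gr"
proof (rule gr_carrierI[of _ "Suc i"])
  fix n
  have "\<zero>\<^bsub>gr_comp R \<mm> M n\<^esub> \<in> carrier (gr_comp R \<mm> M n)"
    by (rule abelian_monoid.zero_closed[OF abelian_group.axioms(1)[OF gr_comp_group]])
  then show "(if n = i then pm (Suc i) +>\<^bsub>M\<^esub> v else \<zero>\<^bsub>gr_comp R \<mm> M n\<^esub>) \<in> carrier (gr_comp R \<mm> M n)"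
    using v by (simp add: gr_comp_carrier)
qed simp

text \<open>Excludes the case in which \<open>depth\<close> is infinite by convention: multiples by
  elements of \<open>gr_plus\<close> vanish in degree 0, whereas the class of \<open>u\<close> does
  not.\<close>

lemma gr_plus_mod_proper:
  assumes u: "u \<in> carrier M" "u \<notin> pm 1"
  shows "ideal_mod (gr_ring R \<mm>) Gr (gr_plus R \<mm>) \<noteq> carrier Gr"
proof -
  let ?H = "{f \<in> carrier Gr. f 0 = \<zero>\<^bsub>gr_comp R \<mm> M 0\<^esub>}"
  interpret G: abelian_group Gr by (rule gr_group)
  interpret C: abelian_group "gr_comp R \<mm> M 0" by (rule gr_comp_group)
  have H: "submodule ?H (gr_ring R \<mm>) Gr"
  proof (rule submodule_gr)
    show "\<zero>\<^bsub>Gr\<^esub> \<in> ?H" using gr_zero_closed by (simp add: gr_zero)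
    fix f g assume f: "f \<in> ?H"
    { assume g: "g \<in> ?H"
      have "(f \<oplus>\<^bsub>Gr\<^esub> g) 0 = \<zero>\<^bsub>gr_comp R \<mm> M 0\<^esub>" unfolding gr_add using f g by simp
      then show "f \<oplus>\<^bsub>Gr\<^esub> g \<in> ?H" using f g by simp }
    assume g: "g \<in> carrier Gr" "g \<oplus>\<^bsub>Gr\<^esub> f = \<zero>\<^bsub>Gr\<^esub>"
    have "(g \<oplus>\<^bsub>Gr\<^esub> f) 0 = \<zero>\<^bsub>gr_comp R \<mm> M 0\<^esub>" unfolding g(2) gr_zero ..
    then have "g 0 \<oplus>\<^bsub>gr_comp R \<mm> M 0\<^esub> \<zero>\<^bsub>gr_comp R \<mm> M 0\<^esub> = \<zero>\<^bsub>gr_comp R \<mm> M 0\<^esub>"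
      unfolding gr_add using f by simp
    then show "g \<in> ?H" using g(1) gr_comp_mem[OF g(1), of 0] by simp
  next
    fix a f assume a: "a \<in> carrier (gr_ring R \<mm>)" and f: "f \<in> ?H"
    have a0: "a 0 \<in> carrier (gr_comp R \<mm> (ring_module R) 0)" using a by (simp add: gr_ring_def gr_carrier_def)
    have "gr_pairing R \<mm> M 0 (a 0) (f 0) = \<zero>\<^bsub>gr_comp R \<mm> M 0\<^esub>"
      using gr_pairing_right_zero[OF a0, of 0] f by simp
    then show "gr_act R \<mm> M a f \<in> ?H" using gr_act_closed[OF a, of f] gr_act_0 f by simp
  qed auto
  have "{a \<odot>\<^bsub>Gr\<^esub> f | a f. a \<in> gr_plus R \<mm> \<and> f \<in> carrier Gr} \<subseteq> ?H"
  proof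
    fix g assume "g \<in> {a \<odot>\<^bsub>Gr\<^esub> f | a f. a \<in> gr_plus R \<mm> \<and> f \<in> carrier Gr}"
    then obtain a f where af: "a \<in> gr_plus R \<mm>" "f \<in> carrier Gr" "g = gr_act R \<mm> M a f"
      by (auto simp: gr_module_def)
    have a: "a \<in> carrier (gr_ring R \<mm>)" using af(1) by (simp add: gr_plus_def)
    have a0: "a 0 = P 1" using af(1) gr_ring_zero[of 0] by (simp add: gr_plus_def gr_ring_def)
    have a0': "a 0 \<in> carrier (gr_comp R \<mm> (ring_module R) 0)" using a by (simp add: gr_ring_def gr_carrier_def)
    have "gr_pairing R \<mm> M 0 (a 0) (f 0) = \<zero>\<^bsub>gr_comp R \<mm> M 0\<^esub>"
      unfolding gr_comp_zero
    proof (rule gr_pairing_zero[OF gr_ring_comp(1)[OF a0'] gr_comp_nonempty[OF gr_comp_mem[OF af(2)]]])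
      fix c x assume "c \<in> a 0" "x \<in> f 0"
      then show "c \<odot>\<^bsub>M\<^esub> x \<in> pm (Suc 0)"
        using pm_smult[of c 1 x 0] a0 gr_comp_subset[OF gr_comp_mem[OF af(2)], of 0] by auto
    qed
    then show "g \<in> ?H" unfolding af(3) using gr_act_closed[OF a af(2)] gr_act_0 by simp
  qed
  then have sub: "ideal_mod (gr_ring R \<mm>) Gr (gr_plus R \<mm>) \<subseteq> ?H"
    unfolding ideal_mod_def gen_submodule_def using H by blast
  let ?F = "\<lambda>n. if n = 0 then pm (Suc 0) +>\<^bsub>M\<^esub> u else \<zero>\<^bsub>gr_comp R \<mm> M n\<^esub>"
  have "?F \<in> carrier Gr" by (rule gr_homogeneous) (simp add: pm_0 u)
  moreover have "pm (Suc 0) +>\<^bsub>M\<^esub> u \<noteq> pm (Suc 0)" using coset_eq_self_iff[OF submodule_pm u(1)] u(2) by simp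
  then have "?F \<notin> ?H" by (simp add: gr_comp_zero)
  ultimately show ?thesis using sub by blast
qed

text \<open>
  Otherwise the initial form of \<open>v\<close> in degree \<open>i\<close> would be a nonzero element of
  \<open>gr\<^sub>\<mm>(M)\<close> annihilated by all homogeneous elements of positive degree.
\<close>

lemma gr_depth_pos:
  assumes depth: "0 < depth (gr_ring R \<mm>) (gr_plus R \<mm>) Gr"
    and ne: "pm 1 \<noteq> carrier M"
    and v: "v \<in> pm i" and ann: "\<And>j a. 0 < j \<Longrightarrow> a \<in> P j \<Longrightarrow> a \<odot>\<^bsub>M\<^esub> v \<in> pm (Suc (j + i))"
  shows "v \<in> pm (Suc i)"
proof -
  obtain u where u: "u \<in> carrier M" "u \<notin> pm 1" using ne pm_carrier by blast
  obtain f where f: "f \<in> gr_plus R \<mm>"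
    and reg: "\<And>F. F \<in> carrier Gr \<Longrightarrow> f \<odot>\<^bsub>Gr\<^esub> F = \<zero>\<^bsub>Gr\<^esub> \<Longrightarrow> F = \<zero>\<^bsub>Gr\<^esub>"
    using depth_pos_regular[OF depth gr_plus_mod_proper[OF u]] unfolding gr_gen_empty by auto
  have fc: "f n \<in> carrier (gr_comp R \<mm> (ring_module R) n)" for n
    using f by (simp add: gr_plus_def gr_ring_def gr_carrier_def)
  have f0: "f 0 = P 1" using f gr_ring_zero[of 0] by (simp add: gr_plus_def gr_ring_def)
  let ?F = "\<lambda>n. if n = i then pm (Suc i) +>\<^bsub>M\<^esub> v else \<zero>\<^bsub>gr_comp R \<mm> M n\<^esub>"
  have cv: "v \<in> carrier M" by (rule pm_carrier[OF v])
  have F: "?F \<in> carrier Gr" by (rule gr_homogeneous[OF v])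
  have "gr_pairing R \<mm> M n (f k) (?F (n - k)) = \<zero>\<^bsub>gr_comp R \<mm> M n\<^esub>" if k: "k \<le> n" for n k
  proof (cases "n - k = i")
    case False
    then show ?thesis using gr_pairing_right_zero[OF fc k] by simp
  next
    case True
    then have n: "n = k + i" using k by simp
    have "gr_pairing R \<mm> M n (f k) (pm (Suc i) +>\<^bsub>M\<^esub> v) = pm (Suc n)"
    proof (rule gr_pairing_zero[OF gr_ring_comp(1)[OF fc]])
      show "pm (Suc i) +>\<^bsub>M\<^esub> v \<noteq> {}" using coset_self[OF submodule_pm cv] by blast
      fix a x assume a: "a \<in> f k" and "x \<in> pm (Suc i) +>\<^bsub>M\<^esub> v"
      then obtain w where w: "w \<in> pm (Suc i)" "x = w \<oplus>\<^bsub>M\<^esub> v" unfolding a_r_coset_def' by blast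
      have ak: "a \<in> P k" using a gr_ring_comp(2)[OF fc] by blast
      have 1: "a \<odot>\<^bsub>M\<^esub> w \<in> pm (Suc n)" using pm_smult[OF ak w(1)] n by simp
      have 2: "a \<odot>\<^bsub>M\<^esub> v \<in> pm (Suc n)"
      \<comment> \<open>The component of \<open>f\<close> in degree 0 is the zero coset, that is
        \<open>\<mm>\<close>, so its representatives raise the degree of \<open>v\<close> by
        one.\<close>
      proof (cases "k = 0")
        case True
        then show ?thesis using pm_smult[of a 1 v i] a f0 v n by simp
      next
        case False
        then show ?thesis using ann[OF _ ak] n by simp
      qed
      have "a \<odot>\<^bsub>M\<^esub> x = a \<odot>\<^bsub>M\<^esub> w \<oplus>\<^bsub>M\<^esub> a \<odot>\<^bsub>M\<^esub> v"
        unfolding w(2) using P_carrier[OF ak] pm_carrier[OF w(1)] cv by (rule smult_r_distr)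
      then show "a \<odot>\<^bsub>M\<^esub> x \<in> pm (Suc n)" using submoduleE(5)[OF submodule_pm 1 2] by simp
    qed
    then show ?thesis unfolding True gr_comp_zero by simp
  qed
  then have "gr_act R \<mm> M f ?F n = \<zero>\<^bsub>Gr\<^esub> n" for n
    unfolding gr_act_def gr_zero by (intro abelian_group.finsum_all_zero[OF gr_comp_group]) simp
  then have "f \<odot>\<^bsub>Gr\<^esub> ?F = \<zero>\<^bsub>Gr\<^esub>" by (simp add: gr_module_def fun_eq_iff)
  from reg[OF F this] have "?F i = \<zero>\<^bsub>gr_comp R \<mm> M i\<^esub>" unfolding gr_zero by (rule fun_cong)
  then show ?thesis using coset_eq_self_iff[OF submodule_pm cv] by (simp add: gr_comp_zero)
qed

end

subsection \<open>Dual modules\<close>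

lemma submodule_kernel:
  assumes M: "module R M" and N: "module R N" and f: "f \<in> lin_maps R M N"
  shows "submodule {x \<in> carrier M. f x = \<zero>\<^bsub>N\<^esub>} R M"
proof -
  interpret M: plain_module R M by (intro plain_module.intro assms)
  interpret N: plain_module R N by (intro plain_module.intro assms)
  have n0: "\<ominus>\<^bsub>N\<^esub> \<zero>\<^bsub>N\<^esub> = \<zero>\<^bsub>N\<^esub>" using N.M.r_neg[OF N.M.zero_closed] by simp
  show ?thesis
    by (rule M.submoduleI) (auto simp: lin_maps_zero[OF M N f] lin_maps_minus[OF M N f] lin_mapsD[OF f] n0)
qed

context local_module begin

abbreviation "D \<equiv> dual_module R M"

lemma module_dual: "module R D"
  unfolding dual_module_def by (rule module_hom[OF module_axioms R.module_ring_module])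

lemma dual_carrier: "carrier D = lin_maps R M (ring_module R) \<inter> extensional (carrier M)"
  by (simp add: dual_module_def hom_module_simps)

lemma dual_zero: "\<zero>\<^bsub>D\<^esub> = (\<lambda>x\<in>carrier M. \<zero>)"
  by (simp add: dual_module_def hom_module_simps)

lemma dual_add: "f \<oplus>\<^bsub>D\<^esub> g = (\<lambda>x\<in>carrier M. f x \<oplus> g x)"
  by (simp add: dual_module_def hom_module_simps)

lemma dual_smult: "a \<odot>\<^bsub>D\<^esub> f = (\<lambda>x\<in>carrier M. a \<otimes> f x)"
  by (simp add: dual_module_def hom_module_simps)

lemma dual_eqI:
  assumes "f \<in> carrier D" "g \<in> carrier D" "\<And>x. x \<in> carrier M \<Longrightarrow> f x = g x"
  shows "f = g"
  by (rule extensionalityI[of f "carrier M"]) (use assms in \<open>auto simp: dual_carrier\<close>)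

lemma dualD:
  assumes "f \<in> carrier D" "x \<in> carrier M"
  shows "f x \<in> carrier R" "y \<in> carrier M \<Longrightarrow> f (x \<oplus>\<^bsub>M\<^esub> y) = f x \<oplus> f y"
    "a \<in> carrier R \<Longrightarrow> f (a \<odot>\<^bsub>M\<^esub> x) = a \<otimes> f x"
  using assms lin_mapsD[of f R M "ring_module R"] by (simp_all add: dual_carrier)

lemma local_module_dual: "local_module R D \<mm>"
  by (intro local_module.intro plain_module.intro module_dual local_ring_axioms)

text \<open>Evaluations at finitely many generators of \<open>M\<close> are jointly injective on the
  dual.\<close>

lemma dual_fin_gen:
  assumes "fin_gen R M" shows "fin_gen R D"
proof -
  interpret D: local_module R D \<mm> by (rule local_module_dual)
  obtain S where S: "finite S" "S \<subseteq> carrier M" "gen_submodule R M S = carrier M"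
    using assms by (auto simp: fin_gen_def generates_def)
  let ?F = "(\<lambda>x (f :: 'm \<Rightarrow> 'r). f x) ` S"
  have "fg_sub R D (carrier D)"
  proof (rule D.fg_sub_of_functionals)
    show "finite ?F" using S by simp
    show "submodule (carrier D) R D" by (rule D.carrier_is_submodule)
    fix \<phi> assume "\<phi> \<in> ?F"
    then obtain x where x: "x \<in> S" "\<phi> = (\<lambda>f. f x)" by blast
    have c: "x \<in> carrier M" using x S by blast
    show "\<phi> \<in> lin_maps R D (ring_module R)"
      unfolding x(2) by (rule lin_mapsI) (simp_all add: dualD c dual_add dual_smult)
  next
    fix f assume f: "f \<in> carrier D" and z: "\<And>\<phi>. \<phi> \<in> ?F \<Longrightarrow> \<phi> f = \<zero>"
    have lf: "f \<in> lin_maps R M (ring_module R)" using f by (simp add: dual_carrier)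
    have fx: "f x = \<zero>" if "x \<in> S" for x using z[of "\<lambda>f. f x"] that by blast
    have K: "submodule {x \<in> carrier M. f x = \<zero>} R M"
      using submodule_kernel[OF module_axioms R.module_ring_module lf] by simp
    have "gen_submodule R M S \<subseteq> {x \<in> carrier M. f x = \<zero>}"
      by (rule gen_submodule_least[OF K]) (use S fx in blast)
    then have "f x = \<zero>" if "x \<in> carrier M" for x using that S(3) by blast
    then show "f = \<zero>\<^bsub>D\<^esub>" by (intro dual_eqI f) (simp_all add: dual_zero[symmetric], simp add: dual_zero)
  qed
  then show ?thesis by (simp add: fin_gen_iff_fg_sub)
qed

lemma dual_regular:
  assumes y: "y \<in> carrier R" and reg: "\<And>x. x \<in> carrier R \<Longrightarrow> y \<otimes> x = \<zero> \<Longrightarrow> x = \<zero>"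
    and f: "f \<in> carrier D" and z: "y \<odot>\<^bsub>D\<^esub> f = \<zero>\<^bsub>D\<^esub>"
  shows "f = \<zero>\<^bsub>D\<^esub>"
proof -
  interpret D: local_module R D \<mm> by (rule local_module_dual)
  have "f x = \<zero>\<^bsub>D\<^esub> x" if x: "x \<in> carrier M" for x
  proof -
    have "(y \<odot>\<^bsub>D\<^esub> f) x = \<zero>\<^bsub>D\<^esub> x" unfolding z ..
    then have "y \<otimes> f x = \<zero>" using x by (simp add: dual_smult dual_zero)
    then show ?thesis using reg[OF dualD(1)[OF f x]] x by (simp add: dual_zero)
  qed
  then show ?thesis by (intro dual_eqI f D.M.zero_closed)
qed

end

context cm1_ring begin

text \<open>A prime \<open>Q \<noteq> \<mm>\<close> is minimal, since \<open>dim R = 1\<close>, hence associated to \<open>R\<close>.\<close>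

lemma nonmaximal_prime_annihilates:
  assumes Q: "primeideal Q R" and y: "y \<in> \<mm>" "y \<notin> Q"
  obtains r where "r \<in> carrier R" "r \<noteq> \<zero>" "\<And>a. a \<in> Q \<Longrightarrow> a \<otimes> r = \<zero>"
proof -
  note iQ = primeideal.axioms(1)[OF Q]
  have "Q \<subseteq> \<mm>" by (rule ideal_subset_m[OF iQ]) (use primeideal.I_notcarr[OF Q] in auto)
  then have Qm: "Q \<subset> \<mm>" using y by blast
  \<comment> \<open>Every element of \<open>Q\<close> becomes nilpotent in the localization at
    \<open>Q\<close>. Otherwise \<open>prime_below\<close> would complete \<open>Q\<close> and
    \<open>\<mm>\<close> to a chain of three primes.\<close>
  have nilp: "\<exists>s n. s \<in> carrier R \<and> s \<notin> Q \<and> s \<otimes> p [^] (n::nat) = \<zero>" if p: "p \<in> Q" for p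
  proof (rule ccontr)
    assume no: "\<not> (\<exists>s n. s \<in> carrier R \<and> s \<notin> Q \<and> s \<otimes> p [^] (n::nat) = \<zero>)"
    obtain P0 where "primeideal P0 R" "P0 \<subset> Q" by (rule prime_below[OF Q p]) (use no in blast)
    then show False using krull_dim_1_chain[OF dim _ Q maximalideal_prime[OF maximal_m]] Qm by blast
  qed
  obtain T where T: "T \<subseteq> carrier R" "finite T" "Q = Idl T" using finitely_gen[OF iQ] by blast
  have TQ: "T \<subseteq> Q" using genideal_self[OF T(1)] T(3) by simp
  have one: "\<one> \<notin> Q" using ideal.one_imp_carrier[OF iQ] primeideal.I_notcarr[OF Q] by blast
  have "\<exists>s\<in>carrier R. s \<notin> Q \<and> (\<forall>p\<in>T'. \<exists>n::nat. s \<otimes> p [^] n = \<zero>)" if "T' \<subseteq> T" for T'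
    using finite_subset[OF that T(2)] that
  proof (induct T')
    case empty show ?case using one by (intro bexI[of _ \<one>]) auto
  next
    case (insert p T')
    then obtain s where s: "s \<in> carrier R" "s \<notin> Q" "\<forall>p\<in>T'. \<exists>n::nat. s \<otimes> p [^] n = \<zero>" by blast
    have p: "p \<in> Q" using insert TQ by blast
    obtain t m where t: "t \<in> carrier R" "t \<notin> Q" "t \<otimes> p [^] (m::nat) = \<zero>" using nilp[OF p] by blast
    have "s \<otimes> t \<notin> Q" using primeideal.I_prime[OF Q s(1) t(1)] s t by blast
    moreover have "\<exists>n::nat. (s \<otimes> t) \<otimes> q [^] n = \<zero>" if q: "q \<in> insert p T'" for q
    proof (cases "q = p")
      case True
      have "(s \<otimes> t) \<otimes> p [^] m = s \<otimes> (t \<otimes> p [^] m)" using s t ideal.Icarr[OF iQ p] by (simp add: m_assoc)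
      then show ?thesis using True t s by (intro exI[of _ m]) simp
    next
      case False
      then have qT: "q \<in> T'" using q by blast
      then obtain n :: nat where n: "s \<otimes> q [^] n = \<zero>" using s by blast
      have cq: "q \<in> carrier R" using qT insert T(1) by blast
      have "(s \<otimes> t) \<otimes> q [^] n = t \<otimes> (s \<otimes> q [^] n)" using s t cq by (simp add: m_ac)
      then show ?thesis using n t by (intro exI[of _ n]) simp
    qed
    ultimately show ?case using s t by (intro bexI[of _ "s \<otimes> t"]) auto
  qed
  from this[OF subset_refl] obtain s where s: "s \<in> carrier R" "s \<notin> Q" "\<forall>p\<in>T. \<exists>n::nat. s \<otimes> p [^] n = \<zero>" by blast
  \<comment> \<open>The annihilator of \<open>s\<close>. It contains a power of \<open>Q\<close>;
    the last power of \<open>Q\<close> not contained in it supplies an \<open>x\<close> such that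
    \<open>r = sx\<close> is nonzero and killed by \<open>Q\<close>.\<close>
  let ?J = "{x \<in> carrier R. s \<otimes> x \<in> {\<zero>}}"
  have J: "ideal ?J R" by (rule ideal.helper_max_prime[OF zeroideal is_cring s(1)])
  have "\<exists>M. \<forall>n\<ge>M. ideal_pow R (Idl T) n \<subseteq> ?J"
  proof (rule ideal_pow_in_graded[OF T(2,1) J])
    fix c x and d :: nat assume c: "c \<in> T" and x: "x \<in> ?J"
    show "c \<otimes> x \<in> ?J" using ideal.I_l_closed[OF J x] c T(1) by blast
  next
    fix c assume c: "c \<in> T"
    have "c \<in> carrier R" using c T(1) by blast
    then show "\<exists>N::nat. c [^] N \<in> ?J" using s(3) c by simp
  qed
  then obtain k where k: "ideal_pow R Q k \<subseteq> ?J" using T(3) by blast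
  let ?q = "\<lambda>n. ideal_pow R Q n \<subseteq> ?J"
  have q0: "\<not> ?q 0"
  proof
    assume "?q 0"
    then have "s \<otimes> \<one> = \<zero>" by (auto simp: ideal_pow_0)
    then show False using s additive_subgroup.zero_closed[OF ideal.axioms(1)[OF iQ]] by simp
  qed
  have L: "?q (LEAST n. ?q n)" by (rule LeastI[of ?q, OF k])
  obtain j where j: "(LEAST n. ?q n) = Suc j" using L q0 by (cases "LEAST n. ?q n") auto
  have "\<not> ?q j" using not_less_Least[of j ?q] j by simp
  then obtain x where x: "x \<in> ideal_pow R Q j" "x \<notin> ?J" by blast
  have cx: "x \<in> carrier R" by (rule ideal.Icarr[OF ideal_ideal_pow[OF iQ] x(1)])
  show ?thesis
  proof (rule that[of "s \<otimes> x"])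
    show "s \<otimes> x \<in> carrier R" using s cx by simp
    show "s \<otimes> x \<noteq> \<zero>" using x(2) cx by simp
    fix a assume a: "a \<in> Q"
    have "a \<otimes> x \<in> ideal_pow R Q (Suc j)" unfolding ideal_pow_Suc[OF iQ] using a x(1) by (rule ideal_prod.prod)
    then have "s \<otimes> (a \<otimes> x) = \<zero>" using L j by auto
    then show "a \<otimes> (s \<otimes> x) = \<zero>" using s cx ideal.Icarr[OF iQ a] by (simp add: m_ac)
  qed
qed

end

locale cm1_module = local_module R M \<mm> + cm1_ring R \<mm>
  for R :: "('r, 'x) ring_scheme" (structure) and M :: "('r, 'm) module" (structure) and \<mm>
begin

text \<open>
  Take a maximal proper submodule \<open>W\<close> such that \<open>y\<close> is regular on \<open>M/W\<close>, and \<open>u \<notin> W\<close>. Then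
  \<open>y\<^sup>jM \<subseteq> W + Ru\<close> for some \<open>j\<close>, and \<open>(W : u)\<close> is a prime that does not contain \<open>y\<close>, hence
  annihilates some \<open>r \<noteq> 0\<close>. The functional sends \<open>v\<close> to \<open>cr\<close>, where \<open>y\<^sup>jv - cu \<in> W\<close>.
\<close>

lemma dual_nonzero:
  assumes fg: "fin_gen R M" and ne: "carrier M \<noteq> {\<zero>\<^bsub>M\<^esub>}" and y: "y \<in> \<mm>"
    and regR: "\<And>x. x \<in> carrier R \<Longrightarrow> y \<otimes> x = \<zero> \<Longrightarrow> x = \<zero>"
    and regM: "\<And>x. x \<in> carrier M \<Longrightarrow> y \<odot>\<^bsub>M\<^esub> x = \<zero>\<^bsub>M\<^esub> \<Longrightarrow> x = \<zero>\<^bsub>M\<^esub>"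
  shows "carrier D \<noteq> {\<zero>\<^bsub>D\<^esub>}"
proof -
  have cy: "y \<in> carrier R" using y m_carrier by blast
  obtain S where S: "finite S" "S \<subseteq> carrier M" "gen_submodule R M S = carrier M"
    using fg by (auto simp: fin_gen_def generates_def)
  let ?F = "{W. submodule W R M \<and> W \<noteq> carrier M \<and> (\<forall>v\<in>carrier M. y \<odot>\<^bsub>M\<^esub> v \<in> W \<longrightarrow> v \<in> W)}"
  have "\<exists>W\<in>?F. \<forall>X\<in>?F. W \<subseteq> X \<longrightarrow> X = W"
  proof (rule subset_Zorn_nonempty)
    have "{\<zero>\<^bsub>M\<^esub>} \<in> ?F" using submodule_null ne regM by auto
    then show "?F \<noteq> {}" by blast
    fix C assume C: "C \<noteq> {}" "subset.chain ?F C"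
    have CF: "X \<in> ?F" if "X \<in> C" for X using C(2) that unfolding pred_on.chain_def by blast
    have dir: "X \<subseteq> Y \<or> Y \<subseteq> X" if "X \<in> C" "Y \<in> C" for X Y using C(2) that unfolding pred_on.chain_def by blast
    have sm: "submodule (\<Union>C) R M"
    proof (rule submoduleI)
      show "\<Union>C \<subseteq> carrier M" using CF submoduleE(1) by blast
      obtain X where "X \<in> C" using C(1) by blast
      then show "\<zero>\<^bsub>M\<^esub> \<in> \<Union>C" using CF[of X] submodule_zero by blast
      fix a assume "a \<in> \<Union>C"
      then obtain X where X: "X \<in> C" "a \<in> X" by blast
      have sX: "submodule X R M" using CF[OF X(1)] by blast
      show "\<ominus>\<^bsub>M\<^esub> a \<in> \<Union>C" using submoduleE(3)[OF sX X(2)] X(1) by blast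
      show "r \<odot>\<^bsub>M\<^esub> a \<in> \<Union>C" if "r \<in> carrier R" for r using submoduleE(4)[OF sX that X(2)] X(1) by blast
      fix b assume "b \<in> \<Union>C"
      then obtain Y where Y: "Y \<in> C" "b \<in> Y" by blast
      have sY: "submodule Y R M" using CF[OF Y(1)] by blast
      from dir[OF X(1) Y(1)] show "a \<oplus>\<^bsub>M\<^esub> b \<in> \<Union>C"
      proof
        assume "X \<subseteq> Y"
        then have "a \<in> Y" using X by blast
        then show ?thesis using submoduleE(5)[OF sY _ Y(2)] Y(1) by blast
      next
        assume "Y \<subseteq> X"
        then have "b \<in> X" using Y by blast
        then show ?thesis using submoduleE(5)[OF sX X(2)] X(1) by blast
      qed
    qed
    \<comment> \<open>A chain exhausting \<open>M\<close> would have a member containing the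
      finitely many generators, hence all of \<open>M\<close>.\<close>
    have "\<Union>C \<noteq> carrier M"
    proof
      assume e: "\<Union>C = carrier M"
      have "S \<subseteq> \<Union>C" using S(2) e by simp
      moreover have "subset.chain UNIV C" using C(2) unfolding pred_on.chain_def by blast
      ultimately obtain X where X: "X \<in> C" "S \<subseteq> X"
        using finite_subset_Union_chain[OF S(1) _ C(1)] by metis
      then have "carrier M \<subseteq> X" using gen_submodule_least[of X S] CF[OF X(1)] S(3) by auto
      then show False using CF[OF X(1)] submoduleE(1)[of X] by blast
    qed
    moreover have "v \<in> \<Union>C" if "v \<in> carrier M" "y \<odot>\<^bsub>M\<^esub> v \<in> \<Union>C" for v using that CF by blast
    ultimately show "\<Union>C \<in> ?F" using sm by blast
  qed
  then obtain W where WF: "W \<in> ?F" and "\<forall>X\<in>?F. W \<subseteq> X \<longrightarrow> X = W" by (rule bexE)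
  then have max: "X = W" if "X \<in> ?F" "W \<subseteq> X" for X using that by blast
  have W: "submodule W R M" and W_ne: "W \<noteq> carrier M" using WF by auto
  note cW = submoduleE(1)[OF W, THEN subsetD]
  have sat1: "v \<in> W" if "v \<in> carrier M" "y \<odot>\<^bsub>M\<^esub> v \<in> W" for v using WF that by blast
  have sat: "v \<in> W" if "v \<in> carrier M" "y [^] (j::nat) \<odot>\<^bsub>M\<^esub> v \<in> W" for v j
    using that
  proof (induct j arbitrary: v)
    case (Suc j)
    have "y [^] j \<odot>\<^bsub>M\<^esub> (y \<odot>\<^bsub>M\<^esub> v) \<in> W" using Suc(2,3) cy by (simp add: smult_assoc1[symmetric])
    then have "y \<odot>\<^bsub>M\<^esub> v \<in> W" using Suc(1)[of "y \<odot>\<^bsub>M\<^esub> v"] Suc(2) cy by blast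
    then show ?case using sat1 Suc(2) by blast
  qed simp
  have yM: "y [^] (k::nat) \<odot>\<^bsub>M\<^esub> (y [^] (j::nat) \<odot>\<^bsub>M\<^esub> v) = y [^] (k + j) \<odot>\<^bsub>M\<^esub> v" if "v \<in> carrier M" for j k v
    using that cy by (simp add: smult_assoc1[symmetric] R.nat_pow_mult)
  \<comment> \<open>The elements that a power of \<open>y\<close> moves into \<open>W + Rb\<close>
    form a submodule closed under division by \<open>y\<close> and strictly larger than
    \<open>W\<close>. By maximality it is all of \<open>M\<close>.\<close>
  have absorb: "\<exists>j::nat. y [^] j \<odot>\<^bsub>M\<^esub> v \<in> W <+>\<^bsub>M\<^esub> cyclic R M b" if b: "b \<in> carrier M" "b \<notin> W" and v: "v \<in> carrier M" for b v
  proof -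
    let ?B = "W <+>\<^bsub>M\<^esub> cyclic R M b"
    have B: "submodule ?B R M" by (rule submodule_set_add[OF W submodule_cyclic[OF b(1)]])
    let ?X = "{v \<in> carrier M. \<exists>j::nat. y [^] j \<odot>\<^bsub>M\<^esub> v \<in> ?B}"
    have up: "y [^] (k + j) \<odot>\<^bsub>M\<^esub> w \<in> ?B" if "w \<in> carrier M" "y [^] j \<odot>\<^bsub>M\<^esub> w \<in> ?B" for w and j k :: nat
      using submoduleE(4)[OF B _ that(2), of "y [^] k"] yM[OF that(1)] cy by simp
    have X: "submodule ?X R M"
    proof (rule submoduleI)
      show "?X \<subseteq> carrier M" by blast
      show "\<zero>\<^bsub>M\<^esub> \<in> ?X" using submodule_zero[OF B] by (auto intro: exI[of _ 0])
      fix w assume w: "w \<in> ?X"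
      then obtain j :: nat where j: "w \<in> carrier M" "y [^] j \<odot>\<^bsub>M\<^esub> w \<in> ?B" by blast
      have "y [^] j \<odot>\<^bsub>M\<^esub> (\<ominus>\<^bsub>M\<^esub> w) \<in> ?B" using submoduleE(3)[OF B j(2)] j(1) cy by (simp add: smult_r_minus)
      then show "\<ominus>\<^bsub>M\<^esub> w \<in> ?X" using j(1) by blast
      show "r \<odot>\<^bsub>M\<^esub> w \<in> ?X" if r: "r \<in> carrier R" for r
      proof -
        have "y [^] j \<odot>\<^bsub>M\<^esub> (r \<odot>\<^bsub>M\<^esub> w) = r \<odot>\<^bsub>M\<^esub> (y [^] j \<odot>\<^bsub>M\<^esub> w)"
          using r j(1) cy by (simp add: smult_assoc1[symmetric] R.m_comm)
        then have "y [^] j \<odot>\<^bsub>M\<^esub> (r \<odot>\<^bsub>M\<^esub> w) \<in> ?B" using submoduleE(4)[OF B r j(2)] by simp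
        then show ?thesis using r j(1) by blast
      qed
      fix w' assume "w' \<in> ?X"
      then obtain j' :: nat where j': "w' \<in> carrier M" "y [^] j' \<odot>\<^bsub>M\<^esub> w' \<in> ?B" by blast
      have "y [^] (j + j') \<odot>\<^bsub>M\<^esub> w' \<in> ?B" "y [^] (j + j') \<odot>\<^bsub>M\<^esub> w \<in> ?B"
        using up[OF j'(1,2), of j] up[OF j(1,2), of j'] by (simp_all add: add.commute)
      then have "y [^] (j + j') \<odot>\<^bsub>M\<^esub> (w \<oplus>\<^bsub>M\<^esub> w') \<in> ?B"
        using submoduleE(5)[OF B] j(1) j'(1) cy by (simp add: smult_r_distr)
      then show "w \<oplus>\<^bsub>M\<^esub> w' \<in> ?X" using j(1) j'(1) by blast
    qed
    have in0: "w \<in> ?X" if w: "w \<in> ?B" for w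
    proof -
      have cw: "w \<in> carrier M" using w submoduleE(1)[OF B] by blast
      then have "y [^] (0::nat) \<odot>\<^bsub>M\<^esub> w \<in> ?B" using w by simp
      then show ?thesis using cw by blast
    qed
    have WX: "W \<subseteq> ?X" using in0 set_add_upper1[OF W submodule_cyclic[OF b(1)]] by blast
    have bX: "b \<in> ?X" using in0 set_add_upper2[OF W submodule_cyclic[OF b(1)]] cyclic_self[OF b(1)] by blast
    have "w \<in> ?X" if w: "w \<in> carrier M" and yw: "y \<odot>\<^bsub>M\<^esub> w \<in> ?X" for w
    proof -
      from yw obtain j :: nat where "y [^] j \<odot>\<^bsub>M\<^esub> (y \<odot>\<^bsub>M\<^esub> w) \<in> ?B" by blast
      then have "y [^] Suc j \<odot>\<^bsub>M\<^esub> w \<in> ?B" using w cy by (simp add: smult_assoc1[symmetric])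
      then show ?thesis using w by blast
    qed
    then have "?X = carrier M" using max[of ?X] X WX bX b(2) by blast
    then show ?thesis using v by blast
  qed
  obtain u where u: "u \<in> carrier M" "u \<notin> W" using W_ne submoduleE(1)[OF W] by blast
  define A where "A = {a \<in> carrier R. \<forall>x\<in>{u}. a \<odot>\<^bsub>M\<^esub> x \<in> W}"
  have iA: "ideal A R" unfolding A_def by (rule ideal_annihilator_mod[OF W]) (use u in simp)
  have A_iff: "a \<in> A \<longleftrightarrow> a \<odot>\<^bsub>M\<^esub> u \<in> W" if "a \<in> carrier R" for a using that by (simp add: A_def)
  \<comment> \<open>If \<open>bu \<notin> W\<close>, then some \<open>y^j u\<close> lies in
    \<open>W + R(bu)\<close>. Multiplying by \<open>a\<close> with \<open>ab \<in> A\<close> gives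
    \<open>y^j(au) \<in> W\<close>, and then \<open>au \<in> W\<close>.\<close>
  have pA: "primeideal A R"
  proof (rule primeidealI[OF iA R.is_cring])
    show "carrier R \<noteq> A" using A_iff[OF R.one_closed] u by auto
    fix a b assume ab: "a \<in> carrier R" "b \<in> carrier R" "a \<otimes> b \<in> A"
    show "a \<in> A \<or> b \<in> A"
    proof (rule ccontr)
      assume no: "\<not> (a \<in> A \<or> b \<in> A)"
      then have bu: "b \<odot>\<^bsub>M\<^esub> u \<notin> W" using A_iff ab by blast
      have cbu: "b \<odot>\<^bsub>M\<^esub> u \<in> carrier M" using ab u by simp
      obtain j :: nat where "y [^] j \<odot>\<^bsub>M\<^esub> u \<in> W <+>\<^bsub>M\<^esub> cyclic R M (b \<odot>\<^bsub>M\<^esub> u)"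
        using absorb[OF cbu bu u(1)] by blast
      then obtain w c where wc: "w \<in> W" "c \<in> carrier R" "y [^] j \<odot>\<^bsub>M\<^esub> u = w \<oplus>\<^bsub>M\<^esub> c \<odot>\<^bsub>M\<^esub> (b \<odot>\<^bsub>M\<^esub> u)"
        unfolding set_add_def' cyclic_def by blast
      have "y [^] j \<odot>\<^bsub>M\<^esub> (a \<odot>\<^bsub>M\<^esub> u) = a \<odot>\<^bsub>M\<^esub> (y [^] j \<odot>\<^bsub>M\<^esub> u)"
        using ab u cy by (simp add: smult_assoc1[symmetric] R.m_comm)
      also have "\<dots> = a \<odot>\<^bsub>M\<^esub> w \<oplus>\<^bsub>M\<^esub> a \<odot>\<^bsub>M\<^esub> (c \<odot>\<^bsub>M\<^esub> (b \<odot>\<^bsub>M\<^esub> u))"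
        unfolding wc(3) using ab wc cW cbu by (intro smult_r_distr) auto
      also have "a \<odot>\<^bsub>M\<^esub> (c \<odot>\<^bsub>M\<^esub> (b \<odot>\<^bsub>M\<^esub> u)) = c \<odot>\<^bsub>M\<^esub> ((a \<otimes> b) \<odot>\<^bsub>M\<^esub> u)"
        using ab wc u by (simp add: smult_assoc1[symmetric] R.m_ac)
      finally have e: "y [^] j \<odot>\<^bsub>M\<^esub> (a \<odot>\<^bsub>M\<^esub> u) = a \<odot>\<^bsub>M\<^esub> w \<oplus>\<^bsub>M\<^esub> c \<odot>\<^bsub>M\<^esub> ((a \<otimes> b) \<odot>\<^bsub>M\<^esub> u)" .
      have "(a \<otimes> b) \<odot>\<^bsub>M\<^esub> u \<in> W" using A_iff[of "a \<otimes> b"] ab by simp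
      then have "y [^] j \<odot>\<^bsub>M\<^esub> (a \<odot>\<^bsub>M\<^esub> u) \<in> W"
        unfolding e using submoduleE(4)[OF W ab(1) wc(1)] submoduleE(4)[OF W wc(2)] submoduleE(5)[OF W] by blast
      then have "a \<odot>\<^bsub>M\<^esub> u \<in> W" using sat[of "a \<odot>\<^bsub>M\<^esub> u" j] ab(1) u(1) by blast
      then show False using no A_iff ab(1) by blast
    qed
  qed
  have yA: "y \<notin> A" using A_iff[OF cy] sat1[OF u(1)] u(2) by blast
  obtain r where r: "r \<in> carrier R" "r \<noteq> \<zero>" "\<And>a. a \<in> A \<Longrightarrow> a \<otimes> r = \<zero>"
    using nonmaximal_prime_annihilates[OF pA y yA] by blast
  let ?B = "W <+>\<^bsub>M\<^esub> cyclic R M u"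
  have B: "submodule ?B R M" by (rule submodule_set_add[OF W submodule_cyclic[OF u(1)]])
  \<comment> \<open>A functional on all of \<open>M\<close> needs one exponent for all elements; one
    that works for the generators does.\<close>
  have "\<exists>J::nat. \<forall>x\<in>S'. y [^] J \<odot>\<^bsub>M\<^esub> x \<in> ?B" if "S' \<subseteq> S" for S'
    using finite_subset[OF that S(1)] that
  proof (induct S')
    case (insert x S')
    then obtain J :: nat where J: "\<forall>x\<in>S'. y [^] J \<odot>\<^bsub>M\<^esub> x \<in> ?B" by blast
    have x: "x \<in> carrier M" using insert S(2) by blast
    obtain j :: nat where j: "y [^] j \<odot>\<^bsub>M\<^esub> x \<in> ?B" using absorb[OF u x] by blast
    have "y [^] (J + j) \<odot>\<^bsub>M\<^esub> w \<in> ?B" if w: "w \<in> insert x S'" for w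
    proof (cases "w = x")
      case True
      then show ?thesis using submoduleE(4)[OF B _ j, of "y [^] J"] yM[OF x] cy by simp
    next
      case False
      then have "w \<in> S'" "w \<in> carrier M" using w insert S(2) by auto
      then show ?thesis using submoduleE(4)[OF B, of "y [^] j" "y [^] J \<odot>\<^bsub>M\<^esub> w"] J yM[of w j J] cy by (simp add: add.commute)
    qed
    then show ?case by blast
  qed simp
  from this[OF subset_refl] obtain J :: nat where J: "\<forall>x\<in>S. y [^] J \<odot>\<^bsub>M\<^esub> x \<in> ?B" by blast
  have cyJ: "y [^] J \<in> carrier R" using cy by simp
  have "S \<subseteq> {x \<in> carrier M. \<forall>a\<in>{y [^] J}. a \<odot>\<^bsub>M\<^esub> x \<in> ?B}" using J S(2) by auto
  then have "carrier M \<subseteq> {x \<in> carrier M. \<forall>a\<in>{y [^] J}. a \<odot>\<^bsub>M\<^esub> x \<in> ?B}"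
    using gen_submodule_least[OF submodule_colon[OF B, of "{y [^] J}"], of S] S(3) cyJ by simp
  then have yJ: "y [^] J \<odot>\<^bsub>M\<^esub> x \<in> ?B" if "x \<in> carrier M" for x using that by blast
  define rel where "rel v c \<longleftrightarrow> c \<in> carrier R \<and> y [^] J \<odot>\<^bsub>M\<^esub> v \<ominus>\<^bsub>M\<^esub> c \<odot>\<^bsub>M\<^esub> u \<in> W" for v c
  have rel_ex: "\<exists>c. rel v c" if v: "v \<in> carrier M" for v
  proof -
    obtain w c where wc: "w \<in> W" "c \<in> carrier R" "y [^] J \<odot>\<^bsub>M\<^esub> v = w \<oplus>\<^bsub>M\<^esub> c \<odot>\<^bsub>M\<^esub> u"
      using yJ[OF v] unfolding set_add_def' cyclic_def by blast
    have "y [^] J \<odot>\<^bsub>M\<^esub> v \<ominus>\<^bsub>M\<^esub> c \<odot>\<^bsub>M\<^esub> u = w" unfolding wc(3) using wc cW u by (simp add: a_minus_def M.a_assoc M.r_neg)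
    then show ?thesis using wc by (auto simp: rel_def)
  qed
  \<comment> \<open>Two choices of \<open>c\<close> differ by an element of \<open>A\<close>, which
    annihilates \<open>r\<close>, so \<open>cr\<close> is well defined although \<open>c\<close> is
    not.\<close>
  have rel_uniq: "c \<otimes> r = c' \<otimes> r" if v: "v \<in> carrier M" and c: "rel v c" "rel v c'" for v c c'
  proof -
    have cc: "c \<in> carrier R" "c' \<in> carrier R" using c by (auto simp: rel_def)
    have "(c \<ominus> c') \<odot>\<^bsub>M\<^esub> u = (y [^] J \<odot>\<^bsub>M\<^esub> v \<ominus>\<^bsub>M\<^esub> c' \<odot>\<^bsub>M\<^esub> u) \<ominus>\<^bsub>M\<^esub> (y [^] J \<odot>\<^bsub>M\<^esub> v \<ominus>\<^bsub>M\<^esub> c \<odot>\<^bsub>M\<^esub> u)"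
    proof -
      let ?t = "y [^] J \<odot>\<^bsub>M\<^esub> v" and ?p = "c \<odot>\<^bsub>M\<^esub> u" and ?q = "c' \<odot>\<^bsub>M\<^esub> u"
      have car: "?t \<in> carrier M" "?p \<in> carrier M" "?q \<in> carrier M" using cc u v cyJ by simp_all
      have "(?t \<ominus>\<^bsub>M\<^esub> ?q) \<ominus>\<^bsub>M\<^esub> (?t \<ominus>\<^bsub>M\<^esub> ?p) = ?p \<oplus>\<^bsub>M\<^esub> \<ominus>\<^bsub>M\<^esub> ?q"
        using car by (simp add: a_minus_def M.minus_add M.a_ac M.r_neg M.r_neg1 M.r_neg2)
      then show ?thesis using cc u by (simp add: R.minus_eq smult_l_distr smult_l_minus)
    qed
    also have "\<dots> \<in> W" using c submodule_diff[OF W] by (auto simp: rel_def)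
    finally have "c \<ominus> c' \<in> A" using A_iff[of "c \<ominus> c'"] cc by simp
    then have "(c \<ominus> c') \<otimes> r = \<zero>" by (rule r(3))
    then have "c \<otimes> r \<ominus> c' \<otimes> r = \<zero>" using cc r(1) by (simp add: R.minus_eq R.l_distr R.l_minus)
    then show ?thesis using cc r(1) by simp
  qed
  define g where "g v = (SOME c. rel v c)" for v
  have g: "rel v (g v)" if "v \<in> carrier M" for v unfolding g_def using rel_ex[OF that] by (rule someI_ex)
  have gc: "g v \<in> carrier R" if "v \<in> carrier M" for v using g[OF that] by (simp add: rel_def)
  define f where "f = (\<lambda>v\<in>carrier M. g v \<otimes> r)"
  have "f \<in> lin_maps R M (ring_module R)"
  proof (rule lin_mapsI)
    fix v assume v: "v \<in> carrier M"
    show "f v \<in> carrier (ring_module R)" using v gc r by (simp add: f_def)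
    { fix v' assume v': "v' \<in> carrier M"
      have "y [^] J \<odot>\<^bsub>M\<^esub> (v \<oplus>\<^bsub>M\<^esub> v') \<ominus>\<^bsub>M\<^esub> (g v \<oplus> g v') \<odot>\<^bsub>M\<^esub> u
          = (y [^] J \<odot>\<^bsub>M\<^esub> v \<ominus>\<^bsub>M\<^esub> g v \<odot>\<^bsub>M\<^esub> u) \<oplus>\<^bsub>M\<^esub> (y [^] J \<odot>\<^bsub>M\<^esub> v' \<ominus>\<^bsub>M\<^esub> g v' \<odot>\<^bsub>M\<^esub> u)"
        using v v' gc u cyJ by (simp add: a_minus_def smult_l_distr smult_r_distr M.minus_add M.a_ac)
      then have "rel (v \<oplus>\<^bsub>M\<^esub> v') (g v \<oplus> g v')"
        using g[OF v] g[OF v'] submoduleE(5)[OF W] by (simp add: rel_def)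
      then have "g (v \<oplus>\<^bsub>M\<^esub> v') \<otimes> r = (g v \<oplus> g v') \<otimes> r"
        using rel_uniq[of "v \<oplus>\<^bsub>M\<^esub> v'"] g[of "v \<oplus>\<^bsub>M\<^esub> v'"] v v' by blast
      then show "f (v \<oplus>\<^bsub>M\<^esub> v') = f v \<oplus>\<^bsub>ring_module R\<^esub> f v'"
        using v v' gc r(1) by (simp add: f_def R.l_distr) }
    fix a assume a: "a \<in> carrier R"
    have "y [^] J \<odot>\<^bsub>M\<^esub> (a \<odot>\<^bsub>M\<^esub> v) \<ominus>\<^bsub>M\<^esub> (a \<otimes> g v) \<odot>\<^bsub>M\<^esub> u = a \<odot>\<^bsub>M\<^esub> (y [^] J \<odot>\<^bsub>M\<^esub> v \<ominus>\<^bsub>M\<^esub> g v \<odot>\<^bsub>M\<^esub> u)"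
    proof -
      have "y [^] J \<odot>\<^bsub>M\<^esub> (a \<odot>\<^bsub>M\<^esub> v) = a \<odot>\<^bsub>M\<^esub> (y [^] J \<odot>\<^bsub>M\<^esub> v)"
        using a v cyJ by (simp add: smult_assoc1[symmetric] R.m_comm)
      then show ?thesis using a v gc u cyJ by (simp add: a_minus_def smult_r_distr smult_r_minus smult_assoc1)
    qed
    then have "rel (a \<odot>\<^bsub>M\<^esub> v) (a \<otimes> g v)"
      using g[OF v] submoduleE(4)[OF W a] a by (simp add: rel_def)
    then have "g (a \<odot>\<^bsub>M\<^esub> v) \<otimes> r = (a \<otimes> g v) \<otimes> r"
      using rel_uniq[of "a \<odot>\<^bsub>M\<^esub> v"] g[of "a \<odot>\<^bsub>M\<^esub> v"] v a by blast
    then show "f (a \<odot>\<^bsub>M\<^esub> v) = a \<odot>\<^bsub>ring_module R\<^esub> f v"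
      using v a gc r(1) by (simp add: f_def R.m_assoc)
  qed
  then have fD: "f \<in> carrier D" by (simp add: dual_carrier f_def)
  have "rel u (y [^] J)" using cyJ u submodule_zero[OF W] by (simp add: rel_def a_minus_def M.r_neg)
  then have "f u = y [^] J \<otimes> r" using rel_uniq[OF u(1) g[OF u(1)]] u(1) by (simp add: f_def)
  moreover have "y [^] k \<otimes> r \<noteq> \<zero>" for k :: nat
  proof (induct k)
    case 0 then show ?case using r by simp
  next
    case (Suc k)
    have "y [^] Suc k \<otimes> r = y \<otimes> (y [^] k \<otimes> r)" using cy r by (simp add: R.m_ac)
    then show ?case using regR[of "y [^] k \<otimes> r"] Suc cy r by auto
  qed
  ultimately have "f u \<noteq> \<zero>" by simp
  moreover have "\<zero>\<^bsub>D\<^esub> u = \<zero>" using u(1) by (simp add: dual_zero)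
  ultimately have "f \<noteq> \<zero>\<^bsub>D\<^esub>" by metis
  then show ?thesis using fD by blast
qed

end

subsection \<open>Free resolutions\<close>

lemma free_module_simps:
  "carrier (free_module R n) = {..<n} \<rightarrow>\<^sub>E carrier R"
  "\<zero>\<^bsub>free_module R n\<^esub> = (\<lambda>i\<in>{..<n}. \<zero>\<^bsub>R\<^esub>)"
  "u \<oplus>\<^bsub>free_module R n\<^esub> v = (\<lambda>i\<in>{..<n}. u i \<oplus>\<^bsub>R\<^esub> v i)"
  "a \<odot>\<^bsub>free_module R n\<^esub> u = (\<lambda>i\<in>{..<n}. a \<otimes>\<^bsub>R\<^esub> u i)"
  by (simp_all add: free_module_def)

lemma free_restrict:
  assumes "x \<in> carrier (free_module R (Suc n))"
  shows "restrict x {..<n} \<in> carrier (free_module R n)" "x n \<in> carrier R"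
proof -
  have x: "x i \<in> carrier R" if "i < Suc n" for i
    using assms that PiE_mem[of x "{..<Suc n}" "\<lambda>_. carrier R" i] by (simp add: free_module_simps)
  show "restrict x {..<n} \<in> carrier (free_module R n)"
    using x by (simp add: free_module_simps restrict_PiE_iff)
  show "x n \<in> carrier R" using x by simp
qed

lemma (in cring) module_free: "module R (free_module R n)"
proof (rule moduleI)
  note S = free_module_simps
  have ext: "u = v" if "u \<in> extensional {..<n}" "v \<in> extensional {..<n}" "\<And>i. i < n \<Longrightarrow> u i = v i" for u v :: "nat \<Rightarrow> 'a"
    by (rule extensionalityI[OF that(1,2)]) (use that(3) in simp)
  have mem: "u i \<in> carrier R" if "u \<in> {..<n} \<rightarrow>\<^sub>E carrier R" "i < n" for u i using that by auto
  have e: "u \<in> extensional {..<n}" if "u \<in> {..<n} \<rightarrow>\<^sub>E carrier R" for u :: "nat \<Rightarrow> 'a"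
    using that by (simp add: PiE_def)
  show "cring R" by (rule is_cring)
  show "abelian_group (free_module R n)"
  proof (rule abelian_groupI)
    show "\<zero>\<^bsub>free_module R n\<^esub> \<in> carrier (free_module R n)" by (simp add: S)
    fix u assume u: "u \<in> carrier (free_module R n)"
    then have u': "u \<in> {..<n} \<rightarrow>\<^sub>E carrier R" by (simp add: S)
    show "\<zero>\<^bsub>free_module R n\<^esub> \<oplus>\<^bsub>free_module R n\<^esub> u = u"
      by (rule ext) (simp_all add: S e[OF u'] mem[OF u'])
    show "\<exists>v\<in>carrier (free_module R n). v \<oplus>\<^bsub>free_module R n\<^esub> u = \<zero>\<^bsub>free_module R n\<^esub>"
    proof (rule bexI)
      let ?v = "\<lambda>i\<in>{..<n}. \<ominus> u i"
      show "?v \<in> carrier (free_module R n)" using mem[OF u'] by (simp add: S)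
      show "?v \<oplus>\<^bsub>free_module R n\<^esub> u = \<zero>\<^bsub>free_module R n\<^esub>"
        by (rule ext) (simp_all add: S mem[OF u'] l_neg)
    qed
    fix v assume v: "v \<in> carrier (free_module R n)"
    then have v': "v \<in> {..<n} \<rightarrow>\<^sub>E carrier R" by (simp add: S)
    show "u \<oplus>\<^bsub>free_module R n\<^esub> v \<in> carrier (free_module R n)" using mem[OF u'] mem[OF v'] by (simp add: S)
    show "u \<oplus>\<^bsub>free_module R n\<^esub> v = v \<oplus>\<^bsub>free_module R n\<^esub> u"
      by (rule ext) (simp_all add: S mem[OF u'] mem[OF v'] a_comm)
    fix w assume w: "w \<in> carrier (free_module R n)"
    then have w': "w \<in> {..<n} \<rightarrow>\<^sub>E carrier R" by (simp add: S)
    show "u \<oplus>\<^bsub>free_module R n\<^esub> v \<oplus>\<^bsub>free_module R n\<^esub> w = u \<oplus>\<^bsub>free_module R n\<^esub> (v \<oplus>\<^bsub>free_module R n\<^esub> w)"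
      by (rule ext) (simp_all add: S mem[OF u'] mem[OF v'] mem[OF w'] a_assoc)
  qed
  fix u assume u: "u \<in> carrier (free_module R n)"
  then have u': "u \<in> {..<n} \<rightarrow>\<^sub>E carrier R" by (simp add: S)
  show "\<one> \<odot>\<^bsub>free_module R n\<^esub> u = u"
    by (rule ext) (simp_all add: S e[OF u'] mem[OF u'])
  fix a assume a: "a \<in> carrier R"
  show "a \<odot>\<^bsub>free_module R n\<^esub> u \<in> carrier (free_module R n)" using a mem[OF u'] by (simp add: S)
  { fix v assume v: "v \<in> carrier (free_module R n)"
    then have v': "v \<in> {..<n} \<rightarrow>\<^sub>E carrier R" by (simp add: S)
    show "a \<odot>\<^bsub>free_module R n\<^esub> (u \<oplus>\<^bsub>free_module R n\<^esub> v) =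
        a \<odot>\<^bsub>free_module R n\<^esub> u \<oplus>\<^bsub>free_module R n\<^esub> a \<odot>\<^bsub>free_module R n\<^esub> v"
      by (rule ext) (simp_all add: S mem[OF u'] mem[OF v'] a r_distr) }
  fix b assume b: "b \<in> carrier R"
  show "(a \<oplus> b) \<odot>\<^bsub>free_module R n\<^esub> u = a \<odot>\<^bsub>free_module R n\<^esub> u \<oplus>\<^bsub>free_module R n\<^esub> b \<odot>\<^bsub>free_module R n\<^esub> u"
    by (rule ext) (simp_all add: S mem[OF u'] a b l_distr)
  show "(a \<otimes> b) \<odot>\<^bsub>free_module R n\<^esub> u = a \<odot>\<^bsub>free_module R n\<^esub> (b \<odot>\<^bsub>free_module R n\<^esub> u)"
    by (rule ext) (simp_all add: S mem[OF u'] a b m_assoc)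
qed

lemma (in plain_module) lin_extend:
  assumes \<phi>: "\<phi> \<in> lin_maps R (free_module R n) M" and w: "w \<in> carrier M"
  shows "(\<lambda>x. \<phi> (restrict x {..<n}) \<oplus>\<^bsub>M\<^esub> x n \<odot>\<^bsub>M\<^esub> w) \<in> lin_maps R (free_module R (Suc n)) M"
proof (rule lin_mapsI)
  note S = free_module_simps
  note r = free_restrict[of _ R n]
  fix x assume x: "x \<in> carrier (free_module R (Suc n))"
  show "\<phi> (restrict x {..<n}) \<oplus>\<^bsub>M\<^esub> x n \<odot>\<^bsub>M\<^esub> w \<in> carrier M"
    using lin_mapsD(1)[OF \<phi> r(1)[OF x]] r(2)[OF x] w by simp
  { fix y assume y: "y \<in> carrier (free_module R (Suc n))"
    have e: "restrict (x \<oplus>\<^bsub>free_module R (Suc n)\<^esub> y) {..<n} = restrict x {..<n} \<oplus>\<^bsub>free_module R n\<^esub> restrict y {..<n}"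
      by (auto simp: S fun_eq_iff)
    have e': "(x \<oplus>\<^bsub>free_module R (Suc n)\<^esub> y) n = x n \<oplus> y n" by (simp add: S)
    show "\<phi> (restrict (x \<oplus>\<^bsub>free_module R (Suc n)\<^esub> y) {..<n}) \<oplus>\<^bsub>M\<^esub> (x \<oplus>\<^bsub>free_module R (Suc n)\<^esub> y) n \<odot>\<^bsub>M\<^esub> w =
      \<phi> (restrict x {..<n}) \<oplus>\<^bsub>M\<^esub> x n \<odot>\<^bsub>M\<^esub> w \<oplus>\<^bsub>M\<^esub> (\<phi> (restrict y {..<n}) \<oplus>\<^bsub>M\<^esub> y n \<odot>\<^bsub>M\<^esub> w)"
      unfolding e e' lin_mapsD(2)[OF \<phi> r(1)[OF x] r(1)[OF y]]
      using lin_mapsD(1)[OF \<phi> r(1)[OF x]] lin_mapsD(1)[OF \<phi> r(1)[OF y]] r(2)[OF x] r(2)[OF y] w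
      by (simp add: smult_l_distr M.a_ac) }
  fix a assume a: "a \<in> carrier R"
  have e: "restrict (a \<odot>\<^bsub>free_module R (Suc n)\<^esub> x) {..<n} = a \<odot>\<^bsub>free_module R n\<^esub> restrict x {..<n}"
    by (auto simp: S fun_eq_iff)
  have e': "(a \<odot>\<^bsub>free_module R (Suc n)\<^esub> x) n = a \<otimes> x n" by (simp add: S)
  show "\<phi> (restrict (a \<odot>\<^bsub>free_module R (Suc n)\<^esub> x) {..<n}) \<oplus>\<^bsub>M\<^esub> (a \<odot>\<^bsub>free_module R (Suc n)\<^esub> x) n \<odot>\<^bsub>M\<^esub> w =
      a \<odot>\<^bsub>M\<^esub> (\<phi> (restrict x {..<n}) \<oplus>\<^bsub>M\<^esub> x n \<odot>\<^bsub>M\<^esub> w)"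
    unfolding e e' lin_mapsD(3)[OF \<phi> r(1)[OF x] a]
    using lin_mapsD(1)[OF \<phi> r(1)[OF x]] r(2)[OF x] w a
    by (simp add: smult_r_distr smult_assoc1)
qed

lemma (in plain_module) lin_map_onto_fg:
  assumes "fg_sub R M A"
  shows "\<exists>n \<phi>. \<phi> \<in> lin_maps R (free_module R n) M \<and> \<phi> ` carrier (free_module R n) = A"
proof -
  note S = free_module_simps
  obtain T where T: "finite T" "T \<subseteq> carrier M" "gen_submodule R M T = A" using assms unfolding fg_sub_def by blast
  have "\<exists>n \<phi>. \<phi> \<in> lin_maps R (free_module R n) M \<and> \<phi> ` carrier (free_module R n) = gen_submodule R M T'"
    if "T' \<subseteq> T" for T'
    using finite_subset[OF that T(1)] that
  proof (induct T')
    case empty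
    have "(\<lambda>_. \<zero>\<^bsub>M\<^esub>) \<in> lin_maps R (free_module R 0) M" by (rule lin_mapsI) simp_all
    moreover have "(\<lambda>_. \<zero>\<^bsub>M\<^esub>) ` carrier (free_module R 0) = gen_submodule R M {}" by (simp add: S gen_empty)
    ultimately show ?case by blast
  next
    case (insert w T')
    then obtain n \<phi> where \<phi>: "\<phi> \<in> lin_maps R (free_module R n) M" "\<phi> ` carrier (free_module R n) = gen_submodule R M T'"
      by blast
    have w: "w \<in> carrier M" and T': "T' \<subseteq> carrier M" using insert T by blast+
    let ?\<psi> = "\<lambda>x. \<phi> (restrict x {..<n}) \<oplus>\<^bsub>M\<^esub> x n \<odot>\<^bsub>M\<^esub> w"
    have G: "submodule (gen_submodule R M T') R M" by (rule submodule_gen[OF T'])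
    have gi: "gen_submodule R M (insert w T') = gen_submodule R M T' <+>\<^bsub>M\<^esub> cyclic R M w"
      using gen_gen_Un[OF T', of "{w}"] gen_insert[OF G w] w by simp
    have "?\<psi> ` carrier (free_module R (Suc n)) = gen_submodule R M T' <+>\<^bsub>M\<^esub> cyclic R M w"
    proof
      show "?\<psi> ` carrier (free_module R (Suc n)) \<subseteq> gen_submodule R M T' <+>\<^bsub>M\<^esub> cyclic R M w"
      proof
        fix v assume "v \<in> ?\<psi> ` carrier (free_module R (Suc n))"
        then obtain x where x: "x \<in> carrier (free_module R (Suc n))" "v = ?\<psi> x" by blast
        have "\<phi> (restrict x {..<n}) \<in> gen_submodule R M T'" "x n \<odot>\<^bsub>M\<^esub> w \<in> cyclic R M w"
          using \<phi>(2) free_restrict[OF x(1)] unfolding cyclic_def by blast+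
        then show "v \<in> gen_submodule R M T' <+>\<^bsub>M\<^esub> cyclic R M w" unfolding x(2) set_add_def' by blast
      qed
      show "gen_submodule R M T' <+>\<^bsub>M\<^esub> cyclic R M w \<subseteq> ?\<psi> ` carrier (free_module R (Suc n))"
      proof
        fix v assume "v \<in> gen_submodule R M T' <+>\<^bsub>M\<^esub> cyclic R M w"
        then obtain g r where gr: "g \<in> gen_submodule R M T'" "r \<in> carrier R" "v = g \<oplus>\<^bsub>M\<^esub> r \<odot>\<^bsub>M\<^esub> w"
          unfolding set_add_def' cyclic_def by blast
        obtain x where x: "x \<in> carrier (free_module R n)" "g = \<phi> x" using gr(1) \<phi>(2) by blast
        let ?x = "x(n := r)"
        have "?x \<in> carrier (free_module R (Suc n))" using x(1) gr(2) by (auto simp: S PiE_def extensional_def Pi_def)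
        moreover have "restrict ?x {..<n} = x" using x(1) by (auto simp: S PiE_def extensional_def fun_eq_iff)
        then have "?\<psi> ?x = v" using gr(3) x(2) by simp
        ultimately show "v \<in> ?\<psi> ` carrier (free_module R (Suc n))" by blast
      qed
    qed
    then show ?case unfolding gi using lin_extend[OF \<phi>(1) w] by blast
  qed
  from this[OF subset_refl] show ?thesis using T(3) by simp
qed

text \<open>Projectivity of free modules by induction on the rank: a preimage \<open>w\<close> of
  the value at the last basis vector extends a lift on the first \<open>n\<close>
  coordinates.\<close>

lemma lin_map_lift:
  assumes A: "module R A" and B: "module R B" and \<pi>: "\<pi> \<in> lin_maps R A B" and surj: "\<pi> ` carrier A = carrier B"
    and \<epsilon>: "\<epsilon> \<in> lin_maps R (free_module R n) B"
  shows "\<exists>l\<in>lin_maps R (free_module R n) A. \<forall>x\<in>carrier (free_module R n). \<pi> (l x) = \<epsilon> x"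
  using \<epsilon>
proof (induct n arbitrary: \<epsilon>)
  note S = free_module_simps
  interpret A: plain_module R A by (intro plain_module.intro A)
  interpret B: plain_module R B by (intro plain_module.intro B)
  {
    case 0
    have "(\<lambda>_. \<zero>\<^bsub>A\<^esub>) \<in> lin_maps R (free_module R 0) A" by (rule lin_mapsI) simp_all
    moreover have "\<pi> \<zero>\<^bsub>A\<^esub> = \<epsilon> x" if "x \<in> carrier (free_module R 0)" for x
    proof -
      have "x = \<zero>\<^bsub>free_module R 0\<^esub>" using that by (simp add: S restrict_def)
      then show ?thesis using lin_maps_zero[OF A.R.module_free B 0] lin_maps_zero[OF A B \<pi>] by simp
    qed
    ultimately show ?case by (intro bexI[of _ "\<lambda>_. \<zero>\<^bsub>A\<^esub>"]) auto
  next
    case (Suc n)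
    interpret F: plain_module R "free_module R (Suc n)" by (intro plain_module.intro A.R.module_free)
    let ?\<iota> = "\<lambda>x::nat \<Rightarrow> _. x(n := \<zero>\<^bsub>R\<^esub>)" and ?e = "\<lambda>i\<in>{..<Suc n}. if i = n then \<one>\<^bsub>R\<^esub> else \<zero>\<^bsub>R\<^esub>"
    have \<iota>: "?\<iota> x \<in> carrier (free_module R (Suc n))" if "x \<in> carrier (free_module R n)" for x
      using that by (auto simp: S PiE_def extensional_def Pi_def)
    have e: "?e \<in> carrier (free_module R (Suc n))" by (simp add: S)
    have "(\<lambda>x. \<epsilon> (?\<iota> x)) \<in> lin_maps R (free_module R n) B"
    proof (rule lin_mapsI)
      fix x assume x: "x \<in> carrier (free_module R n)"
      show "\<epsilon> (?\<iota> x) \<in> carrier B" by (rule lin_mapsD(1)[OF Suc(2) \<iota>[OF x]])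
      { fix y assume y: "y \<in> carrier (free_module R n)"
        have "?\<iota> (x \<oplus>\<^bsub>free_module R n\<^esub> y) = ?\<iota> x \<oplus>\<^bsub>free_module R (Suc n)\<^esub> ?\<iota> y"
          by (auto simp: S fun_eq_iff)
        then show "\<epsilon> (?\<iota> (x \<oplus>\<^bsub>free_module R n\<^esub> y)) = \<epsilon> (?\<iota> x) \<oplus>\<^bsub>B\<^esub> \<epsilon> (?\<iota> y)"
          by (simp only: lin_mapsD(2)[OF Suc(2) \<iota>[OF x] \<iota>[OF y]]) }
      fix a assume a: "a \<in> carrier R"
      have "?\<iota> (a \<odot>\<^bsub>free_module R n\<^esub> x) = a \<odot>\<^bsub>free_module R (Suc n)\<^esub> ?\<iota> x"
        using a by (auto simp: S fun_eq_iff)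
      then show "\<epsilon> (?\<iota> (a \<odot>\<^bsub>free_module R n\<^esub> x)) = a \<odot>\<^bsub>B\<^esub> \<epsilon> (?\<iota> x)"
        by (simp only: lin_mapsD(3)[OF Suc(2) \<iota>[OF x] a])
    qed
    from Suc(1)[OF this] obtain l where l: "l \<in> lin_maps R (free_module R n) A"
      "\<And>x. x \<in> carrier (free_module R n) \<Longrightarrow> \<pi> (l x) = \<epsilon> (?\<iota> x)" by blast
    have "\<epsilon> ?e \<in> carrier B" by (rule lin_mapsD(1)[OF Suc(2) e])
    then obtain w where w: "w \<in> carrier A" "\<pi> w = \<epsilon> ?e" using surj by (metis imageE)
    have "\<pi> (l (restrict x {..<n}) \<oplus>\<^bsub>A\<^esub> x n \<odot>\<^bsub>A\<^esub> w) = \<epsilon> x" if x: "x \<in> carrier (free_module R (Suc n))" for x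
    proof -
      note r = free_restrict[OF x]
      have lr: "l (restrict x {..<n}) \<in> carrier A" by (rule lin_mapsD(1)[OF l(1) r(1)])
      have "\<pi> (l (restrict x {..<n}) \<oplus>\<^bsub>A\<^esub> x n \<odot>\<^bsub>A\<^esub> w) = \<pi> (l (restrict x {..<n})) \<oplus>\<^bsub>B\<^esub> \<pi> (x n \<odot>\<^bsub>A\<^esub> w)"
        by (rule lin_mapsD(2)[OF \<pi> lr A.smult_closed[OF r(2) w(1)]])
      also have "\<dots> = \<epsilon> (?\<iota> (restrict x {..<n})) \<oplus>\<^bsub>B\<^esub> \<epsilon> (x n \<odot>\<^bsub>free_module R (Suc n)\<^esub> ?e)"
        unfolding l(2)[OF r(1)] lin_mapsD(3)[OF \<pi> w(1) r(2)] w(2) lin_mapsD(3)[OF Suc(2) e r(2)] ..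
      also have "\<dots> = \<epsilon> (?\<iota> (restrict x {..<n}) \<oplus>\<^bsub>free_module R (Suc n)\<^esub> x n \<odot>\<^bsub>free_module R (Suc n)\<^esub> ?e)"
        by (rule lin_mapsD(2)[OF Suc(2) \<iota>[OF r(1)] F.smult_closed[OF r(2) e], symmetric])
      also have "?\<iota> (restrict x {..<n}) \<oplus>\<^bsub>free_module R (Suc n)\<^esub> x n \<odot>\<^bsub>free_module R (Suc n)\<^esub> ?e = x"
      proof (rule extensionalityI[of _ "{..<Suc n}"])
        show "x \<in> extensional {..<Suc n}" using x by (simp add: S PiE_def)
        fix i assume i: "i \<in> {..<Suc n}"
        have "x i \<in> carrier R" using x i by (auto simp: S)
        then show "(?\<iota> (restrict x {..<n}) \<oplus>\<^bsub>free_module R (Suc n)\<^esub> x n \<odot>\<^bsub>free_module R (Suc n)\<^esub> ?e) i = x i"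
          using i r(2) by (auto simp: S)
      qed (simp add: S)
      finally show ?thesis .
    qed
    then show ?case using A.lin_extend[OF l(1) w(1)] by (intro bexI) auto
  }
qed

context local_ring begin

text \<open>The coordinate functions are jointly injective functionals.\<close>

lemma fg_sub_free:
  assumes "submodule Z R (free_module R n)" shows "fg_sub R (free_module R n) Z"
proof -
  interpret F: local_module R "free_module R n" \<mm>
    by (intro local_module.intro plain_module.intro module_free local_ring_axioms)
  let ?F = "(\<lambda>i (x :: nat \<Rightarrow> 'r). x i) ` {..<n}"
  show ?thesis
  proof (rule F.fg_sub_of_functionals[OF _ _ assms])
    show "finite ?F" by simp
    fix \<phi> assume "\<phi> \<in> ?F"
    then obtain i where i: "i < n" "\<phi> = (\<lambda>x. x i)" by blast
    show "\<phi> \<in> lin_maps R (free_module R n) (ring_module R)"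
      unfolding i(2) by (rule lin_mapsI) (use i(1) in \<open>auto simp: free_module_simps\<close>)
  next
    fix x assume x: "x \<in> Z" and z: "\<And>\<phi>. \<phi> \<in> ?F \<Longrightarrow> \<phi> x = \<zero>"
    have "x \<in> {..<n} \<rightarrow>\<^sub>E carrier R" using x F.submoduleE(1)[OF assms] by (auto simp: free_module_simps)
    moreover have "x i = \<zero>" if "i < n" for i using z[of "\<lambda>x. x i"] that by blast
    ultimately show "x = \<zero>\<^bsub>free_module R n\<^esub>"
      by (intro extensionalityI[of x "{..<n}"]) (auto simp: free_module_simps PiE_def)
  qed
qed

text \<open>\<open>ext_module\<close> selects a resolution by \<open>SOME\<close>, so exactness of
  the selected one is available only through existence.\<close>

lemma exists_free_resolution:
  fixes N :: "('r, 'n) module"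
  assumes N: "module R N" and fg: "fin_gen R N"
  shows "\<exists>b d \<epsilon>. free_resolution R N b d \<epsilon>"
proof -
  interpret N: plain_module R N by (intro plain_module.intro N)
  let ?F = "free_module R"
  obtain n \<epsilon> where \<epsilon>: "\<epsilon> \<in> lin_maps R (?F n) N" "\<epsilon> ` carrier (?F n) = carrier N"
    using N.lin_map_onto_fg fg unfolding fin_gen_iff_fg_sub by blast
  have onto: "\<exists>m \<phi>. \<phi> \<in> lin_maps R (?F m) (?F k) \<and> \<phi> ` carrier (?F m) = Z" if Z: "submodule Z R (?F k)" for k Z
    by (rule plain_module.lin_map_onto_fg[OF plain_module.intro[OF module_free] fg_sub_free[OF Z]])
  \<comment> \<open>A state consists of the target rank, the source rank and the map.
    \<open>Q\<close> at index 0 ties the first map to the kernel of \<open>\<epsilon>\<close>, and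
    \<open>T\<close> is exactness between consecutive maps.\<close>
  define Q where "Q i t \<longleftrightarrow> (case t of (k, m, \<phi>) \<Rightarrow> \<phi> \<in> lin_maps R (?F m) (?F k) \<and>
      (i = 0 \<longrightarrow> k = n \<and> \<phi> ` carrier (?F m) = {x \<in> carrier (?F n). \<epsilon> x = \<zero>\<^bsub>N\<^esub>}))"
    for i :: nat and t :: "nat \<times> nat \<times> ((nat \<Rightarrow> 'r) \<Rightarrow> (nat \<Rightarrow> 'r))"
  define T where "T t t' \<longleftrightarrow> (case (t, t') of ((k, m, \<phi>), (k', m', \<phi>')) \<Rightarrow> k' = m \<and>
      \<phi>' ` carrier (?F m') = {x \<in> carrier (?F m). \<phi> x = \<zero>\<^bsub>?F k\<^esub>})"
    for t t' :: "nat \<times> nat \<times> ((nat \<Rightarrow> 'r) \<Rightarrow> (nat \<Rightarrow> 'r))"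
  have "\<exists>f. \<forall>i. Q i (f i) \<and> T (f i) (f (Suc i))"
  proof (rule dependent_nat_choice)
    obtain m \<phi> where "\<phi> \<in> lin_maps R (?F m) (?F n)" "\<phi> ` carrier (?F m) = {x \<in> carrier (?F n). \<epsilon> x = \<zero>\<^bsub>N\<^esub>}"
      using onto[OF submodule_kernel[OF module_free N \<epsilon>(1)]] by blast
    then have "Q 0 (n, m, \<phi>)" by (simp add: Q_def)
    then show "\<exists>t. Q 0 t" by blast
  next
    fix t i assume q: "Q i t"
    obtain k m \<phi> where t: "t = (k, m, \<phi>)" by (cases t)
    have \<phi>: "\<phi> \<in> lin_maps R (?F m) (?F k)" using q by (simp add: Q_def t)
    obtain m' \<phi>' where "\<phi>' \<in> lin_maps R (?F m') (?F m)" "\<phi>' ` carrier (?F m') = {x \<in> carrier (?F m). \<phi> x = \<zero>\<^bsub>?F k\<^esub>}"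
      using onto[OF submodule_kernel[OF module_free module_free \<phi>]] by blast
    then have "Q (Suc i) (m, m', \<phi>') \<and> T t (m, m', \<phi>')" by (simp add: Q_def T_def t)
    then show "\<exists>t'. Q (Suc i) t' \<and> T t t'" by blast
  qed
  then obtain f where f: "\<And>i. Q i (f i)" "\<And>i. T (f i) (f (Suc i))" by blast
  define b where "b i = fst (f i)" for i
  define d where "d i = snd (snd (f i))" for i
  have m: "fst (snd (f i)) = b (Suc i)" for i
    using f(2)[of i] by (simp add: T_def b_def split: prod.splits)
  have fi: "f i = (b i, b (Suc i), d i)" for i using m[of i] by (simp add: prod_eq_iff b_def d_def)
  have b0: "b 0 = n" using f(1)[of 0] unfolding fi by (simp add: Q_def)
  have "free_resolution R N b d \<epsilon>"
    unfolding free_resolution_def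
  proof (intro conjI allI)
    show "d i \<in> lin_maps R (?F (b (Suc i))) (?F (b i))" for i using f(1)[of i] unfolding fi by (simp add: Q_def)
    show "d 0 ` carrier (?F (b 1)) = {x \<in> carrier (?F (b 0)). \<epsilon> x = \<zero>\<^bsub>N\<^esub>}"
      using f(1)[of 0] unfolding fi by (simp add: Q_def)
    show "d (Suc i) ` carrier (?F (b (Suc (Suc i)))) =
          {x \<in> carrier (?F (b (Suc i))). d i x = \<zero>\<^bsub>?F (b i)\<^esub>}" for i
      using f(2)[of i] unfolding fi by (simp add: T_def)
  qed (simp_all add: b0 \<epsilon>)
  then show ?thesis by blast
qed

end

subsection \<open>Modules of type one\<close>

lemma vdim_eq_1E:
  assumes "vdim K V = 1"
  obtains v where "finite_basis K V {v}"
proof -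
  let ?S = "{enat (card B) | B. finite_basis K V B}"
  \<comment> \<open>The infimum of the empty set is infinite, so a finite value guarantees that a
    basis exists.\<close>
  have "?S \<noteq> {}" using assms by (auto simp: vdim_def Inf_enat_def one_enat_def split: if_splits)
  then have "Inf ?S \<in> ?S" unfolding Inf_enat_def by (simp only: if_False) (rule LeastI_ex, blast)
  then obtain B where B: "finite_basis K V B" "enat (card B) = 1" using assms unfolding vdim_def by auto
  then have "card B = 1" by (simp add: one_enat_def)
  then obtain v where "B = {v}" by (rule card_1_singletonE)
  with B that show ?thesis by blast
qed

text \<open>Scalars of the residue field act through representatives in \<open>R\<close>. Hence a
  cyclic submodule over \<open>R\<close> is also a subspace, and a generator over the residue field
  generates over \<open>R\<close>.\<close>

lemma (in local_ring) residue_space_generated: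
  fixes E :: "('r, 'e) module"
  assumes E: "module R E" and gen: "generates (R Quot \<mm>) (residue_space R E) {v}"
  shows "v \<in> carrier E" "carrier E \<subseteq> cyclic R E v"
proof -
  interpret E: plain_module R E by (intro plain_module.intro E)
  let ?V = "residue_space R E"
  have V: "carrier ?V = carrier E" "\<zero>\<^bsub>?V\<^esub> = \<zero>\<^bsub>E\<^esub>" "add ?V = add E"
    "c \<odot>\<^bsub>?V\<^esub> x = (SOME r. r \<in> c) \<odot>\<^bsub>E\<^esub> x" for c x
    by (simp_all add: residue_space_def)
  show v: "v \<in> carrier E" using gen by (simp add: generates_def V)
  have C: "submodule (cyclic R E v) R E" by (rule E.submodule_cyclic[OF v])
  have "submodule (cyclic R E v) (R Quot \<mm>) ?V"
  proof (intro submodule.intro submodule_axioms.intro)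
    show "subgroup (cyclic R E v) (add_monoid ?V)"
      using submodule.axioms(1)[OF C] by (simp add: subgroup_def m_inv_def V)
    fix c x assume c: "c \<in> carrier (R Quot \<mm>)" and x: "x \<in> cyclic R E v"
    obtain a where a: "a \<in> carrier R" "c = \<mm> +> a" using c by (auto simp: FactRing_def A_RCOSETS_def')
    have "\<zero> \<oplus> a \<in> c" unfolding a(2) a_r_coset_def'
      using additive_subgroup.zero_closed[OF ideal.axioms(1)[OF ideal_m]] by blast
    then have "(SOME r. r \<in> c) \<in> c" by (rule someI)
    then have "(SOME r. r \<in> c) \<in> carrier R" using a m_carrier unfolding a_r_coset_def' by auto
    then show "c \<odot>\<^bsub>?V\<^esub> x \<in> cyclic R E v" unfolding V using E.submoduleE(4)[OF C _ x] by blast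
  qed
  then have "gen_submodule (R Quot \<mm>) ?V {v} \<subseteq> cyclic R E v"
    unfolding gen_submodule_def using E.cyclic_self[OF v] by blast
  then show "carrier E \<subseteq> cyclic R E v" using gen by (simp add: generates_def V)
qed

context local_module begin

text \<open>
  \<open>Ext\<^sup>1(k, M)\<close> contains the socle of \<open>M/yM\<close>: if \<open>\<lambda>\<close> is a functional on the first free module of
  the resolution that lifts the augmentation, \<open>u\<close> corresponds to the cocycle
  \<open>x \<mapsto> \<lambda>(d\<^sub>0x)u/y\<close>. Cocycles are compared by evaluating them at a preimage \<open>x'\<close> of \<open>yx\<^sub>1\<close>, where
  \<open>\<lambda>(x\<^sub>1)\<close> is a unit.
\<close>

lemma type_one_socle:
  assumes depth: "depth R \<mm> M = 1" and type: "cm_type R \<mm> M = 1" and y: "y \<in> \<mm>"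
    and reg: "\<And>x. x \<in> carrier M \<Longrightarrow> y \<odot>\<^bsub>M\<^esub> x = \<zero>\<^bsub>M\<^esub> \<Longrightarrow> x = \<zero>\<^bsub>M\<^esub>"
    and u1: "u1 \<in> carrier M" "\<And>a. a \<in> \<mm> \<Longrightarrow> a \<odot>\<^bsub>M\<^esub> u1 \<in> scaled M y (carrier M)"
    and u2: "u2 \<in> carrier M" "\<And>a. a \<in> \<mm> \<Longrightarrow> a \<odot>\<^bsub>M\<^esub> u2 \<in> scaled M y (carrier M)"
    and nu2: "u2 \<notin> scaled M y (carrier M)"
  shows "\<exists>r\<in>carrier R. u1 \<ominus>\<^bsub>M\<^esub> r \<odot>\<^bsub>M\<^esub> u2 \<in> scaled M y (carrier M)"
proof -
  interpret RM: local_module R "ring_module R" \<mm> by (rule local_module_ring)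
  have cy: "y \<in> carrier R" using y m_carrier by blast
  let ?k = "quot_module R (ring_module R) \<mm>"
  let ?\<pi> = "\<lambda>a. \<mm> +>\<^bsub>ring_module R\<^esub> a"
  have sm: "submodule \<mm> R (ring_module R)" by (simp add: submodule_ring_module_iff ideal_m)
  have k: "module R ?k" by (rule RM.module_quot[OF sm])
  interpret k: plain_module R ?k by (intro plain_module.intro k)
  have kc: "carrier ?k = ?\<pi> ` carrier R" using RM.quot_carrier[of \<mm>] by simp
  have \<pi>: "?\<pi> \<in> lin_maps R (ring_module R) ?k"
    by (rule lin_mapsI) (simp_all add: kc RM.quot_add[OF sm] RM.quot_smult[OF sm])
  have \<pi>_mem: "?\<pi> a = \<mm> \<longleftrightarrow> a \<in> \<mm>" if "a \<in> carrier R" for a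
    using RM.coset_eq_self_iff[OF sm, of a] that by simp
  have "fin_gen R ?k"
    unfolding fin_gen_def generates_def
  proof (intro exI[of _ "{?\<pi> \<one>}"] conjI)
    show one: "{?\<pi> \<one>} \<subseteq> carrier ?k" by (simp add: kc)
    note G = k.submodule_gen[OF one]
    show "gen_submodule R ?k {?\<pi> \<one>} = carrier ?k"
    proof
      show "gen_submodule R ?k {?\<pi> \<one>} \<subseteq> carrier ?k" by (rule k.submoduleE(1)[OF G])
      show "carrier ?k \<subseteq> gen_submodule R ?k {?\<pi> \<one>}"
      proof
        fix X assume "X \<in> carrier ?k"
        then obtain a where a: "a \<in> carrier R" "X = ?\<pi> a" unfolding kc by blast
        have "?\<pi> \<one> \<in> gen_submodule R ?k {?\<pi> \<one>}" using k.gen_submodule_superset[of "{?\<pi> \<one>}"] by blast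
        then have "a \<odot>\<^bsub>?k\<^esub> ?\<pi> \<one> \<in> gen_submodule R ?k {?\<pi> \<one>}" by (rule k.submoduleE(4)[OF G a(1)])
        then show "X \<in> gen_submodule R ?k {?\<pi> \<one>}" using a RM.quot_smult[OF sm, of \<one> a] by simp
      qed
    qed
  qed simp
  \<comment> \<open>Existence passes to the resolution that \<open>ext_module\<close> selects;
    \<open>b\<close>, \<open>d\<close>, \<open>\<epsilon>\<close> below denote that one.\<close>
  then have "\<exists>t. case t of (b, d, \<epsilon>) \<Rightarrow> free_resolution R ?k b d \<epsilon>"
    using exists_free_resolution[OF k] by auto
  then have "case (SOME (b, d, \<epsilon>). free_resolution R ?k b d \<epsilon>) of (b, d, \<epsilon>) \<Rightarrow> free_resolution R ?k b d \<epsilon>"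
    by (rule someI_ex)
  moreover obtain b d \<epsilon> where bd: "(SOME (b, d, \<epsilon>). free_resolution R ?k b d \<epsilon>) = (b, d, \<epsilon>)"
    by (rule prod_cases3)
  ultimately have res: "free_resolution R ?k b d \<epsilon>" by simp
  let ?F0 = "free_module R (b 0)" and ?F1 = "free_module R (b (Suc 0))" and ?F2 = "free_module R (b (Suc (Suc 0)))"
  have dres: "d i \<in> lin_maps R (free_module R (b (Suc i))) (free_module R (b i))"
    and exres: "d (Suc i) ` carrier (free_module R (b (Suc (Suc i))))
      = {x \<in> carrier (free_module R (b (Suc i))). d i x = \<zero>\<^bsub>free_module R (b i)\<^esub>}" for i
    using res by (simp_all add: free_resolution_def)
  have \<epsilon>: "\<epsilon> \<in> lin_maps R ?F0 ?k" "\<epsilon> ` carrier ?F0 = carrier ?k"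
    and d0: "d 0 \<in> lin_maps R ?F1 ?F0" and d1: "d (Suc 0) \<in> lin_maps R ?F2 ?F1"
    and ex0: "d 0 ` carrier ?F1 = {x \<in> carrier ?F0. \<epsilon> x = \<zero>\<^bsub>?k\<^esub>}"
    and ex1: "d (Suc 0) ` carrier ?F2 = {x \<in> carrier ?F1. d 0 x = \<zero>\<^bsub>?F0\<^esub>}"
    using res dres[of 0] dres[of "Suc 0"] exres[of 0] by (simp_all add: free_resolution_def)
  interpret F0: plain_module R ?F0 by (intro plain_module.intro R.module_free)
  interpret F1: plain_module R ?F1 by (intro plain_module.intro R.module_free)
  interpret F2: plain_module R ?F2 by (intro plain_module.intro R.module_free)
  let ?H = "hom_module R ?F1 M" and ?Z = "ext_cocycles R b d M (Suc 0)" and ?B = "ext_coboundaries R b d M (Suc 0)"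
  let ?HZ = "?H\<lparr>carrier := ?Z\<rparr>"
  let ?E = "quot_module R ?HZ ?B"
  interpret H: plain_module R ?H by (intro plain_module.intro module_hom F1.module_axioms module_axioms)
  note S = hom_module_simps
  have Zdef: "\<phi> \<in> ?Z \<longleftrightarrow> \<phi> \<in> carrier ?H \<and> (\<forall>x\<in>carrier ?F2. \<phi> (d (Suc 0) x) = \<zero>\<^bsub>M\<^esub>)" for \<phi>
    by (simp add: ext_cocycles_def)
  have lin1: "\<phi> \<in> lin_maps R ?F1 M" if "\<phi> \<in> carrier ?H" for \<phi> using that by (simp add: S)
  have d1F: "d (Suc 0) x \<in> carrier ?F1" if "x \<in> carrier ?F2" for x by (rule lin_mapsD(1)[OF d1 that])
  have Z: "submodule ?Z R ?H"
  proof (rule H.submoduleI)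
    show "?Z \<subseteq> carrier ?H" using Zdef by blast
    have "\<zero>\<^bsub>?H\<^esub> (d (Suc 0) x) = \<zero>\<^bsub>M\<^esub>" if "x \<in> carrier ?F2" for x using d1F[OF that] by (simp add: S(2))
    then show "\<zero>\<^bsub>?H\<^esub> \<in> ?Z" unfolding Zdef using H.M.zero_closed by blast
    fix \<phi> assume \<phi>: "\<phi> \<in> ?Z"
    have c\<phi>: "\<phi> \<in> carrier ?H" using \<phi> Zdef by blast
    show sc: "a \<odot>\<^bsub>?H\<^esub> \<phi> \<in> ?Z" if a: "a \<in> carrier R" for a
      unfolding Zdef
    proof (intro conjI ballI)
      show "a \<odot>\<^bsub>?H\<^esub> \<phi> \<in> carrier ?H" by (rule H.smult_closed[OF a c\<phi>])
      fix x assume x: "x \<in> carrier ?F2"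
      have "\<phi> (d (Suc 0) x) = \<zero>\<^bsub>M\<^esub>" using \<phi> Zdef x by blast
      then show "(a \<odot>\<^bsub>?H\<^esub> \<phi>) (d (Suc 0) x) = \<zero>\<^bsub>M\<^esub>" using d1F[OF x] a by (simp add: S(4))
    qed
    have "\<ominus>\<^bsub>?H\<^esub> \<phi> = (\<ominus> \<one>) \<odot>\<^bsub>?H\<^esub> \<phi>"
      using H.smult_l_minus[OF R.one_closed c\<phi>] H.smult_one[OF c\<phi>] by simp
    then show "\<ominus>\<^bsub>?H\<^esub> \<phi> \<in> ?Z" using sc[of "\<ominus> \<one>"] by simp
    fix \<psi> assume \<psi>: "\<psi> \<in> ?Z"
    have c\<psi>: "\<psi> \<in> carrier ?H" using \<psi> Zdef by blast
    show "\<phi> \<oplus>\<^bsub>?H\<^esub> \<psi> \<in> ?Z"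
      unfolding Zdef
    proof (intro conjI ballI)
      show "\<phi> \<oplus>\<^bsub>?H\<^esub> \<psi> \<in> carrier ?H" by (rule H.M.a_closed[OF c\<phi> c\<psi>])
      fix x assume x: "x \<in> carrier ?F2"
      have "\<phi> (d (Suc 0) x) = \<zero>\<^bsub>M\<^esub>" "\<psi> (d (Suc 0) x) = \<zero>\<^bsub>M\<^esub>" using \<phi> \<psi> Zdef x by blast+
      then show "(\<phi> \<oplus>\<^bsub>?H\<^esub> \<psi>) (d (Suc 0) x) = \<zero>\<^bsub>M\<^esub>" using d1F[OF x] by (simp add: S(3))
    qed
  qed
  interpret HZ: plain_module R ?HZ
    by (intro plain_module.intro submodule.submodule_is_module[OF Z] H.module_axioms)
  have B_iff: "\<chi> \<in> ?B \<longleftrightarrow> (\<exists>\<psi>\<in>carrier (hom_module R ?F0 M). \<chi> = (\<lambda>x\<in>carrier ?F1. \<psi> (d 0 x)))" for \<chi>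
    by (auto simp: ext_coboundaries_def)
  interpret H0: plain_module R "hom_module R ?F0 M" by (intro plain_module.intro module_hom F0.module_axioms module_axioms)
  have d0F: "d 0 x \<in> carrier ?F0" if "x \<in> carrier ?F1" for x by (rule lin_mapsD(1)[OF d0 that])
  have BZ: "(\<lambda>x\<in>carrier ?F1. \<psi> (d 0 x)) \<in> ?Z" if \<psi>: "\<psi> \<in> carrier (hom_module R ?F0 M)" for \<psi>
  proof -
    have l\<psi>: "\<psi> \<in> lin_maps R ?F0 M" using \<psi> by (simp add: S)
    have "(\<lambda>x\<in>carrier ?F1. \<psi> (d 0 x)) \<in> lin_maps R ?F1 M"
      by (rule lin_mapsI) (simp_all add: d0F lin_mapsD[OF l\<psi>] lin_mapsD[OF d0] F1.M.a_closed F1.smult_closed)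
    moreover have "\<psi> (d 0 (d (Suc 0) x)) = \<zero>\<^bsub>M\<^esub>" if "x \<in> carrier ?F2" for x
    proof -
      have "d 0 (d (Suc 0) x) = \<zero>\<^bsub>?F0\<^esub>" using ex1 that by blast
      then show ?thesis using lin_maps_zero[OF F0.module_axioms module_axioms l\<psi>] by simp
    qed
    ultimately show ?thesis unfolding Zdef using d1F by (simp add: S(1))
  qed
  have HZs: "\<zero>\<^bsub>?HZ\<^esub> = (\<lambda>x\<in>carrier ?F1. \<zero>\<^bsub>M\<^esub>)" "f \<oplus>\<^bsub>?HZ\<^esub> g = (\<lambda>x\<in>carrier ?F1. f x \<oplus>\<^bsub>M\<^esub> g x)"
    "a \<odot>\<^bsub>?HZ\<^esub> f = (\<lambda>x\<in>carrier ?F1. a \<odot>\<^bsub>M\<^esub> f x)" for f g a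
    by (simp_all add: S)
  have B: "submodule ?B R ?HZ"
  proof (rule HZ.submoduleI)
    show "?B \<subseteq> carrier ?HZ" using B_iff BZ by auto
    have "(\<lambda>x\<in>carrier ?F1. \<zero>\<^bsub>hom_module R ?F0 M\<^esub> (d 0 x)) = \<zero>\<^bsub>?HZ\<^esub>"
      unfolding HZs by (rule restrict_ext) (simp add: S(2) d0F)
    then show "\<zero>\<^bsub>?HZ\<^esub> \<in> ?B" unfolding B_iff using H0.M.zero_closed by metis
    fix \<chi> assume \<chi>: "\<chi> \<in> ?B"
    then obtain \<psi> where \<psi>: "\<psi> \<in> carrier (hom_module R ?F0 M)" "\<chi> = (\<lambda>x\<in>carrier ?F1. \<psi> (d 0 x))" unfolding B_iff by blast
    show sc: "a \<odot>\<^bsub>?HZ\<^esub> \<chi> \<in> ?B" if a: "a \<in> carrier R" for a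
    proof -
      have "a \<odot>\<^bsub>?HZ\<^esub> \<chi> = (\<lambda>x\<in>carrier ?F1. (a \<odot>\<^bsub>hom_module R ?F0 M\<^esub> \<psi>) (d 0 x))"
        unfolding HZs \<psi>(2) by (rule restrict_ext) (simp add: S(4) d0F)
      then show ?thesis unfolding B_iff using H0.smult_closed[OF a \<psi>(1)] by blast
    qed
    have "\<ominus>\<^bsub>?HZ\<^esub> \<chi> = (\<ominus> \<one>) \<odot>\<^bsub>?HZ\<^esub> \<chi>"
    proof -
      have "\<chi> \<in> carrier ?HZ" using BZ[OF \<psi>(1)] \<psi>(2) by simp
      then show ?thesis using HZ.smult_l_minus[of \<one> \<chi>] HZ.smult_one[of \<chi>] by simp
    qed
    then show "\<ominus>\<^bsub>?HZ\<^esub> \<chi> \<in> ?B" using sc[of "\<ominus> \<one>"] by simp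
    fix \<chi>' assume "\<chi>' \<in> ?B"
    then obtain \<psi>' where \<psi>': "\<psi>' \<in> carrier (hom_module R ?F0 M)" "\<chi>' = (\<lambda>x\<in>carrier ?F1. \<psi>' (d 0 x))" unfolding B_iff by blast
    have "\<chi> \<oplus>\<^bsub>?HZ\<^esub> \<chi>' = (\<lambda>x\<in>carrier ?F1. (\<psi> \<oplus>\<^bsub>hom_module R ?F0 M\<^esub> \<psi>') (d 0 x))"
      unfolding HZs \<psi>(2) \<psi>'(2) by (rule restrict_ext) (simp add: S(3) d0F)
    then show "\<chi> \<oplus>\<^bsub>?HZ\<^esub> \<chi>' \<in> ?B" unfolding B_iff using H0.M.a_closed[OF \<psi>(1) \<psi>'(1)] by blast
  qed
  have E: "module R ?E" by (rule HZ.module_quot[OF B])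
  have "ext_module R (Suc 0) ?k M = ?E" unfolding ext_module_def bd by simp
  then have "vdim (R Quot \<mm>) (residue_space R ?E) = 1"
    using type unfolding cm_type_def depth by (simp add: one_enat_def)
  then obtain v where "finite_basis (R Quot \<mm>) (residue_space R ?E) {v}" by (rule vdim_eq_1E)
  then have "generates (R Quot \<mm>) (residue_space R ?E) {v}" by (simp add: finite_basis_def)
  note v = residue_space_generated[OF E this]
  obtain \<phi>0 where \<phi>0: "\<phi>0 \<in> ?Z" "v = ?B +>\<^bsub>?HZ\<^esub> \<phi>0" using v(1) unfolding HZ.quot_carrier by auto
  have lin0: "\<phi>0 \<in> lin_maps R ?F1 M" using \<phi>0(1) Zdef lin1 by blast
  have G: "\<exists>r\<in>carrier R. \<exists>\<psi>\<in>lin_maps R ?F0 M. \<forall>x\<in>carrier ?F1. \<phi> x = \<psi> (d 0 x) \<oplus>\<^bsub>M\<^esub> r \<odot>\<^bsub>M\<^esub> \<phi>0 x"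
    if \<phi>: "\<phi> \<in> ?Z" for \<phi>
  proof -
    have c\<phi>: "\<phi> \<in> carrier ?HZ" and c\<phi>0: "\<phi>0 \<in> carrier ?HZ" using \<phi> \<phi>0(1) by simp_all
    have "?B +>\<^bsub>?HZ\<^esub> \<phi> \<in> cyclic R ?E v" using v(2) c\<phi> unfolding HZ.quot_carrier by blast
    then obtain r where r: "r \<in> carrier R" "?B +>\<^bsub>?HZ\<^esub> \<phi> = r \<odot>\<^bsub>?E\<^esub> v" unfolding cyclic_def by blast
    let ?g = "r \<odot>\<^bsub>?HZ\<^esub> \<phi>0"
    have cg: "?g \<in> carrier ?HZ" by (rule HZ.smult_closed[OF r(1) c\<phi>0])
    have "?B +>\<^bsub>?HZ\<^esub> \<phi> = ?B +>\<^bsub>?HZ\<^esub> ?g" unfolding r(2) \<phi>0(2) by (rule HZ.quot_smult[OF B c\<phi>0 r(1)])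
    then have "\<phi> \<ominus>\<^bsub>?HZ\<^esub> ?g \<in> ?B" using HZ.coset_eq_iff[OF B c\<phi> cg] by blast
    then obtain \<psi> where \<psi>: "\<psi> \<in> carrier (hom_module R ?F0 M)" "\<phi> \<ominus>\<^bsub>?HZ\<^esub> ?g = (\<lambda>x\<in>carrier ?F1. \<psi> (d 0 x))"
      unfolding B_iff by blast
    have e: "(\<phi> \<ominus>\<^bsub>?HZ\<^esub> ?g) \<oplus>\<^bsub>?HZ\<^esub> ?g = \<phi>"
      unfolding a_minus_def using c\<phi> cg HZ.M.a_inv_closed[OF cg] by (simp only: HZ.M.a_assoc HZ.M.l_neg HZ.M.r_zero)
    have "\<phi> x = \<psi> (d 0 x) \<oplus>\<^bsub>M\<^esub> r \<odot>\<^bsub>M\<^esub> \<phi>0 x" if x: "x \<in> carrier ?F1" for x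
    proof -
      have "((\<phi> \<ominus>\<^bsub>?HZ\<^esub> ?g) \<oplus>\<^bsub>?HZ\<^esub> ?g) x = (\<phi> \<ominus>\<^bsub>?HZ\<^esub> ?g) x \<oplus>\<^bsub>M\<^esub> ?g x"
        unfolding HZs(2) using x by (rule restrict_apply')
      also have "(\<phi> \<ominus>\<^bsub>?HZ\<^esub> ?g) x = \<psi> (d 0 x)" unfolding \<psi>(2) using x by (rule restrict_apply')
      also have "?g x = r \<odot>\<^bsub>M\<^esub> \<phi>0 x" unfolding HZs(3) using x by (rule restrict_apply')
      finally show ?thesis unfolding e .
    qed
    then show ?thesis using r(1) \<psi>(1) by (auto simp: S(1))
  qed
  obtain l where l: "l \<in> lin_maps R ?F0 (ring_module R)" "\<And>x. x \<in> carrier ?F0 \<Longrightarrow> ?\<pi> (l x) = \<epsilon> x"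
    using lin_map_lift[OF R.module_ring_module k \<pi> _ \<epsilon>(1)] kc by auto
  note lD = lin_mapsD[OF l(1), simplified]
  have k0: "\<zero>\<^bsub>?k\<^esub> = \<mm>" by (simp add: quot_module_def)
  have ld: "l (d 0 x) \<in> \<mm>" if x: "x \<in> carrier ?F1" for x
  proof -
    have "\<epsilon> (d 0 x) = \<mm>" using ex0 x k0 by blast
    then show ?thesis using l(2)[OF d0F[OF x]] \<pi>_mem[OF lD(1)[OF d0F[OF x]]] by simp
  qed
  have injy: "a = b" if "y \<odot>\<^bsub>M\<^esub> a = y \<odot>\<^bsub>M\<^esub> b" "a \<in> carrier M" "b \<in> carrier M" for a b
    using inj_onD[OF regular_inj[OF cy reg]] that by simp
  have coc: "\<exists>\<phi>\<in>?Z. \<forall>x\<in>carrier ?F1. y \<odot>\<^bsub>M\<^esub> \<phi> x = l (d 0 x) \<odot>\<^bsub>M\<^esub> u"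
    if u: "u \<in> carrier M" "\<And>a. a \<in> \<mm> \<Longrightarrow> a \<odot>\<^bsub>M\<^esub> u \<in> scaled M y (carrier M)" for u
  proof -
    define q where "q x = (SOME w. w \<in> carrier M \<and> y \<odot>\<^bsub>M\<^esub> w = l (d 0 x) \<odot>\<^bsub>M\<^esub> u)" for x
    have "\<exists>w. w \<in> carrier M \<and> y \<odot>\<^bsub>M\<^esub> w = l (d 0 x) \<odot>\<^bsub>M\<^esub> u" if "x \<in> carrier ?F1" for x
      using u(2)[OF ld[OF that]] unfolding scaled_def by auto
    then have q: "q x \<in> carrier M \<and> y \<odot>\<^bsub>M\<^esub> q x = l (d 0 x) \<odot>\<^bsub>M\<^esub> u" if "x \<in> carrier ?F1" for x
      unfolding q_def using that by (intro someI_ex[of "\<lambda>w. w \<in> carrier M \<and> y \<odot>\<^bsub>M\<^esub> w = l (d 0 x) \<odot>\<^bsub>M\<^esub> u"]) blast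
    have "restrict q (carrier ?F1) \<in> lin_maps R ?F1 M"
    proof (rule lin_mapsI)
      fix x assume x: "x \<in> carrier ?F1"
      show "restrict q (carrier ?F1) x \<in> carrier M" using q x by simp
      { fix x' assume x': "x' \<in> carrier ?F1"
        have xx: "x \<oplus>\<^bsub>?F1\<^esub> x' \<in> carrier ?F1" using x x' by (rule F1.M.a_closed)
        have "y \<odot>\<^bsub>M\<^esub> q (x \<oplus>\<^bsub>?F1\<^esub> x') = (l (d 0 x) \<oplus> l (d 0 x')) \<odot>\<^bsub>M\<^esub> u"
          using q[OF xx] lin_mapsD(2)[OF d0 x x'] lD(2)[OF d0F[OF x] d0F[OF x']] by simp
        also have "\<dots> = y \<odot>\<^bsub>M\<^esub> (q x \<oplus>\<^bsub>M\<^esub> q x')"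
          using q[OF x] q[OF x'] lD(1)[OF d0F[OF x]] lD(1)[OF d0F[OF x']] u(1) cy by (simp add: smult_l_distr smult_r_distr)
        finally have "q (x \<oplus>\<^bsub>?F1\<^esub> x') = q x \<oplus>\<^bsub>M\<^esub> q x'" by (rule injy) (use q xx x x' in auto)
        then show "restrict q (carrier ?F1) (x \<oplus>\<^bsub>?F1\<^esub> x') = restrict q (carrier ?F1) x \<oplus>\<^bsub>M\<^esub> restrict q (carrier ?F1) x'"
          using x x' xx by simp }
      fix a assume a: "a \<in> carrier R"
      have ax: "a \<odot>\<^bsub>?F1\<^esub> x \<in> carrier ?F1" by (rule F1.smult_closed[OF a x])
      have "y \<odot>\<^bsub>M\<^esub> q (a \<odot>\<^bsub>?F1\<^esub> x) = (a \<otimes> l (d 0 x)) \<odot>\<^bsub>M\<^esub> u"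
        using q[OF ax] lin_mapsD(3)[OF d0 x a] lD(3)[OF d0F[OF x] a] by simp
      also have "\<dots> = a \<odot>\<^bsub>M\<^esub> (y \<odot>\<^bsub>M\<^esub> q x)"
        using q[OF x] lD(1)[OF d0F[OF x]] u(1) a by (simp add: smult_assoc1)
      also have "\<dots> = y \<odot>\<^bsub>M\<^esub> (a \<odot>\<^bsub>M\<^esub> q x)" using q[OF x, THEN conjunct1] a cy by (simp add: smult_assoc1[symmetric] R.m_comm)
      finally have "q (a \<odot>\<^bsub>?F1\<^esub> x) = a \<odot>\<^bsub>M\<^esub> q x" by (rule injy) (use q ax x a in auto)
      then show "restrict q (carrier ?F1) (a \<odot>\<^bsub>?F1\<^esub> x) = a \<odot>\<^bsub>M\<^esub> restrict q (carrier ?F1) x" using x ax by simp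
    qed
    moreover have "q (d (Suc 0) x) = \<zero>\<^bsub>M\<^esub>" if x: "x \<in> carrier ?F2" for x
    proof -
      have "d 0 (d (Suc 0) x) = \<zero>\<^bsub>?F0\<^esub>" using ex1 x by blast
      then have "l (d 0 (d (Suc 0) x)) = \<zero>" using lin_maps_zero[OF F0.module_axioms R.module_ring_module l(1)] by simp
      then have "y \<odot>\<^bsub>M\<^esub> q (d (Suc 0) x) = \<zero>\<^bsub>M\<^esub>" using q[OF d1F[OF x]] u(1) by simp
      then show ?thesis by (rule reg[rotated]) (use q d1F[OF x] in blast)
    qed
    ultimately have "restrict q (carrier ?F1) \<in> ?Z" unfolding Zdef using d1F by (simp add: S(1))
    then show ?thesis using q by (intro bexI[of _ "restrict q (carrier ?F1)"]) auto
  qed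
  have "?\<pi> \<one> \<in> \<epsilon> ` carrier ?F0" unfolding \<epsilon>(2) kc by simp
  then obtain x1 where x1: "x1 \<in> carrier ?F0" "\<epsilon> x1 = ?\<pi> \<one>" by auto
  have cl: "l x1 \<in> carrier R" by (rule lD(1)[OF x1(1)])
  have "l x1 \<notin> \<mm>" using l(2)[OF x1(1)] x1(2) \<pi>_mem[OF cl] \<pi>_mem[OF R.one_closed] one_notin_m by simp
  then obtain e where e: "e \<in> carrier R" "e \<otimes> l x1 = \<one>" using unit_notin_m[OF cl] by blast
  \<comment> \<open>The augmentation takes \<open>x1\<close> to the class of \<open>\<one>\<close>,
    hence \<open>\<mm> x1\<close> to zero, and exactness provides preimages under
    \<open>d 0\<close>.\<close>
  have im: "a \<odot>\<^bsub>?F0\<^esub> x1 \<in> d 0 ` carrier ?F1" if a: "a \<in> \<mm>" for a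
  proof -
    have ca: "a \<in> carrier R" using a m_carrier by blast
    have "\<epsilon> (a \<odot>\<^bsub>?F0\<^esub> x1) = a \<odot>\<^bsub>?k\<^esub> ?\<pi> \<one>" using lin_mapsD(3)[OF \<epsilon>(1) x1(1) ca] x1(2) by simp
    also have "\<dots> = ?\<pi> a" using RM.quot_smult[OF sm, of \<one> a] ca by simp
    also have "\<dots> = \<zero>\<^bsub>?k\<^esub>" using \<pi>_mem[OF ca] a k0 by simp
    finally show ?thesis unfolding ex0 using F0.smult_closed[OF ca x1(1)] by blast
  qed
  obtain x' where x': "x' \<in> carrier ?F1" "d 0 x' = y \<odot>\<^bsub>?F0\<^esub> x1" using im[OF y] by auto
  let ?Y = "scaled M y (carrier M)"
  have Y: "submodule ?Y R M" by (rule submodule_scaled[OF carrier_is_submodule cy])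
  have ev: "\<phi> x' = l x1 \<odot>\<^bsub>M\<^esub> u"
    if "\<phi> \<in> ?Z" "\<forall>x\<in>carrier ?F1. y \<odot>\<^bsub>M\<^esub> \<phi> x = l (d 0 x) \<odot>\<^bsub>M\<^esub> u" "u \<in> carrier M" for \<phi> u
  proof (rule injy)
    have "l (d 0 x') = y \<otimes> l x1" unfolding x'(2) by (rule lD(3)[OF x1(1) cy])
    then show "y \<odot>\<^bsub>M\<^esub> \<phi> x' = y \<odot>\<^bsub>M\<^esub> (l x1 \<odot>\<^bsub>M\<^esub> u)" using that(2) x'(1) that(3) cl cy by (simp add: smult_assoc1)
    have "\<phi> \<in> lin_maps R ?F1 M" using that(1) Zdef lin1 by blast
    then show "\<phi> x' \<in> carrier M" by (rule lin_mapsD(1)[OF _ x'(1)])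
    show "l x1 \<odot>\<^bsub>M\<^esub> u \<in> carrier M" using cl that(3) by simp
  qed
  have unl: "u \<in> ?Y" if "l x1 \<odot>\<^bsub>M\<^esub> u \<in> ?Y" "u \<in> carrier M" for u
  proof -
    have "e \<odot>\<^bsub>M\<^esub> (l x1 \<odot>\<^bsub>M\<^esub> u) \<in> ?Y" by (rule submoduleE(4)[OF Y e(1) that(1)])
    then show ?thesis using e cl that(2) by (simp add: smult_assoc1[symmetric])
  qed
  \<comment> \<open>A coboundary takes a value in \<open>yM\<close> at \<open>x'\<close>, since
    \<open>d 0 x' = y x1\<close>. So the unit multiple \<open>l x1\<close> of a socle element is a
    multiple of the single element \<open>\<phi>0 x'\<close> modulo \<open>yM\<close>.\<close>
  have decomp: "\<exists>r\<in>carrier R. \<exists>s\<in>?Y. l x1 \<odot>\<^bsub>M\<^esub> u = s \<oplus>\<^bsub>M\<^esub> r \<odot>\<^bsub>M\<^esub> \<phi>0 x'"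
    if u: "u \<in> carrier M" "\<And>a. a \<in> \<mm> \<Longrightarrow> a \<odot>\<^bsub>M\<^esub> u \<in> ?Y" for u
  proof -
    obtain \<phi> where \<phi>: "\<phi> \<in> ?Z" "\<forall>x\<in>carrier ?F1. y \<odot>\<^bsub>M\<^esub> \<phi> x = l (d 0 x) \<odot>\<^bsub>M\<^esub> u" using coc[OF u] by blast
    obtain r \<psi> where r: "r \<in> carrier R" "\<psi> \<in> lin_maps R ?F0 M"
      "\<forall>x\<in>carrier ?F1. \<phi> x = \<psi> (d 0 x) \<oplus>\<^bsub>M\<^esub> r \<odot>\<^bsub>M\<^esub> \<phi>0 x" using G[OF \<phi>(1)] by blast
    have "\<psi> (d 0 x') = y \<odot>\<^bsub>M\<^esub> \<psi> x1" unfolding x'(2) by (rule lin_mapsD(3)[OF r(2) x1(1) cy])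
    then have "\<psi> (d 0 x') \<in> ?Y" unfolding scaled_def using lin_mapsD(1)[OF r(2) x1(1)] by blast
    moreover have "l x1 \<odot>\<^bsub>M\<^esub> u = \<psi> (d 0 x') \<oplus>\<^bsub>M\<^esub> r \<odot>\<^bsub>M\<^esub> \<phi>0 x'"
      using ev[OF \<phi> u(1)] r(3) x'(1) by simp
    ultimately show ?thesis using r(1) by blast
  qed
  obtain r1 s1 where 1: "r1 \<in> carrier R" "s1 \<in> ?Y" "l x1 \<odot>\<^bsub>M\<^esub> u1 = s1 \<oplus>\<^bsub>M\<^esub> r1 \<odot>\<^bsub>M\<^esub> \<phi>0 x'" using decomp[OF u1] by blast
  obtain r2 s2 where 2: "r2 \<in> carrier R" "s2 \<in> ?Y" "l x1 \<odot>\<^bsub>M\<^esub> u2 = s2 \<oplus>\<^bsub>M\<^esub> r2 \<odot>\<^bsub>M\<^esub> \<phi>0 x'" using decomp[OF u2] by blast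
  have cf: "\<phi>0 x' \<in> carrier M" by (rule lin_mapsD(1)[OF lin0 x'(1)])
  have cs: "s1 \<in> carrier M" "s2 \<in> carrier M" using 1 2 submoduleE(1)[OF Y] by blast+
  \<comment> \<open>Otherwise \<open>r2 x1 = d 0 x''\<close> for some \<open>x''\<close>. Then
    \<open>r2 x' - y x''\<close> is a cycle, hence a boundary, and \<open>\<phi>0\<close> vanishes
    on it. This puts \<open>r2 \<phi>0(x')\<close> and with it \<open>u2\<close> into
    \<open>yM\<close>.\<close>
  have "r2 \<notin> \<mm>"
  proof
    assume r2: "r2 \<in> \<mm>"
    obtain x'' where x'': "x'' \<in> carrier ?F1" "d 0 x'' = r2 \<odot>\<^bsub>?F0\<^esub> x1" using im[OF r2] by auto
    have a: "r2 \<odot>\<^bsub>?F1\<^esub> x' \<in> carrier ?F1" "y \<odot>\<^bsub>?F1\<^esub> x'' \<in> carrier ?F1"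
      using F1.smult_closed 2(1) cy x'(1) x''(1) by blast+
    let ?t = "r2 \<odot>\<^bsub>?F1\<^esub> x' \<ominus>\<^bsub>?F1\<^esub> y \<odot>\<^bsub>?F1\<^esub> x''"
    have t: "?t \<in> carrier ?F1" using a by (rule F1.M.minus_closed)
    have eq: "d 0 (r2 \<odot>\<^bsub>?F1\<^esub> x') = d 0 (y \<odot>\<^bsub>?F1\<^esub> x'')"
      unfolding lin_mapsD(3)[OF d0 x'(1) 2(1)] lin_mapsD(3)[OF d0 x''(1) cy] x'(2) x''(2)
      using 2(1) cy x1(1) F0.smult_assoc1 R.m_comm by metis
    have "d 0 ?t = d 0 (r2 \<odot>\<^bsub>?F1\<^esub> x') \<oplus>\<^bsub>?F0\<^esub> \<ominus>\<^bsub>?F0\<^esub> d 0 (y \<odot>\<^bsub>?F1\<^esub> x'')"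
      unfolding a_minus_def lin_mapsD(2)[OF d0 a(1) F1.M.a_inv_closed[OF a(2)]]
        lin_maps_minus[OF F1.module_axioms F0.module_axioms d0 a(2)] ..
    also have "\<dots> = \<zero>\<^bsub>?F0\<^esub>" unfolding eq by (rule F0.M.r_neg[OF d0F[OF a(2)]])
    finally have "?t \<in> d (Suc 0) ` carrier ?F2" unfolding ex1 using t by blast
    then have "\<phi>0 ?t = \<zero>\<^bsub>M\<^esub>" using \<phi>0(1) Zdef by auto
    moreover have "?t \<oplus>\<^bsub>?F1\<^esub> y \<odot>\<^bsub>?F1\<^esub> x'' = r2 \<odot>\<^bsub>?F1\<^esub> x'"
      unfolding a_minus_def using a F1.M.a_inv_closed[OF a(2)] by (simp only: F1.M.a_assoc F1.M.l_neg F1.M.r_zero)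
    ultimately have "\<phi>0 (r2 \<odot>\<^bsub>?F1\<^esub> x') = \<zero>\<^bsub>M\<^esub> \<oplus>\<^bsub>M\<^esub> \<phi>0 (y \<odot>\<^bsub>?F1\<^esub> x'')"
      using lin_mapsD(2)[OF lin0 t a(2)] by simp
    then have "r2 \<odot>\<^bsub>M\<^esub> \<phi>0 x' = y \<odot>\<^bsub>M\<^esub> \<phi>0 x''"
      using lin_mapsD(3)[OF lin0 x'(1) 2(1)] lin_mapsD(3)[OF lin0 x''(1) cy] lin_mapsD(1)[OF lin0 x''(1)] cy by simp
    then have "r2 \<odot>\<^bsub>M\<^esub> \<phi>0 x' \<in> ?Y" unfolding scaled_def using lin_mapsD(1)[OF lin0 x''(1)] by blast
    then have "l x1 \<odot>\<^bsub>M\<^esub> u2 \<in> ?Y" unfolding 2(3) by (rule submoduleE(5)[OF Y 2(2)])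
    then show False using unl u2(1) nu2 by blast
  qed
  then obtain i where i: "i \<in> carrier R" "i \<otimes> r2 = \<one>" using unit_notin_m[OF 2(1)] by blast
  let ?r = "r1 \<otimes> i"
  have "?r \<odot>\<^bsub>M\<^esub> (r2 \<odot>\<^bsub>M\<^esub> \<phi>0 x') = r1 \<odot>\<^bsub>M\<^esub> \<phi>0 x'"
    using 1(1) 2(1) i cf by (simp add: smult_assoc1[symmetric] R.m_assoc)
  then have s: "?r \<odot>\<^bsub>M\<^esub> (l x1 \<odot>\<^bsub>M\<^esub> u2) = ?r \<odot>\<^bsub>M\<^esub> s2 \<oplus>\<^bsub>M\<^esub> r1 \<odot>\<^bsub>M\<^esub> \<phi>0 x'"
    unfolding 2(3) using 1(1) 2(1) i cf cs by (simp add: smult_r_distr)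
  have "l x1 \<odot>\<^bsub>M\<^esub> (u1 \<ominus>\<^bsub>M\<^esub> ?r \<odot>\<^bsub>M\<^esub> u2) = l x1 \<odot>\<^bsub>M\<^esub> u1 \<ominus>\<^bsub>M\<^esub> ?r \<odot>\<^bsub>M\<^esub> (l x1 \<odot>\<^bsub>M\<^esub> u2)"
    using u1(1) u2(1) cl 1(1) i(1) by (simp add: a_minus_def smult_r_distr smult_r_minus smult_assoc1[symmetric] R.m_ac)
  also have "\<dots> = s1 \<ominus>\<^bsub>M\<^esub> ?r \<odot>\<^bsub>M\<^esub> s2"
    unfolding s 1(3) using cs cf 1(1) i(1) by (simp add: a_minus_def M.minus_add M.a_ac M.r_neg M.r_neg1 M.r_neg2)
  also have "\<dots> \<in> ?Y" using 1(1) i(1) by (intro submodule_diff[OF Y 1(2)] submoduleE(4)[OF Y _ 2(2)]) simp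
  finally have lY: "l x1 \<odot>\<^bsub>M\<^esub> (u1 \<ominus>\<^bsub>M\<^esub> ?r \<odot>\<^bsub>M\<^esub> u2) \<in> ?Y" .
  have "u1 \<ominus>\<^bsub>M\<^esub> ?r \<odot>\<^bsub>M\<^esub> u2 \<in> carrier M" using u1(1) u2(1) 1(1) i(1) by simp
  with lY have "u1 \<ominus>\<^bsub>M\<^esub> ?r \<odot>\<^bsub>M\<^esub> u2 \<in> ?Y" by (rule unl)
  then show ?thesis using 1(1) i(1) by blast
qed

text \<open>
  If \<open>f w\<close> is a unit, \<open>M\<close> is the direct sum of \<open>Rw\<close> and the kernel of \<open>f\<close>. Both would contribute
  to the one-dimensional socle of \<open>M/yM\<close>, so the kernel vanishes and \<open>M \<cong> R\<close>.
\<close>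

lemma finite_inj_dim_ring:
  assumes fg: "fin_gen R M" and depth: "depth R \<mm> M = 1" and type: "cm_type R \<mm> M = 1"
    and inj: "finite_inj_dim R M" and y: "y \<in> \<mm>" and k: "P k \<subseteq> PIdl y"
    and reg: "\<And>x. x \<in> carrier M \<Longrightarrow> y \<odot>\<^bsub>M\<^esub> x = \<zero>\<^bsub>M\<^esub> \<Longrightarrow> x = \<zero>\<^bsub>M\<^esub>"
    and f: "f \<in> carrier D" and w: "w \<in> carrier M" "f w \<notin> \<mm>"
  shows "finite_inj_dim R (ring_module R)"
proof -
  have cy: "y \<in> carrier R" using y m_carrier by blast
  note fD = dualD[OF f]
  have lf: "f \<in> lin_maps R M (ring_module R)" using f by (simp add: dual_carrier)
  obtain e where e: "e \<in> carrier R" "e \<otimes> f w = \<one>" using unit_notin_m[OF fD(1)[OF w(1)] w(2)] by blast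
  let ?Y = "scaled M y (carrier M)" and ?K = "{x \<in> carrier M. f x = \<zero>}"
  have K: "submodule ?K R M" using submodule_kernel[OF module_axioms R.module_ring_module lf] by simp
  have C: "submodule (cyclic R M w) R M" by (rule submodule_cyclic[OF w(1)])
  have wc: "\<exists>c\<in>carrier R. \<exists>x\<in>?K. v = c \<odot>\<^bsub>M\<^esub> w \<oplus>\<^bsub>M\<^esub> x" if v: "v \<in> carrier M" for v
  proof (intro bexI)
    let ?c = "f v \<otimes> e"
    show c: "?c \<in> carrier R" using fD(1)[OF v] e by simp
    let ?x = "v \<ominus>\<^bsub>M\<^esub> ?c \<odot>\<^bsub>M\<^esub> w"
    have cw: "?c \<odot>\<^bsub>M\<^esub> w \<in> carrier M" using c w(1) by (rule smult_closed)
    have "f ?x = f v \<oplus> f ((\<ominus> ?c) \<odot>\<^bsub>M\<^esub> w)"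
      using fD(2)[OF v, of "(\<ominus> ?c) \<odot>\<^bsub>M\<^esub> w"] c w(1) by (simp add: a_minus_def smult_l_minus)
    also have "f ((\<ominus> ?c) \<odot>\<^bsub>M\<^esub> w) = \<ominus> (f v \<otimes> (e \<otimes> f w))"
      using fD(3)[OF w(1), of "\<ominus> ?c"] c fD(1)[OF v] fD(1)[OF w(1)] e(1) by (simp add: R.l_minus R.m_assoc)
    finally have "f ?x = \<zero>" using e fD(1)[OF v] by (simp add: R.r_neg)
    then show "?x \<in> ?K" using v cw by simp
    show "v = ?c \<odot>\<^bsub>M\<^esub> w \<oplus>\<^bsub>M\<^esub> ?x" using v cw by (simp add: a_minus_def M.a_ac M.r_neg M.r_neg1 M.r_neg2)
  qed
  \<comment> \<open>It suffices that the kernel lies in \<open>yM\<close>: then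
    \<open>M = Rw + \<mm>M\<close>, and Nakayama's lemma gives \<open>M = Rw\<close>.\<close>
  have "?K \<subseteq> ?Y"
  proof (rule ccontr)
    assume nK: "\<not> ?K \<subseteq> ?Y"
    obtain u2 where u2: "u2 \<in> ?K" "u2 \<notin> ?Y" "\<And>a. a \<in> \<mm> \<Longrightarrow> a \<odot>\<^bsub>M\<^esub> u2 \<in> ?Y"
      using socle_element[OF K cy k nK] by blast
    have fY: "f v \<in> \<mm>" if v: "v \<in> ?Y" for v
    proof -
      obtain x where x: "x \<in> carrier M" "v = y \<odot>\<^bsub>M\<^esub> x" using v unfolding scaled_def by blast
      show ?thesis unfolding x(2) fD(3)[OF x(1) cy] by (rule ideal.I_r_closed[OF ideal_m y fD(1)[OF x(1)]])
    qed
    have nC: "\<not> cyclic R M w \<subseteq> ?Y" using fY[of w] w(2) cyclic_self[OF w(1)] by blast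
    obtain u1 where u1: "u1 \<in> cyclic R M w" "u1 \<notin> ?Y" "\<And>a. a \<in> \<mm> \<Longrightarrow> a \<odot>\<^bsub>M\<^esub> u1 \<in> ?Y"
      using socle_element[OF C cy k nC] by blast
    obtain c where c: "c \<in> carrier R" "u1 = c \<odot>\<^bsub>M\<^esub> w" using u1(1) unfolding cyclic_def by blast
    have cu: "u1 \<in> carrier M" "u2 \<in> carrier M" using c w u2(1) by simp_all
    obtain r where r: "r \<in> carrier R" "u1 \<ominus>\<^bsub>M\<^esub> r \<odot>\<^bsub>M\<^esub> u2 \<in> ?Y"
      using type_one_socle[OF depth type y reg cu(1) u1(3) cu(2) u2(3) u2(2)] by blast
    then obtain x where x: "x \<in> carrier M" "u1 \<ominus>\<^bsub>M\<^esub> r \<odot>\<^bsub>M\<^esub> u2 = y \<odot>\<^bsub>M\<^esub> x" unfolding scaled_def by blast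
    \<comment> \<open>As \<open>f\<close> vanishes on \<open>u2\<close>, applying it to the relation
      isolates the coefficient \<open>c\<close> of \<open>u1\<close> and shows that \<open>y\<close>
      divides it.\<close>
    have "f (u1 \<ominus>\<^bsub>M\<^esub> r \<odot>\<^bsub>M\<^esub> u2) = f u1 \<oplus> f ((\<ominus> r) \<odot>\<^bsub>M\<^esub> u2)"
      using fD(2)[OF cu(1), of "(\<ominus> r) \<odot>\<^bsub>M\<^esub> u2"] r(1) cu by (simp add: a_minus_def smult_l_minus)
    also have "\<dots> = c \<otimes> f w"
      using fD(3)[OF cu(2), of "\<ominus> r"] r(1) u2(1) fD(3)[OF w(1) c(1)] c fD(1)[OF w(1)] by simp
    finally have "c \<otimes> f w = y \<otimes> f x" unfolding x(2) fD(3)[OF x(1) cy] by simp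
    then have "e \<otimes> (c \<otimes> f w) = e \<otimes> (y \<otimes> f x)" by simp
    moreover have "e \<otimes> (c \<otimes> f w) = c \<otimes> (e \<otimes> f w)" using e(1) c(1) fD(1)[OF w(1)] by (simp add: R.m_ac)
    ultimately have "c = y \<otimes> (e \<otimes> f x)" using e c(1) cy fD(1)[OF x(1)] by (simp add: R.m_ac)
    then have "u1 = y \<odot>\<^bsub>M\<^esub> ((e \<otimes> f x) \<odot>\<^bsub>M\<^esub> w)" using c(2) e(1) cy fD(1)[OF x(1)] w(1) by (simp add: smult_assoc1)
    then have "u1 \<in> ?Y" unfolding scaled_def using e(1) fD(1)[OF x(1)] w(1) by simp
    with u1(2) show False by blast
  qed
  have "carrier M = cyclic R M w"
  proof (rule nakayama[OF _ C submoduleE(1)[OF C]])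
    show "fg_sub R M (carrier M)" using fg by (simp add: fin_gen_iff_fg_sub)
    show "carrier M \<subseteq> cyclic R M w <+>\<^bsub>M\<^esub> ideal_smul R M \<mm> (carrier M)"
    proof
      fix v assume "v \<in> carrier M"
      then obtain c x where cx: "c \<in> carrier R" "x \<in> ?K" "v = c \<odot>\<^bsub>M\<^esub> w \<oplus>\<^bsub>M\<^esub> x" using wc by blast
      have "x \<in> ?Y" using cx(2) \<open>?K \<subseteq> ?Y\<close> by blast
      then have "x \<in> ideal_smul R M \<mm> (carrier M)" unfolding scaled_def using ideal_smulI[OF y] by blast
      then show "v \<in> cyclic R M w <+>\<^bsub>M\<^esub> ideal_smul R M \<mm> (carrier M)"
        unfolding cx(3) set_add_def' cyclic_def using cx(1) by blast
    qed
  qed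
  \<comment> \<open>The factor \<open>e\<close> inverts \<open>f w\<close>, which makes
    \<open>h\<close> the inverse of \<open>f\<close>.\<close>
  define h where "h a = (a \<otimes> e) \<odot>\<^bsub>M\<^esub> w" for a
  have h_img: "h ` carrier R = carrier M"
  proof
    show "h ` carrier R \<subseteq> carrier M" using e(1) w(1) by (auto simp: h_def)
    show "carrier M \<subseteq> h ` carrier R"
    proof
      fix v assume "v \<in> carrier M"
      then obtain c where c: "c \<in> carrier R" "v = c \<odot>\<^bsub>M\<^esub> w" using \<open>carrier M = cyclic R M w\<close> unfolding cyclic_def by blast
      have "c \<otimes> f w \<otimes> e = c \<otimes> (e \<otimes> f w)" using c(1) e(1) fD(1)[OF w(1)] by (simp add: R.m_ac)
      then have "c \<otimes> f w \<otimes> e = c" using c(1) e(2) by simp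
      then have "v = h (c \<otimes> f w)" using c(2) by (simp add: h_def)
      then show "v \<in> h ` carrier R" using c(1) fD(1)[OF w(1)] by blast
    qed
  qed
  have fh: "f (h a) = a" if "a \<in> carrier R" for a
    using fD(3)[OF w(1), of "a \<otimes> e"] that e fD(1)[OF w(1)] by (simp add: h_def R.m_assoc)
  have h: "h \<in> lin_maps R (ring_module R) M"
    by (rule lin_mapsI) (use e(1) w(1) in \<open>simp_all add: h_def R.l_distr smult_l_distr R.m_assoc smult_assoc1\<close>)
  obtain E :: "nat \<Rightarrow> ('r, nat \<Rightarrow> 'r) module" and d \<eta> n where
    res: "injective_resolution R M E d \<eta>" and fin: "\<forall>i>n. carrier (E i) = {\<zero>\<^bsub>E i\<^esub>}"
    using inj unfolding finite_inj_dim_def by blast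
  have \<eta>: "\<eta> \<in> lin_maps R M (E 0)" "inj_on \<eta> (carrier M)" using res by (simp_all add: injective_resolution_def)
  \<comment> \<open>Only the augmentation of the resolution has to change; \<open>h\<close> carries
    it from \<open>M\<close> to \<open>R\<close> with the same image.\<close>
  have "(\<eta> \<circ> h) \<in> lin_maps R (ring_module R) (E 0)"
  proof (rule lin_mapsI)
    fix a assume a: "a \<in> carrier (ring_module R)"
    note ha = lin_mapsD[OF h a]
    show "(\<eta> \<circ> h) a \<in> carrier (E 0)" using lin_mapsD(1)[OF \<eta>(1) ha(1)] by simp
    show "(\<eta> \<circ> h) (a \<oplus>\<^bsub>ring_module R\<^esub> b) = (\<eta> \<circ> h) a \<oplus>\<^bsub>E 0\<^esub> (\<eta> \<circ> h) b" if b: "b \<in> carrier (ring_module R)" for b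
      unfolding comp_apply ha(2)[OF b] by (rule lin_mapsD(2)[OF \<eta>(1) ha(1) lin_mapsD(1)[OF h b]])
    show "(\<eta> \<circ> h) (r \<odot>\<^bsub>ring_module R\<^esub> a) = r \<odot>\<^bsub>E 0\<^esub> (\<eta> \<circ> h) a" if r: "r \<in> carrier R" for r
      unfolding comp_apply ha(3)[OF r] by (rule lin_mapsD(3)[OF \<eta>(1) ha(1) r])
  qed
  moreover have "inj_on h (carrier R)" by (rule inj_on_inverseI[of _ f]) (rule fh)
  then have "inj_on (\<eta> \<circ> h) (carrier (ring_module R))" using \<eta>(2) h_img by (simp add: comp_inj_on)
  moreover have "(\<eta> \<circ> h) ` carrier (ring_module R) = \<eta> ` carrier M" by (simp only: image_comp[symmetric] ring_module_simps h_img)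
  ultimately have "injective_resolution R (ring_module R) E d (\<eta> \<circ> h)"
    using res unfolding injective_resolution_def by (simp only: simp_thms)
  then show ?thesis using fin unfolding finite_inj_dim_def by blast
qed

end

subsection \<open>Ulrich modules\<close>

context plain_module begin

lemma module_restrict: "submodule V R M \<Longrightarrow> module R (M\<lparr>carrier := V\<rparr>)"
  by (rule submodule.submodule_is_module[OF _ module_axioms])

lemma submodule_restrict_iff:
  assumes V: "submodule V R M"
  shows "submodule W R (M\<lparr>carrier := V\<rparr>) \<longleftrightarrow> submodule W R M \<and> W \<subseteq> V"
proof -
  interpret N: module R "M\<lparr>carrier := V\<rparr>" by (rule module_restrict[OF V])
  show ?thesis
  proof
    assume W: "submodule W R (M\<lparr>carrier := V\<rparr>)"
    have sub: "W \<subseteq> V" using N.submoduleE(1)[OF W] by simp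
    have "module R (M\<lparr>carrier := V\<rparr>\<lparr>carrier := W\<rparr>)"
      by (rule submodule.submodule_is_module[OF W N.module_axioms])
    then have "submodule W R M"
      using sub submoduleE(1)[OF V] by (intro module_incl_imp_submodule) auto
    with sub show "submodule W R M \<and> W \<subseteq> V" by simp
  next
    assume W: "submodule W R M \<and> W \<subseteq> V"
    show "submodule W R (M\<lparr>carrier := V\<rparr>)"
      using W module_restrict[of W] by (intro N.module_incl_imp_submodule) simp_all
  qed
qed

lemma gen_submodule_restrict:
  assumes V: "submodule V R M" and S: "S \<subseteq> V"
  shows "gen_submodule R (M\<lparr>carrier := V\<rparr>) S = gen_submodule R M S"
proof
  interpret N: plain_module R "M\<lparr>carrier := V\<rparr>" by (rule plain_module.intro[OF module_restrict[OF V]])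
  have sV: "gen_submodule R M S \<subseteq> V" by (rule gen_submodule_least[OF V S])
  have "submodule (gen_submodule R M S) R M" using submodule_gen S submoduleE(1)[OF V] by simp
  then show "gen_submodule R (M\<lparr>carrier := V\<rparr>) S \<subseteq> gen_submodule R M S"
    using sV by (intro N.gen_submodule_least gen_submodule_superset) (simp add: submodule_restrict_iff[OF V])
  have "submodule (gen_submodule R (M\<lparr>carrier := V\<rparr>) S) R (M\<lparr>carrier := V\<rparr>)"
    using S by (intro N.submodule_gen) simp
  then show "gen_submodule R M S \<subseteq> gen_submodule R (M\<lparr>carrier := V\<rparr>) S"
    by (intro gen_submodule_least N.gen_submodule_superset) (simp add: submodule_restrict_iff[OF V])
qed

lemma ideal_smul_restrict:
  assumes V: "submodule V R M" and I: "I \<subseteq> carrier R" and A: "A \<subseteq> V"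
  shows "ideal_smul R (M\<lparr>carrier := V\<rparr>) I A = ideal_smul R M I A"
proof -
  have "{a \<odot>\<^bsub>M\<^esub> x |a x. a \<in> I \<and> x \<in> A} \<subseteq> V" using submoduleE(4)[OF V] I A by auto
  from gen_submodule_restrict[OF V this] show ?thesis by (simp add: ideal_smul_def)
qed

lemma fin_gen_restrict:
  assumes A: "fg_sub R M V"
  shows "fin_gen R (M\<lparr>carrier := V\<rparr>)"
proof -
  obtain S where S: "finite S" "S \<subseteq> carrier M" "gen_submodule R M S = V" using A unfolding fg_sub_def by blast
  have SV: "S \<subseteq> V" unfolding S(3)[symmetric] by (rule gen_submodule_superset)
  have "generates R (M\<lparr>carrier := V\<rparr>) S"
    unfolding generates_def gen_submodule_restrict[OF fg_sub_submodule[OF A] SV] using SV S(3) by simp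
  then show ?thesis unfolding fin_gen_def using S(1) by blast
qed

lemma scaled_ideal_smul:
  assumes I: "I \<subseteq> carrier R" and A: "submodule A R M" and z: "z \<in> carrier R"
  shows "ideal_smul R M (scaled (ring_module R) z I) A = scaled M z (ideal_smul R M I A)"
proof -
  have comm: "(z \<otimes> b) \<odot>\<^bsub>M\<^esub> x = b \<odot>\<^bsub>M\<^esub> (z \<odot>\<^bsub>M\<^esub> x)" if "b \<in> I" "x \<in> A" for b x
    using subsetD[OF I that(1)] subsetD[OF submoduleE(1)[OF A] that(2)] z
    by (simp add: R.m_comm[of z b] smult_assoc1)
  have "{a \<odot>\<^bsub>M\<^esub> x |a x. a \<in> scaled (ring_module R) z I \<and> x \<in> A}
      = {a \<odot>\<^bsub>M\<^esub> x |a x. a \<in> I \<and> x \<in> scaled M z A}" (is "?L = ?R")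
  proof
    show "?L \<subseteq> ?R" unfolding scaled_def using comm by fastforce
    show "?R \<subseteq> ?L"
    proof
      fix v assume "v \<in> ?R"
      then obtain b x where bx: "b \<in> I" "x \<in> A" "v = b \<odot>\<^bsub>M\<^esub> (z \<odot>\<^bsub>M\<^esub> x)" unfolding scaled_def by blast
      have "v = (z \<otimes> b) \<odot>\<^bsub>M\<^esub> x" "z \<otimes> b \<in> scaled (ring_module R) z I"
        unfolding scaled_def using bx comm by auto
      then show "v \<in> ?L" using bx(2) by blast
    qed
  qed
  then have "ideal_smul R M (scaled (ring_module R) z I) A = ideal_smul R M I (scaled M z A)"
    by (simp add: ideal_smul_def)
  also have "\<dots> = scaled M z (ideal_smul R M I A)" by (rule ideal_smul_scaled[OF I A z])
  finally show ?thesis .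
qed

end

context local_module begin

lemma local_module_restrict: "submodule V R M \<Longrightarrow> local_module R (M\<lparr>carrier := V\<rparr>) \<mm>"
  by (intro local_module.intro plain_module.intro module_restrict local_ring_axioms)

text \<open>The Ulrich criterion for a submodule, with its right-hand side computed in the ambient
  module. It is used for \<open>\<mm>^2\<close> in the ring and for \<open>\<mm>\<omega>^*\<close>
  in the dual, with the same \<open>z\<close>.\<close>

lemma min_gens_eq_multiplicity_restrict_iff:
  assumes V: "fg_sub R M V" and dim: "krull_dim R = 1" and s: "0 < s" and z: "z \<in> P s"
    and inj: "inj_on (\<lambda>x. z \<odot>\<^bsub>M\<^esub> x) (carrier M)"
    and red: "\<And>n. n0 \<le> n \<Longrightarrow> scaled (ring_module R) z (P n) = P (n + s)"
  shows "real (min_gens R (M\<lparr>carrier := V\<rparr>)) = multiplicity R \<mm> (M\<lparr>carrier := V\<rparr>)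
    \<longleftrightarrow> ideal_smul R M (P s) V = scaled M z V"
proof -
  have sV: "submodule V R M" by (rule fg_sub_submodule[OF V])
  let ?N = "M\<lparr>carrier := V\<rparr>"
  interpret N: local_module R ?N \<mm> by (rule local_module_restrict[OF sV])
  have cP: "P n \<subseteq> carrier R" for n by (rule ideal_subset[OF ideal_P])
  have "inj_on (\<lambda>x. z \<odot>\<^bsub>?N\<^esub> x) (carrier ?N)" using inj submoduleE(1)[OF sV] by (auto intro: inj_on_subset)
  \<comment> \<open>The relation between \<open>z\<close> and the powers of \<open>\<mm>\<close> in
    the ring is multiplied into the module.\<close>
  moreover have "scaled ?N z (ideal_smul R ?N (P n) (carrier ?N)) = ideal_smul R ?N (P (n + s)) (carrier ?N)"
    if n: "n0 \<le> n" for n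
    unfolding red[OF n, symmetric]
    by (rule N.scaled_ideal_smul[OF cP N.carrier_is_submodule P_carrier[OF z], symmetric])
  ultimately have "real (min_gens R ?N) = multiplicity R \<mm> ?N
      \<longleftrightarrow> ideal_smul R ?N (P s) (carrier ?N) = scaled ?N z (carrier ?N)"
    by (rule N.min_gens_eq_multiplicity_iff[OF fin_gen_restrict[OF V] dim s z])
  then show ?thesis by (simp add: ideal_smul_restrict[OF sV cP] scaled_def)
qed

text \<open>Descending induction on the degree. If
  \<open>\<mm>^n u \<subseteq> \<mm>^(n+1) M\<close> for all \<open>n > i\<close>, the initial forms
  of degree \<open>i\<close> of elements of \<open>\<mm>^i u\<close> are annihilated in positive
  degrees and vanish by \<open>gr_depth_pos\<close>. Degree 0 is the claim.\<close>

lemma mem_pm_1_of_gr_depth: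
  assumes depth: "0 < depth (gr_ring R \<mm>) (gr_plus R \<mm>) Gr" and ne: "pm 1 \<noteq> carrier M"
    and u: "u \<in> carrier M" and J: "\<And>a. a \<in> P J \<Longrightarrow> a \<odot>\<^bsub>M\<^esub> u \<in> pm (Suc J)"
  shows "u \<in> pm 1"
proof -
  \<comment> \<open>Stated for the submodule \<open>Ru\<close>, so that products with powers of
    \<open>\<mm>\<close> can be combined by \<open>ideal_smul_pow_add\<close>.\<close>
  define Q where "Q n \<longleftrightarrow> ideal_smul R M (P n) (cyclic R M u) \<subseteq> pm (Suc n)" for n
  have C: "submodule (cyclic R M u) R M" by (rule submodule_cyclic[OF u])
  have QI: "Q n" if a: "\<And>a. a \<in> P n \<Longrightarrow> a \<odot>\<^bsub>M\<^esub> u \<in> pm (Suc n)" for n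
    unfolding Q_def
  proof (rule ideal_smul_least[OF submodule_pm])
    fix b x assume b: "b \<in> P n" and "x \<in> cyclic R M u"
    then obtain c where c: "c \<in> carrier R" "x = c \<odot>\<^bsub>M\<^esub> u" unfolding cyclic_def by blast
    have "b \<odot>\<^bsub>M\<^esub> x = c \<odot>\<^bsub>M\<^esub> (b \<odot>\<^bsub>M\<^esub> u)"
      using c P_carrier[OF b] u by (simp add: smult_assoc1[symmetric] R.m_comm)
    then show "b \<odot>\<^bsub>M\<^esub> x \<in> pm (Suc n)" using submoduleE(4)[OF submodule_pm c(1) a[OF b]] by simp
  qed
  have QD: "a \<odot>\<^bsub>M\<^esub> u \<in> pm (Suc n)" if "Q n" "a \<in> P n" for n a
    using that(1) ideal_smulI[OF that(2) cyclic_self[OF u]] unfolding Q_def by blast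
  have QJ: "Q n" if n: "J \<le> n" for n
  proof -
    obtain d where d: "n = d + J" using n by (metis le_iff_add add.commute)
    have "ideal_smul R M (P n) (cyclic R M u) = ideal_smul R M (P d) (ideal_smul R M (P J) (cyclic R M u))"
      unfolding d by (rule ideal_smul_pow_add[OF ideal_m C, symmetric])
    also have "\<dots> \<subseteq> ideal_smul R M (P d) (pm (Suc J))"
      using QI[OF J] unfolding Q_def by (intro ideal_smul_mono subset_refl)
    also have "\<dots> = pm (d + Suc J)"
      unfolding ideal_mod_smul by (rule ideal_smul_pow_add[OF ideal_m carrier_is_submodule])
    finally show ?thesis unfolding Q_def d by simp
  qed
  \<comment> \<open>An element \<open>b\<close> of positive degree \<open>j\<close> multiplies
    \<open>au\<close> into \<open>\<mm>^(j+i) u\<close>, where the inclusion is already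
    known.\<close>
  have step: "Q i" if i: "\<And>n. i < n \<Longrightarrow> Q n" for i
  proof (rule QI)
    fix a assume a: "a \<in> P i"
    show "a \<odot>\<^bsub>M\<^esub> u \<in> pm (Suc i)"
    proof (rule gr_depth_pos[OF depth ne])
      show "a \<odot>\<^bsub>M\<^esub> u \<in> pm i" using pm_smult[OF a, of u 0] u by (simp add: pm_0)
      fix j b assume j: "0 < j" and b: "b \<in> P j"
      have "b \<odot>\<^bsub>M\<^esub> (a \<odot>\<^bsub>M\<^esub> u) = (b \<otimes> a) \<odot>\<^bsub>M\<^esub> u"
        using P_carrier[OF a] P_carrier[OF b] u by (simp add: smult_assoc1)
      also have "\<dots> \<in> pm (Suc (j + i))" using j by (intro QD[OF i P_mult[OF b a]]) simp
      finally show "b \<odot>\<^bsub>M\<^esub> (a \<odot>\<^bsub>M\<^esub> u) \<in> pm (Suc (j + i))" .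
    qed
  qed
  have "\<forall>n\<ge>J - d. Q n" for d
  proof (induction d)
    case 0 then show ?case using QJ by simp
  next
    case (Suc d)
    show ?case
    proof (intro allI impI)
      fix n assume n: "J - Suc d \<le> n"
      show "Q n"
      proof (cases "J - d \<le> n")
        case True with Suc show ?thesis by simp
      next
        case False
        with n have "\<And>k. n < k \<Longrightarrow> J - d \<le> k" by linarith
        then show ?thesis using Suc step by simp
      qed
    qed
  qed
  from this[of J] have "Q 0" by simp
  moreover have "\<one> \<in> P 0" by (simp add: R.ideal_pow_0)
  ultimately show ?thesis using QD[of 0 \<one>] u by simp
qed

end

context cm1_module begin

theorem ulrich_smult_dual:
  assumes fg: "fin_gen R M" and depth: "depth R \<mm> M = 1" and type: "cm_type R \<mm> M = 1"
    and inj: "finite_inj_dim R M" and ngor: "\<not> finite_inj_dim R (ring_module R)"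
    and gr: "0 < Defs.depth (gr_ring R \<mm>) (gr_plus R \<mm>) (gr_module R \<mm> D)"
    and ulrich: "ulrich R \<mm> ((ring_module R)\<lparr>carrier := P 2\<rparr>)"
  shows "ulrich R \<mm> (D\<lparr>carrier := ideal_mod R D \<mm>\<rparr>)"
proof -
  interpret D: local_module R D \<mm> by (rule local_module_dual)
  interpret A: local_module R "ring_module R" \<mm> by (rule local_module_ring)
  obtain y k where y: "y \<in> \<mm>" and regR: "\<And>x. x \<in> carrier R \<Longrightarrow> y \<otimes> x = \<zero> \<Longrightarrow> x = \<zero>"
    and k: "P k \<subseteq> PIdl y" using exists_parameter by blast
  have cy: "y \<in> carrier R" using y m_carrier by blast
  have P1: "P 1 = \<mm>" using R.ideal_pow_1[OF ideal_m] by simp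
  obtain y' where y': "y' \<in> \<mm>" and reg': "\<And>x. x \<in> carrier M \<Longrightarrow> y' \<odot>\<^bsub>M\<^esub> x = \<zero>\<^bsub>M\<^esub> \<Longrightarrow> x = \<zero>\<^bsub>M\<^esub>"
    using depth_eq_1_regular(1)[OF depth] by blast
  have "y' [^] k \<in> P k" using P_pow[of y' 1 k] y' P1 by simp
  then obtain r where r: "r \<in> carrier R" "y' [^] k = r \<otimes> y" using k unfolding cgenideal_def by blast
  have regM: "x = \<zero>\<^bsub>M\<^esub>" if "x \<in> carrier M" "y \<odot>\<^bsub>M\<^esub> x = \<zero>\<^bsub>M\<^esub>" for x
    by (rule regular_of_regular[OF y' reg' cy r that])
  have ne: "carrier M \<noteq> {\<zero>\<^bsub>M\<^esub>}"
  proof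
    assume z: "carrier M = {\<zero>\<^bsub>M\<^esub>}"
    have "\<zero>\<^bsub>M\<^esub> \<in> ideal_mod R M \<mm>"
      unfolding ideal_mod_smul by (rule submodule_zero[OF submodule_ideal_smul[OF m_carrier subset_refl]])
    moreover have "ideal_mod R M \<mm> \<subseteq> carrier M"
      unfolding ideal_mod_smul by (rule submoduleE(1)[OF submodule_ideal_smul[OF m_carrier subset_refl]])
    ultimately show False using depth_eq_1_regular(2)[OF depth] unfolding z by blast
  qed
  have fgD: "fin_gen R D" by (rule dual_fin_gen[OF fg])
  have neD: "carrier D \<noteq> {\<zero>\<^bsub>D\<^esub>}" by (rule dual_nonzero[OF fg ne y regR regM])
  have regD: "f = \<zero>\<^bsub>D\<^esub>" if "f \<in> carrier D" "y \<odot>\<^bsub>D\<^esub> f = \<zero>\<^bsub>D\<^esub>" for f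
    by (rule dual_regular[OF cy regR that])
  have ne1: "D.pm 1 \<noteq> carrier D" unfolding P1 ideal_mod_smul by (rule D.smult_proper[OF fgD neD])
  have fm: "f w \<in> \<mm>" if "f \<in> carrier D" "w \<in> carrier M" for f w
    using finite_inj_dim_ring[OF fg depth type inj y k regM that] ngor by blast
  obtain s z n0 where s: "0 < s" and z: "z \<in> P s"
    and red: "\<And>n. n0 \<le> n \<Longrightarrow> scaled (ring_module R) z (P n) = P (n + s)"
    using exists_reduction by blast
  have cz: "z \<in> carrier R" by (rule P_carrier[OF z])
  \<comment> \<open>Shows that \<open>z\<close> divides a power of \<open>y\<close>; so
    \<open>z\<close> is regular wherever \<open>y\<close> is, on the ring and on the dual.\<close>
  have "y [^] (n0 + s) \<in> P (n0 + s)" using P_pow[of y 1 "n0 + s"] y P1 by simp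
  then obtain q where q: "q \<in> P n0" "y [^] (n0 + s) = z \<otimes> q"
    unfolding red[OF order_refl, symmetric] scaled_def by auto
  have q': "q \<in> carrier R" "y [^] (n0 + s) = q \<otimes> z"
    using q(2) P_carrier[OF q(1)] cz by (simp_all add: R.m_comm)
  have zR: "x = \<zero>" if "x \<in> carrier R" "z \<otimes> x = \<zero>" for x
    using A.regular_of_regular[OF y _ cz q', of x] regR that by simp
  have zD: "f = \<zero>\<^bsub>D\<^esub>" if "f \<in> carrier D" "z \<odot>\<^bsub>D\<^esub> f = \<zero>\<^bsub>D\<^esub>" for f
    by (rule D.regular_of_regular[OF y regD cz q' that])
  have injR: "inj_on (\<lambda>x. z \<odot>\<^bsub>ring_module R\<^esub> x) (carrier (ring_module R))"
    by (rule A.regular_inj[OF cz]) (simp add: zR)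
  have injD: "inj_on (\<lambda>x. z \<odot>\<^bsub>D\<^esub> x) (carrier D)" by (rule D.regular_inj[OF cz zD])
  have fgP: "fg_sub R (ring_module R) (P 2)"
  proof -
    obtain T where T: "T \<subseteq> carrier R" "finite T" "P 2 = Idl T" using finitely_gen[OF ideal_P] by blast
    have "gen_submodule R (ring_module R) T = Idl T"
      by (simp add: gen_submodule_def genideal_def R.submodule_ring_module_iff)
    then show ?thesis unfolding fg_sub_def using T by auto
  qed
  have zP: "ideal_smul R (ring_module R) (P s) (P 2) = scaled (ring_module R) z (P 2)"
    using ulrich A.min_gens_eq_multiplicity_restrict_iff[OF fgP dim s z injR red]
    unfolding ulrich_def by blast
  define V where "V = D.pm 1"
  have V: "submodule V R D" unfolding V_def by (rule D.submodule_pm)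
  note cV = D.submoduleE(1)[OF V, THEN subsetD]
  have fgV: "fg_sub R D V"
    unfolding V_def ideal_mod_smul using fgD by (intro D.fg_sub_smul ideal_P) (simp add: fin_gen_iff_fg_sub)
  have V2: "f w \<in> P 2" if f: "f \<in> V" and w: "w \<in> carrier M" for f w
  proof -
    \<comment> \<open>Evaluation at \<open>w\<close> is linear, so the functionals with value in
      \<open>P 2\<close> form a submodule, and only products \<open>a f\<close> with
      \<open>a \<in> \<mm>\<close> have to be tested.\<close>
    let ?E = "{f \<in> carrier D. f w \<in> P 2}"
    have ev: "(\<lambda>f. f w) \<in> lin_maps R D (ring_module R)"
      using w dualD(1) by (intro lin_mapsI) (simp_all add: dual_add dual_smult)
    have P2: "submodule (P 2) R (ring_module R)" using ideal_P by (simp add: R.submodule_ring_module_iff)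
    have "submodule ?E R D"
    proof (rule D.submoduleI)
      show "?E \<subseteq> carrier D" by blast
      show "\<zero>\<^bsub>D\<^esub> \<in> ?E" using w P_zero by (simp add: dual_zero[symmetric]) (simp add: dual_zero)
      fix f g assume f: "f \<in> ?E"
      show "\<ominus>\<^bsub>D\<^esub> f \<in> ?E"
        using f lin_maps_minus[OF D.module_axioms A.module_axioms ev, of f] A.submoduleE(3)[OF P2, of "f w"] by simp
      { assume "g \<in> ?E" then show "f \<oplus>\<^bsub>D\<^esub> g \<in> ?E"
          using f lin_mapsD(2)[OF ev, of f g] P_add by simp }
      { fix a assume a: "a \<in> carrier R" then show "a \<odot>\<^bsub>D\<^esub> f \<in> ?E"
          using f lin_mapsD(3)[OF ev, of f a] ideal.I_l_closed[OF ideal_P] by simp }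
    qed
    moreover have "a \<odot>\<^bsub>D\<^esub> f \<in> ?E" if af: "a \<in> P 1" "f \<in> carrier D" for a f
    proof -
      have "a \<otimes> f w \<in> P (1 + 1)" using af fm[OF af(2) w] P1 by (intro P_mult) simp_all
      then have "a \<odot>\<^bsub>D\<^esub> f \<in> ?E \<longleftrightarrow> a \<odot>\<^bsub>D\<^esub> f \<in> carrier D" using w by (simp add: dual_smult numeral_2_eq_2)
      then show ?thesis using af(2) P_carrier[OF af(1)] by simp
    qed
    ultimately have "D.pm 1 \<subseteq> ?E" unfolding ideal_mod_smul by (rule D.ideal_smul_least)
    then show ?thesis using f unfolding V_def by blast
  qed
  have div: "c \<odot>\<^bsub>D\<^esub> f \<in> scaled D z (carrier D)" if c: "c \<in> P s" and f: "f \<in> V" for c f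
  proof -
    have cc: "c \<in> carrier R" by (rule P_carrier[OF c])
    have "\<exists>t. t \<in> P 2 \<and> c \<otimes> f w = z \<otimes> t" if w: "w \<in> carrier M" for w
    proof -
      have "c \<odot>\<^bsub>ring_module R\<^esub> f w \<in> scaled (ring_module R) z (P 2)"
        unfolding zP[symmetric] by (rule A.ideal_smulI[OF c V2[OF f w]])
      then show ?thesis unfolding scaled_def by auto
    qed
    then obtain g where g: "\<And>w. w \<in> carrier M \<Longrightarrow> g w \<in> P 2 \<and> c \<otimes> f w = z \<otimes> g w" by metis
    note gc = g[THEN conjunct1, THEN P_carrier] and ge = g[THEN conjunct2]
    note fD = dualD[OF cV[OF f]]
    \<comment> \<open>Cancelling \<open>z\<close> makes the chosen quotients unique, hence linear in
      the argument.\<close>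
    have zi: "a = b" if "z \<otimes> a = z \<otimes> b" "a \<in> carrier R" "b \<in> carrier R" for a b
      using inj_onD[OF injR, of a b] that by simp
    have gl: "restrict g (carrier M) \<in> carrier D"
    proof -
      have "restrict g (carrier M) \<in> lin_maps R M (ring_module R)"
      proof (rule lin_mapsI)
        fix x assume x: "x \<in> carrier M"
        show "restrict g (carrier M) x \<in> carrier (ring_module R)" using gc[OF x] x by simp
        { fix x' assume x': "x' \<in> carrier M"
          have "z \<otimes> g (x \<oplus>\<^bsub>M\<^esub> x') = c \<otimes> (f x \<oplus> f x')"
            using ge[of "x \<oplus>\<^bsub>M\<^esub> x'"] x x' fD(2)[OF x x'] by simp
          also have "\<dots> = z \<otimes> g x \<oplus> z \<otimes> g x'" using ge[OF x] ge[OF x'] cc fD(1)[OF x] fD(1)[OF x'] by (simp add: R.r_distr)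
          also have "\<dots> = z \<otimes> (g x \<oplus> g x')" using cz gc[OF x] gc[OF x'] by (simp add: R.r_distr)
          finally have "g (x \<oplus>\<^bsub>M\<^esub> x') = g x \<oplus> g x'"
            by (rule zi) (use x x' gc in simp_all)
          then show "restrict g (carrier M) (x \<oplus>\<^bsub>M\<^esub> x') = restrict g (carrier M) x \<oplus>\<^bsub>ring_module R\<^esub> restrict g (carrier M) x'"
            using x x' by simp }
        { fix a assume a: "a \<in> carrier R"
          have "z \<otimes> g (a \<odot>\<^bsub>M\<^esub> x) = c \<otimes> (a \<otimes> f x)"
            using ge[of "a \<odot>\<^bsub>M\<^esub> x"] x a fD(3)[OF x a] by simp
          also have "\<dots> = a \<otimes> (z \<otimes> g x)" unfolding ge[OF x, symmetric] using cc a fD(1)[OF x] by (rule R.m_lcomm)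
          also have "\<dots> = z \<otimes> (a \<otimes> g x)" using a cz gc[OF x] by (rule R.m_lcomm)
          finally have "g (a \<odot>\<^bsub>M\<^esub> x) = a \<otimes> g x"
            by (rule zi) (use x a gc in simp_all)
          then show "restrict g (carrier M) (a \<odot>\<^bsub>M\<^esub> x) = a \<odot>\<^bsub>ring_module R\<^esub> restrict g (carrier M) x"
            using x a by simp }
      qed
      then show ?thesis by (simp add: dual_carrier)
    qed
    have "c \<odot>\<^bsub>D\<^esub> f = z \<odot>\<^bsub>D\<^esub> restrict g (carrier M)"
      unfolding dual_smult by (rule restrict_ext) (simp add: ge)
    then show ?thesis unfolding scaled_def using gl by blast
  qed
  have "ideal_smul R D (P s) V \<subseteq> scaled D z V"
  proof
    fix w assume w: "w \<in> ideal_smul R D (P s) V"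
    have "ideal_smul R D (P s) V \<subseteq> scaled D z (carrier D)"
      by (rule D.ideal_smul_least[OF D.submodule_scaled[OF D.carrier_is_submodule cz] div])
    then obtain u where u: "u \<in> carrier D" "w = z \<odot>\<^bsub>D\<^esub> u" using w unfolding scaled_def by blast
    have ws: "w \<in> D.pm (Suc s)"
      using w D.ideal_smul_pow_add[OF ideal_m D.carrier_is_submodule, of s 1] unfolding V_def ideal_mod_smul by simp
    have "u \<in> D.pm 1"
    proof (rule D.mem_pm_1_of_gr_depth[OF gr ne1 u(1)])
      fix a assume "a \<in> P (n0 + s)"
      then obtain b where b: "b \<in> P n0" "a = z \<otimes> b" unfolding red[OF order_refl, symmetric] scaled_def by auto
      have "a \<odot>\<^bsub>D\<^esub> u = b \<odot>\<^bsub>D\<^esub> w"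
        unfolding b(2) u(2) using P_carrier[OF b(1)] cz u(1) by (simp add: R.m_comm[of z b] D.smult_assoc1)
      also have "\<dots> \<in> D.pm (n0 + Suc s)" by (rule D.pm_smult[OF b(1) ws])
      finally show "a \<odot>\<^bsub>D\<^esub> u \<in> D.pm (Suc (n0 + s))" by simp
    qed
    then show "w \<in> scaled D z V" unfolding scaled_def V_def u(2) by blast
  qed
  moreover have "scaled D z V \<subseteq> ideal_smul R D (P s) V"
    unfolding scaled_def using D.ideal_smulI[OF z] by blast
  ultimately have eq: "ideal_smul R D (P s) V = scaled D z V" by blast
  let ?V = "D\<lparr>carrier := V\<rparr>"
  interpret V: local_module R ?V \<mm> by (rule D.local_module_restrict[OF V])
  \<comment> \<open>The zero module has infinite depth and is not maximal Cohen--Macaulay. A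
    multiple by the regular element \<open>y\<close> shows that \<open>V\<close> is nonzero.\<close>
  obtain f where f: "f \<in> carrier D" "f \<noteq> \<zero>\<^bsub>D\<^esub>" using neD D.M.zero_closed by blast
  have "y \<odot>\<^bsub>D\<^esub> f \<in> V" unfolding V_def P1 ideal_mod_smul by (rule D.ideal_smulI[OF y f(1)])
  moreover have "y \<odot>\<^bsub>D\<^esub> f \<noteq> \<zero>\<^bsub>D\<^esub>" using regD f by blast
  ultimately have neV: "carrier ?V \<noteq> {\<zero>\<^bsub>?V\<^esub>}" by auto
  have "Defs.depth R \<mm> ?V = 1"
    by (rule V.depth_eq_1[OF D.fin_gen_restrict[OF fgV] neV y k]) (use regD cV in simp)
  moreover have "real (min_gens R ?V) = multiplicity R \<mm> ?V"
    using D.min_gens_eq_multiplicity_restrict_iff[OF fgV dim s z injD red] eq by blast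
  ultimately show ?thesis
    using V.module_axioms D.fin_gen_restrict[OF fgV]
    unfolding ulrich_def maximal_cohen_macaulay_def dim V_def P1 by simp
qed

end

theorem theorem4:
  fixes R :: "'r ring" and \<mm> :: "'r set" and \<omega> :: "('r, 'w) module"
  assumes "cohen_macaulay_local R \<mm>"
    and "krull_dim R = 1"
    and "canonical_module R \<mm> \<omega>"
    and "depth (gr_ring R \<mm>) (gr_plus R \<mm>) (gr_module R \<mm> (dual_module R \<omega>)) > 0"
    and "\<not> gorenstein_local R \<mm>"
    and "ulrich R \<mm> ((ring_module R)\<lparr>carrier := ideal_pow R \<mm> 2\<rparr>)"
  shows "ulrich R \<mm> ((dual_module R \<omega>)\<lparr>carrier := ideal_mod R (dual_module R \<omega>) \<mm>\<rparr>)"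
proof -
  have loc: "noetherian_local R \<mm>" using assms(1) by (simp add: cohen_macaulay_local_def)
  have mcm: "module R \<omega>" "fin_gen R \<omega>" "depth R \<mm> \<omega> = 1" "cm_type R \<mm> \<omega> = 1" "finite_inj_dim R \<omega>"
    using assms(2,3) by (simp_all add: canonical_module_def maximal_cohen_macaulay_def)
  interpret local_ring R \<mm>
    using loc by (intro local_ring.intro local_ring_axioms.intro) (simp_all add: noetherian_local_def)
  interpret cm1_module R \<omega> \<mm>
    by (intro cm1_module.intro local_module.intro plain_module.intro cm1_ring.intro cm1_ring_axioms.intro
        mcm(1) local_ring_axioms assms(1,2))
  show ?thesis
    using assms(4-6) loc by (intro ulrich_smult_dual mcm) (simp_all add: gorenstein_local_def)
qed

end
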